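(* Fix $s>1/2$ and $E_{\max},h_0,\varepsilon_0>0$. Let $\{E(h)\}_{h\in(0,h_0]}\subseteq[-E_{\max},E_{\max}]$ be a family that may depend on $h$. Let $P(h)$ be the magnetic Schrödinger operator with domain $\mathcal D$ described in the context, with coefficients $\alpha,\beta,b=b_0+b_1,V=V_0+V_1$ satisfying the assumptions listed there. Assume moreover: (1) $\|V_1(\cdot,h)\|_{L^\infty}$, $\|dV_1(h)\|$, $\|b_1(\cdot,h)\|_{L^\infty}$, $\|db_1(h)\|$, $\|d\alpha(h)\|$, $\|d\beta(h)\|$, $\sup\alpha(\cdot,h)$ and $\sup\beta(\cdot,h)$ are bounded uniformly for $h\in(0,h_0]$. (2) There is $c>0$ independent of $h$ such that $\inf\alpha(\cdot,h)>c$ and $\inf\beta(\cdot,h)>c$ for all $h\in(0,h_0]$. (3) There is $R_1>0$ independent of $h$ such that $$\inf_{h\in(0,h_0],\,|x|\ge R_1}\Big(\beta^{-1}(x,h)\alpha(x,h)\big(E(h)-V_1(x,h)\big)+b_1^2(x,h)\Big)>0 .$$ (4) There is $R_0>0$ independent of $h$ such that $V_0(h)$ and $b_0(\cdot,h)$ are supported in $[-R_0,R_0]$ for all $h\in(0,h_0]$. Then there exists $C_0>0$ independent of $h$ such that for all $h\in(0,h_0]$ and all $\varepsilon(h)\in[-\varepsilon_0,\varepsilon_0]$ with $\varepsilon(h)\ne 0$, $$\big\|\langle x\rangle^{-s}\mathbf 1_{>R}\,(P(h)-E(h)-i\varepsilon(h))^{-1}\,\mathbf 1_{>R}\langle x\rangle^{-s}\big\|_{L^2(\mathbb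 R)\to L^2(\mathbb R)}\le\frac{C_0}{h},$$ where $\mathbf 1_{>R}$ is the indicator function of $\{x:|x|>R\}$ and $R=\max(R_0,R_1)$.
   Context: Notation: $D_x=-i\partial_x$, $\langle x\rangle=(1+|x|^2)^{1/2}$. A function $f:\mathbb R\to\mathbb R$ has bounded variation (BV) if it is a difference of two bounded nondecreasing functions. A complex-valued function has locally bounded variation if its real and imaginary parts are each a difference of (not necessarily bounded) nondecreasing functions; an element of $L^1_{\rm loc}$ has this property if it has such a representative. For $f$ of locally bounded variation, $df$ denotes its distributional derivative, a complex Borel measure on bounded Borel sets (a finite signed Borel measure on $\mathbb R$ if $f$ is real and BV). For a finite signed Borel measure $\mu$, $|\mu|$ is its total variation measure and $\|\mu\|=|\mu|(\mathbb R)$. Coefficient assumptions, for each $h>0$ (all coefficients are real valued and may depend on $h$): $V=V_0+V_1$ and $b=b_0+b_1$, where $V_0=V_0(h)$ is a finite signed Borel measure on $\mathbb R$; $b_0(\cdot,h)\in L^1(\mathbb R)\cap L^2(\mathbb R)$; $V_1(\cdot,h)$ and $b_1(\cdot,h)$ have BV; $\alpha(\cdot,h),\beta(\cdot,h):\mathbb R\to(0,\infty)$ have BV; and $\inf\alpha(\cdot,h)>0$, $\inf\beta(\cdot,h)>0$. The operator is $$P(h)=\beta\big(-h^2\partial_x(\alpha\partial_x)+hbD_x+hD_xb\big)+V$$ on $L^2(\mathbb R;\beta^{-1}dx)$ (which equals $L^2(\mathbb R)$ with an equivalent norm). Its domain $\mathcal D=\mathcal D(h)$ is the set of all $u\in H^1(\mathbb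 R)$ such that $h\alpha u'+ibu$ belongs to $L^\infty(\mathbb R)$ and has locally bounded variation, and such that the measure $$\beta\,d(-h^2\alpha u'-ihbu)+h\beta bD_xu+u_cV$$ is (given by a density) in $L^2(\mathbb R)$, where $u_c$ is the continuous representative of $u$ and $V$ is viewed as the measure $V_0+V_1dx$. For $u\in\mathcal D$, $P(h)u$ is defined to be this $L^2$ function. With this domain $P(h)$ is self-adjoint on $L^2(\mathbb R;\beta^{-1}dx)$, so $(P(h)-E-i\varepsilon)^{-1}$ exists as a bounded operator for real $E$ and real $\varepsilon\neq0$. *)

theory Defs
  imports "HOL-Analysis.Analysis"
begin

section \<open>Functions of bounded variation\<close>

definition bounded_variation :: "(real \<Rightarrow> real) \<Rightarrow> bool" where
  "bounded_variation f \<longleftrightarrow>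
     (\<exists>p q. mono p \<and> mono q \<and> bounded (range p) \<and> bounded (range q) \<and> f = (\<lambda>x. p x - q x))"

definition locally_bounded_variation :: "(real \<Rightarrow> complex) \<Rightarrow> bool" where
  "locally_bounded_variation f \<longleftrightarrow>
     (\<exists>p q r s :: real \<Rightarrow> real. mono p \<and> mono q \<and> mono r \<and> mono s \<and>
        (\<forall>x. Re (f x) = p x - q x \<and> Im (f x) = r x - s x))"

definition has_locally_bounded_variation_rep :: "(real \<Rightarrow> complex) \<Rightarrow> bool" where
  "has_locally_bounded_variation_rep f \<longleftrightarrow>
     (\<exists>g. locally_bounded_variation g \<and> (AE x in lborel. f x = g x))"


section \<open>Signed and complex Borel measures on the line\<close>

text \<open>
  The library's measures are nonnegative, so signed and complex measures are countably additive
  set functions. Only their values on Borel sets (respectively on bounded Borel sets) are meaningful.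
\<close>

definition finite_signed_borel_measure :: "(real set \<Rightarrow> real) \<Rightarrow> bool" where
  "finite_signed_borel_measure \<mu> \<longleftrightarrow>
     (\<forall>A :: nat \<Rightarrow> real set. range A \<subseteq> sets borel \<longrightarrow> disjoint_family A \<longrightarrow>
        (\<lambda>i. \<mu> (A i)) sums \<mu> (\<Union>i. A i))"

definition local_complex_borel_measure :: "(real set \<Rightarrow> complex) \<Rightarrow> bool" where
  "local_complex_borel_measure \<nu> \<longleftrightarrow>
     (\<forall>A :: nat \<Rightarrow> real set. range A \<subseteq> sets borel \<longrightarrow> disjoint_family A \<longrightarrow> bounded (\<Union>i. A i) \<longrightarrow>
        (\<lambda>i. \<nu> (A i)) sums \<nu> (\<Union>i. A i))"

text \<open>The total mass of the total variation measure; \<^term>\<open>\<infinity>\<close> is allowed.\<close>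

definition total_variation_norm :: "(real set \<Rightarrow> complex) \<Rightarrow> ennreal" where
  "total_variation_norm \<nu> =
     (SUP F \<in> {F. finite F \<and> disjoint F \<and> (\<forall>B\<in>F. B \<in> sets borel \<and> bounded B)}.
        \<Sum>B\<in>F. ennreal (cmod (\<nu> B)))"

text \<open>
  The positive part in the Jordan decomposition; the negative part of \<open>\<mu>\<close> is the positive part
  of \<open>-\<mu>\<close>. Restricting to bounded \<open>B\<close> does not change the supremum for a finite signed measure
  and makes the formula meaningful for one that is only defined on bounded Borel sets.
\<close>

definition positive_part_measure :: "(real set \<Rightarrow> real) \<Rightarrow> real measure" where
  "positive_part_measure \<mu> =
     measure_of UNIV (sets borel)
       (\<lambda>A. SUP B \<in> {B. B \<in> sets borel \<and> bounded B \<and> B \<subseteq> A}. ennreal (\<mu> B))"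

definition signed_integral :: "(real set \<Rightarrow> real) \<Rightarrow> (real \<Rightarrow> complex) \<Rightarrow> complex" where
  "signed_integral \<mu> f =
     (LINT x|positive_part_measure \<mu>. f x) - (LINT x|positive_part_measure (\<lambda>A. - \<mu> A). f x)"

definition complex_measure_integral :: "(real set \<Rightarrow> complex) \<Rightarrow> (real \<Rightarrow> complex) \<Rightarrow> complex" where
  "complex_measure_integral \<nu> f =
     signed_integral (\<lambda>A. Re (\<nu> A)) f + \<i> * signed_integral (\<lambda>A. Im (\<nu> A)) f"


section \<open>Distributional derivatives and the Sobolev space of order one\<close>

definition test_function :: "(real \<Rightarrow> real) \<Rightarrow> bool" where
  "test_function \<phi> \<longleftrightarrow>
     (\<forall>n x. (deriv ^^ n) \<phi> differentiable (at x)) \<and> compact (closure {x. \<phi> x \<noteq> 0})"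

definition is_derivative_measure :: "(real \<Rightarrow> complex) \<Rightarrow> (real set \<Rightarrow> complex) \<Rightarrow> bool" where
  "is_derivative_measure f \<nu> \<longleftrightarrow>
     local_complex_borel_measure \<nu> \<and>
     (\<forall>\<phi>. test_function \<phi> \<longrightarrow>
        complex_measure_integral \<nu> (\<lambda>x. of_real (\<phi> x)) =
          - (LINT x|lborel. f x * of_real (deriv \<phi> x)))"

text \<open>
  For \<open>f\<close> of locally bounded variation such a measure exists and its values on bounded Borel sets
  are unique; the values elsewhere are never used.
\<close>

definition derivative_measure :: "(real \<Rightarrow> complex) \<Rightarrow> real set \<Rightarrow> complex" where
  "derivative_measure f = (SOME \<nu>. is_derivative_measure f \<nu>)"

definition in_L2 :: "(real \<Rightarrow> complex) \<Rightarrow> bool" where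
  "in_L2 f \<longleftrightarrow> f \<in> borel_measurable borel \<and> integrable lborel (\<lambda>x. (cmod (f x))\<^sup>2)"

definition L2_norm :: "(real \<Rightarrow> complex) \<Rightarrow> ennreal" where
  "L2_norm f = (if in_L2 f then ennreal (sqrt (LINT x|lborel. (cmod (f x))\<^sup>2)) else \<infinity>)"

definition in_Linf :: "(real \<Rightarrow> complex) \<Rightarrow> bool" where
  "in_Linf f \<longleftrightarrow> f \<in> borel_measurable borel \<and> (\<exists>C. AE x in lborel. cmod (f x) \<le> C)"

definition is_weak_derivative :: "(real \<Rightarrow> complex) \<Rightarrow> (real \<Rightarrow> complex) \<Rightarrow> bool" where
  "is_weak_derivative u v \<longleftrightarrow>
     (\<forall>\<phi>. test_function \<phi> \<longrightarrow>
        (LINT x|lborel. u x * of_real (deriv \<phi> x)) = - (LINT x|lborel. v x * of_real (\<phi> x)))"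

definition in_H1 :: "(real \<Rightarrow> complex) \<Rightarrow> bool" where
  "in_H1 u \<longleftrightarrow> in_L2 u \<and> (\<exists>v. in_L2 v \<and> is_weak_derivative u v)"

text \<open>Elements of \<open>L\<^sup>2\<close> are represented by functions; the choice below is unique almost everywhere.\<close>

definition weak_derivative :: "(real \<Rightarrow> complex) \<Rightarrow> real \<Rightarrow> complex" where
  "weak_derivative u = (SOME v. in_L2 v \<and> is_weak_derivative u v)"

definition continuous_rep :: "(real \<Rightarrow> complex) \<Rightarrow> real \<Rightarrow> complex" where
  "continuous_rep u = (THE v. continuous_on UNIV v \<and> (AE x in lborel. v x = u x))"


section \<open>The magnetic Schroedinger operator\<close>

definition coefficients ::
  "(real \<Rightarrow> real) \<Rightarrow> (real \<Rightarrow> real) \<Rightarrow> (real \<Rightarrow> real) \<Rightarrow> (real \<Rightarrow> real) \<Rightarrow>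
   (real set \<Rightarrow> real) \<Rightarrow> (real \<Rightarrow> real) \<Rightarrow> bool" where
  "coefficients \<alpha> \<beta> b\<^sub>0 b\<^sub>1 V\<^sub>0 V\<^sub>1 \<longleftrightarrow>
     finite_signed_borel_measure V\<^sub>0 \<and>
     b\<^sub>0 \<in> borel_measurable borel \<and> integrable lborel b\<^sub>0 \<and> integrable lborel (\<lambda>x. (b\<^sub>0 x)\<^sup>2) \<and>
     bounded_variation V\<^sub>1 \<and> bounded_variation b\<^sub>1 \<and>
     bounded_variation \<alpha> \<and> bounded_variation \<beta> \<and>
     (\<forall>x. 0 < \<alpha> x) \<and> (\<forall>x. 0 < \<beta> x) \<and>
     0 < (INF x. \<alpha> x) \<and> 0 < (INF x. \<beta> x)"

text \<open>The measure \<open>V\<^sub>0 + V\<^sub>1 dx\<close> on bounded Borel sets.\<close>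

definition potential_measure :: "(real set \<Rightarrow> real) \<Rightarrow> (real \<Rightarrow> real) \<Rightarrow> real set \<Rightarrow> real" where
  "potential_measure V\<^sub>0 V\<^sub>1 A = V\<^sub>0 A + (LINT x:A|lborel. V\<^sub>1 x)"

text \<open>
  The value on a bounded Borel set \<open>A\<close> of the measure
  \<open>\<beta> d(-h\<^sup>2 \<alpha> u' - i h b u) + h \<beta> b D\<^sub>x u + u\<^sub>c V\<close>, with \<open>D\<^sub>x = -i \<partial>\<^sub>x\<close>.
\<close>

definition schroedinger_measure ::
  "real \<Rightarrow> (real \<Rightarrow> real) \<Rightarrow> (real \<Rightarrow> real) \<Rightarrow> (real \<Rightarrow> real) \<Rightarrow> (real set \<Rightarrow> real) \<Rightarrow>
   (real \<Rightarrow> complex) \<Rightarrow> real set \<Rightarrow> complex" where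
  "schroedinger_measure h \<alpha> \<beta> b V u A =
     complex_measure_integral
       (derivative_measure
         (\<lambda>x. - (of_real (h\<^sup>2 * \<alpha> x) * weak_derivative u x) - \<i> * of_real (h * b x) * u x))
       (\<lambda>x. of_real (indicator A x * \<beta> x)) +
     (LINT x:A|lborel. of_real (h * \<beta> x * b x) * (- \<i> * weak_derivative u x)) +
     signed_integral V (\<lambda>x. of_real (indicator A x) * continuous_rep u x)"

definition is_density :: "(real \<Rightarrow> complex) \<Rightarrow> (real set \<Rightarrow> complex) \<Rightarrow> bool" where
  "is_density g \<nu> \<longleftrightarrow> (\<forall>A. A \<in> sets borel \<longrightarrow> bounded A \<longrightarrow> \<nu> A = (LINT x:A|lborel. g x))"

definition schroedinger_domain ::
  "real \<Rightarrow> (real \<Rightarrow> real) \<Rightarrow> (real \<Rightarrow> real) \<Rightarrow> (real \<Rightarrow> real) \<Rightarrow> (real set \<Rightarrow> real) \<Rightarrow>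
   (real \<Rightarrow> complex) set" where
  "schroedinger_domain h \<alpha> \<beta> b V =
     {u. in_H1 u \<and>
         in_Linf (\<lambda>x. of_real (h * \<alpha> x) * weak_derivative u x + \<i> * of_real (b x) * u x) \<and>
         has_locally_bounded_variation_rep
           (\<lambda>x. of_real (h * \<alpha> x) * weak_derivative u x + \<i> * of_real (b x) * u x) \<and>
         (\<exists>g. in_L2 g \<and> is_density g (schroedinger_measure h \<alpha> \<beta> b V u))}"

definition schroedinger_op ::
  "real \<Rightarrow> (real \<Rightarrow> real) \<Rightarrow> (real \<Rightarrow> real) \<Rightarrow> (real \<Rightarrow> real) \<Rightarrow> (real set \<Rightarrow> real) \<Rightarrow>
   (real \<Rightarrow> complex) \<Rightarrow> real \<Rightarrow> complex" where
  "schroedinger_op h \<alpha> \<beta> b V u =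
     (SOME g. in_L2 g \<and> is_density g (schroedinger_measure h \<alpha> \<beta> b V u))"


section \<open>Resolvents and operator norms\<close>

text \<open>
  \<open>T - z\<close>, with domain \<open>D\<close>, is a bijection onto \<open>L\<^sup>2\<close> (modulo equality almost everywhere) with
  bounded inverse.
\<close>

definition in_resolvent_set ::
  "(real \<Rightarrow> complex) set \<Rightarrow> ((real \<Rightarrow> complex) \<Rightarrow> real \<Rightarrow> complex) \<Rightarrow> complex \<Rightarrow> bool" where
  "in_resolvent_set D T z \<longleftrightarrow>
     (\<forall>f. in_L2 f \<longrightarrow>
        (\<exists>u\<in>D. (AE x in lborel. T u x - z * u x = f x) \<and>
           (\<forall>v\<in>D. (AE x in lborel. T v x - z * v x = f x) \<longrightarrow> (AE x in lborel. v x = u x)))) \<and>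
     (\<exists>C::real. \<forall>u\<in>D. L2_norm u \<le> ennreal C * L2_norm (\<lambda>x. T u x - z * u x))"

definition resolvent ::
  "(real \<Rightarrow> complex) set \<Rightarrow> ((real \<Rightarrow> complex) \<Rightarrow> real \<Rightarrow> complex) \<Rightarrow> complex \<Rightarrow>
   (real \<Rightarrow> complex) \<Rightarrow> real \<Rightarrow> complex" where
  "resolvent D T z f = (SOME u. u \<in> D \<and> (AE x in lborel. T u x - z * u x = f x))"

definition L2_op_norm :: "((real \<Rightarrow> complex) \<Rightarrow> real \<Rightarrow> complex) \<Rightarrow> ennreal" where
  "L2_op_norm A = (SUP f \<in> {f. L2_norm f \<le> 1}. L2_norm (A f))"

text \<open>Multiplication by \<open>\<langle>x\<rangle>\<^sup>-\<^sup>s\<close> times the indicator function of \<open>|x| > R\<close>.\<close>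

definition exterior_weight :: "real \<Rightarrow> real \<Rightarrow> (real \<Rightarrow> complex) \<Rightarrow> real \<Rightarrow> complex" where
  "exterior_weight s R f x =
     of_real (sqrt (1 + \<bar>x\<bar>\<^sup>2) powr (- s) * indicator {x. \<bar>x\<bar> > R} x) * f x"

end

theory Submission
  imports Defs
begin

text \<open>
  The measure \<open>V\<^sub>0\<close> makes \<open>G = h \<alpha> u' + i b u\<close> jump, so \<open>P u - z u = f\<close> is rewritten as a
  first order system for \<open>u\<close> and the absolutely continuous function \<open>Q = G - W u\<close>, where the bounded
  function \<open>W\<close> is built from a primitive of \<open>V\<^sub>0 / (h \<beta>)\<close>. The imaginary part of the energy
  identity for \<open>Q \<cdot> cnj u\<close> gives \<open>|\<epsilon>| \<integral>|u|\<^sup>2 \<le> C \<integral>|f| |u|\<close>, hence uniqueness, and existence by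
  solving Dirichlet problems on growing intervals.

  For \<open>|x| > R\<close> the function \<open>W\<close> is constant on each side and \<open>G\<close> is continuous. There the energy
  \<open>|G|\<^sup>2 / \<alpha> + p |u|\<^sup>2\<close>, with \<open>p = (E - V\<^sub>1) / \<beta> + b\<^sub>1\<^sup>2 / \<alpha>\<close> bounded below, is
  compared with its value near infinity by freezing the coefficients on a fine partition: only their
  total variation enters, through an exponential factor, and the sources contribute
  \<open>h\<^sup>-\<^sup>1 \<integral>|G| (|\<epsilon>| |u| + |f|)\<close>. The term with \<open>\<epsilon>\<close> is absorbed by means of the two global energy
  identities, which leaves \<open>sup |u| \<le> (C / h) \<integral>|f|\<close> on \<open>|x| > R\<close>. Since \<open>s > 1/2\<close>, the weight is
  square integrable and the weighted \<open>L\<^sup>2\<close> bound follows.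
\<close>

section \<open>Jordan decomposition of signed Borel measures\<close>

text \<open>Nothing is known about \<open>V0\<close>, \<open>b0\<close> uniformly in
  \<open>h\<close>, so no estimate may be carried through the interior. Two facts avoid this. Since
  \<open>W\<close> is real, \<open>Im (Q * cnj u) = Im (G * cnj u)\<close>: the imaginary part of
  the energy identity does not see \<open>W\<close>, and its constant is built from the bounds on
  \<beta> alone. And the data vanish for \<open>|x| <= R\<close>, so the integral of
  \<open>|f| |u|\<close> only sees exterior values of \<open>u\<close>, the very quantity to be
  bounded. Each half line is treated starting from infinity, where square integrability replaces a
  boundary condition.

  The parameter \<epsilon> is merely bounded, not of size \<open>h\<close>. The source
  \<open>|\<epsilon>| |G| |u| / h\<close> is still harmless: the boundary term of the real energy
  identity carries a factor \<open>h\<close> that cancels \<open>1 / h\<close>, and what remains is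
  a multiple of the supremum that Young's inequality makes equal to one half.

  On the measure side all objects become linear functionals on bounded Borel functions of bounded
  support. These are determined by their values on intervals \<open>{x<..y}\<close>, which
  neutralises the choice operators in the definitions.\<close>

definition local_signed_measure :: "(real set \<Rightarrow> real) \<Rightarrow> bool" where
  "local_signed_measure \<mu> \<longleftrightarrow>
     (\<forall>A :: nat \<Rightarrow> real set. range A \<subseteq> sets borel \<longrightarrow> disjoint_family A \<longrightarrow> bounded (\<Union>i. A i) \<longrightarrow>
        (\<lambda>i. \<mu> (A i)) sums \<mu> (\<Union>i. A i))"

lemma local_signed_measureD:
  "local_signed_measure \<mu> \<Longrightarrow> range A \<subseteq> sets borel \<Longrightarrow> disjoint_family A \<Longrightarrow> bounded (\<Union>i. A i) \<Longrightarrow>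
     (\<lambda>i. \<mu> (A i)) sums \<mu> (\<Union>i. A i)"
  by (auto simp: local_signed_measure_def)

lemma local_signed_measure_uminus:
  "local_signed_measure \<mu> \<Longrightarrow> local_signed_measure (\<lambda>A. - \<mu> A)"
  unfolding local_signed_measure_def by (auto intro: sums_minus)

lemma finite_signed_imp_local: "finite_signed_borel_measure \<mu> \<Longrightarrow> local_signed_measure \<mu>"
  unfolding local_signed_measure_def finite_signed_borel_measure_def by blast

lemma local_complex_Re: "local_complex_borel_measure \<nu> \<Longrightarrow> local_signed_measure (\<lambda>A. Re (\<nu> A))"
  unfolding local_signed_measure_def local_complex_borel_measure_def by (auto intro: sums_Re)

lemma local_complex_Im: "local_complex_borel_measure \<nu> \<Longrightarrow> local_signed_measure (\<lambda>A. Im (\<nu> A))"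
  unfolding local_signed_measure_def local_complex_borel_measure_def by (auto intro: sums_Im)

lemma local_signed_empty:
  assumes "local_signed_measure \<mu>"
  shows "\<mu> {} = 0"
proof -
  have "(\<lambda>i::nat. \<mu> {}) sums \<mu> {}"
    using local_signed_measureD[OF assms, of "\<lambda>i. {}"] by (simp add: disjoint_family_on_def)
  then have "(\<lambda>i::nat. \<mu> {}) \<longlonglongrightarrow> 0"
    using sums_summable summable_LIMSEQ_zero by blast
  then show ?thesis by (simp add: LIMSEQ_const_iff)
qed

lemma local_signed_Un:
  assumes \<mu>: "local_signed_measure \<mu>"
    and "A \<in> sets borel" "B \<in> sets borel" "A \<inter> B = {}" "bounded A" "bounded B"
  shows "\<mu> (A \<union> B) = \<mu> A + \<mu> B"
proof -
  have "(\<lambda>i. \<mu> (binaryset A B i)) sums \<mu> (\<Union>i. binaryset A B i)"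
  proof (rule local_signed_measureD[OF \<mu>])
    show "range (binaryset A B) \<subseteq> sets borel" using assms by (auto simp: range_binaryset_eq)
    show "disjoint_family (binaryset A B)"
      using assms by (auto simp: disjoint_family_on_def binaryset_def)
    show "bounded (\<Union>i. binaryset A B i)" using assms by (simp add: UN_binaryset_eq)
  qed
  moreover have "(\<lambda>i. \<mu> (binaryset A B i)) sums (\<mu> A + \<mu> B)"
    by (rule binaryset_sums) (rule local_signed_empty[OF \<mu>])
  ultimately show ?thesis using sums_unique2 by (auto simp: UN_binaryset_eq)
qed

lemma local_signed_Diff:
  assumes \<mu>: "local_signed_measure \<mu>"
    and "A \<in> sets borel" "B \<in> sets borel" "A \<subseteq> B" "bounded B"
  shows "\<mu> (B - A) = \<mu> B - \<mu> A"
proof -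
  have "bounded A" "bounded (B - A)" using assms by (auto intro: bounded_subset[OF assms(5)])
  moreover have "A \<union> (B - A) = B" using assms by auto
  ultimately show ?thesis using local_signed_Un[OF \<mu>, of A "B - A"] assms by auto
qed

text \<open>The set function inside \<open>positive_part_measure\<close>. As \<open>ennreal\<close>
  sends negative reals to 0, it is the positive variation of \<open>\<mu>\<close>.\<close>

definition upper_variation :: "(real set \<Rightarrow> real) \<Rightarrow> real set \<Rightarrow> ennreal" where
  "upper_variation \<mu> A = (SUP B \<in> {B. B \<in> sets borel \<and> bounded B \<and> B \<subseteq> A}. ennreal (\<mu> B))"

lemma upper_variation_upper:
  "B \<in> sets borel \<Longrightarrow> bounded B \<Longrightarrow> B \<subseteq> A \<Longrightarrow> ennreal (\<mu> B) \<le> upper_variation \<mu> A"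
  unfolding upper_variation_def by (rule SUP_upper) auto

lemma upper_variation_mono: "A \<subseteq> A' \<Longrightarrow> upper_variation \<mu> A \<le> upper_variation \<mu> A'"
  unfolding upper_variation_def by (rule SUP_subset_mono) auto

text \<open>For competitors \<open>B\<close>, \<open>B'\<close> of nonnegative measure the union is
  a competitor and additivity applies. If one of the two values is negative it is truncated to 0,
  and the other competitor alone suffices.\<close>

lemma upper_variation_superadd:
  assumes \<mu>: "local_signed_measure \<mu>" and disj: "A \<inter> A' = {}"
  shows "upper_variation \<mu> A + upper_variation \<mu> A' \<le> upper_variation \<mu> (A \<union> A')"
proof -
  have *: "ennreal (\<mu> B) + ennreal (\<mu> B') \<le> upper_variation \<mu> (A \<union> A')"
    if "B \<in> sets borel" "bounded B" "B \<subseteq> A" "B' \<in> sets borel" "bounded B'" "B' \<subseteq> A'" for B B'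
  proof (cases "0 \<le> \<mu> B \<and> 0 \<le> \<mu> B'")
    case True
    then have "ennreal (\<mu> B) + ennreal (\<mu> B') = ennreal (\<mu> (B \<union> B'))"
      using that disj by (subst local_signed_Un[OF \<mu>]) auto
    also have "\<dots> \<le> upper_variation \<mu> (A \<union> A')"
      using that by (intro upper_variation_upper) auto
    finally show ?thesis .
  next
    case False
    then have "ennreal (\<mu> B) = 0 \<or> ennreal (\<mu> B') = 0" by (auto simp: ennreal_neg)
    moreover have "B \<subseteq> A \<union> A'" "B' \<subseteq> A \<union> A'" using that by auto
    ultimately show ?thesis
      using that upper_variation_upper[of B "A \<union> A'" \<mu>] upper_variation_upper[of B' "A \<union> A'" \<mu>]
      by auto
  qed
  have "{} \<in> {B. B \<in> sets borel \<and> bounded B \<and> B \<subseteq> A}" for A :: "real set" by auto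
  then have ne: "{B. B \<in> sets borel \<and> bounded B \<and> B \<subseteq> A} \<noteq> {}" for A :: "real set" by blast
  show ?thesis
    unfolding upper_variation_def[of \<mu> A] upper_variation_def[of \<mu> A']
    by (subst ennreal_SUP_add_left[symmetric, OF ne], rule SUP_least,
        subst ennreal_SUP_add_right[OF ne], rule SUP_least) (use * in auto)
qed

text \<open>The terms may have either sign: truncation at 0 makes \<open>ennreal\<close> subadditive
  on the reals, so the inequality holds for partial sums and passes to the limit.\<close>

lemma sums_ennreal_le:
  assumes "g sums (x::real)"
  shows "ennreal x \<le> (\<Sum>i. ennreal (g i))"
proof (rule LIMSEQ_le_const2)
  show "(\<lambda>n. ennreal (\<Sum>i<n. g i)) \<longlonglongrightarrow> ennreal x"
    using assms unfolding sums_def by (rule tendsto_ennrealI)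
  have le: "ennreal (a + b) \<le> ennreal a + ennreal b" for a b :: real
    by (cases "0 \<le> a"; cases "0 \<le> b") (auto simp: ennreal_neg ennreal_plus[symmetric] simp del: ennreal_plus intro: ennreal_leI)
  have "ennreal (\<Sum>i<n. g i) \<le> (\<Sum>i<n. ennreal (g i))" for n
  proof (induction n)
    case (Suc n)
    have "ennreal (\<Sum>i<Suc n. g i) \<le> ennreal (\<Sum>i<n. g i) + ennreal (g n)"
      using le[of "\<Sum>i<n. g i" "g n"] by simp
    also have "\<dots> \<le> (\<Sum>i<Suc n. ennreal (g i))" using Suc by (simp add: add_right_mono)
    finally show ?case .
  qed simp
  then show "\<exists>N. \<forall>n\<ge>N. ennreal (\<Sum>i<n. g i) \<le> (\<Sum>i. ennreal (g i))"
    by (meson order_trans sum_le_suminf summableI finite_lessThan zero_le)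
qed

text \<open>One inequality is finite superadditivity followed by a supremum. For the other, a
  competitor \<open>B\<close> for the union is cut into the pieces \<open>B \<inter> A i\<close>,
  and the signed sum of their measures is bounded termwise.\<close>

lemma upper_variation_countably_additive:
  assumes \<mu>: "local_signed_measure \<mu>"
  shows "countably_additive (sets borel) (upper_variation \<mu>)"
  unfolding countably_additive_def
proof (intro allI impI)
  fix A :: "nat \<Rightarrow> real set"
  assume A: "range A \<subseteq> sets borel" "disjoint_family A" "(\<Union>i. A i) \<in> sets borel"
  have fin: "(\<Sum>i<n. upper_variation \<mu> (A i)) \<le> upper_variation \<mu> (\<Union>i<n. A i)" for n
  proof (induction n)
    case (Suc n)
    have "A i \<inter> A n = {}" if "i < n" for i
      using A(2) that by (simp add: disjoint_family_on_def)
    then have "(\<Union>i<n. A i) \<inter> A n = {}" by blast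
    then have "upper_variation \<mu> (\<Union>i<n. A i) + upper_variation \<mu> (A n) \<le> upper_variation \<mu> ((\<Union>i<n. A i) \<union> A n)"
      by (rule upper_variation_superadd[OF \<mu>])
    also have "(\<Union>i<n. A i) \<union> A n = (\<Union>i<Suc n. A i)" by (auto simp: lessThan_Suc)
    finally show ?case using add_right_mono[OF Suc, of "upper_variation \<mu> (A n)"]
      unfolding sum.lessThan_Suc by (rule order_trans[rotated])
  qed simp
  show "(\<Sum>i. upper_variation \<mu> (A i)) = upper_variation \<mu> (\<Union>i. A i)"
  proof (rule antisym)
    show "(\<Sum>i. upper_variation \<mu> (A i)) \<le> upper_variation \<mu> (\<Union>i. A i)"
      unfolding suminf_eq_SUP
      by (rule SUP_least, rule order_trans[OF fin]) (auto intro!: upper_variation_mono)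
    show "upper_variation \<mu> (\<Union>i. A i) \<le> (\<Sum>i. upper_variation \<mu> (A i))"
      unfolding upper_variation_def[of \<mu> "\<Union>i. A i"]
    proof (rule SUP_least)
      fix B assume "B \<in> {B. B \<in> sets borel \<and> bounded B \<and> B \<subseteq> (\<Union>i. A i)}"
      then have B: "B \<in> sets borel" "bounded B" "B \<subseteq> (\<Union>i. A i)" by auto
      have "(\<lambda>i. \<mu> (B \<inter> A i)) sums \<mu> (\<Union>i. B \<inter> A i)"
        using A B by (intro local_signed_measureD[OF \<mu>])
          (auto simp: disjoint_family_on_def intro!: bounded_subset[OF B(2)])
      also have "(\<Union>i. B \<inter> A i) = B" using B by auto
      finally have "ennreal (\<mu> B) \<le> (\<Sum>i. ennreal (\<mu> (B \<inter> A i)))" by (rule sums_ennreal_le)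
      also have "\<dots> \<le> (\<Sum>i. upper_variation \<mu> (A i))"
        using A B by (intro suminf_le upper_variation_upper) (auto intro!: bounded_subset[OF B(2)])
      finally show "ennreal (\<mu> B) \<le> (\<Sum>i. upper_variation \<mu> (A i))" .
    qed
  qed
qed

lemma space_positive_part [simp]: "space (positive_part_measure \<mu>) = UNIV"
  unfolding positive_part_measure_def by (simp add: space_measure_of_conv)

lemma sets_positive_part [simp, measurable_cong]: "sets (positive_part_measure \<mu>) = sets borel"
  using sets.sigma_sets_eq[of "borel :: real measure"]
  unfolding positive_part_measure_def by (simp add: sets_measure_of)

lemma emeasure_positive_part:
  assumes \<mu>: "local_signed_measure \<mu>" and A: "A \<in> sets borel"
  shows "emeasure (positive_part_measure \<mu>) A = upper_variation \<mu> A"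
proof (rule emeasure_measure_of[OF positive_part_measure_def[unfolded upper_variation_def[symmetric]]])
  show "sets borel \<subseteq> Pow (UNIV :: real set)" by simp
  show "A \<in> sets (positive_part_measure \<mu>)" using A by simp
  have "upper_variation \<mu> {} \<le> 0"
    unfolding upper_variation_def using local_signed_empty[OF \<mu>] by (intro SUP_least) auto
  then show "positive (sets (positive_part_measure \<mu>)) (upper_variation \<mu>)"
    by (simp add: positive_def)
  show "countably_additive (sets (positive_part_measure \<mu>)) (upper_variation \<mu>)"
    using upper_variation_countably_additive[OF \<mu>] by simp
qed

lemma upper_variation_Un:
  assumes \<mu>: "local_signed_measure \<mu>" and "A \<in> sets borel" "B \<in> sets borel" "A \<inter> B = {}"
  shows "upper_variation \<mu> (A \<union> B) = upper_variation \<mu> A + upper_variation \<mu> B"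
  using plus_emeasure[of A "positive_part_measure \<mu>" B] assms
  by (simp add: emeasure_positive_part)

text \<open>The classical argument that a signed measure has finite variation. A set of infinite
  variation contains a subset that still has infinite variation, while the part removed has measure
  at least 1 in absolute value. Iteration gives disjoint removed parts inside the bounded set
  \<open>E\<close>; countable additivity forces their measures to tend to 0.\<close>

lemma upper_variation_finite:
  assumes \<mu>: "local_signed_measure \<mu>" and E: "E \<in> sets borel" "bounded E"
  shows "upper_variation \<mu> E < \<infinity>"
proof -
  define T where "T A = upper_variation \<mu> A + upper_variation (\<lambda>A. - \<mu> A) A" for A
  note \<mu>' = local_signed_measure_uminus[OF \<mu>]
  have split: "\<exists>A. (A \<in> sets borel \<and> bounded A \<and> T A = \<infinity>) \<and> A \<subseteq> E \<and> 1 \<le> \<bar>\<mu> (E - A)\<bar>"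
    if E: "E \<in> sets borel" "bounded E" "T E = \<infinity>" for E
  proof -
    \<comment> \<open>The threshold \<open>1 + \<bar>\<mu> E\<bar>\<close> makes both
      \<open>\<mu> B\<close> and \<open>\<mu> (E - B)\<close> at least 1 in absolute value, so that
      either half may be the one kept.\<close>
    have "\<exists>B. B \<in> sets borel \<and> B \<subseteq> E \<and> 1 + \<bar>\<mu> E\<bar> \<le> \<bar>\<mu> B\<bar>"
    proof (rule ccontr)
      assume "\<not> ?thesis"
      then have lt: "\<bar>\<mu> B\<bar> \<le> 1 + \<bar>\<mu> E\<bar>" if "B \<in> sets borel" "B \<subseteq> E" for B using that by (meson linorder_not_le less_imp_le)
      have "upper_variation \<mu> E \<le> ennreal (1 + \<bar>\<mu> E\<bar>)" "upper_variation (\<lambda>A. - \<mu> A) E \<le> ennreal (1 + \<bar>\<mu> E\<bar>)"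
        unfolding upper_variation_def
        by (rule SUP_least, rule ennreal_leI, use lt abs_le_D1 in blast,
            rule SUP_least, rule ennreal_leI, use lt abs_le_D2 in blast)
      then have "T E \<le> ennreal (1 + \<bar>\<mu> E\<bar>) + ennreal (1 + \<bar>\<mu> E\<bar>)"
        unfolding T_def by (rule add_mono)
      also have "\<dots> < \<infinity>" by (simp add: ennreal_add_eq_top less_top)
      finally show False using E by simp
    qed
    then obtain B where B: "B \<in> sets borel" "B \<subseteq> E" "1 + \<bar>\<mu> E\<bar> \<le> \<bar>\<mu> B\<bar>" by blast
    have d: "\<mu> (E - B) = \<mu> E - \<mu> B" using local_signed_Diff[OF \<mu> B(1) E(1) B(2) E(2)] .
    have "T (B \<union> (E - B)) = T B + T (E - B)"
      using upper_variation_Un[OF \<mu> B(1), of "E - B"] upper_variation_Un[OF \<mu>' B(1), of "E - B"] B(1) E(1)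
      unfolding T_def by (simp only: Diff_disjoint sets.Diff ac_simps)
    then have "T B + T (E - B) = \<infinity>" using B E by (simp add: Un_absorb1)
    then consider "T B = \<infinity>" | "T (E - B) = \<infinity>" by auto
    then show ?thesis
    proof cases
      case 1
      then show ?thesis using B E d by (intro exI[of _ B]) (auto intro: bounded_subset[OF E(2)])
    next
      case 2
      moreover have "E - (E - B) = B" using B by auto
      ultimately show ?thesis using B E
        by (intro exI[of _ "E - B"]) (auto intro: bounded_subset[OF E(2)])
    qed
  qed
  have "T E < \<infinity>"
  proof (rule ccontr)
    assume "\<not> T E < \<infinity>"
    then have TE: "T E = \<infinity>" by (simp add: not_less top_unique)
    have "\<exists>F. \<forall>n. (F n \<in> sets borel \<and> bounded (F n) \<and> T (F n) = \<infinity> \<and> F n \<subseteq> E) \<and>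
        (F (Suc n) \<subseteq> F n \<and> 1 \<le> \<bar>\<mu> (F n - F (Suc n))\<bar>)"
    proof (rule dependent_nat_choice)
      show "\<exists>x. x \<in> sets borel \<and> bounded x \<and> T x = \<infinity> \<and> x \<subseteq> E" using E TE by blast
      fix x n assume "x \<in> sets borel \<and> bounded x \<and> T x = \<infinity> \<and> x \<subseteq> E"
      then show "\<exists>y. (y \<in> sets borel \<and> bounded y \<and> T y = \<infinity> \<and> y \<subseteq> E) \<and> y \<subseteq> x \<and> 1 \<le> \<bar>\<mu> (x - y)\<bar>"
        using split[of x] by blast
    qed
    then obtain F where *: "\<forall>n. (F n \<in> sets borel \<and> bounded (F n) \<and> T (F n) = \<infinity> \<and> F n \<subseteq> E) \<and>
        (F (Suc n) \<subseteq> F n \<and> 1 \<le> \<bar>\<mu> (F n - F (Suc n))\<bar>)" ..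
    have F: "F n \<in> sets borel" "F n \<subseteq> E" "F (Suc n) \<subseteq> F n" "1 \<le> \<bar>\<mu> (F n - F (Suc n))\<bar>" for n
      using spec[OF *, of n] by (blast, blast, blast, blast)
    have "decseq F" using F(3) by (simp add: decseq_Suc_iff)
    then have *: "F n \<subseteq> F (Suc m)" if "m < n" for m n using that by (simp add: decseq_def)
    have "disjoint_family (\<lambda>n. F n - F (Suc n))"
      unfolding disjoint_family_on_def
    proof (intro ballI impI)
      fix m n :: nat assume "m \<noteq> n"
      then show "(F m - F (Suc m)) \<inter> (F n - F (Suc n)) = {}"
        using *[of m n] *[of n m] by (cases "m < n") auto
    qed
    then have "(\<lambda>n. \<mu> (F n - F (Suc n))) sums \<mu> (\<Union>n. F n - F (Suc n))"
      using F(1,2) by (intro local_signed_measureD[OF \<mu>]) (auto intro!: bounded_subset[OF E(2)])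
    then have "(\<lambda>n. \<mu> (F n - F (Suc n))) \<longlonglongrightarrow> 0"
      using sums_summable summable_LIMSEQ_zero by blast
    then have "\<forall>\<^sub>F n in sequentially. \<bar>\<mu> (F n - F (Suc n))\<bar> < 1"
      using tendstoD[of _ 0 sequentially 1] by fastforce
    then obtain n where "\<bar>\<mu> (F n - F (Suc n))\<bar> < 1" by (auto dest: eventually_happens)
    then show False using F(4)[of n] by simp
  qed
  then show ?thesis unfolding T_def by (simp add: less_top)
qed

text \<open>For \<open>B \<subseteq> A\<close> one has
  \<open>- \<mu> B = \<mu> (A - B) - \<mu> A\<close>, and \<open>\<mu> (A - B)\<close> is at most
  the positive variation. The supremum over \<open>B\<close> gives one inequality of the Jordan
  formula; the same inequality for \<open>- \<mu>\<close> gives the other. Finiteness permits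
  passing to real values.\<close>

lemma upper_variation_jordan:
  assumes \<mu>: "local_signed_measure \<mu>" and A: "A \<in> sets borel" "bounded A"
  shows "upper_variation \<mu> A = ennreal (measure (positive_part_measure \<mu>) A)"
    and "\<mu> A = measure (positive_part_measure \<mu>) A - measure (positive_part_measure (\<lambda>A. - \<mu> A)) A"
proof -
  note \<mu>' = local_signed_measure_uminus[OF \<mu>]
  have e: "upper_variation \<mu> A = ennreal (measure (positive_part_measure \<mu>) A)" 
    if \<mu>: "local_signed_measure \<mu>" and A: "A \<in> sets borel" "bounded A" for \<mu> A
    using upper_variation_finite[OF \<mu> A] emeasure_positive_part[OF \<mu> A(1)]
    by (metis emeasure_eq_ennreal_measure infinity_ennreal_def order_less_irrefl)
  show "upper_variation \<mu> A = ennreal (measure (positive_part_measure \<mu>) A)" using e[OF \<mu> A] .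
  have le: "\<mu> A + measure (positive_part_measure (\<lambda>A. - \<mu> A)) A \<le> measure (positive_part_measure \<mu>) A"
    if \<mu>: "local_signed_measure \<mu>" for \<mu>
  proof -
    note \<mu>' = local_signed_measure_uminus[OF \<mu>]
    have "upper_variation (\<lambda>A. - \<mu> A) A \<le> ennreal (measure (positive_part_measure \<mu>) A - \<mu> A)"
      unfolding upper_variation_def
    proof (rule SUP_least)
      fix B assume "B \<in> {B. B \<in> sets borel \<and> bounded B \<and> B \<subseteq> A}"
      then have B: "B \<in> sets borel" "bounded B" "B \<subseteq> A" by auto
      have "ennreal (\<mu> (A - B)) \<le> upper_variation \<mu> A"
        using A B by (intro upper_variation_upper) (auto intro: bounded_subset[OF A(2)])
      then have "\<mu> (A - B) \<le> measure (positive_part_measure \<mu>) A"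
        by (simp add: e[OF \<mu> A] ennreal_le_iff)
      then show "ennreal (- \<mu> B) \<le> ennreal (measure (positive_part_measure \<mu>) A - \<mu> A)"
        using local_signed_Diff[OF \<mu> B(1) A(1) B(3) A(2)] by (intro ennreal_leI) auto
    qed
    moreover have "ennreal (\<mu> A) \<le> upper_variation \<mu> A" using A by (intro upper_variation_upper) auto
    then have "\<mu> A \<le> measure (positive_part_measure \<mu>) A" by (simp add: e[OF \<mu> A] ennreal_le_iff)
    ultimately show ?thesis by (simp add: e[OF \<mu>' A] ennreal_le_iff)
  qed
  show "\<mu> A = measure (positive_part_measure \<mu>) A - measure (positive_part_measure (\<lambda>A. - \<mu> A)) A"
    using le[OF \<mu>] le[OF \<mu>'] by simp
qed

lemma emeasure_positive_part_bounded:
  assumes "local_signed_measure \<mu>" "A \<in> sets borel" "bounded A"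
  shows "emeasure (positive_part_measure \<mu>) A < \<infinity>"
  using upper_variation_finite[OF assms] emeasure_positive_part[OF assms(1,2)] by simp

section \<open>Radon functionals\<close>

definition bdd_fun :: "(real \<Rightarrow> complex) \<Rightarrow> bool" where
  "bdd_fun f \<longleftrightarrow> f \<in> borel_measurable borel \<and> (\<exists>C K. \<forall>x. cmod (f x) \<le> C \<and> (K < \<bar>x\<bar> \<longrightarrow> f x = 0))"

text \<open>An abstract complex Radon measure: linearity together with continuity under bounded
  pointwise convergence with common bounded support. Integrals against set functions and against
  locally integrable densities, and multiples of these by locally bounded functions, all have this
  form, so later arguments need not know which one is at hand.\<close>

definition radon :: "((real \<Rightarrow> complex) \<Rightarrow> complex) \<Rightarrow> bool" where
  "radon L \<longleftrightarrow>
     (\<forall>f g. bdd_fun f \<longrightarrow> bdd_fun g \<longrightarrow> L (\<lambda>x. f x + g x) = L f + L g) \<and>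
     (\<forall>c f. bdd_fun f \<longrightarrow> L (\<lambda>x. c * f x) = c * L f) \<and>
     (\<forall>F f C K. (\<forall>n. F n \<in> borel_measurable borel) \<longrightarrow>
        (\<forall>n x. cmod (F n x) \<le> C \<and> (K < \<bar>x\<bar> \<longrightarrow> F n x = 0)) \<longrightarrow>
        (\<forall>x. (\<lambda>n. F n x) \<longlonglongrightarrow> f x) \<longrightarrow> (\<lambda>n. L (F n)) \<longlonglongrightarrow> L f)"

lemma bdd_funI:
  "f \<in> borel_measurable borel \<Longrightarrow> (\<And>x. cmod (f x) \<le> C) \<Longrightarrow> (\<And>x. K < \<bar>x\<bar> \<Longrightarrow> f x = 0) \<Longrightarrow> bdd_fun f"
  unfolding bdd_fun_def by blast

lemma bdd_fun_measurable [measurable_dest]: "bdd_fun f \<Longrightarrow> f \<in> borel_measurable borel"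
  by (simp add: bdd_fun_def)

lemma bdd_fun_add: 
  assumes "bdd_fun f" "bdd_fun g" shows "bdd_fun (\<lambda>x. f x + g x)"
proof -
  obtain C K where f: "f \<in> borel_measurable borel" "\<And>x. cmod (f x) \<le> C" "\<And>x. K < \<bar>x\<bar> \<Longrightarrow> f x = 0"
    using assms(1) unfolding bdd_fun_def by blast
  obtain C' K' where g: "g \<in> borel_measurable borel" "\<And>x. cmod (g x) \<le> C'" "\<And>x. K' < \<bar>x\<bar> \<Longrightarrow> g x = 0"
    using assms(2) unfolding bdd_fun_def by blast
  show ?thesis
    using f g norm_triangle_mono[OF f(2) g(2)] by (intro bdd_funI[of _ "C + C'" "max K K'"]) auto
qed

definition locally_bdd :: "(real \<Rightarrow> complex) \<Rightarrow> bool" where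
  "locally_bdd k \<longleftrightarrow> k \<in> borel_measurable borel \<and> (\<forall>K. \<exists>C. \<forall>x. \<bar>x\<bar> \<le> K \<longrightarrow> cmod (k x) \<le> C)"

lemma bdd_fun_mult:
  assumes "locally_bdd k" "bdd_fun f" shows "bdd_fun (\<lambda>x. k x * f x)"
proof -
  obtain C K where f: "f \<in> borel_measurable borel" "\<And>x. cmod (f x) \<le> C" "\<And>x. K < \<bar>x\<bar> \<Longrightarrow> f x = 0"
    using assms(2) unfolding bdd_fun_def by blast
  obtain C' where k: "\<And>x. \<bar>x\<bar> \<le> K \<Longrightarrow> cmod (k x) \<le> C'"
    using assms(1) unfolding locally_bdd_def by blast
  have "cmod (k x * f x) \<le> max C' 0 * C" for x
  proof (cases "\<bar>x\<bar> \<le> K")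
    case True
    then show ?thesis using f(2)[of x] k[of x] by (auto simp: norm_mult intro!: mult_mono)
  next
    case False
    then show ?thesis using f(3)[of x] norm_ge_zero[of "f x"] f(2)[of x] by (auto intro!: mult_nonneg_nonneg)
  qed
  then show ?thesis using assms f by (intro bdd_funI[of _ "max C' 0 * C" K]) (auto simp: locally_bdd_def)
qed

lemma locally_bdd_const [simp]: "locally_bdd (\<lambda>x. c)"
  by (auto simp: locally_bdd_def)

lemma bdd_fun_cmult: "bdd_fun f \<Longrightarrow> bdd_fun (\<lambda>x. c * f x)"
  by (rule bdd_fun_mult) auto

lemma bdd_fun_indicator:
  assumes "A \<in> sets borel" "bounded A" shows "bdd_fun (indicator A)"
proof -
  obtain K where "\<And>x. x \<in> A \<Longrightarrow> \<bar>x\<bar> \<le> K" using assms(2) by (auto simp: bounded_iff)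
  then have "x \<notin> A" if "K < \<bar>x\<bar>" for x using that by force
  then show ?thesis using assms(1) by (intro bdd_funI[of _ 1 K]) (auto simp: indicator_def)
qed

lemma bdd_fun_Ioc [simp]: "bdd_fun (indicator {x<..y})"
  by (rule bdd_fun_indicator) auto

lemma radon_add: "radon L \<Longrightarrow> bdd_fun f \<Longrightarrow> bdd_fun g \<Longrightarrow> L (\<lambda>x. f x + g x) = L f + L g"
  by (simp add: radon_def)

lemma radon_cmult: "radon L \<Longrightarrow> bdd_fun f \<Longrightarrow> L (\<lambda>x. c * f x) = c * L f"
  by (simp add: radon_def)

lemma radon_zero: "radon L \<Longrightarrow> L (\<lambda>x. 0) = 0"
  using radon_cmult[of L "indicator {}" 0] by (simp add: bdd_fun_indicator)

lemma radon_diff: "radon L \<Longrightarrow> bdd_fun f \<Longrightarrow> bdd_fun g \<Longrightarrow> L (\<lambda>x. f x - g x) = L f - L g"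
  using radon_add[of L f "\<lambda>x. -1 * g x"] radon_cmult[of L g "-1"] bdd_fun_cmult[of g "-1"] by simp

lemma radon_limit:
  assumes "radon L" "\<And>n. F n \<in> borel_measurable borel" "\<And>n x. cmod (F n x) \<le> C"
    "\<And>n x. K < \<bar>x\<bar> \<Longrightarrow> F n x = 0" "\<And>x. (\<lambda>n. F n x) \<longlonglongrightarrow> f x"
  shows "(\<lambda>n. L (F n)) \<longlonglongrightarrow> L f"
  using assms unfolding radon_def by blast

lemma bdd_fun_sum: "(\<And>i. i \<in> I \<Longrightarrow> bdd_fun (f i)) \<Longrightarrow> bdd_fun (\<lambda>x. \<Sum>i\<in>I. f i x)"
  using bdd_fun_indicator[of "{}"]
  by (induction I rule: infinite_finite_induct) (auto intro: bdd_fun_add simp: indicator_def[abs_def])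

lemma radon_sum:
  assumes "radon L" "\<And>i. i \<in> I \<Longrightarrow> bdd_fun (f i)"
  shows "L (\<lambda>x. \<Sum>i\<in>I. f i x) = (\<Sum>i\<in>I. L (f i))"
  using assms(2)
proof (induction I rule: infinite_finite_induct)
  case (insert i I)
  then show ?case
    using radon_add[OF assms(1), of "f i" "\<lambda>x. \<Sum>i\<in>I. f i x"] by (simp add: bdd_fun_sum)
qed (simp_all add: radon_zero assms(1))

lemma radonI:
  assumes "\<And>f g. bdd_fun f \<Longrightarrow> bdd_fun g \<Longrightarrow> L (\<lambda>x. f x + g x) = L f + L g"
    "\<And>c f. bdd_fun f \<Longrightarrow> L (\<lambda>x. c * f x) = c * L f"
    "\<And>F f C K. (\<And>n. F n \<in> borel_measurable borel) \<Longrightarrow> (\<And>n x. cmod (F n x) \<le> C) \<Longrightarrow>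
       (\<And>n x. K < \<bar>x\<bar> \<Longrightarrow> F n x = 0) \<Longrightarrow> (\<And>x. (\<lambda>n. F n x) \<longlonglongrightarrow> f x) \<Longrightarrow> 0 \<le> C \<Longrightarrow>
       f \<in> borel_measurable borel \<Longrightarrow> (\<lambda>n. L (F n)) \<longlonglongrightarrow> L f"
  shows "radon L"
  unfolding radon_def
proof (intro conjI allI impI)
  fix F :: "nat \<Rightarrow> real \<Rightarrow> complex" and f C K
  assume *: "\<forall>n. F n \<in> borel_measurable borel" "\<forall>n x. cmod (F n x) \<le> C \<and> (K < \<bar>x\<bar> \<longrightarrow> F n x = 0)"
    "\<forall>x. (\<lambda>n. F n x) \<longlonglongrightarrow> f x"
  have "0 \<le> C" using * norm_ge_zero[of "F 0 0"] order_trans by blast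
  moreover have "f \<in> borel_measurable borel"
    by (rule borel_measurable_LIMSEQ_metric[where f = F]) (use * in auto)
  ultimately show "(\<lambda>n. L (F n)) \<longlonglongrightarrow> L f" using * assms(3)[of F C K f] by blast
qed (use assms in auto)

lemma radon_plus:
  assumes "radon L" "radon L'" shows "radon (\<lambda>f. L f + L' f)"
proof (rule radonI)
  fix F :: "nat \<Rightarrow> real \<Rightarrow> complex" and f C K
  assume "\<And>n. F n \<in> borel_measurable borel" "\<And>n x. cmod (F n x) \<le> C"
    "\<And>n x. K < \<bar>x\<bar> \<Longrightarrow> F n x = 0" "\<And>x. (\<lambda>n. F n x) \<longlonglongrightarrow> f x"
  note * = radon_limit[OF _ this]
  show "(\<lambda>n. L (F n) + L' (F n)) \<longlonglongrightarrow> L f + L' f" by (intro tendsto_add * assms)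
qed (auto simp: radon_add radon_cmult assms distrib_left)

lemma radon_scale:
  assumes "radon L" shows "radon (\<lambda>f. c * L f)"
proof (rule radonI)
  fix F :: "nat \<Rightarrow> real \<Rightarrow> complex" and f C K
  assume "\<And>n. F n \<in> borel_measurable borel" "\<And>n x. cmod (F n x) \<le> C"
    "\<And>n x. K < \<bar>x\<bar> \<Longrightarrow> F n x = 0" "\<And>x. (\<lambda>n. F n x) \<longlonglongrightarrow> f x"
  note * = radon_limit[OF _ this]
  show "(\<lambda>n. c * L (F n)) \<longlonglongrightarrow> c * L f" by (intro tendsto_mult_left * assms)
qed (auto simp: radon_add radon_cmult assms distrib_left)

lemma radon_minus:
  assumes "radon L" "radon L'" shows "radon (\<lambda>f. L f - L' f)"
  using radon_plus[OF assms(1) radon_scale[OF assms(2), of "-1"]] by simp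

lemma radon_mult:
  assumes L: "radon L" and k: "locally_bdd k" shows "radon (\<lambda>f. L (\<lambda>x. k x * f x))"
proof (rule radonI)
  fix f g assume "bdd_fun f" "bdd_fun g"
  then show "L (\<lambda>x. k x * (f x + g x)) = L (\<lambda>x. k x * f x) + L (\<lambda>x. k x * g x)"
    using radon_add[OF L bdd_fun_mult[OF k] bdd_fun_mult[OF k]] by (simp add: distrib_left)
next
  fix c f assume "bdd_fun f"
  then show "L (\<lambda>x. k x * (c * f x)) = c * L (\<lambda>x. k x * f x)"
    using radon_cmult[OF L bdd_fun_mult[OF k], of f c] by (simp add: mult.left_commute)
next
  fix F :: "nat \<Rightarrow> real \<Rightarrow> complex" and f C K
  assume *: "\<And>n. F n \<in> borel_measurable borel" "\<And>n x. cmod (F n x) \<le> C"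
    "\<And>n x. K < \<bar>x\<bar> \<Longrightarrow> F n x = 0" "\<And>x. (\<lambda>n. F n x) \<longlonglongrightarrow> f x" "0 \<le> C"
  obtain C' where C': "\<And>x. \<bar>x\<bar> \<le> K \<Longrightarrow> cmod (k x) \<le> C'"
    using k unfolding locally_bdd_def by blast
  have "cmod (k x * F n x) \<le> max C' 0 * C" for n x
  proof (cases "\<bar>x\<bar> \<le> K")
    case True
    then show ?thesis using *(2)[of n x] C'[of x] by (auto simp: norm_mult intro!: mult_mono)
  next
    case False
    then show ?thesis using *(3,5) by simp
  qed
  then show "(\<lambda>n. L (\<lambda>x. k x * F n x)) \<longlonglongrightarrow> L (\<lambda>x. k x * f x)"
    using * k by (intro radon_limit[OF L, of _ "max C' 0 * C" K])
      (auto simp: locally_bdd_def intro!: tendsto_intros borel_measurable_times)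
qed

lemma bdd_fun_of_real:
  "g \<in> borel_measurable borel \<Longrightarrow> (\<And>x. \<bar>g x\<bar> \<le> C) \<Longrightarrow> (\<And>x. K < \<bar>x\<bar> \<Longrightarrow> g x = 0) \<Longrightarrow> bdd_fun (\<lambda>x. of_real (g x))"
  by (rule bdd_funI[of _ C K]) auto

text \<open>Measurable induction on nonnegative functions, followed by the decomposition into
  positive and negative, real and imaginary parts.\<close>

lemma radon_eq_zero:
  assumes L: "radon L" and ind: "\<And>A. A \<in> sets borel \<Longrightarrow> bounded A \<Longrightarrow> L (indicator A) = 0" and f: "bdd_fun f"
  shows "L f = 0"
proof -
  have nonneg: "L (\<lambda>x. of_real (u x)) = 0"
    if "u \<in> borel_measurable borel" "\<And>x. 0 \<le> u x" "\<And>x. u x \<le> C" "\<And>x. K < \<bar>x\<bar> \<Longrightarrow> u x = 0" for u C K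
  proof -
    \<comment> \<open>The bound and the support are quantified inside the induction predicate. By
      nonnegativity they pass from a sum to its summands and from a monotone limit to its
      approximants.\<close>
    have "(\<forall>C K. (\<forall>x. u x \<le> C) \<longrightarrow> (\<forall>x. K < \<bar>x\<bar> \<longrightarrow> u x = 0) \<longrightarrow> L (\<lambda>x. of_real (u x)) = 0)"
      using that(1,2)
    proof (induction u rule: borel_measurable_induct_real)
      case (set A)
      show ?case
      proof (intro allI impI)
        fix C K assume "\<forall>x. K < \<bar>x\<bar> \<longrightarrow> indicat_real A x = 0"
        then have "\<bar>x\<bar> \<le> K" if "x \<in> A" for x using that by (force simp: indicator_def)
        then have "bounded A" by (auto simp: bounded_iff)
        moreover have "(\<lambda>x. complex_of_real (indicator A x)) = indicator A" by (auto simp: indicator_def)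
        ultimately show "L (\<lambda>x. complex_of_real (indicator A x)) = 0" using ind[OF set] by simp
      qed
    next
      case (mult u c)
      show ?case
      proof (intro allI impI)
        fix C K assume *: "\<forall>x. c * u x \<le> C" "\<forall>x. K < \<bar>x\<bar> \<longrightarrow> c * u x = 0"
        show "L (\<lambda>x. complex_of_real (c * u x)) = 0"
        proof (cases "c = 0")
          case True
          then show ?thesis using radon_zero[OF L] by simp
        next
          case False
          then have c: "c > 0" using mult.hyps by simp
          have "\<forall>x. u x \<le> C / c" using *(1) c by (simp add: field_simps)
          moreover have "\<forall>x. K < \<bar>x\<bar> \<longrightarrow> u x = 0" using *(2) c by simp
          ultimately have "L (\<lambda>x. complex_of_real (u x)) = 0" "bdd_fun (\<lambda>x. complex_of_real (u x))"
            using mult.IH mult.hyps by (blast, intro bdd_fun_of_real[of u "C / c" K]) auto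
          then show ?thesis using radon_cmult[OF L, of "\<lambda>x. complex_of_real (u x)" "of_real c"] by simp
        qed
      qed
    next
      case (add u v)
      show ?case
      proof (intro allI impI)
        fix C K assume *: "\<forall>x. v x + u x \<le> C" "\<forall>x. K < \<bar>x\<bar> \<longrightarrow> v x + u x = 0"
        have "u x \<le> C" "v x \<le> C" for x
          using add.hyps(2,4)[of x] *(1)[rule_format, of x] by linarith+
        moreover have "u x = 0" "v x = 0" if "K < \<bar>x\<bar>" for x
          using add.hyps(2,4)[of x] *(2)[rule_format, of x] that by linarith+
        ultimately have b: "\<forall>x. u x \<le> C" "\<forall>x. K < \<bar>x\<bar> \<longrightarrow> u x = 0"
          "\<forall>x. v x \<le> C" "\<forall>x. K < \<bar>x\<bar> \<longrightarrow> v x = 0" by auto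
        then have "L (\<lambda>x. complex_of_real (u x)) = 0" "L (\<lambda>x. complex_of_real (v x)) = 0"
          using add.IH by blast+
        moreover have "bdd_fun (\<lambda>x. complex_of_real (u x))" "bdd_fun (\<lambda>x. complex_of_real (v x))"
          using b add.hyps by (auto intro!: bdd_fun_of_real[of _ C K])
        ultimately show "L (\<lambda>x. complex_of_real (v x + u x)) = 0"
          using radon_add[OF L, of "\<lambda>x. complex_of_real (v x)" "\<lambda>x. complex_of_real (u x)"] by simp
      qed
    next
      case (seq U)
      show ?case
      proof (intro allI impI)
        fix C K assume *: "\<forall>x. u x \<le> C" "\<forall>x. K < \<bar>x\<bar> \<longrightarrow> u x = 0"
        have le: "U i x \<le> u x" for i x
          using incseq_le[of "\<lambda>i. U i x" "u x" i] seq.hyps(3,4) by (auto simp: incseq_def le_fun_def)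
        have b: "U i x \<le> C" "K < \<bar>x\<bar> \<Longrightarrow> U i x = 0" for i x
          using le[of i x] *(1)[rule_format, of x] *(2)[rule_format, of x] seq.hyps(2)[of i x] by auto
        have "L (\<lambda>x. complex_of_real (U i x)) = 0" for i using seq.IH[of i] b by blast
        moreover have "(\<lambda>i. L (\<lambda>x. complex_of_real (U i x))) \<longlonglongrightarrow> L (\<lambda>x. complex_of_real (u x))"
          using seq.hyps(1,2,4) b by (intro radon_limit[OF L, of _ C K]) (auto intro!: tendsto_of_real)
        ultimately show "L (\<lambda>x. complex_of_real (u x)) = 0" by (simp add: LIMSEQ_const_iff)
      qed
    qed
    then show ?thesis using that by blast
  qed
  obtain C K where fb: "f \<in> borel_measurable borel" "\<And>x. cmod (f x) \<le> C" "\<And>x. K < \<bar>x\<bar> \<Longrightarrow> f x = 0"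
    using f unfolding bdd_fun_def by blast
  have real: "L (\<lambda>x. of_real (g x)) = 0 \<and> bdd_fun (\<lambda>x. of_real (g x))"
    if g: "g \<in> borel_measurable borel" "\<And>x. \<bar>g x\<bar> \<le> C" "\<And>x. K < \<bar>x\<bar> \<Longrightarrow> g x = 0" for g
  proof -
    have m: "(\<lambda>x. max (g x) 0) \<in> borel_measurable borel" "(\<lambda>x. max (- g x) 0) \<in> borel_measurable borel"
      using g by auto
    have C: "0 \<le> C" using g(2)[of 0] by linarith
    have b: "max (g x) 0 \<le> C" "max (- g x) 0 \<le> C" for x using g(2)[of x] C by auto
    have "L (\<lambda>x. of_real (max (g x) 0)) = 0" "L (\<lambda>x. of_real (max (- g x) 0)) = 0"
      by (rule nonneg[of _ C K]; use g b m in auto)+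
    moreover have "bdd_fun (\<lambda>x. of_real (max (g x) 0))" "bdd_fun (\<lambda>x. of_real (max (- g x) 0))"
      by (rule bdd_fun_of_real[of _ C K]; use g b m in auto)+
    moreover have "of_real (g x) = complex_of_real (max (g x) 0) - of_real (max (- g x) 0)" for x
      by (simp add: max_def)
    ultimately have "L (\<lambda>x. of_real (g x)) = 0" using radon_diff[OF L] by simp
    then show ?thesis using bdd_fun_of_real[OF g] by blast
  qed
  have "L (\<lambda>x. of_real (Re (f x)) + \<i> * of_real (Im (f x))) = 0"
  proof -
    have "L (\<lambda>x. of_real (Re (f x))) = 0 \<and> bdd_fun (\<lambda>x. of_real (Re (f x)))"
      by (rule real) (use fb in \<open>auto intro: order_trans[OF abs_Re_le_cmod]\<close>)
    moreover have "L (\<lambda>x. of_real (Im (f x))) = 0 \<and> bdd_fun (\<lambda>x. of_real (Im (f x)))"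
      by (rule real) (use fb in \<open>auto intro: order_trans[OF abs_Im_le_cmod]\<close>)
    ultimately show ?thesis by (simp add: radon_add[OF L] radon_cmult[OF L] bdd_fun_cmult)
  qed
  then show ?thesis by (simp add: complex_eq[symmetric])
qed

lemma radon_unique:
  assumes "radon L" "radon L'" "\<And>A. A \<in> sets borel \<Longrightarrow> bounded A \<Longrightarrow> L (indicator A) = L' (indicator A)" "bdd_fun f"
  shows "L f = L' f"
  using radon_eq_zero[OF radon_minus[OF assms(1,2)] _ assms(4)] assms(3) by simp

section \<open>Integrals and densities as Radon functionals\<close>

lemma radon_integral:
  assumes m: "sets m = sets borel" and fin: "\<And>K. emeasure m {-K..K} < \<infinity>"
  shows "radon (\<lambda>f. LINT x|m. f x)" and "bdd_fun f \<Longrightarrow> integrable m f"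
proof -
  note [measurable_cong] = m
  have int: "integrable m f" if f: "bdd_fun f" for f :: "real \<Rightarrow> complex"
  proof -
    obtain C K where fb: "f \<in> borel_measurable borel" "\<And>x. cmod (f x) \<le> C" "\<And>x. K < \<bar>x\<bar> \<Longrightarrow> f x = 0"
      using f unfolding bdd_fun_def by blast
    show ?thesis
      by (rule integrableI_bounded_set[of "{-K..K}" _ _ C]) (use fb fin m in \<open>auto simp: abs_le_iff not_le[symmetric]\<close>)
  qed
  then show "bdd_fun f \<Longrightarrow> integrable m f" .
  show "radon (\<lambda>f. LINT x|m. f x)"
  proof (rule radonI)
    fix F :: "nat \<Rightarrow> real \<Rightarrow> complex" and f C K
    assume *: "\<And>n. F n \<in> borel_measurable borel" "\<And>n x. cmod (F n x) \<le> C"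
      "\<And>n x. K < \<bar>x\<bar> \<Longrightarrow> F n x = 0" "\<And>x. (\<lambda>n. F n x) \<longlonglongrightarrow> f x" "f \<in> borel_measurable borel"
    show "(\<lambda>n. LINT x|m. F n x) \<longlonglongrightarrow> (LINT x|m. f x)"
    proof (rule integral_dominated_convergence[where w = "\<lambda>x. C * indicator {-K..K} x"])
      show "integrable m (\<lambda>x. C * indicator {-K..K} x)"
        using fin m by (auto intro!: integrable_mult_right integrable_real_indicator)
      show "AE x in m. norm (F n x) \<le> C * indicator {-K..K} x" for n
        using *(2,3) by (auto simp: indicator_def abs_le_iff not_le[symmetric])
    qed (use * m in auto)
  qed (simp_all add: int)
qed

definition loc_int :: "(real \<Rightarrow> 'a::{banach,second_countable_topology}) \<Rightarrow> bool" where
  "loc_int g \<longleftrightarrow> (\<forall>x y. set_integrable lborel {x<..y} g)"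

lemma loc_int_bdd_fun:
  assumes g: "loc_int g" and f: "bdd_fun f"
  shows "integrable lborel (\<lambda>x. f x * g x)"
proof -
  obtain C K where fb: "f \<in> borel_measurable borel" "\<And>x. cmod (f x) \<le> C" "\<And>x. K < \<bar>x\<bar> \<Longrightarrow> f x = 0"
    using f unfolding bdd_fun_def by blast
  have i: "integrable lborel (\<lambda>x. indicator {-K-1<..K} x *\<^sub>R g x)"
    using g unfolding loc_int_def set_integrable_def by blast
  have eq: "f x * g x = f x * (indicator {-K-1<..K} x *\<^sub>R g x)" for x
    using fb(3)[of x] by (cases "K < \<bar>x\<bar>") (auto simp: indicator_def)
  show ?thesis unfolding eq
  proof (rule Bochner_Integration.integrable_bound)
    show "integrable lborel (\<lambda>x. C * norm (indicator {-K-1<..K} x *\<^sub>R g x))"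
      using i by (intro integrable_mult_right integrable_norm)
    show "AE x in lborel. norm (f x * indicator {-K-1<..K} x *\<^sub>R g x) \<le> norm (C * norm (indicator {-K-1<..K} x *\<^sub>R g x))"
    proof (intro always_eventually allI)
      fix x
      have "0 \<le> C" using order_trans[OF norm_ge_zero fb(2)] .
      then show "norm (f x * indicator {-K-1<..K} x *\<^sub>R g x) \<le> norm (C * norm (indicator {-K-1<..K} x *\<^sub>R g x))"
        using fb(2)[of x] by (auto simp: norm_mult indicator_def intro!: mult_right_mono)
    qed
    show "(\<lambda>x. f x * indicator {-K-1<..K} x *\<^sub>R g x) \<in> borel_measurable lborel"
      using fb(1) borel_measurable_integrable[OF i] by (intro borel_measurable_times) auto
  qed
qed

lemma radon_density:
  assumes g: "loc_int g"
  shows "radon (\<lambda>f. LINT x|lborel. f x * g x)"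
proof (rule radonI)
  fix F :: "nat \<Rightarrow> real \<Rightarrow> complex" and f C K
  assume *: "\<And>n. F n \<in> borel_measurable borel" "\<And>n x. cmod (F n x) \<le> C"
    "\<And>n x. K < \<bar>x\<bar> \<Longrightarrow> F n x = 0" "\<And>x. (\<lambda>n. F n x) \<longlonglongrightarrow> f x" "0 \<le> C" "f \<in> borel_measurable borel"
  have i: "integrable lborel (\<lambda>x. indicator {-K-1<..K} x *\<^sub>R g x)"
    using g unfolding loc_int_def set_integrable_def by blast
  have f0: "f x = 0" if "K < \<bar>x\<bar>" for x
    using *(4)[of x] *(3)[OF that] by (simp add: LIMSEQ_const_iff)
  have bf: "bdd_fun (F n)" for n using *(1-3) by (rule bdd_funI)
  have "cmod (f x) \<le> C" for x
    by (rule LIMSEQ_le_const2[OF tendsto_norm[OF *(4)]]) (use *(2) in auto)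
  then have bf': "bdd_fun f" using *(6) f0 by (intro bdd_funI)
  show "(\<lambda>n. LINT x|lborel. F n x * g x) \<longlonglongrightarrow> (LINT x|lborel. f x * g x)"
  proof (rule integral_dominated_convergence[where w = "\<lambda>x. C * norm (indicator {-K-1<..K} x *\<^sub>R g x)"])
    show "integrable lborel (\<lambda>x. C * norm (indicator {-K-1<..K} x *\<^sub>R g x))"
      using i by (intro integrable_mult_right integrable_norm)
    show "AE x in lborel. norm (F n x * g x) \<le> C * norm (indicator {-K-1<..K} x *\<^sub>R g x)" for n
    proof (intro always_eventually allI)
      fix x
      show "norm (F n x * g x) \<le> C * norm (indicator {-K-1<..K} x *\<^sub>R g x)"
        using *(2)[of n x] *(3)[of x n] *(5)
        by (cases "K < \<bar>x\<bar>") (auto simp: norm_mult indicator_def intro!: mult_right_mono)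
    qed
    show "AE x in lborel. (\<lambda>n. F n x * g x) \<longlonglongrightarrow> f x * g x" 
      using tendsto_mult_right[OF *(4)] by (intro always_eventually allI)
    show "(\<lambda>x. F n x * g x) \<in> borel_measurable lborel" for n
      using loc_int_bdd_fun[OF g bf] by (rule borel_measurable_integrable)
    show "(\<lambda>x. f x * g x) \<in> borel_measurable lborel"
      using loc_int_bdd_fun[OF g bf'] by (rule borel_measurable_integrable)
  qed
qed (simp_all add: loc_int_bdd_fun g distrib_right mult.assoc)

lemma LINT_indicator_complex:
  assumes "A \<in> sets m" "space m = UNIV"
  shows "(LINT x|m. (indicator A x :: complex)) = of_real (measure m A)"
proof -
  have "(LINT x|m. (indicator A x :: complex)) = (LINT x|m. of_real (indicator A x))"
    by (intro Bochner_Integration.integral_cong) (auto simp: indicator_def)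
  then show ?thesis using assms by simp
qed

lemma radon_signed_integral:
  assumes \<mu>: "local_signed_measure \<mu>"
  shows "radon (signed_integral \<mu>)"
    and "A \<in> sets borel \<Longrightarrow> bounded A \<Longrightarrow> signed_integral \<mu> (indicator A) = of_real (\<mu> A)"
proof -
  note \<mu>' = local_signed_measure_uminus[OF \<mu>]
  have r: "radon (\<lambda>f. LINT x|positive_part_measure \<mu>. f x)" if "local_signed_measure \<mu>" for \<mu>
    by (rule radon_integral(1)) (simp, rule emeasure_positive_part_bounded[OF that], auto)
  show "radon (signed_integral \<mu>)"
    unfolding signed_integral_def[abs_def] by (intro radon_minus r \<mu> \<mu>')
  show "signed_integral \<mu> (indicator A) = of_real (\<mu> A)" if A: "A \<in> sets borel" "bounded A"
    using A upper_variation_jordan(2)[OF \<mu> A] unfolding signed_integral_def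
    by (simp add: LINT_indicator_complex)
qed

lemma radon_complex_measure_integral:
  assumes \<nu>: "local_complex_borel_measure \<nu>"
  shows "radon (complex_measure_integral \<nu>)"
    and "A \<in> sets borel \<Longrightarrow> bounded A \<Longrightarrow> complex_measure_integral \<nu> (indicator A) = \<nu> A"
proof -
  note Re = radon_signed_integral[OF local_complex_Re[OF \<nu>]] and Im = radon_signed_integral[OF local_complex_Im[OF \<nu>]]
  show "radon (complex_measure_integral \<nu>)"
    unfolding complex_measure_integral_def[abs_def] by (intro radon_plus radon_scale Re(1) Im(1))
  show "complex_measure_integral \<nu> (indicator A) = \<nu> A" if "A \<in> sets borel" "bounded A"
    unfolding complex_measure_integral_def using Re(2)[OF that] Im(2)[OF that] by (simp add: complex_eq[symmetric])
qed

text \<open>The way back from functionals to set functions: countable additivity is the limit axiom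
  applied to partial sums of indicators.\<close>

lemma radon_local_complex:
  assumes L: "radon L"
  shows "local_complex_borel_measure (\<lambda>A. L (indicator A))"
  unfolding local_complex_borel_measure_def
proof (intro allI impI)
  fix A :: "nat \<Rightarrow> real set"
  assume A: "range A \<subseteq> sets borel" "disjoint_family A" "bounded (\<Union>i. A i)"
  have bi: "bdd_fun (indicator (A i))" for i
    using A by (intro bdd_fun_indicator) (auto intro: bounded_subset[OF A(3)])
  have eq: "(\<Sum>i<n. indicator (A i) x) = (indicator (\<Union>i<n. A i) x :: complex)" for n x
    by (rule indicator_UN_disjoint[symmetric]) (use A in \<open>auto simp: disjoint_family_on_def\<close>)
  obtain K where K: "\<And>x. x \<in> (\<Union>i. A i) \<Longrightarrow> \<bar>x\<bar> \<le> K" using A(3) by (auto simp: bounded_iff)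
  have "(\<lambda>n. L (\<lambda>x. \<Sum>i<n. indicator (A i) x)) \<longlonglongrightarrow> L (indicator (\<Union>i. A i))"
  proof (rule radon_limit[OF L, of _ 1 K])
    show "(\<lambda>x. \<Sum>i<n. indicator (A i) x :: complex) \<in> borel_measurable borel" for n
      using bi by (intro borel_measurable_sum) (simp add: bdd_fun_def)
    show "cmod (\<Sum>i<n. indicator (A i) x) \<le> 1" for n x unfolding eq by (simp add: indicator_def)
    show "(\<Sum>i<n. indicator (A i) x :: complex) = 0" if "K < \<bar>x\<bar>" for n x
    proof -
      have "x \<notin> (\<Union>i. A i)" using K[of x] that by force
      then show ?thesis unfolding eq by (simp add: indicator_def)
    qed
    show "(\<lambda>n. \<Sum>i<n. indicator (A i) x :: complex) \<longlonglongrightarrow> indicator (\<Union>i. A i) x" for x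
      unfolding eq by (rule LIMSEQ_indicator_UN)
  qed
  then show "(\<lambda>i. L (indicator (A i))) sums L (indicator (\<Union>i. A i))"
    unfolding sums_def using radon_sum[OF L, of "{..<n}" "\<lambda>i. indicator (A i)" for n] bi by simp
qed

lemma complex_measure_integral_eq:
  assumes "local_complex_borel_measure \<nu>" "radon L"
    "\<And>A. A \<in> sets borel \<Longrightarrow> bounded A \<Longrightarrow> \<nu> A = L (indicator A)" "bdd_fun f"
  shows "complex_measure_integral \<nu> f = L f"
  using radon_unique[OF radon_complex_measure_integral(1) assms(2) _ assms(4)]
    radon_complex_measure_integral(2) assms by simp

section \<open>Integration by parts\<close>

lemma radon_Ioc_split:
  assumes "radon L" "x \<le> y" "y \<le> z"
  shows "L (indicator {x<..z}) = L (indicator {x<..y}) + L (indicator {y<..z})"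
proof -
  have "(indicator {x<..z} :: real \<Rightarrow> complex) = (\<lambda>t. indicator {x<..y} t + indicator {y<..z} t)"
    using assms(2,3) by (auto simp: indicator_def)
  then show ?thesis using radon_add[OF assms(1)] by simp
qed

lemma radon_Ioc_empty: "radon L \<Longrightarrow> y \<le> x \<Longrightarrow> L (indicator {x<..y}) = 0"
  using radon_zero by (simp add: indicator_def[abs_def])

text \<open>The hypothesis says that for each \<open>z\<close> the truth value of
  \<open>z \<le> t m\<close> stabilises, which gives pointwise convergence of the indicators. It
  covers sequences that approach their limit from the right as well as all monotone sequences; in
  the increasing case the limit may be the indicator of an open interval.\<close>

lemma radon_Ioc_limit:
  assumes L: "radon L" and t: "\<And>z. \<exists>N. (\<forall>m\<ge>N. z \<le> t m) \<or> (\<forall>m\<ge>N. t m < z)" and le: "\<And>n. t n \<le> y"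
  shows "(\<lambda>n. L (indicator {x<..t n})) \<longlonglongrightarrow> L (\<lambda>z. if x < z \<and> (\<exists>N. \<forall>m\<ge>N. z \<le> t m) then 1 else 0)"
proof (rule radon_limit[OF L, of _ 1 "\<bar>x\<bar> + \<bar>y\<bar>"])
  show "indicator {x<..t n} z = (0::complex)" if "\<bar>x\<bar> + \<bar>y\<bar> < \<bar>z\<bar>" for n z
    using that le[of n] by (auto simp: indicator_def)
  show "(\<lambda>n. indicator {x<..t n} z) \<longlonglongrightarrow> (if x < z \<and> (\<exists>N. \<forall>m\<ge>N. z \<le> t m) then 1 else 0 :: complex)" for z
  proof (rule tendsto_eventually)
    obtain N where N: "(\<forall>m\<ge>N. z \<le> t m) \<or> (\<forall>m\<ge>N. t m < z)" using t by blast
    have "(\<exists>N. \<forall>m\<ge>N. z \<le> t m) \<longleftrightarrow> (\<forall>m\<ge>N. z \<le> t m)"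
    proof
      assume "\<exists>N. \<forall>m\<ge>N. z \<le> t m"
      then obtain N' where "\<forall>m\<ge>N'. z \<le> t m" ..
      then have "z \<le> t (max N N')" by simp
      moreover have "N \<le> max N N'" by simp
      ultimately show "\<forall>m\<ge>N. z \<le> t m" using N by (metis not_le)
    qed blast
    then show "\<forall>\<^sub>F n in sequentially. indicator {x<..t n} z = (if x < z \<and> (\<exists>N. \<forall>m\<ge>N. z \<le> t m) then 1 else 0 :: complex)"
      using N by (intro eventually_sequentiallyI[of N]) (auto simp: indicator_def not_le)
  qed
qed (auto simp: indicator_def)

lemma radon_Ioc_right_continuous:
  assumes L: "radon L" and t: "t \<longlonglongrightarrow> s" "\<And>n. s \<le> t n"
  shows "(\<lambda>n. L (indicator {x<..t n})) \<longlonglongrightarrow> L (indicator {x<..s})"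
proof -
  obtain y where y: "\<And>n. t n \<le> y"
    using convergent_imp_Bseq[of t] t(1) unfolding convergent_def Bseq_def by (auto simp: abs_le_iff)
  have ev: "\<exists>N. \<forall>m\<ge>N. t m < z" if "s < z" for z
    using order_tendstoD(2)[OF t(1) that] by (simp add: eventually_sequentially)
  have *: "\<exists>N. (\<forall>m\<ge>N. z \<le> t m) \<or> (\<forall>m\<ge>N. t m < z)" for z
  proof (cases "z \<le> s")
    case True
    then show ?thesis using t(2) order_trans by blast
  next
    case False
    then show ?thesis using ev[of z] by auto
  qed
  have "(\<exists>N. \<forall>m\<ge>N. z \<le> t m) \<longleftrightarrow> z \<le> s" for z
  proof
    assume "\<exists>N. \<forall>m\<ge>N. z \<le> t m"
    then show "z \<le> s" using t(1) by (auto intro: LIMSEQ_le_const)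
  qed (use t(2) order_trans in blast)
  then have "(\<lambda>z. if x < z \<and> (\<exists>N. \<forall>m\<ge>N. z \<le> t m) then 1 else 0 :: complex) = indicator {x<..s}"
    by (auto simp: indicator_def)
  then show ?thesis using radon_Ioc_limit[OF L * y, of x] by simp
qed

text \<open>Boundedness without total variation: if the values were unbounded along some sequence of
  end points, a monotone subsequence of it would, by \<open>radon_Ioc_limit\<close>, have convergent
  values.\<close>

lemma radon_Ioc_bounded:
  assumes L: "radon L"
  shows "\<exists>C. \<forall>s\<le>y. cmod (L (indicator {x<..s})) \<le> C"
proof (rule ccontr)
  assume "\<not> ?thesis"
  then have "\<forall>n::nat. \<exists>s\<le>y. real n < cmod (L (indicator {x<..s}))" by (meson not_le)
  then obtain s where s: "\<And>n. s n \<le> y" "\<And>n. real n < cmod (L (indicator {x<..s n}))" by metis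
  obtain f where f: "strict_mono f" "monoseq (\<lambda>n. s (f n))" using seq_monosub by metis
  have "\<exists>N. (\<forall>m\<ge>N. z \<le> s (f m)) \<or> (\<forall>m\<ge>N. s (f m) < z)" for z
  proof (cases "incseq (\<lambda>n. s (f n))")
    case True
    show ?thesis
    proof (cases "\<exists>N. z \<le> s (f N)")
      case True
      then obtain N where "z \<le> s (f N)" ..
      then have "\<forall>m\<ge>N. z \<le> s (f m)" using incseqD[OF \<open>incseq _\<close>] order_trans by blast
      then show ?thesis by blast
    qed (auto simp: not_le)
  next
    case False
    then have d: "decseq (\<lambda>n. s (f n))" using f(2) by (simp add: monoseq_iff)
    show ?thesis
    proof (cases "\<exists>N. s (f N) < z")
      case True
      then obtain N where "s (f N) < z" ..
      then have "\<forall>m\<ge>N. s (f m) < z" using decseqD[OF d] le_less_trans by blast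
      then show ?thesis by blast
    qed (auto simp: not_less)
  qed
  then have "convergent (\<lambda>n. L (indicator {x<..s (f n)}))"
    using radon_Ioc_limit[OF L, of "\<lambda>n. s (f n)" y x] s(1) by (auto simp: convergent_def)
  then have "Bseq (\<lambda>n. L (indicator {x<..s (f n)}))" by (rule convergent_imp_Bseq)
  then obtain K where K: "\<And>n. cmod (L (indicator {x<..s (f n)})) \<le> K" unfolding Bseq_def by blast
  obtain n :: nat where "K < n" using reals_Archimedean2 by blast
  also have "real n \<le> f n" using seq_suble[OF f(1)] by simp
  also have "\<dots> < cmod (L (indicator {x<..s (f n)}))" by (rule s(2))
  finally show False using K[of n] by simp
qed

text \<open>Absolute continuity of \<open>U\<close> with density \<open>w\<close> in integral form.
  Only intervals contained in \<open>S\<close> are tested, and \<open>w\<close> matters only up to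
  null sets, so almost everywhere derivatives never appear.\<close>

definition prim_on :: "real set \<Rightarrow> (real \<Rightarrow> 'a::{banach,second_countable_topology}) \<Rightarrow> (real \<Rightarrow> 'a) \<Rightarrow> bool" where
  "prim_on S U w \<longleftrightarrow> (\<forall>x y. x \<le> y \<longrightarrow> {x..y} \<subseteq> S \<longrightarrow>
     set_integrable lborel {x<..y} w \<and> U y - U x = (LINT s:{x<..y}|lborel. w s))"

lemma prim_onD:
  assumes "prim_on S U w" "x \<le> y" "{x..y} \<subseteq> S"
  shows "set_integrable lborel {x<..y} w" "U y - U x = (LINT s:{x<..y}|lborel. w s)"
  using assms unfolding prim_on_def by blast+

lemma prim_onI:
  "(\<And>x y. x \<le> y \<Longrightarrow> {x..y} \<subseteq> S \<Longrightarrow> set_integrable lborel {x<..y} w) \<Longrightarrow>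
   (\<And>x y. x \<le> y \<Longrightarrow> {x..y} \<subseteq> S \<Longrightarrow> U y - U x = (LINT s:{x<..y}|lborel. w s)) \<Longrightarrow> prim_on S U w"
  unfolding prim_on_def by blast

lemma prim_on_subset: "prim_on S U w \<Longrightarrow> T \<subseteq> S \<Longrightarrow> prim_on T U w"
  unfolding prim_on_def by blast

lemma prim_on_continuous:
  assumes p: "prim_on {x..y} U w"
  shows "continuous_on {x..y} U"
proof (cases "x \<le> y")
  case True
  have int: "integrable lborel (\<lambda>s. indicator {x<..y} s *\<^sub>R w s)"
    using prim_onD(1)[OF p True] by (simp add: set_integrable_def)
  show ?thesis
    unfolding continuous_on_sequentially
  proof (intro allI ballI impI)
    fix t a assume a: "a \<in> {x..y}" and t: "(\<forall>n. t n \<in> {x..y}) \<and> t \<longlonglongrightarrow> a"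
    have eq: "U s = U x + (LINT r|lborel. indicator {x<..s} r *\<^sub>R w r)" if "s \<in> {x..y}" for s
      using prim_onD(2)[OF p, of x s] that by (auto simp: set_lebesgue_integral_def algebra_simps)
    have m: "(\<lambda>r. indicator {x<..s} r *\<^sub>R w r) \<in> borel_measurable lborel" if "s \<in> {x..y}" for s
      using prim_onD(1)[OF p, of x s] that by (auto simp: set_integrable_def dest: borel_measurable_integrable)
    have "(\<lambda>n. LINT r|lborel. indicator {x<..t n} r *\<^sub>R w r) \<longlonglongrightarrow> (LINT r|lborel. indicator {x<..a} r *\<^sub>R w r)"
    proof (rule integral_dominated_convergence[OF m m integrable_norm[OF int]])
      show "AE r in lborel. (\<lambda>n. indicator {x<..t n} r *\<^sub>R w r) \<longlonglongrightarrow> indicator {x<..a} r *\<^sub>R w r"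
        using AE_lborel_singleton[of a]
      proof eventually_elim
        case (elim r)
        have "\<forall>\<^sub>F n in sequentially. indicator {x<..t n} r = (indicator {x<..a} r :: real)"
        proof (cases "r < a")
          case True
          then show ?thesis using order_tendstoD(1)[OF conjunct2[OF t] True] by (auto elim!: eventually_mono simp: indicator_def)
        next
          case False
          then have "a < r" using elim by simp
          then show ?thesis using order_tendstoD(2)[OF conjunct2[OF t], of r] by (auto elim!: eventually_mono simp: indicator_def)
        qed
        then show ?case by (intro tendsto_eventually) (auto elim!: eventually_mono)
      qed
      show "AE r in lborel. norm (indicator {x<..t n} r *\<^sub>R w r) \<le> norm (indicator {x<..y} r *\<^sub>R w r)" for n
      proof -
        have "t n \<le> y" using t by auto
        then show ?thesis by (auto simp: indicator_def)
      qed
    qed (use a t in auto)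
    then show "(U \<circ> t) \<longlonglongrightarrow> U a"
    proof -
      have "U \<circ> t = (\<lambda>n. U x + (LINT r|lborel. indicator {x<..t n} r *\<^sub>R w r))"
        using eq t by (intro ext) auto
      then show ?thesis
        unfolding eq[OF a] using \<open>(\<lambda>n. LINT r|lborel. _ n r) \<longlonglongrightarrow> _\<close> by (simp only: tendsto_add tendsto_const)
    qed
  qed
qed simp

lemma cell_exists:
  fixes p :: "nat \<Rightarrow> real"
  assumes "p 0 < t" "t \<le> p n"
  obtains i where "i < n" "p i < t" "t \<le> p (Suc i)"
proof -
  define j where "j = (LEAST j. t \<le> p j)"
  have j: "t \<le> p j" unfolding j_def by (rule LeastI) (rule assms)
  have jn: "j \<le> n" unfolding j_def by (rule Least_le) (rule assms)
  have "j \<noteq> 0" using j assms(1) by (metis not_le)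
  then obtain i where i: "j = Suc i" by (cases j) auto
  then have "\<not> t \<le> p i" using not_less_Least[of i "\<lambda>j. t \<le> p j"] j_def by auto
  then show ?thesis using that[of i] i j jn by auto
qed

lemma cell_sum:
  fixes p :: "nat \<Rightarrow> real" and c :: "nat \<Rightarrow> complex"
  assumes p: "mono p" and j: "j < n" "p j < t" "t \<le> p (Suc j)"
  shows "(\<Sum>i<n. c i * indicator {p i<..p (Suc i)} t) = c j"
proof -
  have "c i * indicator {p i<..p (Suc i)} t = (if i = j then c j else 0)" for i
  proof (cases "i = j")
    case False
    then consider "Suc i \<le> j" | "Suc j \<le> i" by linarith
    then have "t \<notin> {p i<..p (Suc i)}"
      using monoD[OF p, of "Suc i" j] monoD[OF p, of "Suc j" i] j by cases auto
    then show ?thesis using False by simp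
  qed (use j in simp)
  then show ?thesis using j by simp
qed

lemma abel_sum:
  fixes U W :: "nat \<Rightarrow> complex"
  shows "(\<Sum>i<n. U i * (W (Suc i) - W i)) = U n * W n - U 0 * W 0 - (\<Sum>i<n. W (Suc i) * (U (Suc i) - U i))"
  by (induction n) (auto simp: algebra_simps)

text \<open>Integration by parts between an absolutely continuous function and a measure that may
  have atoms. Riemann-Stieltjes sums of \<open>U\<close> are rearranged by Abel summation into sums
  over increments of \<open>U\<close>, and both sides converge by dominated convergence.\<close>

lemma radon_ibp:
  fixes U w :: "real \<Rightarrow> complex"
  assumes L: "radon L" and xy: "x \<le> y" and p: "prim_on {x..y} U w"
  defines "W \<equiv> \<lambda>s. L (indicator {x<..s})"
  shows "set_integrable lborel {x<..y} (\<lambda>s. w s * W s)" (is ?A)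
    and "L (\<lambda>t. indicator {x<..y} t * U t) = U y * W y - (LINT s:{x<..y}|lborel. w s * W s)" (is ?B)
proof -
  have "?A \<and> ?B"
  proof (cases "x = y")
    case True
    have "L (indicator {}) = 0" using radon_Ioc_empty[OF L, of y y] by simp
    then show ?thesis using True radon_zero[OF L]
      by (simp add: W_def set_integrable_def set_lebesgue_integral_def)
  next
    case False
    then have xy': "x < y" using xy by simp
    define q where "q n i = x + (y - x) * real i / real (Suc n)" for n i :: nat
    have q0: "q n 0 = x" for n by (simp add: q_def)
    have qn: "q n (Suc n) = y" for n
      by (simp add: q_def nonzero_mult_div_cancel_right[of "real (Suc n)"] del: of_nat_Suc times_divide_eq_right)
    have qm: "mono (q n)" for n
      unfolding q_def using xy' by (intro monoI add_left_mono divide_right_mono mult_left_mono) simp_all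
    have qr: "q n i \<in> {x..y}" if "i \<le> Suc n" for n i
      using monoD[OF qm, of 0 i n] monoD[OF qm, of i "Suc n" n] that q0 qn by auto
    have qd: "q n (Suc i) - q n i = (y - x) / real (Suc n)" for n i
      unfolding q_def add_diff_cancel_left diff_divide_distrib[symmetric] right_diff_distrib[symmetric] by simp
    have mesh: "(\<lambda>n. (y - x) / real (Suc n)) \<longlonglongrightarrow> 0"
      using LIMSEQ_Suc[OF lim_const_over_n[of "y - x"]] by simp
    have cell: "\<exists>i<Suc n. q n i < t \<and> t \<le> q n (Suc i)" if "t \<in> {x<..y}" for n t
      using cell_exists[of "q n" t "Suc n"] that q0 qn by (metis greaterThanAtMost_iff)
    have int: "integrable lborel (\<lambda>s. indicator {x<..y} s *\<^sub>R w s)"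
      using prim_onD(1)[OF p xy] by (simp add: set_integrable_def)
    have cont: "continuous_on {x..y} U" by (rule prim_on_continuous[OF p])
    obtain CU where CU: "\<And>t. t \<in> {x..y} \<Longrightarrow> cmod (U t) \<le> CU"
      using compact_imp_bounded[OF compact_continuous_image[OF cont compact_Icc]] unfolding bounded_iff by blast
    obtain CW where CW: "\<And>t. t \<le> y \<Longrightarrow> cmod (W t) \<le> CW"
      using radon_Ioc_bounded[OF L] unfolding W_def by blast
    have outside: "(\<Sum>i<Suc n. c i * indicator {q n i<..q n (Suc i)} t) = (0::complex)" if "t \<notin> {x<..y}" for n t c
    proof -
      have "t \<notin> {q n i<..q n (Suc i)}" if "i < Suc n" for i
        using that qr[of i n] qr[of "Suc i" n] \<open>t \<notin> {x<..y}\<close> by auto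
      then show ?thesis by (intro sum.neutral) auto
    qed
    \<comment> \<open>Abel summation pairs left end points for \<open>U\<close> with right end
      points for \<open>W\<close>. The latter is the favourable side: \<open>W\<close> is only right
      continuous, and the right end points approach \<open>t\<close> from the right.\<close>
    define F where "F n t = (\<Sum>i<Suc n. U (q n i) * indicator {q n i<..q n (Suc i)} t)" for n t
    define H where "H n t = (\<Sum>i<Suc n. W (q n (Suc i)) * indicator {q n i<..q n (Suc i)} t)" for n t
    have Fm: "F n \<in> borel_measurable borel" and Hm: "H n \<in> borel_measurable borel" for n
      unfolding F_def[abs_def] H_def[abs_def]
      by (auto intro!: borel_measurable_sum borel_measurable_times simp del: sum_mult_indicator sum.lessThan_Suc)
    have FL: "(\<lambda>n. L (F n)) \<longlonglongrightarrow> L (\<lambda>t. indicator {x<..y} t * U t)"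
    proof (rule radon_limit[OF L Fm, where C = "max CU 0" and K = "\<bar>x\<bar> + \<bar>y\<bar>"])
      show "cmod (F n t) \<le> max CU 0" for n t
      proof (cases "t \<in> {x<..y}")
        case True
        then obtain i where i: "i < Suc n" "q n i < t" "t \<le> q n (Suc i)" using cell by blast
        show ?thesis unfolding F_def cell_sum[OF qm i] using CU[OF qr[of i n]] i by auto
      next
        case False
        then show ?thesis unfolding F_def outside[OF False] by simp
      qed
      show "F n t = 0" if "\<bar>x\<bar> + \<bar>y\<bar> < \<bar>t\<bar>" for n t
        unfolding F_def by (rule outside) (use that in auto)
      show "(\<lambda>n. F n t) \<longlonglongrightarrow> indicator {x<..y} t * U t" for t
      proof (cases "t \<in> {x<..y}")
        case True
        define i where "i n = (SOME i. i < Suc n \<and> q n i < t \<and> t \<le> q n (Suc i))" for n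
        have i: "i n < Suc n" "q n (i n) < t" "t \<le> q n (Suc (i n))" for n
          using someI_ex[OF cell[OF True, of n]] unfolding i_def by auto
        have "(\<lambda>n. q n (i n)) \<longlonglongrightarrow> t"
        proof (rule LIMSEQ_offset[of _ 0], rule tendsto_sandwich[where f = "\<lambda>n. t - (y - x) / real (Suc n)" and h = "\<lambda>n. t"])
          show "(\<lambda>n. t - (y - x) / real (Suc n)) \<longlonglongrightarrow> t" using tendsto_diff[OF tendsto_const mesh, of t] by simp
          show "\<forall>\<^sub>F n in sequentially. t - (y - x) / real (Suc n) \<le> q (n + 0) (i (n + 0))"
            using i(3) qd by (auto simp: algebra_simps)
          show "\<forall>\<^sub>F n in sequentially. q (n + 0) (i (n + 0)) \<le> t"
            using i(2) by (auto intro!: always_eventually less_imp_le)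
        qed simp
        moreover have "q n (i n) \<in> {x..y}" for n using qr i(1) less_imp_le by blast
        ultimately have "(U \<circ> (\<lambda>n. q n (i n))) \<longlonglongrightarrow> U t"
          using cont True unfolding continuous_on_sequentially by auto
        moreover have "F n t = U (q n (i n))" for n unfolding F_def by (rule cell_sum[OF qm i])
        ultimately show ?thesis using True by (simp add: comp_def)
      next
        case False
        then show ?thesis unfolding F_def outside[OF False] by simp
      qed
    qed
    have HW: "(\<lambda>n. H n t) \<longlonglongrightarrow> W t" if t: "t \<in> {x<..y}" for t
    proof -
      define i where "i n = (SOME i. i < Suc n \<and> q n i < t \<and> t \<le> q n (Suc i))" for n
      have i: "i n < Suc n" "q n (i n) < t" "t \<le> q n (Suc (i n))" for n
        using someI_ex[OF cell[OF t, of n]] unfolding i_def by auto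
      have "(\<lambda>n. q n (Suc (i n))) \<longlonglongrightarrow> t"
      proof (rule tendsto_sandwich[where h = "\<lambda>n. t + (y - x) / real (Suc n)" and f = "\<lambda>n. t"])
        show "(\<lambda>n. t + (y - x) / real (Suc n)) \<longlonglongrightarrow> t" using tendsto_add[OF tendsto_const mesh, of t] by simp
        have "q n (Suc (i n)) \<le> t + (y - x) / real (Suc n)" for n using i(2)[of n] qd[of n "i n"] by linarith
        then show "\<forall>\<^sub>F n in sequentially. q n (Suc (i n)) \<le> t + (y - x) / real (Suc n)" by simp
      qed (use i(3) in auto)
      then have "(\<lambda>n. W (q n (Suc (i n)))) \<longlonglongrightarrow> W t"
        unfolding W_def using i(3) by (intro radon_Ioc_right_continuous[OF L])
      moreover have "H n t = W (q n (Suc (i n)))" for n unfolding H_def by (rule cell_sum[OF qm i])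
      ultimately show ?thesis by simp
    qed
    have Hb: "cmod (H n t) \<le> max CW 0" for n t
    proof (cases "t \<in> {x<..y}")
      case True
      then obtain i where i: "i < Suc n" "q n i < t" "t \<le> q n (Suc i)" using cell by blast
      show ?thesis unfolding H_def cell_sum[OF qm i] using CW[of "q n (Suc i)"] qr[of "Suc i" n] i by auto
    next
      case False
      then show ?thesis unfolding H_def outside[OF False] by simp
    qed
    define f where "f n s = H n s * (indicator {x<..y} s *\<^sub>R w s)" for n s
    have fm: "f n \<in> borel_measurable lborel" for n
      unfolding f_def[abs_def] using Hm int by (intro borel_measurable_times) (auto dest: borel_measurable_integrable)
    have flim: "(\<lambda>n. f n s) \<longlonglongrightarrow> indicator {x<..y} s *\<^sub>R (w s * W s)" for s
      using tendsto_mult_right[OF HW, of s "w s"] unfolding f_def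
      by (cases "s \<in> {x<..y}") (auto simp: mult.commute)
    have fb: "norm (f n s) \<le> max CW 0 * norm (indicator {x<..y} s *\<^sub>R w s)" for n s
      unfolding f_def norm_mult by (intro mult_right_mono Hb norm_ge_zero)
    have gm: "(\<lambda>s. indicator {x<..y} s *\<^sub>R (w s * W s)) \<in> borel_measurable lborel"
      by (rule borel_measurable_LIMSEQ_metric[OF fm flim])
    have ib: "integrable lborel (\<lambda>s. max CW 0 * norm (indicator {x<..y} s *\<^sub>R w s))"
      by (intro integrable_mult_right integrable_norm int)
    note dc = integrable_dominated_convergence[where s = f, OF gm fm ib] integral_dominated_convergence[where s = f, OF gm fm ib]
    have A: ?A unfolding set_integrable_def
      by (rule dc(1)) (use flim fb in auto)
    have lim: "(\<lambda>n. LINT s|lborel. f n s) \<longlonglongrightarrow> (LINT s:{x<..y}|lborel. w s * W s)"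
      unfolding set_lebesgue_integral_def by (rule dc(2)) (use flim fb in auto)
    have LF: "L (F n) = U y * W y - (LINT s|lborel. f n s)" for n
    proof -
      have "L (F n) = (\<Sum>i<Suc n. L (\<lambda>t. U (q n i) * indicator {q n i<..q n (Suc i)} t))"
        unfolding F_def[abs_def] by (rule radon_sum[OF L]) (auto intro: bdd_fun_cmult)
      also have "\<dots> = (\<Sum>i<Suc n. U (q n i) * (W (q n (Suc i)) - W (q n i)))"
      proof (rule sum.cong[OF refl])
        fix i assume "i \<in> {..<Suc n}"
        then have "L (indicator {q n i<..q n (Suc i)}) = W (q n (Suc i)) - W (q n i)"
          using radon_Ioc_split[OF L, of x "q n i" "q n (Suc i)"] monoD[OF qm, of i "Suc i" n] qr[of i n]
          by (simp add: W_def)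
        then show "L (\<lambda>t. U (q n i) * indicator {q n i<..q n (Suc i)} t) = U (q n i) * (W (q n (Suc i)) - W (q n i))"
          using radon_cmult[OF L bdd_fun_Ioc] by simp
      qed
      also have "\<dots> = U y * W y - U x * W x - (\<Sum>i<Suc n. W (q n (Suc i)) * (U (q n (Suc i)) - U (q n i)))"
        by (subst abel_sum[of "\<lambda>i. U (q n i)" "\<lambda>i. W (q n i)"]) (simp only: q0 qn)
      also have "W x = 0" unfolding W_def by (rule radon_Ioc_empty[OF L order_refl])
      also have "(\<Sum>i<Suc n. W (q n (Suc i)) * (U (q n (Suc i)) - U (q n i))) = (LINT s|lborel. f n s)"
      proof -
        have si: "set_integrable lborel {q n i<..q n (Suc i)} w \<and> U (q n (Suc i)) - U (q n i) = (LINT s:{q n i<..q n (Suc i)}|lborel. w s)"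
          if "i < Suc n" for i
          using prim_onD[OF p, of "q n i" "q n (Suc i)"] monoD[OF qm, of i "Suc i" n] qr[of i n] qr[of "Suc i" n] that by auto
        have "(LINT s|lborel. f n s) = (LINT s|lborel. (\<Sum>i<Suc n. W (q n (Suc i)) * (indicator {q n i<..q n (Suc i)} s *\<^sub>R w s)))"
        proof (rule Bochner_Integration.integral_cong[OF refl])
          fix s
          have "(\<Sum>i<Suc n. W (q n (Suc i)) * (indicator {q n i<..q n (Suc i)} s *\<^sub>R w s)) = H n s * w s"
            unfolding H_def sum_distrib_right by (rule sum.cong) (auto simp: indicator_def)
          moreover have "H n s * w s = f n s"
            unfolding f_def by (cases "s \<in> {x<..y}") (simp, unfold H_def outside, simp)
          ultimately show "f n s = (\<Sum>i<Suc n. W (q n (Suc i)) * (indicator {q n i<..q n (Suc i)} s *\<^sub>R w s))" by simp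
        qed
        also have "\<dots> = (\<Sum>i<Suc n. LINT s|lborel. W (q n (Suc i)) * (indicator {q n i<..q n (Suc i)} s *\<^sub>R w s))"
          using si by (intro Bochner_Integration.integral_sum) (auto simp: set_integrable_def simp del: mult_scaleR_right intro!: integrable_mult_right)
        also have "\<dots> = (\<Sum>i<Suc n. W (q n (Suc i)) * (U (q n (Suc i)) - U (q n i)))"
          by (rule sum.cong[OF refl]) (use si in \<open>simp add: set_lebesgue_integral_def del: mult_scaleR_right\<close>)
        finally show ?thesis by simp
      qed
      finally show ?thesis by simp
    qed
    have "(\<lambda>n. L (F n)) \<longlonglongrightarrow> U y * W y - (LINT s:{x<..y}|lborel. w s * W s)"
      unfolding LF by (intro tendsto_diff tendsto_const lim)
    then have ?B using LIMSEQ_unique[OF FL] by simp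
    then show ?thesis using A by blast
  qed
  then show ?A ?B by blast+
qed

section \<open>Calculus of primitives\<close>

lemma set_integrable_Ioc_subset:
  fixes w :: "real \<Rightarrow> 'a::{banach,second_countable_topology}"
  shows "set_integrable lborel {x<..y::real} w \<Longrightarrow> x \<le> x' \<Longrightarrow> y' \<le> y \<Longrightarrow> set_integrable lborel {x'<..y'} w"
  by (rule set_integrable_subset) auto

lemma AE_Ioc_Icc: "AE s in lborel. indicator {x<..y::real} s = (indicator {x..y} s :: real)"
  using AE_lborel_singleton[of x] by eventually_elim (auto simp: indicator_def)

lemma prim_on_C1:
  fixes U w :: "real \<Rightarrow> 'a::euclidean_space"
  assumes d: "\<And>t. (U has_vector_derivative w t) (at t)" and c: "continuous_on UNIV w"
  shows "prim_on S U w"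
proof (rule prim_onI)
  fix x y :: real assume xy: "x \<le> y"
  have i: "integrable lborel (\<lambda>s. indicator {x..y} s *\<^sub>R w s)"
    by (rule borel_integrable_compact) (auto intro: continuous_on_subset[OF c])
  have m: "(\<lambda>s. indicator {x<..y} s *\<^sub>R w s) \<in> borel_measurable lborel"
    using borel_measurable_continuous_onI[OF c] by auto
  show "set_integrable lborel {x<..y} w" unfolding set_integrable_def
    by (rule integrable_cong_AE_imp[OF i m]) (use AE_Ioc_Icc[of x y] in \<open>auto elim!: eventually_mono\<close>)
  have "(LINT s|lborel. indicator {x..y} s *\<^sub>R w s) = U y - U x"
    by (rule integral_FTC_atLeastAtMost[OF xy]) (auto intro: has_vector_derivative_at_within d continuous_on_subset[OF c])
  moreover have "(LINT s:{x<..y}|lborel. w s) = (LINT s|lborel. indicator {x..y} s *\<^sub>R w s)"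
    unfolding set_lebesgue_integral_def
    by (rule integral_cong_AE) (use m i AE_Ioc_Icc[of x y] in \<open>auto elim!: eventually_mono dest: borel_measurable_integrable\<close>)
  ultimately show "U y - U x = (LINT s:{x<..y}|lborel. w s)" by simp
qed

lemma prim_on_const: "prim_on S (\<lambda>t. c) (\<lambda>t. 0)"
  by (rule prim_onI) (auto simp: set_integrable_def set_lebesgue_integral_def)

lemma prim_on_add:
  assumes "prim_on S U w" "prim_on S V z" shows "prim_on S (\<lambda>t. U t + V t) (\<lambda>t. w t + z t)"
proof (rule prim_onI)
  fix x y :: real assume xy: "x \<le> y" "{x..y} \<subseteq> S"
  note * = prim_onD[OF assms(1) xy] prim_onD[OF assms(2) xy]
  show "set_integrable lborel {x<..y} (\<lambda>t. w t + z t)" by (rule set_integral_add(1)[OF *(1,3)])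
  show "U y + V y - (U x + V x) = (LINT s:{x<..y}|lborel. w s + z s)"
    unfolding set_integral_add(2)[OF *(1,3)] *(2,4)[symmetric] by simp
qed

lemma prim_on_bounded_linear:
  assumes f: "bounded_linear f" and p: "prim_on S U w"
  shows "prim_on S (\<lambda>t. f (U t)) (\<lambda>t. f (w t))"
proof (rule prim_onI)
  interpret bounded_linear f by fact
  fix x y :: real assume xy: "x \<le> y" "{x..y} \<subseteq> S"
  note * = prim_onD[OF p xy]
  show "set_integrable lborel {x<..y} (\<lambda>t. f (w t))"
    using integrable_bounded_linear[OF f *(1)[unfolded set_integrable_def]]
    by (simp add: set_integrable_def scaleR)
  show "f (U y) - f (U x) = (LINT s:{x<..y}|lborel. f (w s))"
    using integral_bounded_linear[OF f *(1)[unfolded set_integrable_def]] *(2)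
    by (simp add: set_lebesgue_integral_def scaleR diff[symmetric])
qed

lemma prim_on_cmult:
  fixes c :: "'a::{banach,second_countable_topology,real_normed_algebra}"
  shows "prim_on S U w \<Longrightarrow> prim_on S (\<lambda>t. c * U t) (\<lambda>t. c * w t)"
  by (rule prim_on_bounded_linear[OF bounded_linear_mult_right])

lemma prim_on_diff:
  assumes "prim_on S U w" "prim_on S V z" shows "prim_on S (\<lambda>t. U t - V t) (\<lambda>t. w t - z t)"
  using prim_on_add[OF assms(1) prim_on_bounded_linear[OF bounded_linear_minus[OF bounded_linear_ident] assms(2)]] by simp

lemma prim_on_cong_AE:
  assumes p: "prim_on S U w" and ae: "AE t in lborel. t \<in> S \<longrightarrow> w t = z t" and z: "z \<in> borel_measurable borel"
  shows "prim_on S U z"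
proof (rule prim_onI)
  fix x y :: real assume xy: "x \<le> y" "{x..y} \<subseteq> S"
  note * = prim_onD[OF p xy]
  have ae': "AE t in lborel. indicator {x<..y} t *\<^sub>R w t = indicator {x<..y} t *\<^sub>R z t"
    using ae xy by (auto elim!: eventually_mono simp: indicator_def subset_iff)
  have m: "(\<lambda>t. indicator {x<..y} t *\<^sub>R z t) \<in> borel_measurable lborel" using z by simp
  show "set_integrable lborel {x<..y} z"
    unfolding set_integrable_def by (rule integrable_cong_AE_imp[OF *(1)[unfolded set_integrable_def] m ae'])
  show "U y - U x = (LINT s:{x<..y}|lborel. z s)"
    unfolding *(2) set_lebesgue_integral_def
    by (rule integral_cong_AE[OF _ m ae']) (use *(1) in \<open>auto simp: set_integrable_def dest: borel_measurable_integrable\<close>)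
qed

lemma prim_on_cong:
  assumes "prim_on S U w" "\<And>t. t \<in> S \<Longrightarrow> U t = V t" "\<And>t. t \<in> S \<Longrightarrow> w t = z t"
  shows "prim_on S V z"
proof (rule prim_onI)
  fix x y :: real assume xy: "x \<le> y" "{x..y} \<subseteq> S"
  have e: "indicator {x<..y} t *\<^sub>R w t = indicator {x<..y} t *\<^sub>R z t" for t
    using assms(3)[of t] xy by (auto simp: indicator_def subset_iff)
  show "set_integrable lborel {x<..y} z" using prim_onD(1)[OF assms(1) xy] by (simp add: set_integrable_def e)
  show "V y - V x = (LINT s:{x<..y}|lborel. z s)"
    using prim_onD(2)[OF assms(1) xy] assms(2)[of x] assms(2)[of y] xy by (simp add: set_lebesgue_integral_def e subset_iff)
qed

text \<open>Reflection sends \<open>{-y<..-x}\<close> to the interval closed at \<open>x\<close> and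
  open at \<open>y\<close>; the two end points are a null set and do not affect integrals.\<close>

lemma prim_on_reflect:
  assumes p: "prim_on S U w"
  shows "prim_on (uminus ` S) (\<lambda>t. U (- t)) (\<lambda>t. - w (- t))"
proof (rule prim_onI)
  fix x y :: real assume xy: "x \<le> y" "{x..y} \<subseteq> uminus ` S"
  have sub: "{-y..-x} \<subseteq> S"
  proof
    fix t assume "t \<in> {-y..-x}"
    then have "-t \<in> uminus ` S" using xy(2) by (auto simp: subset_iff)
    then show "t \<in> S" by auto
  qed
  note * = prim_onD[OF p _ sub]
  have 1: "integrable lborel (\<lambda>t. indicator {-y<..-x} t *\<^sub>R w t)" using *(1) xy by (simp add: set_integrable_def)
  then have 2: "integrable lborel (\<lambda>t. indicator {-y<..-x} (- t) *\<^sub>R w (- t))"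
    using lborel_integrable_real_affine_iff[of "-1" "\<lambda>t. indicator {-y<..-x} t *\<^sub>R w t" 0] by simp
  have ae: "AE t in lborel. indicator {-y<..-x} (- t) *\<^sub>R w (- t) = indicator {x<..y} t *\<^sub>R w (- t)"
    using AE_lborel_singleton[of x] AE_lborel_singleton[of y] by eventually_elim (auto simp: indicator_def)
  \<comment> \<open>Since \<open>w\<close> is measurable only after restriction to half-open
    intervals, the value at the end point \<open>y\<close>, which the reflected interval misses, is
    added by hand.\<close>
  have m: "(\<lambda>t. indicator {x<..y} t *\<^sub>R w (- t)) \<in> borel_measurable lborel"
  proof -
    have "(\<lambda>t. indicator {x<..y} t *\<^sub>R w (- t)) = (\<lambda>t. indicator {x<..<y} t *\<^sub>R (indicator {-y<..-x} (- t) *\<^sub>R w (- t)) + indicator {y} t *\<^sub>R (if x < y then w (-y) else 0))"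
      using xy(1) by (intro ext) (auto simp: indicator_def)
    moreover have "(\<lambda>t. indicator {x<..<y} t *\<^sub>R (indicator {-y<..-x} (- t) *\<^sub>R w (- t)) + indicator {y} t *\<^sub>R (if x < y then w (-y) else 0)) \<in> borel_measurable lborel"
      by (intro borel_measurable_add[OF borel_measurable_scaleR[OF _ borel_measurable_integrable[OF 2]]] borel_measurable_scaleR) auto
    ultimately show ?thesis by (simp only:)
  qed
  have 3: "integrable lborel (\<lambda>t. indicator {x<..y} t *\<^sub>R w (- t))"
    by (rule integrable_cong_AE_imp[OF 2 m]) (use ae in \<open>auto elim: eventually_mono\<close>)
  then show "set_integrable lborel {x<..y} (\<lambda>t. - w (- t))"
    using integrable_minus[OF 3] by (simp add: set_integrable_def)
  have "(LINT t:{-y<..-x}|lborel. w t) = (LINT t|lborel. indicator {-y<..-x} (- t) *\<^sub>R w (- t))"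
    using lborel_integral_real_affine[of "-1" "\<lambda>t. indicator {-y<..-x} t *\<^sub>R w t" 0] by (simp add: set_lebesgue_integral_def)
  also have "\<dots> = (LINT t:{x<..y}|lborel. w (- t))"
    unfolding set_lebesgue_integral_def
    by (rule integral_cong_AE[OF _ m ae]) (use borel_measurable_integrable[OF 2] in auto)
  finally show "U (- y) - U (- x) = (LINT t:{x<..y}|lborel. - w (- t))"
    using *(2) xy by (simp add: set_lebesgue_integral_def algebra_simps)
qed

lemma set_integrable_mult_const:
  fixes w :: "real \<Rightarrow> complex"
  shows "set_integrable lborel A w \<Longrightarrow> set_integrable lborel A (\<lambda>s. w s * c)"
  unfolding set_integrable_def mult_scaleR_left[symmetric] by (rule integrable_mult_left)

lemma loc_int_indicator:
  assumes "set_integrable lborel {x<..y::real} z"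
  shows "loc_int (\<lambda>t. indicator {x<..y} t *\<^sub>R z t)"
  unfolding loc_int_def
proof (intro allI)
  fix x' y'
  have "set_integrable lborel ({x<..y} \<inter> {x'<..y'}) z" by (rule set_integrable_subset[OF assms]) auto
  then show "set_integrable lborel {x'<..y'} (\<lambda>t. indicator {x<..y} t *\<^sub>R z t)"
    by (simp add: set_integrable_def indicator_inter_arith mult.commute del: Int_greaterThanAtMost)
qed

text \<open>The product rule is \<open>radon_ibp\<close> for the functional with density
  \<open>z\<close> on \<open>{x<..y}\<close>, whose value on \<open>{x<..s}\<close> is
  \<open>V s - V x\<close>. It also delivers the integrability of both products.\<close>

lemma prim_on_mult:
  fixes U V w z :: "real \<Rightarrow> complex"
  assumes U: "prim_on S U w" and V: "prim_on S V z"
  shows "prim_on S (\<lambda>t. U t * V t) (\<lambda>t. w t * V t + U t * z t)"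
proof (rule prim_onI)
  fix x y :: real assume xy: "x \<le> y" "{x..y} \<subseteq> S"
  define L where "L f = (LINT t|lborel. f t * (indicator {x<..y} t *\<^sub>R z t))" for f
  have li: "loc_int (\<lambda>t. indicator {x<..y} t *\<^sub>R z t)" by (rule loc_int_indicator[OF prim_onD(1)[OF V xy]])
  have L: "radon L" unfolding L_def[abs_def] by (rule radon_density[OF li])
  have Lc: "L (indicator {x<..s}) = V s - V x" if "x \<le> s" "s \<le> y" for s
  proof -
    have "{x..s} \<subseteq> S" using xy that by auto
    note p = prim_onD(2)[OF V that(1) this]
    show ?thesis unfolding p L_def set_lebesgue_integral_def
      by (rule Bochner_Integration.integral_cong) (use that in \<open>auto simp: indicator_def\<close>)
  qed
  have pU: "prim_on {x..y} U w" by (rule prim_on_subset[OF U xy(2)])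
  note ibp = radon_ibp[OF L xy(1) pU]
  have iw: "set_integrable lborel {x<..y} w" using prim_onD(1)[OF U xy] .
  have e1: "indicator {x<..y} s *\<^sub>R (w s * L (indicator {x<..s})) = indicator {x<..y} s *\<^sub>R (w s * (V s - V x))" for s
    using Lc[of s] by (auto simp: indicator_def)
  have i1: "set_integrable lborel {x<..y} (\<lambda>s. w s * (V s - V x))"
    using ibp(1) unfolding set_integrable_def e1 .
  have i2: "set_integrable lborel {x<..y} (\<lambda>s. w s * V s)"
    using set_integral_add(1)[OF i1 set_integrable_mult_const[OF iw, of "V x"]] by (simp add: algebra_simps)
  have cU: "continuous_on {x..y} U" by (rule prim_on_continuous[OF pU])
  have bU: "bdd_fun (\<lambda>t. indicator {x<..y} t * U t)"
  proof -
    obtain CU where CU: "\<And>t. t \<in> {x..y} \<Longrightarrow> cmod (U t) \<le> CU"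
      using compact_imp_bounded[OF compact_continuous_image[OF cU compact_Icc]] unfolding bounded_iff by blast
    have "continuous_on {x<..y} U" by (rule continuous_on_subset[OF cU]) auto
    then have "(\<lambda>t. indicator {x<..y} t *\<^sub>R U t) \<in> borel_measurable borel"
      by (intro borel_measurable_continuous_on_indicator) auto
    moreover have "(\<lambda>t. indicator {x<..y} t *\<^sub>R U t) = (\<lambda>t. indicator {x<..y} t * U t)" by (auto simp: indicator_def)
    moreover have "0 \<le> CU" using order_trans[OF norm_ge_zero CU[of x]] xy by simp
    ultimately show ?thesis using CU by (intro bdd_funI[of _ CU "\<bar>x\<bar> + \<bar>y\<bar>"]) (auto simp: indicator_def)
  qed
  have e3: "indicator {x<..y} t * U t * (indicator {x<..y} t *\<^sub>R z t) = indicator {x<..y} t *\<^sub>R (U t * z t)" for t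
    by (auto simp: indicator_def)
  have i3: "set_integrable lborel {x<..y} (\<lambda>s. U s * z s)"
    using loc_int_bdd_fun[OF li bU] unfolding set_integrable_def e3 .
  show "set_integrable lborel {x<..y} (\<lambda>t. w t * V t + U t * z t)" by (rule set_integral_add(1)[OF i2 i3])
  have "(LINT s:{x<..y}|lborel. U s * z s) = U y * (V y - V x) - (LINT s:{x<..y}|lborel. w s * (V s - V x))"
  proof -
    have "L (\<lambda>t. indicator {x<..y} t * U t) = (LINT s:{x<..y}|lborel. U s * z s)"
      unfolding L_def e3 set_lebesgue_integral_def ..
    moreover have "(LINT s:{x<..y}|lborel. w s * L (indicator {x<..s})) = (LINT s:{x<..y}|lborel. w s * (V s - V x))"
      unfolding set_lebesgue_integral_def e1 ..
    ultimately show ?thesis using ibp(2) Lc[OF xy(1) order_refl] by simp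
  qed
  also have "(LINT s:{x<..y}|lborel. w s * (V s - V x)) = (LINT s:{x<..y}|lborel. w s * V s) - (U y - U x) * V x"
    using set_integral_diff(2)[OF i2 set_integrable_mult_const[OF iw, of "V x"]] prim_onD(2)[OF U xy]
    by (simp add: algebra_simps)
  finally show "U y * V y - U x * V x = (LINT s:{x<..y}|lborel. w s * V s + U s * z s)"
    using set_integral_add(2)[OF i2 i3] by (simp add: algebra_simps)
qed

section \<open>Distribution functions of Radon functionals, normalised to vanish at 0\<close>

definition cdf :: "((real \<Rightarrow> complex) \<Rightarrow> complex) \<Rightarrow> real \<Rightarrow> complex" where
  "cdf L x = L (indicator {0<..x}) - L (indicator {x<..0})"

lemma cdf_diff:
  assumes L: "radon L" and xy: "x \<le> y"
  shows "cdf L y - cdf L x = L (indicator {x<..y})"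
proof -
  consider "0 \<le> x" | "x \<le> 0" "0 \<le> y" | "y \<le> 0" by linarith
  then show ?thesis
  proof cases
    case 1
    then show ?thesis using radon_Ioc_split[OF L 1 xy] radon_Ioc_empty[OF L] xy by (simp add: cdf_def)
  next
    case 2
    then show ?thesis using radon_Ioc_split[OF L 2] radon_Ioc_empty[OF L, of 0 y] radon_Ioc_empty[OF L, of x 0]
      by (simp add: cdf_def)
  next
    case 3
    then show ?thesis using radon_Ioc_split[OF L xy 3] radon_Ioc_empty[OF L, of x 0] radon_Ioc_empty[OF L, of y 0] xy
      by (simp add: cdf_def)
  qed
qed

lemma cdf_right_continuous:
  assumes L: "radon L" and t: "t \<longlonglongrightarrow> s" "\<And>n. s \<le> t n"
  shows "(\<lambda>n. cdf L (t n)) \<longlonglongrightarrow> cdf L s"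
proof -
  have "cdf L (t n) = cdf L s + L (indicator {s<..t n})" for n using cdf_diff[OF L t(2)[of n]] by (simp add: algebra_simps)
  moreover have "(\<lambda>n. L (indicator {s<..t n})) \<longlonglongrightarrow> L (indicator {s<..s})"
    by (rule radon_Ioc_right_continuous[OF L t])
  then have "(\<lambda>n. cdf L s + L (indicator {s<..t n})) \<longlonglongrightarrow> cdf L s + 0"
    by (intro tendsto_add tendsto_const) (simp add: radon_Ioc_empty[OF L, of s s, simplified])
  ultimately show ?thesis by simp
qed

lemma cdf_density:
  assumes g: "loc_int g"
  shows "prim_on UNIV (cdf (\<lambda>f. LINT t|lborel. f t * g t)) g"
proof (rule prim_onI)
  fix x y :: real assume xy: "x \<le> y"
  show "set_integrable lborel {x<..y} g" using g by (simp add: loc_int_def)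
  show "cdf (\<lambda>f. LINT t|lborel. f t * g t) y - cdf (\<lambda>f. LINT t|lborel. f t * g t) x = (LINT s:{x<..y}|lborel. g s)"
    unfolding cdf_diff[OF radon_density[OF g] xy] set_lebesgue_integral_def
    by (rule Bochner_Integration.integral_cong) (auto simp: indicator_def)
qed

text \<open>By right continuity the function is the limit of its values at the grid points just
  above \<open>x\<close>; each such approximation factors through the integers.\<close>

lemma cdf_borel_measurable: 
  assumes L: "radon L" shows "cdf L \<in> borel_measurable borel"
proof (rule borel_measurable_LIMSEQ_metric)
  fix x :: real
  let ?t = "\<lambda>n. real_of_int \<lceil>x * real (Suc n)\<rceil> / real (Suc n)"
  have ge: "x \<le> ?t n" for n using le_of_int_ceiling[of "x * real (Suc n)"] by (simp add: field_simps)
  have le: "?t n \<le> x + 1 / real (Suc n)" for n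
  proof -
    have "?t n \<le> (x * real (Suc n) + 1) / real (Suc n)"
      using of_int_ceiling_le_add_one[of "x * real (Suc n)"] by (intro divide_right_mono) auto
    also have "\<dots> = x + 1 / real (Suc n)" by (simp add: add_divide_distrib del: of_nat_Suc)
    finally show ?thesis .
  qed
  have "?t \<longlonglongrightarrow> x"
    by (rule tendsto_sandwich[where f = "\<lambda>n. x" and h = "\<lambda>n. x + 1 / real (Suc n)"])
      (use ge le tendsto_add[OF tendsto_const LIMSEQ_Suc[OF lim_const_over_n[of "1::real"]], of x] in auto)
  then show "(\<lambda>n. cdf L (?t n)) \<longlonglongrightarrow> cdf L x" by (rule cdf_right_continuous[OF L _ ge])
next
  fix n :: nat
  have "(\<lambda>x. cdf L (real_of_int x / real (Suc n))) \<in> measurable (count_space UNIV) borel" by simp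
  moreover have "(\<lambda>x. \<lceil>x * real (Suc n)\<rceil>) \<in> measurable borel (count_space UNIV)" by measurable
  ultimately show "(\<lambda>x. cdf L (real_of_int \<lceil>x * real (Suc n)\<rceil> / real (Suc n))) \<in> borel_measurable borel"
    using measurable_compose by blast
qed

lemma cdf_locally_bounded:
  assumes L: "radon L" shows "locally_bdd (cdf L)"
proof -
  have "\<exists>C. \<forall>x. \<bar>x\<bar> \<le> K \<longrightarrow> cmod (cdf L x) \<le> C" for K
  proof -
    obtain C where C: "\<And>s. s \<le> K \<Longrightarrow> cmod (L (indicator {-K<..s})) \<le> C"
      using radon_Ioc_bounded[OF L] by blast
    have "cmod (cdf L x) \<le> cmod (cdf L (- K)) + C" if "\<bar>x\<bar> \<le> K" for x
    proof -
      have "cdf L x = cdf L (- K) + L (indicator {-K<..x})"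
        using cdf_diff[OF L, of "-K" x] that by (simp add: algebra_simps abs_le_iff)
      then show ?thesis using C[of x] norm_triangle_ineq[of "cdf L (-K)"] that by (smt (verit) abs_le_iff)
    qed
    then show ?thesis by blast
  qed
  then show ?thesis unfolding locally_bdd_def using cdf_borel_measurable[OF L] by blast
qed

text \<open>A pi-lambda argument for half-open intervals. All sets are intersected with a fixed
  bounded interval \<open>I\<close>, because the functional only handles bounded sets; complements
  are therefore taken relative to \<open>I\<close>.\<close>

lemma radon_eq_zero_Ioc:
  assumes L: "radon L" and Ioc: "\<And>x y. x \<le> y \<Longrightarrow> L (indicator {x<..y}) = 0" and f: "bdd_fun f"
  shows "L f = 0"
proof (rule radon_eq_zero[OF L _ f])
  fix A :: "real set" assume A: "A \<in> sets borel" "bounded A"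
  obtain K where K: "\<And>x. x \<in> A \<Longrightarrow> \<bar>x\<bar> \<le> K" using A(2) by (auto simp: bounded_iff)
  define I where "I = {- \<bar>K\<bar> - 1 <.. \<bar>K\<bar>}"
  have Ib: "I \<in> sets borel" "bounded I" by (auto simp: I_def)
  have sum: "(\<lambda>i. L (indicator (B i \<inter> I))) sums L (indicator (\<Union>i. B i \<inter> I))"
    if "range B \<subseteq> sets borel" "disjoint_family B" for B :: "nat \<Rightarrow> real set"
  proof -
    have "disjoint_family (\<lambda>i. B i \<inter> I)" using that(2) by (auto simp: disjoint_family_on_def)
    moreover have "range (\<lambda>i. B i \<inter> I) \<subseteq> sets borel" using that(1) Ib by auto
    moreover have "bounded (\<Union>i. B i \<inter> I)" by (rule bounded_subset[OF Ib(2)]) auto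
    ultimately show ?thesis
      using radon_local_complex[OF L, unfolded local_complex_borel_measure_def, rule_format, of "\<lambda>i. B i \<inter> I"] by simp
  qed
  have "L (indicator (A \<inter> I)) = 0"
  proof (rule sigma_sets_induct_disjoint[of "range (\<lambda>(a, b). {a <.. b::real})" UNIV A "\<lambda>A. L (indicator (A \<inter> I)) = 0"])
    show "Int_stable (range (\<lambda>(a, b). {a <.. b::real}))"
      by (auto simp: Int_stable_def)
    show "A \<in> sigma_sets UNIV (range (\<lambda>(a, b). {a <.. b::real}))"
      using A(1) by (simp add: borel_sigma_sets_Ioc)
    show "L (indicator (B \<inter> I)) = 0" if B: "B \<in> range (\<lambda>(a, b). {a <.. b::real})" for B
    proof -
      obtain a b where "B = {a<..b}" using B by auto
      then have "B \<inter> I = {max a (- \<bar>K\<bar> - 1)<..min b \<bar>K\<bar>}" by (auto simp: I_def)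
      then show ?thesis using Ioc radon_Ioc_empty[OF L] by (metis linear)
    qed
    show "L (indicator ({} \<inter> I)) = 0" using Ioc[of 0 0] by simp
    show "L (indicator ((UNIV - B) \<inter> I)) = 0"
      if B: "B \<in> sigma_sets UNIV (range (\<lambda>(a, b). {a <.. b::real}))" and 0: "L (indicator (B \<inter> I)) = 0" for B
    proof -
      have Bb: "B \<in> sets borel" using B by (simp add: borel_sigma_sets_Ioc)
      have "(indicator ((UNIV - B) \<inter> I) :: real \<Rightarrow> complex) = (\<lambda>x. indicator I x - indicator (B \<inter> I) x)"
        by (auto simp: indicator_def)
      moreover have "bdd_fun (indicator (B \<inter> I))"
        by (rule bdd_fun_indicator) (use Bb Ib in \<open>auto intro: bounded_subset[OF Ib(2)]\<close>)
      ultimately show ?thesis using radon_diff[OF L, of "indicator I" "indicator (B \<inter> I)"] 0 Ioc[of "- \<bar>K\<bar> - 1" "\<bar>K\<bar>"]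
        by (simp add: I_def)
    qed
    show "L (indicator ((\<Union>i. B i) \<inter> I)) = 0"
      if B: "disjoint_family B" "range B \<subseteq> sigma_sets UNIV (range (\<lambda>(a, b). {a <.. b::real}))"
        "\<And>i. L (indicator (B i \<inter> I)) = 0" for B :: "nat \<Rightarrow> real set"
    proof -
      have "range B \<subseteq> sets borel" using B(2) by (simp add: borel_sigma_sets_Ioc)
      then have "(\<lambda>i. 0::complex) sums L (indicator (\<Union>i. B i \<inter> I))" using sum[OF _ B(1)] B(3) by simp
      then show ?thesis by (simp add: sums_unique2[OF sums_zero, symmetric])
    qed
  qed auto
  moreover have "A \<inter> I = A" using K by (force simp: I_def abs_le_iff)
  ultimately show "L (indicator A) = 0" by simp
qed

lemma AE_zero_if_Ioc_integrals_zero: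
  fixes g :: "real \<Rightarrow> complex"
  assumes g: "loc_int g" and z: "\<And>x y. x \<le> y \<Longrightarrow> (LINT s:{x<..y}|lborel. g s) = 0"
  shows "AE s in lborel. g s = 0"
proof -
  define L where "L f = (LINT t|lborel. f t * g t)" for f
  have L: "radon L" unfolding L_def[abs_def] by (rule radon_density[OF g])
  have L0: "L f = 0" if "bdd_fun f" for f
  proof (rule radon_eq_zero_Ioc[OF L _ that])
    fix x y :: real assume "x \<le> y"
    have "L (indicator {x<..y}) = (LINT s:{x<..y}|lborel. g s)"
      unfolding L_def set_lebesgue_integral_def by (rule Bochner_Integration.integral_cong) (auto simp: indicator_def)
    then show "L (indicator {x<..y}) = 0" using z[OF \<open>x \<le> y\<close>] by simp
  qed
  have "AE s in lborel. indicator {-real n<..real n} s *\<^sub>R g s = 0" for n :: nat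
  proof (rule sigma_finite_measure.density_zero[OF sigma_finite_lborel])
    show "integrable lborel (\<lambda>s. indicator {-real n<..real n} s *\<^sub>R g s)"
      using g unfolding loc_int_def set_integrable_def by blast
    fix A :: "real set" assume A: "A \<in> sets lborel"
    have "(LINT s:A|lborel. indicator {-real n<..real n} s *\<^sub>R g s) = L (indicator (A \<inter> {-real n<..real n}))"
      unfolding L_def set_lebesgue_integral_def by (rule Bochner_Integration.integral_cong) (auto simp: indicator_def)
    also have "\<dots> = 0" using A by (intro L0 bdd_fun_indicator) (auto intro: bounded_subset[of "{-real n<..real n}"])
    finally show "(LINT s:A|lborel. indicator {-real n<..real n} s *\<^sub>R g s) = 0" .
  qed
  then have "AE s in lborel. \<forall>n. indicator {-real n<..real n} s *\<^sub>R g s = 0"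
    unfolding AE_all_countable by blast
  then show ?thesis
  proof eventually_elim
    case (elim s)
    obtain n :: nat where "\<bar>s\<bar> < n" using reals_Archimedean2 by blast
    then have "s \<in> {-real n<..real n}" by auto
    then show ?case using elim[rule_format, of n] by (simp add: indicator_def)
  qed
qed

section \<open>Test functions and distributional derivatives\<close>

text \<open>The smoothness condition of \<open>test_function\<close> in recursive form: order
  \<open>n\<close> means differentiable \<open>n + 1\<close> times. The recursion suits inductions
  with the product and chain rules, where iterated derivatives have no convenient closed
  form.\<close>

fun diff_order :: "nat \<Rightarrow> (real \<Rightarrow> real) \<Rightarrow> bool" where
  "diff_order 0 f = (\<forall>x. f differentiable (at x))" |
  "diff_order (Suc n) f = ((\<forall>x. f differentiable (at x)) \<and> diff_order n (deriv f))"

lemma diff_order_iff: "diff_order n f \<longleftrightarrow> (\<forall>k\<le>n. \<forall>x. (deriv ^^ k) f differentiable (at x))"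
proof (induction n arbitrary: f)
  case (Suc n)
  have "(\<forall>k\<le>Suc n. \<forall>x. (deriv ^^ k) f differentiable (at x)) \<longleftrightarrow>
    (\<forall>x. f differentiable (at x)) \<and> (\<forall>k\<le>n. \<forall>x. (deriv ^^ Suc k) f differentiable (at x))" (is "?L \<longleftrightarrow> ?R")
  proof
    assume L: ?L
    show ?R using L[rule_format, of 0] L[rule_format, of "Suc k" for k] by simp
  next
    assume R: ?R
    show ?L
    proof (intro allI impI)
      fix k x assume "k \<le> Suc n"
      then show "(deriv ^^ k) f differentiable (at x)"
      proof (cases k)
        case (Suc j)
        then show ?thesis using conjunct2[OF R, rule_format, of j x] \<open>k \<le> Suc n\<close> by blast
      qed (use R in simp)
    qed
  qed
  then show ?case using Suc by (simp add: funpow_swap1)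
qed simp

lemma diff_order_0: "diff_order n f \<Longrightarrow> f differentiable (at x)"
  by (cases n) auto

lemma diff_order_Suc_le: "diff_order (Suc n) f \<Longrightarrow> diff_order n f"
  by (induction n arbitrary: f) auto

lemma diff_order_DERIV: "diff_order n f \<Longrightarrow> DERIV f x :> deriv f x"
  using DERIV_deriv_iff_real_differentiable diff_order_0 by blast

lemma diff_order_SucI:
  assumes "\<And>x. DERIV f x :> f' x" "diff_order n f'"
  shows "diff_order (Suc n) f"
proof -
  have "deriv f = f'" using assms(1) DERIV_imp_deriv by blast
  moreover have "f differentiable (at x)" for x using assms(1) real_differentiable_def by blast
  ultimately show ?thesis using assms(2) by simp
qed

lemma diff_order_add: "diff_order n f \<Longrightarrow> diff_order n g \<Longrightarrow> diff_order n (\<lambda>x. f x + g x)"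
proof (induction n arbitrary: f g)
  case 0
  then show ?case by (auto intro: differentiable_add)
next
  case (Suc n)
  show ?case
    by (rule diff_order_SucI[of _ "\<lambda>x. deriv f x + deriv g x"])
      (use Suc in \<open>auto intro!: DERIV_add diff_order_DERIV[of "Suc n"]\<close>)
qed

lemma diff_order_mult: "diff_order n f \<Longrightarrow> diff_order n g \<Longrightarrow> diff_order n (\<lambda>x. f x * g x)"
proof (induction n arbitrary: f g)
  case 0
  then show ?case by (auto intro: differentiable_mult)
next
  case (Suc n)
  have "diff_order n (\<lambda>x. deriv f x * g x + deriv g x * f x)"
    using Suc diff_order_Suc_le[OF Suc.prems(1)] diff_order_Suc_le[OF Suc.prems(2)] by (intro diff_order_add Suc.IH) auto
  then show ?case
    by (intro diff_order_SucI[of _ "\<lambda>x. deriv f x * g x + deriv g x * f x"] DERIV_mult diff_order_DERIV[OF Suc.prems(1)] diff_order_DERIV[OF Suc.prems(2)])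
qed

lemma diff_order_const: "diff_order n (\<lambda>x. c)"
proof (induction n arbitrary: c)
  case (Suc n)
  show ?case by (rule diff_order_SucI[of _ "\<lambda>x. 0"]) (auto intro: Suc)
qed simp

lemma diff_order_affine: "diff_order n f \<Longrightarrow> diff_order n (\<lambda>x. f (a * x + b))"
proof (induction n arbitrary: f)
  case 0
  have "(\<lambda>x. f (a * x + b)) differentiable (at x)" for x
  proof -
    have "DERIV (\<lambda>x. f (a * x + b)) x :> deriv f (a * x + b) * a"
      by (rule DERIV_chain2[OF diff_order_DERIV[OF 0]]) (auto intro!: derivative_eq_intros)
    then show ?thesis by (auto simp: real_differentiable_def)
  qed
  then show ?case by simp
next
  case (Suc n)
  have "DERIV (\<lambda>x. f (a * x + b)) x :> deriv f (a * x + b) * a" for x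
    by (rule DERIV_chain2[OF diff_order_DERIV[OF Suc.prems]]) (auto intro!: derivative_eq_intros)
  moreover have "diff_order n (\<lambda>x. deriv f (a * x + b) * a)"
    using Suc by (intro diff_order_mult diff_order_const) auto
  ultimately show ?case by (rule diff_order_SucI)
qed

section \<open>Smooth cutoff functions\<close>

lemma DERIV_eventually_eq:
  fixes f g :: "real \<Rightarrow> real"
  assumes "DERIV f x :> D" "\<forall>\<^sub>F y in nhds x. f y = g y"
  shows "DERIV g x :> D"
  using DERIV_cong_ev[OF refl assms(2) refl] assms(1) by simp

lemma abs_ge_if_notin_Ioc: "x \<notin> {-K<..K} \<Longrightarrow> K \<le> \<bar>x::real\<bar>"
  by (smt (verit) greaterThanAtMost_iff)

text \<open>The function \<open>exp (- 1 / x)\<close> divided by a power of \<open>x\<close>,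
  extended by 0. The exponent \<open>m\<close> is carried along because the family is, up to linear
  combinations, closed under differentiation; smoothness is then an induction over the order for all
  \<open>m\<close> at once.\<close>

definition exp_cutoff :: "nat \<Rightarrow> real \<Rightarrow> real" where
  "exp_cutoff m x = (if 0 < x then inverse x ^ m / exp (inverse x) else 0)"

lemma exp_cutoff_tendsto_0: "(exp_cutoff m \<longlongrightarrow> 0) (at 0)"
proof (rule filterlim_split_at)
  show "(exp_cutoff m \<longlongrightarrow> 0) (at_left 0)"
    by (rule tendsto_eventually) (auto simp: exp_cutoff_def eventually_at_filter)
  have "((\<lambda>x::real. inverse x ^ m / exp (inverse x)) \<longlongrightarrow> 0) (at_right 0)"
    by (rule filterlim_compose[OF tendsto_power_div_exp_0 filterlim_inverse_at_top_right])
  then show "(exp_cutoff m \<longlongrightarrow> 0) (at_right 0)"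
    by (rule Lim_transform_eventually) (auto simp: exp_cutoff_def eventually_at_filter)
qed

lemma exp_cutoff_DERIV: "DERIV (exp_cutoff m) x :> - real m * exp_cutoff (m + 1) x + exp_cutoff (m + 2) x"
proof -
  consider "x < 0" | "x = 0" | "0 < x" by linarith
  then show ?thesis
  proof cases
    case 1
    have "DERIV (\<lambda>x. 0) x :> (0::real)" by simp
    moreover have "\<forall>\<^sub>F y in nhds x. 0 = exp_cutoff m y"
      using eventually_nhds_in_open[of "{..<0}" x] 1 by (auto elim!: eventually_mono simp: exp_cutoff_def)
    ultimately have "DERIV (exp_cutoff m) x :> 0" by (rule DERIV_eventually_eq)
    then show ?thesis using 1 by (simp add: exp_cutoff_def)
  next
    case 2
    have "((\<lambda>h. (exp_cutoff m (0 + h) - exp_cutoff m 0) / h) \<longlongrightarrow> 0) (at 0)"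
      by (rule Lim_transform_eventually[OF exp_cutoff_tendsto_0[of "m + 1"]])
        (auto simp: exp_cutoff_def eventually_at_filter divide_inverse)
    then show ?thesis using 2 by (simp add: DERIV_def exp_cutoff_def)
  next
    case 3
    have "DERIV (\<lambda>x. inverse x ^ m / exp (inverse x)) x :> - real m * exp_cutoff (m + 1) x + exp_cutoff (m + 2) x"
    proof -
      have "DERIV (\<lambda>x. inverse x ^ m * exp (- inverse x)) x :>
          (real m * (inverse x ^ (m - Suc 0) * - (inverse x ^ Suc (Suc 0)))) * exp (- inverse x) + inverse x ^ m * (exp (- inverse x) * inverse x ^ 2)"
        using 3 by (auto intro!: derivative_eq_intros simp: power2_eq_square algebra_simps)
      moreover have "(real m * (inverse x ^ (m - Suc 0) * - (inverse x ^ Suc (Suc 0)))) * exp (- inverse x) + inverse x ^ m * (exp (- inverse x) * inverse x ^ 2)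
          = - real m * exp_cutoff (m + 1) x + exp_cutoff (m + 2) x"
        using 3 by (cases m) (auto simp: exp_cutoff_def exp_minus divide_inverse power2_eq_square algebra_simps)
      moreover have "(\<lambda>x::real. inverse x ^ m / exp (inverse x)) = (\<lambda>x. inverse x ^ m * exp (- inverse x))"
        by (simp add: exp_minus divide_inverse)
      ultimately show ?thesis by (simp only:)
    qed
    moreover have "\<forall>\<^sub>F y in nhds x. inverse y ^ m / exp (inverse y) = exp_cutoff m y"
      using eventually_nhds_in_open[of "{0<..}" x] 3 by (auto elim!: eventually_mono simp: exp_cutoff_def)
    ultimately show ?thesis by (rule DERIV_eventually_eq)
  qed
qed

lemma diff_order_exp_cutoff: "diff_order n (exp_cutoff m)"
proof (induction n arbitrary: m)
  case 0
  show ?case using exp_cutoff_DERIV real_differentiable_def by auto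
next
  case (Suc n)
  have "diff_order n (\<lambda>x. - real m * exp_cutoff (m + 1) x + exp_cutoff (m + 2) x)"
    by (intro diff_order_add diff_order_mult diff_order_const Suc)
  then show ?case using exp_cutoff_DERIV by (rule diff_order_SucI[rotated])
qed

definition bump :: "real \<Rightarrow> real" where
  "bump x = exp_cutoff 0 x * exp_cutoff 0 (-1 * x + 1)"

lemma diff_order_bump: "diff_order n bump"
  unfolding bump_def[abs_def] by (intro diff_order_mult diff_order_affine diff_order_exp_cutoff)

lemma bump_pos: "0 < x \<Longrightarrow> x < 1 \<Longrightarrow> 0 < bump x"
  and bump_zero: "x \<le> 0 \<or> 1 \<le> x \<Longrightarrow> bump x = 0"
  and bump_nonneg: "0 \<le> bump x"
  by (auto simp: bump_def exp_cutoff_def)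

lemma antiderivative_exists:
  fixes f :: "real \<Rightarrow> real"
  assumes "\<And>x. isCont f x"
  obtains F where "\<And>x. DERIV F x :> f x"
proof -
  have "\<exists>F. \<forall>x :: real. -\<infinity> < ereal x \<longrightarrow> ereal x < \<infinity> \<longrightarrow> (F has_vector_derivative f x) (at x)"
    by (rule einterval_antiderivative) (auto simp: assms)
  then show ?thesis using that by (auto simp: has_real_derivative_iff_has_vector_derivative)
qed

lemma smooth_step_exists:
  obtains \<eta> where "\<And>n. diff_order n \<eta>" "\<And>x. x \<le> 0 \<Longrightarrow> \<eta> x = 0" "\<And>x. 1 \<le> x \<Longrightarrow> \<eta> x = 1" "\<And>x. 0 \<le> \<eta> x" "\<And>x. \<eta> x \<le> 1"
proof -
  have "isCont bump x" for x
    using diff_order_DERIV[OF diff_order_bump[of 0]] DERIV_isCont by blast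
  then obtain F where F: "\<And>x. DERIV F x :> bump x" using antiderivative_exists by blast
  have mono: "F x \<le> F y" if "x \<le> y" for x y
    using DERIV_nonneg_imp_nondecreasing[OF that] F bump_nonneg by blast
  have c0: "F x = F 0" if "x \<le> 0" for x
  proof (cases "x = 0")
    case False
    then have "x < 0" using that by simp
    then show ?thesis
      by (rule DERIV_isconst_end[symmetric]) (use F bump_zero in \<open>auto intro!: DERIV_continuous_on continuous_at_imp_continuous_on DERIV_isCont\<close>, metis F bump_zero less_imp_le)
  qed simp
  have c1: "F x = F 1" if "1 \<le> x" for x
  proof (cases "x = 1")
    case False
    then have "1 < x" using that by simp
    then show ?thesis
      by (rule DERIV_isconst_end) (use F in \<open>auto intro!: continuous_at_imp_continuous_on DERIV_isCont\<close>, metis F bump_zero less_imp_le)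
  qed simp
  have lt: "F 0 < F 1"
  proof -
    have "F (1/4) < F (3/4)"
      by (rule DERIV_pos_imp_increasing) (use F bump_pos in \<open>auto intro!: exI[of _ "bump _"]\<close>)
    then show ?thesis using mono[of 0 "1/4"] mono[of "3/4" 1] by simp
  qed
  define \<eta> where "\<eta> x = (F x - F 0) / (F 1 - F 0)" for x
  have d: "DERIV \<eta> x :> bump x * inverse (F 1 - F 0)" for x
    unfolding \<eta>_def[abs_def] using F[of x] lt by (auto intro!: derivative_eq_intros simp: divide_inverse)
  have "diff_order n \<eta>" for n
  proof (cases n)
    case 0
    then show ?thesis using d real_differentiable_def by auto
  next
    case (Suc m)
    then show ?thesis using diff_order_SucI[OF d] diff_order_mult[OF diff_order_bump diff_order_const] by blast
  qed
  moreover have "\<eta> x \<le> 1" "0 \<le> \<eta> x" for x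
    using mono[of x 0] mono[of 0 x] mono[of x 1] mono[of 1 x] c0[of x] c1[of x] lt
    by (cases "x \<le> 0"; cases "1 \<le> x"; auto simp: \<eta>_def divide_le_eq)+
  moreover have "\<eta> x = 0" if "x \<le> 0" for x using c0[OF that] by (simp add: \<eta>_def)
  moreover have "\<eta> x = 1" if "1 \<le> x" for x using c1[OF that] lt by (simp add: \<eta>_def)
  ultimately show ?thesis using that by blast
qed

section \<open>Test functions and the lemma of du Bois-Reymond\<close>

lemma test_functionI:
  assumes "\<And>n. diff_order n \<phi>" "\<And>x. x \<notin> {a..b} \<Longrightarrow> \<phi> x = 0"
  shows "test_function \<phi>"
  unfolding test_function_def
proof
  show "\<forall>n x. (deriv ^^ n) \<phi> differentiable (at x)" using assms(1) unfolding diff_order_iff by blast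
  have "closure {x. \<phi> x \<noteq> 0} \<subseteq> {a..b}" by (rule closure_minimal) (use assms(2) in blast, simp)
  then have "bounded (closure {x. \<phi> x \<noteq> 0})" by (rule bounded_subset[rotated]) simp
  then show "compact (closure {x. \<phi> x \<noteq> 0})" by (simp add: compact_eq_bounded_closed)
qed

lemma test_function_diff_order: "test_function \<phi> \<Longrightarrow> diff_order n \<phi>"
  unfolding diff_order_iff test_function_def by blast

lemma test_function_DERIV: "test_function \<phi> \<Longrightarrow> DERIV \<phi> x :> deriv \<phi> x"
  by (rule diff_order_DERIV[OF test_function_diff_order])

lemma test_function_continuous:
  assumes "test_function \<phi>"
  shows "continuous_on UNIV \<phi>" "continuous_on UNIV (deriv \<phi>)"
proof -
  show "continuous_on UNIV \<phi>"
    using test_function_DERIV[OF assms] by (auto intro!: continuous_at_imp_continuous_on DERIV_isCont)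
  have "diff_order 0 (deriv \<phi>)" using test_function_diff_order[OF assms, of 1] by simp
  then show "continuous_on UNIV (deriv \<phi>)"
    using diff_order_DERIV[of 0 "deriv \<phi>"] by (blast intro!: continuous_at_imp_continuous_on DERIV_isCont)
qed

lemma test_function_support:
  assumes "test_function \<phi>"
  shows "\<exists>K>0. \<forall>x. K \<le> \<bar>x\<bar> \<longrightarrow> \<phi> x = 0 \<and> deriv \<phi> x = 0"
proof -
  have "bounded (closure {x. \<phi> x \<noteq> 0})" using assms unfolding test_function_def by (blast intro: compact_imp_bounded)
  then obtain B where B: "\<And>x. x \<in> closure {x. \<phi> x \<noteq> 0} \<Longrightarrow> \<bar>x\<bar> \<le> B" unfolding bounded_iff real_norm_def by blast
  define C where "C = max B 0"
  have z: "\<phi> x = 0" if "C < \<bar>x\<bar>" for x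
  proof (rule ccontr)
    assume "\<phi> x \<noteq> 0"
    then have "x \<in> closure {x. \<phi> x \<noteq> 0}" by (intro subsetD[OF closure_subset]) simp
    then have "\<bar>x\<bar> \<le> B" by (rule B)
    then show False using that unfolding C_def by linarith
  qed
  have dz: "deriv \<phi> x = 0" if "C + 1 \<le> \<bar>x\<bar>" for x
  proof -
    have "\<forall>\<^sub>F y in nhds x. y \<in> {y. C < \<bar>y\<bar>}"
    proof (rule eventually_nhds_in_open)
      show "open {y. C < \<bar>y\<bar>}" by (intro open_Collect_less continuous_intros)
    qed (use that in simp)
    then have "\<forall>\<^sub>F y in nhds x. 0 = \<phi> y" by eventually_elim (use z in auto)
    then have "DERIV \<phi> x :> 0" by (rule DERIV_eventually_eq[rotated]) simp
    then show ?thesis by (rule DERIV_imp_deriv)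
  qed
  have "C + 1 > 0" by (simp add: C_def max_def)
  moreover have "\<phi> x = 0 \<and> deriv \<phi> x = 0" if "C + 1 \<le> \<bar>x\<bar>" for x
    using z[of x] dz[OF that] that by linarith
  ultimately show ?thesis by blast
qed

lemma test_function_prim_on:
  assumes "test_function \<phi>"
  shows "prim_on S (\<lambda>x. complex_of_real (\<phi> x)) (\<lambda>x. of_real (deriv \<phi> x))"
proof -
  note K = test_function_DERIV[OF assms] test_function_continuous(2)[OF assms]
  show ?thesis
    by (rule prim_on_C1) (use K in \<open>auto intro!: continuous_intros has_vector_derivative_of_real simp: has_real_derivative_iff_has_vector_derivative[symmetric]\<close>)
qed

lemma test_function_bdd_fun:
  assumes "test_function \<phi>" shows "bdd_fun (\<lambda>x. of_real (\<phi> x))" "bdd_fun (\<lambda>x. of_real (deriv \<phi> x))"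
proof -
  obtain K where K: "0 < K" "\<And>x. K \<le> \<bar>x\<bar> \<Longrightarrow> \<phi> x = 0" "\<And>x. K \<le> \<bar>x\<bar> \<Longrightarrow> deriv \<phi> x = 0"
    using test_function_support[OF assms] by blast
  have *: "bdd_fun (\<lambda>x. of_real (f x))" if f: "continuous_on UNIV f" "\<And>x. K \<le> \<bar>x\<bar> \<Longrightarrow> f x = 0" for f
  proof -
    have "compact (f ` {-K..K})" using f by (intro compact_continuous_image) (auto intro: continuous_on_subset)
    then have "bounded (f ` {-K..K})" by (rule compact_imp_bounded)
    then obtain C where C: "\<And>x. x \<in> {-K..K} \<Longrightarrow> \<bar>f x\<bar> \<le> C" unfolding bounded_iff real_norm_def by blast
    have "0 \<le> C" using C[of 0] K(1) by auto
    have "\<bar>f x\<bar> \<le> C" for x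
    proof (cases "K \<le> \<bar>x\<bar>")
      case True
      then show ?thesis using f(2) \<open>0 \<le> C\<close> by simp
    next
      case False
      then have "x \<in> {-K..K}" by (simp add: abs_le_iff not_le less_imp_le)
      then show ?thesis by (rule C)
    qed
    then show ?thesis using f by (intro bdd_fun_of_real[of _ C K]) (auto intro: borel_measurable_continuous_onI)
  qed
  show "bdd_fun (\<lambda>x. of_real (\<phi> x))" "bdd_fun (\<lambda>x. of_real (deriv \<phi> x))" by (rule *, rule test_function_continuous[OF assms], rule K, assumption)+
qed

text \<open>Integration by parts on an interval containing the support of \<open>\<phi>\<close>. The
  boundary term vanishes, and so does the contribution of the base point, since
  \<open>deriv \<phi>\<close> has integral 0.\<close>

lemma radon_test_function:
  assumes L: "radon L" and \<phi>: "test_function \<phi>"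
  shows "L (\<lambda>x. of_real (\<phi> x)) = - (LINT x|lborel. cdf L x * of_real (deriv \<phi> x))"
proof -
  obtain K where K: "0 < K" "\<And>x. K \<le> \<bar>x\<bar> \<Longrightarrow> \<phi> x = 0" "\<And>x. K \<le> \<bar>x\<bar> \<Longrightarrow> deriv \<phi> x = 0"
    using test_function_support[OF \<phi>] by blast
  note p = test_function_prim_on[OF \<phi>, of UNIV]
  let ?w = "\<lambda>x. complex_of_real (deriv \<phi> x)"
  have KK: "- K \<le> K" using K by simp
  note ibp = radon_ibp[OF L KK test_function_prim_on[OF \<phi>]]
  have e: "indicator {-K<..K} s *\<^sub>R (?w s * L (indicator {-K<..s})) = indicator {-K<..K} s *\<^sub>R (?w s * cdf L s - ?w s * cdf L (- K))" for s
    using cdf_diff[OF L, of "-K" s] by (auto simp: indicator_def algebra_simps)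
  have i1: "set_integrable lborel {-K<..K} ?w" using prim_onD(1)[OF p KK] by simp
  have i2: "set_integrable lborel {-K<..K} (\<lambda>s. ?w s * cdf L s - ?w s * cdf L (- K))"
    using ibp(1) unfolding set_integrable_def e .
  have i3: "set_integrable lborel {-K<..K} (\<lambda>s. ?w s * cdf L s)"
    using set_integral_add(1)[OF i2 set_integrable_mult_const[OF i1, of "cdf L (- K)"]] by simp
  have "(\<lambda>x. of_real (\<phi> x)) = (\<lambda>x. indicator {-K<..K} x * complex_of_real (\<phi> x))"
  proof
    fix x
    show "of_real (\<phi> x) = indicator {-K<..K} x * complex_of_real (\<phi> x)"
      using K(2)[OF abs_ge_if_notin_Ioc, of x] by (cases "x \<in> {-K<..K}") auto
  qed
  then have "L (\<lambda>x. of_real (\<phi> x)) = - (LINT s:{-K<..K}|lborel. ?w s * L (indicator {-K<..s}))"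
    using ibp(2) K(2)[of K] K(1) by simp
  also have "(LINT s:{-K<..K}|lborel. ?w s * L (indicator {-K<..s})) = (LINT s:{-K<..K}|lborel. ?w s * cdf L s - ?w s * cdf L (- K))"
    unfolding set_lebesgue_integral_def e ..
  also have "\<dots> = (LINT s:{-K<..K}|lborel. ?w s * cdf L s) - (LINT s:{-K<..K}|lborel. ?w s * cdf L (- K))"
    by (rule set_integral_diff(2)[OF i3 set_integrable_mult_const[OF i1]])
  also have "(LINT s:{-K<..K}|lborel. ?w s * cdf L (- K)) = 0"
    using prim_onD(2)[OF p KK] K(1) K(2)[of K] K(2)[of "-K"] by simp
  also have "(LINT s:{-K<..K}|lborel. ?w s * cdf L s) = (LINT x|lborel. cdf L x * ?w x)"
    unfolding set_lebesgue_integral_def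
  proof (rule Bochner_Integration.integral_cong[OF refl])
    fix s
    show "indicator {-K<..K} s *\<^sub>R (?w s * cdf L s) = cdf L s * ?w s"
      using K(3)[OF abs_ge_if_notin_Ioc, of s] by (cases "s \<in> {-K<..K}") auto
  qed
  finally show ?thesis by simp
qed

text \<open>The constant is the integral of \<open>g\<close> against a fixed test function
  \<open>\<psi>0\<close> of integral 1. Any test function minus its integral times
  \<open>\<psi>0\<close> is the derivative of a test function, hence \<open>g - c\<close>
  annihilates all test functions. Smooth approximations of interval indicators then give vanishing
  integrals over all half-open intervals.\<close>

lemma du_bois_reymond:
  fixes g :: "real \<Rightarrow> complex"
  assumes g: "loc_int g" and zero: "\<And>\<phi>. test_function \<phi> \<Longrightarrow> (LINT x|lborel. g x * of_real (deriv \<phi> x)) = 0"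
  shows "\<exists>c. AE x in lborel. g x = c"
proof -
  obtain \<eta> where \<eta>: "\<And>n. diff_order n \<eta>" "\<And>x. x \<le> 0 \<Longrightarrow> \<eta> x = 0" "\<And>x. 1 \<le> x \<Longrightarrow> \<eta> x = 1" "\<And>x. 0 \<le> \<eta> x" "\<And>x. \<eta> x \<le> 1"
    using smooth_step_exists by blast
  define \<psi>0 where "\<psi>0 = deriv \<eta>"
  have D\<eta>: "DERIV \<eta> x :> \<psi>0 x" for x unfolding \<psi>0_def by (rule diff_order_DERIV[OF \<eta>(1)])
  have \<psi>0d: "diff_order n \<psi>0" for n using \<eta>(1)[of "Suc n"] by (simp add: \<psi>0_def)
  have \<psi>0z: "\<psi>0 x = 0" if "x \<notin> {0..1}" for x
  proof -
    consider "x < 0" | "1 < x" using \<open>x \<notin> {0..1}\<close> by force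
    then have "DERIV \<eta> x :> 0"
    proof cases
      case 1
      have "\<forall>\<^sub>F y in nhds x. y \<in> {..<0}" by (rule eventually_nhds_in_open) (use 1 in auto)
      then have "\<forall>\<^sub>F y in nhds x. \<eta> y = 0" by eventually_elim (use \<eta> in auto)
      then show ?thesis using DERIV_cong_ev[of x x \<eta> "\<lambda>_. 0" 0 0] by simp
    next
      case 2
      have "\<forall>\<^sub>F y in nhds x. y \<in> {1<..}" by (rule eventually_nhds_in_open) (use 2 in auto)
      then have "\<forall>\<^sub>F y in nhds x. \<eta> y = 1" by eventually_elim (use \<eta> in auto)
      then show ?thesis using DERIV_cong_ev[of x x \<eta> "\<lambda>_. 1" 0 0] by simp
    qed
    then show ?thesis using D\<eta> DERIV_unique by blast
  qed
  have t0: "test_function \<psi>0" by (rule test_functionI[OF \<psi>0d \<psi>0z])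
  define c where "c = (LINT x|lborel. of_real (\<psi>0 x) * g x)"
  have key: "(LINT x|lborel. of_real (\<psi> x) * (g x - c)) = 0" if \<psi>: "test_function \<psi>" for \<psi>
  proof -
    obtain K where K': "0 < K" "\<And>x. K \<le> \<bar>x\<bar> \<Longrightarrow> \<psi> x = 0" using test_function_support[OF \<psi>] by blast
    note K = test_function_diff_order[OF \<psi>] K' test_function_DERIV[OF \<psi>]
    have "isCont \<psi> x" for x using K(4) DERIV_isCont by blast
    then obtain A where A: "\<And>x. DERIV A x :> \<psi> x" using antiderivative_exists by blast
    define I where "I = A K - A (- K)"
    \<comment> \<open>The antiderivative \<open>A\<close> equals the constant \<open>I\<close> above
      its left value to the right of the support of \<open>\<psi>\<close>; subtracting
      \<open>I\<close> times the smooth step restores compact support.\<close>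
    define \<phi> where "\<phi> x = A x - A (- K) - I * \<eta> x" for x
    have D: "DERIV \<phi> x :> \<psi> x + - I * \<psi>0 x" for x
      unfolding \<phi>_def[abs_def] using A[of x] D\<eta>[of x] by (auto intro!: derivative_eq_intros)
    have dd: "deriv \<phi> = (\<lambda>x. \<psi> x + - I * \<psi>0 x)" using D DERIV_imp_deriv by blast
    have "diff_order n \<phi>" for n
    proof (cases n)
      case 0
      then show ?thesis using D real_differentiable_def by auto
    next
      case (Suc m)
      have "diff_order m (\<lambda>x. \<psi> x + - I * \<psi>0 x)"
        by (intro diff_order_add diff_order_mult diff_order_const K \<psi>0d)
      then show ?thesis unfolding Suc using D by (rule diff_order_SucI[rotated])
    qed
    moreover have "\<phi> x = 0" if out: "x \<notin> {- max K 1..max K 1}" for x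
    proof -
      have cA: "A b = A a" if "a \<le> b" "\<And>x. a < x \<Longrightarrow> x < b \<Longrightarrow> K \<le> \<bar>x\<bar>" for a b
      proof (cases "a = b")
        case False
        then have "a < b" using that by simp
        then show ?thesis
        proof (rule DERIV_isconst_end)
          show "continuous_on {a..b} A" using A by (auto intro!: continuous_at_imp_continuous_on DERIV_isCont)
          show "DERIV A x :> 0" if "a < x" "x < b" for x using A[of x] K(3) \<open>\<And>x. a < x \<Longrightarrow> x < b \<Longrightarrow> K \<le> \<bar>x\<bar>\<close>[OF that] by simp
        qed
      qed simp
      consider "x < - max K 1" | "max K 1 < x" using out by force
      then show ?thesis
      proof cases
        case 1
        then have "A (- K) = A x" by (intro cA) auto
        then show ?thesis using 1 \<eta>(2)[of x] by (auto simp: \<phi>_def)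
      next
        case 2
        then have "A x = A K" by (intro cA) auto
        then show ?thesis using 2 \<eta>(3)[of x] by (auto simp: \<phi>_def I_def)
      qed
    qed
    ultimately have "test_function \<phi>" by (rule test_functionI)
    from zero[OF this] have z: "(LINT x|lborel. g x * of_real (\<psi> x + - I * \<psi>0 x)) = 0" by (simp only: dd)
    have i: "integrable lborel (\<lambda>x. of_real (\<psi> x) * g x)" "integrable lborel (\<lambda>x. of_real (\<psi>0 x) * g x)"
      using loc_int_bdd_fun[OF g] test_function_bdd_fun[OF \<psi>] test_function_bdd_fun[OF t0] by blast+
    have "(LINT x|lborel. g x * of_real (\<psi> x + - I * \<psi>0 x)) = (LINT x|lborel. of_real (\<psi> x) * g x - of_real I * (of_real (\<psi>0 x) * g x))"
      by (rule Bochner_Integration.integral_cong) (auto simp: algebra_simps)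
    also have "\<dots> = (LINT x|lborel. of_real (\<psi> x) * g x) - of_real I * c"
      unfolding c_def using i by (subst Bochner_Integration.integral_diff) (auto simp: mult.assoc)
    finally have 1: "(LINT x|lborel. of_real (\<psi> x) * g x) = of_real I * c" using z by simp
    have "of_real I = (LINT x|lborel. complex_of_real (\<psi> x))"
    proof -
      have p: "prim_on UNIV A \<psi>"
        by (rule prim_on_C1) (use A K(4) in \<open>auto simp: has_real_derivative_iff_has_vector_derivative[symmetric] intro!: continuous_at_imp_continuous_on DERIV_isCont\<close>)
      have "I = (LINT x:{-K<..K}|lborel. \<psi> x)" using prim_onD(2)[OF p, of "-K" K] K(2) by (simp add: I_def)
      also have "\<dots> = (LINT x|lborel. \<psi> x)"
        unfolding set_lebesgue_integral_def
      proof (rule Bochner_Integration.integral_cong[OF refl])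
        fix x
        show "indicator {-K<..K} x *\<^sub>R \<psi> x = \<psi> x"
          using K(3)[OF abs_ge_if_notin_Ioc, of x] by (cases "x \<in> {-K<..K}") auto
      qed
      finally show ?thesis by simp
    qed
    moreover have "integrable lborel (\<lambda>x. complex_of_real (\<psi> x))"
      using radon_integral(2)[of lborel] test_function_bdd_fun(1)[OF \<psi>] by (simp add: emeasure_lborel_Icc_eq)
    ultimately have 2: "(LINT x|lborel. of_real (\<psi> x) * c) = of_real I * c" by simp
    have 3: "(LINT x|lborel. of_real (\<psi> x) * (g x - c)) = (LINT x|lborel. of_real (\<psi> x) * g x) - (LINT x|lborel. of_real (\<psi> x) * c)"
      using i \<open>integrable lborel (\<lambda>x. complex_of_real (\<psi> x))\<close>
      by (subst Bochner_Integration.integral_diff[symmetric]) (auto simp: algebra_simps)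
    show ?thesis unfolding 3 1 2 by simp
  qed
  have gc: "loc_int (\<lambda>x. g x - c)"
    unfolding loc_int_def
  proof (intro allI)
    fix x y :: real
    have "set_integrable lborel {x<..y} (\<lambda>_. c)"
      unfolding set_integrable_def by (cases "x \<le> y") (auto intro!: integrable_scaleR_left integrable_real_indicator simp: emeasure_lborel_Ioc)
    then show "set_integrable lborel {x<..y} (\<lambda>x. g x - c)" using g by (intro set_integral_diff) (auto simp: loc_int_def)
  qed
  define L where "L f = (LINT x|lborel. f x * (g x - c))" for f :: "real \<Rightarrow> complex"
  have L: "radon L" unfolding L_def[abs_def] by (rule radon_density[OF gc])
  have "AE x in lborel. g x - c = 0"
  proof (rule AE_zero_if_Ioc_integrals_zero[OF gc])
    fix x y :: real assume xy: "x \<le> y"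
    \<comment> \<open>Differences of steepening smooth steps. Because \<open>\<eta> 0 = 0\<close>,
      they converge at every point, end points included, to the indicator of
      \<open>{x<..y}\<close>.\<close>
    define \<psi> where "\<psi> n t = \<eta> (real (Suc n) * t + - real (Suc n) * x) + -1 * \<eta> (real (Suc n) * t + - real (Suc n) * y)" for n t
    have \<psi>z: "\<psi> n t = 0" if "t \<notin> {x..y+1}" for n t
    proof -
      consider "t < x" | "y + 1 < t" using \<open>t \<notin> {x..y+1}\<close> by force
      then show ?thesis
      proof cases
        case 1
        then have "real (Suc n) * (t - x) \<le> 0" "real (Suc n) * (t - y) \<le> 0" using xy by (auto intro!: mult_nonneg_nonpos)
        then show ?thesis by (simp add: \<psi>_def \<eta>(2) algebra_simps)
      next
        case 2
        have "1 * 1 \<le> real (Suc n) * (t - x)" "1 * 1 \<le> real (Suc n) * (t - y)" using xy 2 by (intro mult_mono; simp)+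
        then show ?thesis by (simp add: \<psi>_def \<eta>(3) algebra_simps)
      qed
    qed
    have t: "test_function (\<psi> n)" for n
    proof (rule test_functionI[OF _ \<psi>z])
      show "diff_order m (\<psi> n)" for m
        unfolding \<psi>_def[abs_def] by (intro diff_order_add diff_order_mult diff_order_const diff_order_affine \<eta>)
    qed
    have lim: "(\<lambda>n. \<psi> n t) \<longlonglongrightarrow> indicator {x<..y} t" for t
    proof -
      have lim\<eta>: "(\<lambda>n. \<eta> (real (Suc n) * t + - real (Suc n) * z)) \<longlonglongrightarrow> (if z < t then 1 else 0)" for z
      proof (rule tendsto_eventually)
        show "\<forall>\<^sub>F n in sequentially. \<eta> (real (Suc n) * t + - real (Suc n) * z) = (if z < t then 1 else 0)"
        proof (cases "z < t")
          case True
          then obtain N :: nat where N: "1 / (t - z) < real N" using reals_Archimedean2 by blast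
          have "1 \<le> real (Suc n) * (t - z)" if "N \<le> n" for n
          proof -
            have "1 / (t - z) \<le> real (Suc n)" using N that by linarith
            then show ?thesis using True by (simp add: field_simps)
          qed
          then show ?thesis using True \<eta>(3) by (intro eventually_sequentiallyI[of N]) (simp add: algebra_simps)
        next
          case False
          then have "real (Suc n) * (t - z) \<le> 0" for n by (auto intro!: mult_nonneg_nonpos)
          then show ?thesis using False \<eta>(2) by (intro always_eventually) (simp add: algebra_simps)
        qed
      qed
      have "(\<lambda>n. \<psi> n t) \<longlonglongrightarrow> (if x < t then 1 else 0) + -1 * (if y < t then 1 else 0)"
        unfolding \<psi>_def by (intro tendsto_add tendsto_mult tendsto_const lim\<eta>)
      also have "(if x < t then 1 else 0) + -1 * (if y < t then 1 else 0) = (indicator {x<..y} t :: real)"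
        using xy by (auto simp: indicator_def)
      finally show ?thesis .
    qed
    have "(\<lambda>n. L (\<lambda>t. complex_of_real (\<psi> n t))) \<longlonglongrightarrow> L (\<lambda>t. complex_of_real (indicator {x<..y} t))"
    proof (rule radon_limit[OF L, where C = 2 and K = "\<bar>x\<bar> + \<bar>y\<bar> + 1"])
      show "(\<lambda>t. complex_of_real (\<psi> n t)) \<in> borel_measurable borel" for n
        using test_function_bdd_fun(1)[OF t] by (simp add: bdd_fun_def)
      show "cmod (complex_of_real (\<psi> n t)) \<le> 2" for n t
        unfolding \<psi>_def using \<eta>(4,5)[of "real (Suc n) * t + - real (Suc n) * x"] \<eta>(4,5)[of "real (Suc n) * t + - real (Suc n) * y"]
        by (simp only: norm_of_real)
      show "complex_of_real (\<psi> n t) = 0" if "\<bar>x\<bar> + \<bar>y\<bar> + 1 < \<bar>t\<bar>" for n t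
      proof -
        have "t \<notin> {x..y+1}" using that by (smt (verit) atLeastAtMost_iff)
        then show ?thesis using \<psi>z by simp
      qed
      show "(\<lambda>n. complex_of_real (\<psi> n t)) \<longlonglongrightarrow> of_real (indicator {x<..y} t)" for t by (intro tendsto_of_real lim)
    qed
    moreover have "L (\<lambda>t. complex_of_real (\<psi> n t)) = 0" for n unfolding L_def using key[OF t] by simp
    ultimately have "L (\<lambda>t. complex_of_real (indicator {x<..y} t)) = 0" by (simp add: LIMSEQ_const_iff)
    moreover have "L (\<lambda>t. complex_of_real (indicator {x<..y} t)) = (LINT s:{x<..y}|lborel. g s - c)"
      unfolding L_def set_lebesgue_integral_def by (rule Bochner_Integration.integral_cong) (auto simp: indicator_def)
    ultimately show "(LINT s:{x<..y}|lborel. g s - c) = 0" by simp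
  qed
  then show ?thesis by (intro exI[of _ c]) (auto elim: eventually_mono)
qed

section \<open>Distribution functions and distributional derivatives\<close>

lemma AE_lborel_Ioo:
  assumes "AE x in lborel. P (x::real)" "a < b"
  shows "\<exists>x. a < x \<and> x < b \<and> P x"
proof (rule ccontr)
  assume "\<not> ?thesis"
  then have "AE x in lborel. x \<notin> {a<..<b}" using assms(1) by (auto elim!: eventually_mono)
  then have "emeasure lborel {a<..<b} = 0" by (subst AE_iff_measurable[symmetric, of _ _ "\<lambda>x. x \<notin> {a<..<b}"]) auto
  then show False using assms(2) by simp
qed

text \<open>Supplies the sequences by which right continuous functions that agree almost everywhere
  are shown to agree everywhere.\<close>

lemma AE_right_approx:
  assumes "AE x in lborel. P (x::real)"
  shows "\<exists>t. t \<longlonglongrightarrow> s \<and> (\<forall>n. s \<le> t n) \<and> (\<forall>n. P (t n))"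
proof -
  have "\<forall>n. \<exists>x. s < x \<and> x < s + 1 / real (Suc n) \<and> P x" using AE_lborel_Ioo[OF assms] by simp
  then obtain t where t: "\<And>n. s < t n" "\<And>n. t n < s + 1 / real (Suc n)" "\<And>n. P (t n)" by metis
  have "(\<lambda>n. s + 1 / real (Suc n)) \<longlonglongrightarrow> s"
    using tendsto_add[OF tendsto_const LIMSEQ_Suc[OF lim_const_over_n[of "1::real"]], of s] by simp
  then have "t \<longlonglongrightarrow> s"
    by (rule tendsto_sandwich[OF _ _ tendsto_const, rotated 2]) (use t in \<open>auto intro!: always_eventually less_imp_le\<close>)
  then show ?thesis using t less_imp_le by blast
qed

lemma continuous_AE_eq:
  fixes f g :: "real \<Rightarrow> complex"
  assumes "continuous_on UNIV f" "continuous_on UNIV g" "AE x in lborel. f x = g x"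
  shows "f = g"
proof
  fix s
  obtain t where t: "t \<longlonglongrightarrow> s" "\<And>n. f (t n) = g (t n)" using AE_right_approx[OF assms(3)] by blast
  have "(\<lambda>n. f (t n)) \<longlonglongrightarrow> f s" "(\<lambda>n. g (t n)) \<longlonglongrightarrow> g s"
    using assms(1,2) t(1) by (auto simp: continuous_on_eq_continuous_at isCont_tendsto_compose)
  then show "f s = g s" unfolding t(2) by (rule LIMSEQ_unique)
qed

lemma locally_bdd_loc_int:
  assumes "locally_bdd k" shows "loc_int k"
  unfolding loc_int_def
proof (intro allI)
  fix x y :: real
  obtain C where C: "\<And>t. \<bar>t\<bar> \<le> \<bar>x\<bar> + \<bar>y\<bar> \<Longrightarrow> cmod (k t) \<le> C" using assms unfolding locally_bdd_def by blast
  show "set_integrable lborel {x<..y} k"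
    unfolding set_integrable_def
  proof (rule integrableI_bounded_set_indicator[where B = C])
    show "emeasure lborel {x<..y} < \<infinity>" by (cases "x \<le> y") auto
    show "AE t in lborel. t \<in> {x<..y} \<longrightarrow> norm (k t) \<le> C"
      by (intro always_eventually allI impI C) (auto simp: abs_if)
  qed (use assms in \<open>auto simp: locally_bdd_def\<close>)
qed

lemma loc_int_add: "loc_int f \<Longrightarrow> loc_int g \<Longrightarrow> loc_int (\<lambda>x. f x + g x)"
  unfolding loc_int_def by blast

lemma loc_int_diff: "loc_int f \<Longrightarrow> loc_int g \<Longrightarrow> loc_int (\<lambda>x. f x - g x)"
  unfolding loc_int_def by blast

lemma loc_int_const: "loc_int (\<lambda>x. c::complex)"
  by (rule locally_bdd_loc_int) simp

text \<open>The difference of \<open>f\<close> and the distribution function annihilates derivatives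
  of test functions, so du Bois-Reymond makes it constant.\<close>

lemma is_derivative_measure_rep:
  assumes \<nu>: "is_derivative_measure f \<nu>" and f: "loc_int f"
  shows "\<exists>C. AE x in lborel. f x = C + cdf (complex_measure_integral \<nu>) x"
proof -
  define L where "L = complex_measure_integral \<nu>"
  have L: "radon L" unfolding L_def using \<nu> by (intro radon_complex_measure_integral) (simp add: is_derivative_measure_def)
  have c: "loc_int (cdf L)" by (rule locally_bdd_loc_int[OF cdf_locally_bounded[OF L]])
  have "\<exists>C. AE x in lborel. f x - cdf L x = C"
  proof (rule du_bois_reymond[OF loc_int_diff[OF f c]])
    fix \<phi> assume \<phi>: "test_function \<phi>"
    have e: "(LINT x|lborel. f x * of_real (deriv \<phi> x)) = (LINT x|lborel. cdf L x * of_real (deriv \<phi> x))"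
      using \<nu> \<phi> radon_test_function[OF L \<phi>] unfolding is_derivative_measure_def L_def by auto
    have i: "integrable lborel (\<lambda>x. g x * of_real (deriv \<phi> x))" if "loc_int g" for g :: "real \<Rightarrow> complex"
      using loc_int_bdd_fun[OF that test_function_bdd_fun(2)[OF \<phi>]] by (simp add: mult.commute)
    have "(LINT x|lborel. (f x - cdf L x) * of_real (deriv \<phi> x)) = (LINT x|lborel. f x * of_real (deriv \<phi> x) - cdf L x * of_real (deriv \<phi> x))"
      by (simp add: algebra_simps)
    also have "\<dots> = 0" by (subst Bochner_Integration.integral_diff[OF i[OF f] i[OF c]]) (simp add: e)
    finally show "(LINT x|lborel. (f x - cdf L x) * of_real (deriv \<phi> x)) = 0" .
  qed
  then obtain C where "AE x in lborel. f x - cdf L x = C" ..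
  then show ?thesis unfolding L_def by (intro exI[of _ C]) (auto elim!: eventually_mono simp: algebra_simps)
qed

lemma is_derivative_measure_radon:
  assumes L: "radon L" and f: "f \<in> borel_measurable borel" and ae: "AE x in lborel. f x = C + cdf L x"
  shows "is_derivative_measure f (\<lambda>A. L (indicator A))"
  unfolding is_derivative_measure_def
proof (intro conjI allI impI)
  note lc = radon_local_complex[OF L]
  show "local_complex_borel_measure (\<lambda>A. L (indicator A))" by (rule lc)
  fix \<phi> assume \<phi>: "test_function \<phi>"
  have i: "integrable lborel (\<lambda>x. g x * of_real (deriv \<phi> x))" if "loc_int g" for g :: "real \<Rightarrow> complex"
    using loc_int_bdd_fun[OF that test_function_bdd_fun(2)[OF \<phi>]] by (simp add: mult.commute)
  have c: "loc_int (cdf L)" by (rule locally_bdd_loc_int[OF cdf_locally_bounded[OF L]])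
  obtain K where K: "0 < K" "\<And>x. K \<le> \<bar>x\<bar> \<Longrightarrow> \<phi> x = 0" "\<And>x. K \<le> \<bar>x\<bar> \<Longrightarrow> deriv \<phi> x = 0"
    using test_function_support[OF \<phi>] by blast
  have z: "(LINT x|lborel. complex_of_real (deriv \<phi> x)) = 0"
  proof -
    have "(LINT x|lborel. complex_of_real (deriv \<phi> x)) = (LINT x:{-K<..K}|lborel. complex_of_real (deriv \<phi> x))"
      unfolding set_lebesgue_integral_def
    proof (rule Bochner_Integration.integral_cong[OF refl])
      fix x show "complex_of_real (deriv \<phi> x) = indicator {-K<..K} x *\<^sub>R complex_of_real (deriv \<phi> x)"
        using K(3)[OF abs_ge_if_notin_Ioc, of x] by (cases "x \<in> {-K<..K}") auto
    qed
    also have "\<dots> = of_real (\<phi> K) - of_real (\<phi> (- K))"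
      by (rule prim_onD(2)[OF test_function_prim_on[OF \<phi>, of UNIV], symmetric]) (use K in auto)
    finally show ?thesis using K by simp
  qed
  have "(LINT x|lborel. f x * of_real (deriv \<phi> x)) = (LINT x|lborel. C * of_real (deriv \<phi> x) + cdf L x * of_real (deriv \<phi> x))"
  proof (rule integral_cong_AE)
    show "(\<lambda>x. C * of_real (deriv \<phi> x) + cdf L x * of_real (deriv \<phi> x)) \<in> borel_measurable lborel"
      by (intro borel_measurable_add borel_measurable_integrable i c loc_int_const)
    show "(\<lambda>x. f x * of_real (deriv \<phi> x)) \<in> borel_measurable lborel"
      using f test_function_bdd_fun(2)[OF \<phi>] by (auto simp: bdd_fun_def intro!: borel_measurable_times)
    show "AE x in lborel. f x * of_real (deriv \<phi> x) = C * of_real (deriv \<phi> x) + cdf L x * of_real (deriv \<phi> x)"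
      using ae by eventually_elim (simp add: algebra_simps)
  qed
  also have "\<dots> = C * (LINT x|lborel. of_real (deriv \<phi> x)) + (LINT x|lborel. cdf L x * of_real (deriv \<phi> x))"
    by (subst Bochner_Integration.integral_add[OF i[OF loc_int_const] i[OF c]]) simp
  also have "\<dots> = - L (\<lambda>x. of_real (\<phi> x))" using radon_test_function[OF L \<phi>] z by simp
  finally show "complex_measure_integral (\<lambda>A. L (indicator A)) (\<lambda>x. of_real (\<phi> x)) = - (LINT x|lborel. f x * of_real (deriv \<phi> x))"
    using complex_measure_integral_eq[OF lc L refl test_function_bdd_fun(1)[OF \<phi>]] by simp
qed

lemma radon_eq_if_cdf_AE:
  assumes L: "radon L" and L': "radon L'" and ae: "AE x in lborel. C + cdf L x = C' + cdf L' x" and g: "bdd_fun g"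
  shows "L g = L' g"
proof -
  have eq: "C + cdf L s = C' + cdf L' s" for s
  proof -
    obtain t where t: "t \<longlonglongrightarrow> s" "\<And>n. s \<le> t n" "\<And>n. C + cdf L (t n) = C' + cdf L' (t n)"
      using AE_right_approx[OF ae] by blast
    have "(\<lambda>n. C + cdf L (t n)) \<longlonglongrightarrow> C + cdf L s" "(\<lambda>n. C' + cdf L' (t n)) \<longlonglongrightarrow> C' + cdf L' s"
      by (intro tendsto_add tendsto_const cdf_right_continuous L L' t)+
    then show ?thesis unfolding t(3) by (rule LIMSEQ_unique)
  qed
  have "(\<lambda>f. L f - L' f) g = 0"
  proof (rule radon_eq_zero_Ioc[OF radon_minus[OF L L'] _ g])
    fix x y :: real assume xy: "x \<le> y"
    have eq2: "cdf L z = (C' + cdf L' z) - C" for z unfolding eq[symmetric] by simp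
    show "L (indicator {x<..y}) - L' (indicator {x<..y}) = 0"
      unfolding cdf_diff[OF L xy, symmetric] cdf_diff[OF L' xy, symmetric] eq2 by simp
  qed
  then show ?thesis by simp
qed

text \<open>The arbitrary choice in \<open>derivative_measure\<close> is harmless: the chosen
  measure and \<open>L\<close> both have distribution functions that represent \<open>f\<close> up
  to constants. By right continuity these agree everywhere, hence so do the functionals.\<close>

lemma derivative_measure_radon:
  assumes L: "radon L" and f: "f \<in> borel_measurable borel" and ae: "AE x in lborel. f x = C + cdf L x"
  shows "local_complex_borel_measure (derivative_measure f)"
    and "bdd_fun g \<Longrightarrow> complex_measure_integral (derivative_measure f) g = L g"
proof -
  have d: "is_derivative_measure f (derivative_measure f)"
    unfolding derivative_measure_def by (rule someI[where P = "is_derivative_measure f", OF is_derivative_measure_radon[OF assms]])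
  then show lc: "local_complex_borel_measure (derivative_measure f)" by (simp add: is_derivative_measure_def)
  have "loc_int (\<lambda>x. C + cdf L x)"
    by (intro loc_int_add loc_int_const locally_bdd_loc_int[OF cdf_locally_bounded[OF L]])
  then have "loc_int f"
    unfolding loc_int_def set_integrable_def
  proof (intro allI)
    fix x y assume *: "\<forall>x y. integrable lborel (\<lambda>xa. indicator {x<..y} xa *\<^sub>R (C + cdf L xa))"
    show "integrable lborel (\<lambda>t. indicator {x<..y} t *\<^sub>R f t)"
      by (rule integrable_cong_AE_imp[OF *[rule_format, of x y]]) (use f ae in \<open>auto elim!: eventually_mono\<close>)
  qed
  then obtain C' where C': "AE x in lborel. f x = C' + cdf (complex_measure_integral (derivative_measure f)) x"
    using is_derivative_measure_rep[OF d] by blast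
  show "complex_measure_integral (derivative_measure f) g = L g" if "bdd_fun g"
    by (rule radon_eq_if_cdf_AE[OF radon_complex_measure_integral(1)[OF lc] L _ that])
      (use ae C' in \<open>eventually_elim, simp\<close>)
qed

text \<open>The infimum of \<open>p\<close> over points to the right of \<open>x\<close> is the
  right continuous version of \<open>p\<close>; it differs from \<open>p\<close> only at the
  countably many discontinuities, and its Stieltjes measure gives the functional.\<close>

lemma mono_cdf:
  fixes p :: "real \<Rightarrow> real"
  assumes p: "mono p"
  shows "\<exists>L C. radon L \<and> (AE x in lborel. of_real (p x) = C + cdf L x)"
proof -
  define q where "q x = Inf (p ` {x<..})" for x
  have bdd: "bdd_below (p ` {x<..})" for x
    by (rule bdd_belowI[of _ "p x"]) (use monoD[OF p] in auto)
  have ge: "p x \<le> q x" for x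
    unfolding q_def by (rule cINF_greatest) (use monoD[OF p] in auto)
  have le: "q x \<le> p y" if "x < y" for x y
    unfolding q_def by (rule cINF_lower[OF bdd]) (use that in auto)
  have qm: "mono q"
  proof (rule monoI)
    fix x y :: real assume "x \<le> y"
    show "q x \<le> q y"
      unfolding q_def[of y] by (rule cINF_greatest) (use le \<open>x \<le> y\<close> in auto)
  qed
  have qr: "continuous (at_right a) q" for a
    unfolding continuous_within
  proof (rule order_tendstoI)
    fix e assume "e < q a"
    then show "\<forall>\<^sub>F x in at_right a. e < q x"
      unfolding eventually_at_filter using monoD[OF qm, of a]
      by (intro always_eventually allI impI) (meson greaterThan_iff less_imp_le less_le_trans)
  next
    fix e assume "q a < e"
    then obtain y where y: "a < y" "p y < e"
      unfolding q_def by (subst (asm) cINF_less_iff[OF _ bdd]) auto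
    then have "\<forall>x\<in>{a<..<y}. q x < e" using le y(2) by (metis greaterThanLessThan_iff le_less_trans)
    then show "\<forall>\<^sub>F x in at_right a. q x < e" unfolding eventually_at_right[OF y(1)] using y(1) by auto
  qed
  have qc: "q x = p x" if "isCont p x" for x
  proof (rule antisym[OF _ ge])
    have "(\<lambda>n. p (x + 1 / real (Suc n))) \<longlonglongrightarrow> p x"
      by (rule isCont_tendsto_compose[OF that])
        (use tendsto_add[OF tendsto_const LIMSEQ_Suc[OF lim_const_over_n[of "1::real"]], of x] in simp)
    then show "q x \<le> p x" by (rule LIMSEQ_le_const) (auto intro!: le)
  qed
  have "countable {x. \<not> isCont p x}" using mono_on_ctble_discont[of UNIV p] p by (simp add: monotone_on_subset)
  then have "AE x in lborel. x \<notin> {x. \<not> isCont p x}"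
    by (intro AE_not_in) (simp add: countable_imp_null_set_lborel)
  then have ae: "AE x in lborel. p x = q x" by eventually_elim (use qc in auto)
  define m where "m = interval_measure q"
  have em: "emeasure m {a<..b} = ennreal (q b - q a)" if "a \<le> b" for a b
    unfolding m_def by (rule emeasure_interval_measure_Ioc[OF that]) (use monoD[OF qm] qr in auto)
  have sm: "sets m = sets borel" "space m = UNIV" by (auto simp: m_def space_interval_measure)
  have fin: "emeasure m {-K..K} < \<infinity>" for K
  proof -
    have "emeasure m {-K..K} \<le> emeasure m {-\<bar>K\<bar>-1<..\<bar>K\<bar>}" by (rule emeasure_mono) (auto simp: sm)
    also have "\<dots> < \<infinity>" by (subst em) auto
    finally show ?thesis .
  qed
  define L where "L f = (LINT x|m. f x)" for f :: "real \<Rightarrow> complex"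
  have L: "radon L" unfolding L_def[abs_def] by (rule radon_integral(1)[OF sm(1) fin])
  have Li: "L (indicator {x<..y}) = of_real (q y - q x)" if "x \<le> y" for x y
    unfolding L_def using em[OF that] monoD[OF qm that] by (subst LINT_indicator_complex) (auto simp: sm measure_def)
  have eq: "of_real (q x) = of_real (q 0) + cdf L x" for x
    using Li[of 0 x] Li[of x 0] radon_Ioc_empty[OF L, of x 0] radon_Ioc_empty[OF L, of 0 x]
    by (cases "0 \<le> x") (auto simp: cdf_def)
  from ae have "AE x in lborel. of_real (p x) = of_real (q 0) + cdf L x"
    by eventually_elim (simp only: eq[symmetric])
  then show ?thesis using L by blast
qed

lemma cdf_plus: "cdf (\<lambda>f. L f + L' f) x = cdf L x + cdf L' x"
  and cdf_minus: "cdf (\<lambda>f. L f - L' f) x = cdf L x - cdf L' x"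
  and cdf_scale: "cdf (\<lambda>f. c * L f) x = c * cdf L x"
  by (simp_all add: cdf_def algebra_simps)

lemma locally_bounded_variation_cdf:
  assumes "locally_bounded_variation f"
  shows "\<exists>L C. radon L \<and> (AE x in lborel. f x = C + cdf L x)"
proof -
  obtain p q r s :: "real \<Rightarrow> real" where m: "mono p" "mono q" "mono r" "mono s"
    and f: "\<And>x. Re (f x) = p x - q x" "\<And>x. Im (f x) = r x - s x"
    using assms unfolding locally_bounded_variation_def by blast
  obtain L1 C1 where 1: "radon L1" "AE x in lborel. of_real (p x) = C1 + cdf L1 x" using mono_cdf[OF m(1)] by blast
  obtain L2 C2 where 2: "radon L2" "AE x in lborel. of_real (q x) = C2 + cdf L2 x" using mono_cdf[OF m(2)] by blast
  obtain L3 C3 where 3: "radon L3" "AE x in lborel. of_real (r x) = C3 + cdf L3 x" using mono_cdf[OF m(3)] by blast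
  obtain L4 C4 where 4: "radon L4" "AE x in lborel. of_real (s x) = C4 + cdf L4 x" using mono_cdf[OF m(4)] by blast
  have "radon (\<lambda>f. (L1 f - L2 f) + \<i> * (L3 f - L4 f))" by (intro radon_plus radon_minus radon_scale 1 2 3 4)
  moreover have "AE x in lborel. f x = ((C1 - C2) + \<i> * (C3 - C4)) + cdf (\<lambda>f. (L1 f - L2 f) + \<i> * (L3 f - L4 f)) x"
    using 1(2) 2(2) 3(2) 4(2)
  proof eventually_elim
    case (elim x)
    have "f x = (of_real (p x) - of_real (q x)) + \<i> * (of_real (r x) - of_real (s x))"
      using f[of x] by (simp add: complex_eq_iff)
    then show ?case unfolding cdf_plus cdf_minus cdf_scale elim by (simp add: algebra_simps)
  qed
  ultimately show ?thesis by blast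
qed

text \<open>The distribution functions of the two Jordan parts are monotone and their difference is
  the given function. This is what puts solutions of the first order system into the operator
  domain.\<close>

lemma cdf_locally_bounded_variation:
  assumes L: "radon L"
  shows "locally_bounded_variation (\<lambda>x. C + cdf L x)"
proof -
  define \<nu> where "\<nu> A = L (indicator A)" for A
  have \<nu>: "local_complex_borel_measure \<nu>" unfolding \<nu>_def[abs_def] by (rule radon_local_complex[OF L])
  define P where "P \<mu> x = measure (positive_part_measure \<mu>) {0<..x} - measure (positive_part_measure \<mu>) {x<..0}" for \<mu> and x :: real
  have P: "mono (P \<mu>)" if \<mu>: "local_signed_measure \<mu>" for \<mu>
  proof (rule monoI)
    fix x y :: real assume xy: "x \<le> y"
    have f: "A \<in> fmeasurable (positive_part_measure \<mu>)" if "A \<in> sets borel" "bounded A" for A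
      using emeasure_positive_part_bounded[OF \<mu> that] that by (simp add: fmeasurable_def)
    have "measure (positive_part_measure \<mu>) {0<..x} \<le> measure (positive_part_measure \<mu>) {0<..y}"
      using xy by (intro measure_mono_fmeasurable f) auto
    moreover have "measure (positive_part_measure \<mu>) {y<..0} \<le> measure (positive_part_measure \<mu>) {x<..0}"
      using xy by (intro measure_mono_fmeasurable f) auto
    ultimately show "P \<mu> x \<le> P \<mu> y" by (simp add: P_def)
  qed
  have d: "\<mu> {0<..x} - \<mu> {x<..0} = P \<mu> x - P (\<lambda>A. - \<mu> A) x" if \<mu>: "local_signed_measure \<mu>" for \<mu> x
    using upper_variation_jordan(2)[OF \<mu>, of "{0<..x}"] upper_variation_jordan(2)[OF \<mu>, of "{x<..0}"] by (simp add: P_def)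
  note Re = local_complex_Re[OF \<nu>] and Im = local_complex_Im[OF \<nu>]
  note uRe = local_signed_measure_uminus[OF Re] and uIm = local_signed_measure_uminus[OF Im]
  have mc: "mono (\<lambda>x. c + g x)" if "mono g" for c and g :: "real \<Rightarrow> real" using that by (auto simp: mono_def)
  show ?thesis unfolding locally_bounded_variation_def
  proof (intro exI conjI allI)
    show "mono (\<lambda>x. Re C + P (\<lambda>A. Re (\<nu> A)) x)" by (rule mc[OF P[OF Re]])
    show "mono (P (\<lambda>A. - Re (\<nu> A)))" by (rule P[OF uRe])
    show "mono (\<lambda>x. Im C + P (\<lambda>A. Im (\<nu> A)) x)" by (rule mc[OF P[OF Im]])
    show "mono (P (\<lambda>A. - Im (\<nu> A)))" by (rule P[OF uIm])
    show "Re (C + cdf L x) = Re C + P (\<lambda>A. Re (\<nu> A)) x - P (\<lambda>A. - Re (\<nu> A)) x" for x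
      using d[OF Re, of x] by (simp add: cdf_def \<nu>_def)
    show "Im (C + cdf L x) = Im C + P (\<lambda>A. Im (\<nu> A)) x - P (\<lambda>A. - Im (\<nu> A)) x" for x
      using d[OF Im, of x] by (simp add: cdf_def \<nu>_def)
  qed
qed

text \<open>
  The total variation only controls a representative: the values of \<open>f\<close> at the points of a
  countable set are invisible to its distributional derivative.
\<close>

lemma total_variation_representative:
  fixes f :: "real \<Rightarrow> real"
  assumes f: "bounded_variation f" and M: "total_variation_norm (derivative_measure (\<lambda>x. of_real (f x))) \<le> ennreal M"
  obtains g \<tau> where "AE x in lborel. f x = g x" "g \<in> borel_measurable borel" "mono \<tau>" "\<And>x. 0 \<le> \<tau> x" "\<And>x. \<tau> x \<le> 2 * \<bar>M\<bar>"
    "\<And>x y. x \<le> y \<Longrightarrow> \<bar>g y - g x\<bar> \<le> \<tau> y - \<tau> x"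
proof -
  obtain p q where pq: "mono p" "mono q" "f = (\<lambda>x. p x - q x)"
    using f unfolding bounded_variation_def by blast
  have fm: "(\<lambda>x. complex_of_real (f x)) \<in> borel_measurable borel"
    unfolding pq(3) using borel_measurable_mono[OF pq(1)] borel_measurable_mono[OF pq(2)] by auto
  have "locally_bounded_variation (\<lambda>x. complex_of_real (f x))"
    unfolding locally_bounded_variation_def
    by (rule exI[of _ p], rule exI[of _ q], rule exI[of _ "\<lambda>x. 0"], rule exI[of _ "\<lambda>x. 0"]) (use pq in \<open>auto simp: mono_def\<close>)
  then obtain L C where L: "radon L" and ae: "AE x in lborel. complex_of_real (f x) = C + cdf L x"
    using locally_bounded_variation_cdf by blast
  define \<nu> where "\<nu> = derivative_measure (\<lambda>x. complex_of_real (f x))"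
  have \<nu>: "local_complex_borel_measure \<nu>" unfolding \<nu>_def by (rule derivative_measure_radon(1)[OF L fm ae])
  have L\<nu>: "L (indicator A) = \<nu> A" if "A \<in> sets borel" "bounded A" for A
    using derivative_measure_radon(2)[OF L fm ae bdd_fun_indicator[OF that]]
      radon_complex_measure_integral(2)[OF \<nu> that] by (simp add: \<nu>_def)
  define \<mu> where "\<mu> A = Re (\<nu> A)" for A
  have \<mu>: "local_signed_measure \<mu>" unfolding \<mu>_def[abs_def] by (rule local_complex_Re[OF \<nu>])
  note \<mu>' = local_signed_measure_uminus[OF \<mu>]
  have le: "ennreal (cmod (\<nu> B)) \<le> ennreal M" if "B \<in> sets borel" "bounded B" for B
  proof -
    have "(\<Sum>B\<in>{B}. ennreal (cmod (\<nu> B))) \<le> total_variation_norm \<nu>"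
      unfolding total_variation_norm_def by (rule SUP_upper) (use that in \<open>auto simp: disjoint_def\<close>)
    then show ?thesis using M by (simp add: \<nu>_def)
  qed
  have Mabs: "ennreal M \<le> ennreal \<bar>M\<bar>" by (rule ennreal_leI) simp
  have tot: "emeasure (positive_part_measure \<mu>') A \<le> ennreal \<bar>M\<bar>"
    if "local_signed_measure \<mu>'" "A \<in> sets borel" "\<And>B. \<mu>' B \<le> cmod (\<nu> B)" for \<mu>' A
    unfolding emeasure_positive_part[OF that(1,2)] upper_variation_def
  proof (rule SUP_least)
    fix B assume B: "B \<in> {B. B \<in> sets borel \<and> bounded B \<and> B \<subseteq> A}"
    have "ennreal (\<mu>' B) \<le> ennreal (cmod (\<nu> B))" by (rule ennreal_leI[OF that(3)])
    also have "\<dots> \<le> ennreal M" by (rule le) (use B in auto)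
    also note Mabs
    finally show "ennreal (\<mu>' B) \<le> ennreal \<bar>M\<bar>" .
  qed
  have b: "\<mu> B \<le> cmod (\<nu> B)" "- \<mu> B \<le> cmod (\<nu> B)" for B
    using abs_Re_le_cmod[of "\<nu> B"] by (auto simp: \<mu>_def)
  note t1 = tot[OF \<mu> _ b(1)] and t2 = tot[OF \<mu>' _ b(2)]
  define P where "P = measure (positive_part_measure \<mu>)"
  define N where "N = measure (positive_part_measure (\<lambda>A. - \<mu> A))"
  have Ple: "P A \<le> \<bar>M\<bar>" and Nle: "N A \<le> \<bar>M\<bar>" if "A \<in> sets borel" for A
    using t1[OF that] t2[OF that] by (auto simp: P_def N_def measure_def enn2real_leI)
  have split: "measure (positive_part_measure \<mu>') {..y} - measure (positive_part_measure \<mu>') {..x} = measure (positive_part_measure \<mu>') {x<..y}"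
    if "x \<le> y" "emeasure (positive_part_measure \<mu>') {..y} \<le> ennreal \<bar>M\<bar>" for \<mu>' and x y :: real
  proof -
    have "measure (positive_part_measure \<mu>') ({..y} - {..x}) = measure (positive_part_measure \<mu>') {..y} - measure (positive_part_measure \<mu>') {..x}"
      using that by (intro measure_Diff) (auto simp: top_unique less_top[symmetric] intro: le_less_trans[OF _ ennreal_less_top] dest: order_trans)
    moreover have "{..y} - {..x} = {x<..y}" by auto
    ultimately show ?thesis by simp
  qed
  define g where "g x = Re (C + cdf L x)" for x
  \<comment> \<open>The sum of the distribution functions of both Jordan parts. Each part has mass
    at most \<open>\<bar>M\<bar>\<close>, whence the bound \<open>2 * \<bar>M\<bar>\<close>; unlike
    \<open>cdf\<close>, it is normalised at minus infinity, so its total increase is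
    controlled.\<close>
  define \<tau> where "\<tau> x = P {..x} + N {..x}" for x
  have \<tau>d: "\<tau> y - \<tau> x = P {x<..y} + N {x<..y}" if "x \<le> y" for x y
    using split[OF that, of \<mu>] split[OF that, of "\<lambda>A. - \<mu> A"] t1 t2 by (simp add: \<tau>_def P_def N_def)
  have gd: "g y - g x = P {x<..y} - N {x<..y}" if "x \<le> y" for x y
  proof -
    have "g y - g x = Re (cdf L y - cdf L x)" by (simp add: g_def)
    also have "\<dots> = \<mu> {x<..y}" unfolding cdf_diff[OF L that] by (simp add: L\<nu> \<mu>_def)
    also have "\<dots> = P {x<..y} - N {x<..y}"
      unfolding P_def N_def by (rule upper_variation_jordan(2)[OF \<mu>]) auto
    finally show ?thesis .
  qed
  have nn: "0 \<le> P A" "0 \<le> N A" for A by (auto simp: P_def N_def)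
  show ?thesis
  proof (rule that[of g \<tau>])
    show "AE x in lborel. f x = g x" using ae by eventually_elim (metis Re_complex_of_real g_def)
    show "g \<in> borel_measurable borel" unfolding g_def[abs_def] using cdf_borel_measurable[OF L] by auto
    show "mono \<tau>" using \<tau>d nn by (intro monoI) (smt (verit))
    show "0 \<le> \<tau> x" for x using nn by (simp add: \<tau>_def)
    show "\<tau> x \<le> 2 * \<bar>M\<bar>" for x using Ple[of "{..x}"] Nle[of "{..x}"] by (simp add: \<tau>_def)
    show "\<bar>g y - g x\<bar> \<le> \<tau> y - \<tau> x" if "x \<le> y" for x y
      unfolding \<tau>d[OF that] gd[OF that] using nn[of "{x<..y}"] by linarith
  qed
qed

section \<open>The Sobolev space of order one\<close>

lemma in_L2_loc_int:
  assumes w: "in_L2 w" shows "loc_int w"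
  unfolding loc_int_def set_integrable_def
proof (intro allI)
  fix x y :: real
  have m: "w \<in> borel_measurable borel" and i: "integrable lborel (\<lambda>x. (cmod (w x))\<^sup>2)" using w by (auto simp: in_L2_def)
  have "integrable lborel (\<lambda>t. indicator {x<..y} t + (cmod (w t))\<^sup>2)"
    by (intro Bochner_Integration.integrable_add i integrable_real_indicator) (cases "x \<le> y"; simp)+
  then show "integrable lborel (\<lambda>t. indicator {x<..y} t *\<^sub>R w t)"
  proof (rule Bochner_Integration.integrable_bound)
    show "AE t in lborel. norm (indicator {x<..y} t *\<^sub>R w t) \<le> norm (indicator {x<..y} t + (cmod (w t))\<^sup>2)"
    proof (intro always_eventually allI)
      fix t
      have "cmod (w t) \<le> 1 + (cmod (w t))\<^sup>2" using sum_squares_bound[of "cmod (w t)" 1] by (simp add: power2_eq_square) (smt (verit) norm_ge_zero)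
      then show "norm (indicator {x<..y} t *\<^sub>R w t) \<le> norm (indicator {x<..y} t + (cmod (w t))\<^sup>2)"
        by (auto simp: indicator_def)
    qed
  qed (use m in auto)
qed

text \<open>Du Bois-Reymond for \<open>u\<close> minus a primitive of \<open>w\<close>. It turns the
  distributional definition of the Sobolev space into the integral form used from here on.\<close>

lemma weak_derivative_prim_on:
  assumes u: "loc_int u" and w: "loc_int w" and d: "is_weak_derivative u w"
  obtains U where "prim_on UNIV U w" "AE x in lborel. u x = U x" "continuous_on UNIV U"
proof -
  define L where "L f = (LINT t|lborel. f t * w t)" for f
  have L: "radon L" unfolding L_def[abs_def] by (rule radon_density[OF w])
  have c: "loc_int (cdf L)" by (rule locally_bdd_loc_int[OF cdf_locally_bounded[OF L]])
  have "\<exists>C. AE x in lborel. u x - cdf L x = C"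
  proof (rule du_bois_reymond[OF loc_int_diff[OF u c]])
    fix \<phi> assume \<phi>: "test_function \<phi>"
    have e: "(LINT x|lborel. u x * of_real (deriv \<phi> x)) = (LINT x|lborel. cdf L x * of_real (deriv \<phi> x))"
      using d \<phi> radon_test_function[OF L \<phi>] unfolding is_weak_derivative_def L_def by (simp add: mult.commute)
    have i: "integrable lborel (\<lambda>x. g x * of_real (deriv \<phi> x))" if "loc_int g" for g :: "real \<Rightarrow> complex"
      using loc_int_bdd_fun[OF that test_function_bdd_fun(2)[OF \<phi>]] by (simp add: mult.commute)
    have "(LINT x|lborel. (u x - cdf L x) * of_real (deriv \<phi> x)) = (LINT x|lborel. u x * of_real (deriv \<phi> x) - cdf L x * of_real (deriv \<phi> x))"
      by (simp add: algebra_simps)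
    also have "\<dots> = 0" by (subst Bochner_Integration.integral_diff[OF i[OF u] i[OF c]]) (simp add: e)
    finally show "(LINT x|lborel. (u x - cdf L x) * of_real (deriv \<phi> x)) = 0" .
  qed
  then obtain C where C: "AE x in lborel. u x - cdf L x = C" ..
  have p: "prim_on UNIV (\<lambda>x. C + cdf L x) w"
    using prim_on_add[OF prim_on_const[of UNIV C] cdf_density[OF w]] unfolding L_def[abs_def] by simp
  have "continuous_on UNIV (\<lambda>x. C + cdf L x)"
  proof (rule continuous_at_imp_continuous_on, rule ballI)
    fix x :: real
    have "continuous_on {x-1..x+1} (\<lambda>x. C + cdf L x)"
      by (rule prim_on_continuous[OF prim_on_subset[OF p]]) simp
    then show "isCont (\<lambda>x. C + cdf L x) x" by (rule continuous_on_interior) simp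
  qed
  then show ?thesis using that[OF p] C by (auto elim!: eventually_mono simp: algebra_simps)
qed

lemma prim_on_UNIV_continuous:
  assumes p: "prim_on UNIV U w" shows "continuous_on UNIV U"
proof (rule continuous_at_imp_continuous_on, rule ballI)
  fix x :: real
  have "continuous_on {x-1..x+1} U" by (rule prim_on_continuous[OF prim_on_subset[OF p]]) simp
  then show "isCont U x" by (rule continuous_on_interior) simp
qed

lemma prim_on_weak_derivative:
  assumes p: "prim_on UNIV u w"
  shows "is_weak_derivative u w"
  unfolding is_weak_derivative_def
proof (intro allI impI)
  fix \<phi> assume \<phi>: "test_function \<phi>"
  have w: "loc_int w" unfolding loc_int_def
  proof (intro allI)
    fix x y :: real show "set_integrable lborel {x<..y} w"
      using prim_onD(1)[OF p, of x y] by (cases "x \<le> y") (auto simp: set_integrable_def)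
  qed
  define L where "L f = (LINT t|lborel. f t * w t)" for f
  have L: "radon L" unfolding L_def[abs_def] by (rule radon_density[OF w])
  have "cdf L x = u x - u 0" for x
    using prim_onD(2)[OF p, of 0 x] prim_onD(2)[OF p, of x 0]
      prim_onD(2)[OF cdf_density[OF w], of 0 x] prim_onD(2)[OF cdf_density[OF w], of x 0] radon_Ioc_empty[OF L, of 0 0]
    unfolding L_def[abs_def] by (cases "0 \<le> x") (auto simp: cdf_def algebra_simps)
  then have "AE x in lborel. u x = u 0 + cdf L x" by simp
  from is_derivative_measure_radon[OF L borel_measurable_continuous_onI[OF prim_on_UNIV_continuous[OF p]] this]
  have "L (\<lambda>x. of_real (\<phi> x)) = - (LINT x|lborel. u x * of_real (deriv \<phi> x))"
    using \<open>is_derivative_measure u _\<close> \<phi> complex_measure_integral_eq[OF radon_local_complex[OF L] L refl test_function_bdd_fun(1)[OF \<phi>]]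
    unfolding is_derivative_measure_def by simp
  then show "(LINT x|lborel. u x * of_real (deriv \<phi> x)) = - (LINT x|lborel. w x * of_real (\<phi> x))"
    by (simp add: L_def mult.commute)
qed

lemma prim_on_unique_density:
  fixes w w' :: "real \<Rightarrow> complex"
  assumes "prim_on UNIV U w" "prim_on UNIV U w'"
  shows "AE x in lborel. w x = w' x"
proof -
  have p: "prim_on UNIV (\<lambda>x. U x - U x) (\<lambda>x. w x - w' x)" by (rule prim_on_diff[OF assms])
  have "AE x in lborel. w x - w' x = 0"
  proof (rule AE_zero_if_Ioc_integrals_zero)
    show "loc_int (\<lambda>x. w x - w' x)" unfolding loc_int_def
    proof (intro allI)
      fix x y :: real show "set_integrable lborel {x<..y} (\<lambda>x. w x - w' x)"
        using prim_onD(1)[OF p, of x y] by (cases "x \<le> y") (auto simp: set_integrable_def)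
    qed
    show "(LINT s:{x<..y}|lborel. w s - w' s) = 0" if "x \<le> y" for x y
      using prim_onD(2)[OF p that] by simp
  qed
  then show ?thesis by (auto elim: eventually_mono)
qed

lemma continuous_rep_eq:
  assumes "continuous_on UNIV U" "AE x in lborel. u x = U x"
  shows "continuous_rep u = U"
  unfolding continuous_rep_def
proof (rule the_equality)
  show "continuous_on UNIV U \<and> (AE x in lborel. U x = u x)" using assms by (auto elim: eventually_mono)
  fix v assume v: "continuous_on UNIV v \<and> (AE x in lborel. v x = u x)"
  have "AE x in lborel. v x = U x" using conjunct2[OF v] assms(2) by eventually_elim simp
  then show "v = U" using continuous_AE_eq v assms(1) by blast
qed

lemma in_H1_weak_derivative:
  assumes "in_H1 u"
  shows "in_L2 u" "in_L2 (weak_derivative u)" "is_weak_derivative u (weak_derivative u)"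
proof -
  show "in_L2 u" using assms by (simp add: in_H1_def)
  obtain v where "in_L2 v \<and> is_weak_derivative u v" using assms unfolding in_H1_def by blast
  then have "in_L2 (weak_derivative u) \<and> is_weak_derivative u (weak_derivative u)"
    unfolding weak_derivative_def by (rule someI[where P = "\<lambda>v. in_L2 v \<and> is_weak_derivative u v"])
  then show "in_L2 (weak_derivative u)" "is_weak_derivative u (weak_derivative u)" by auto
qed

section \<open>Linear Caratheodory systems\<close>

definition prim0 :: "(real \<Rightarrow> 'a::{banach,second_countable_topology}) \<Rightarrow> real \<Rightarrow> 'a" where
  "prim0 w x = (LINT t:{0<..x}|lborel. w t) - (LINT t:{x<..0}|lborel. w t)"

lemma LINT_Ioc_split:
  fixes w :: "real \<Rightarrow> 'a::{banach,second_countable_topology}"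
  assumes "set_integrable lborel {x<..z} w" "x \<le> y" "y \<le> z"
  shows "(LINT t:{x<..z}|lborel. w t) = (LINT t:{x<..y}|lborel. w t) + (LINT t:{y<..z}|lborel. w t)"
proof -
  have "{x<..z} = {x<..y} \<union> {y<..z}" using assms by auto
  then show ?thesis
    using set_integral_Un[of "{x<..y}" "{y<..z}" lborel w] assms
    by (simp add: set_integrable_Ioc_subset[OF assms(1)] disjoint_iff)
qed

lemma prim0_prim_on:
  assumes w: "loc_int w" shows "prim_on UNIV (prim0 w) w"
proof (rule prim_onI)
  fix x y :: real assume xy: "x \<le> y"
  have i: "set_integrable lborel {u<..v} w" for u v using w by (simp add: loc_int_def)
  then show "set_integrable lborel {x<..y} w" .
  have e: "(LINT t:{u<..v}|lborel. w t) = 0" if "v \<le> u" for u v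
    using that by (simp add: set_lebesgue_integral_def)
  consider "0 \<le> x" | "x \<le> 0" "0 \<le> y" | "y \<le> 0" by linarith
  then show "prim0 w y - prim0 w x = (LINT s:{x<..y}|lborel. w s)"
  proof cases
    case 1
    then show ?thesis using LINT_Ioc_split[OF i 1 xy] e xy by (simp add: prim0_def)
  next
    case 2
    then show ?thesis using LINT_Ioc_split[OF i 2] e[of 0 y] e[of x 0] by (simp add: prim0_def)
  next
    case 3
    then show ?thesis using LINT_Ioc_split[OF i xy 3] e xy by (simp add: prim0_def)
  qed
qed

lemma prim0_0 [simp]: "prim0 w 0 = 0"
  by (simp add: prim0_def)

lemma LINT_norm_le:
  fixes w :: "real \<Rightarrow> 'a::{banach,second_countable_topology}"
  assumes "set_integrable lborel A w" "set_integrable lborel A k" "\<And>t. t \<in> A \<Longrightarrow> norm (w t) \<le> k t"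
  shows "norm (LINT t:A|lborel. w t) \<le> (LINT t:A|lborel. k t)"
  unfolding set_lebesgue_integral_def
proof (rule Bochner_Integration.integral_norm_bound_integral)
  show "norm (indicator A x *\<^sub>R w x) \<le> indicator A x *\<^sub>R k x" if "x \<in> space lborel" for x
    using assms(3)[of x] by (auto simp: indicator_def)
qed (use assms in \<open>auto simp: set_integrable_def\<close>)

lemma prim0_norm_le:
  assumes w: "loc_int w" and k: "loc_int k" and le: "\<And>t. \<bar>t\<bar> \<le> \<bar>x\<bar> \<Longrightarrow> norm (w t) \<le> k t"
  shows "norm (prim0 w x) \<le> \<bar>prim0 k x\<bar>"
proof -
  have "norm (LINT t:{u<..v}|lborel. w t) \<le> (LINT t:{u<..v}|lborel. k t)" if "\<And>t. t \<in> {u<..v} \<Longrightarrow> \<bar>t\<bar> \<le> \<bar>x\<bar>" for u v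
    by (rule LINT_norm_le) (use w k le that in \<open>auto simp: loc_int_def\<close>)
  from this[of 0 x] this[of x 0] show ?thesis
    by (cases "0 \<le> x") (auto simp: prim0_def set_lebesgue_integral_def[of _ "{}"])
qed

lemma loc_int_mult_bdd:
  fixes A y :: "real \<Rightarrow> complex"
  assumes A: "loc_int A" and y: "locally_bdd y"
  shows "loc_int (\<lambda>t. A t * y t)"
  unfolding loc_int_def
proof (intro allI)
  fix u v :: real
  have "bdd_fun (\<lambda>t. y t * indicator {u<..v} t)" by (rule bdd_fun_mult[OF y bdd_fun_Ioc])
  from loc_int_bdd_fun[OF A this] show "set_integrable lborel {u<..v} (\<lambda>t. A t * y t)"
    unfolding set_integrable_def by (rule back_subst[of "integrable lborel"]) (auto simp: indicator_def)
qed

lemma loc_int_sum: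
  "(\<And>i. i \<in> I \<Longrightarrow> loc_int (f i)) \<Longrightarrow> loc_int (\<lambda>t. \<Sum>i\<in>I. f i t)"
proof (induction I rule: infinite_finite_induct)
  case (insert i I)
  then show ?case using loc_int_add[of "f i" "\<lambda>t. \<Sum>i\<in>I. f i t"] by simp
qed (simp_all add: loc_int_def set_integrable_def)

lemma loc_int_cmod: "loc_int f \<Longrightarrow> loc_int (\<lambda>t. cmod (f t))"
  unfolding loc_int_def by (auto intro: set_integrable_norm)

lemma loc_int_of_real: "loc_int f \<Longrightarrow> loc_int (\<lambda>t. complex_of_real (f t))"
  unfolding loc_int_def set_integrable_def
proof (intro allI)
  fix x y assume "\<forall>x y. integrable lborel (\<lambda>t. indicator {x<..y} t *\<^sub>R f t)"
  then have "integrable lborel (\<lambda>t. complex_of_real (indicator {x<..y} t *\<^sub>R f t))" by (intro integrable_of_real) auto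
  then show "integrable lborel (\<lambda>t. indicator {x<..y} t *\<^sub>R complex_of_real (f t))"
    by (rule back_subst[of "integrable lborel"]) (auto simp: indicator_def)
qed

lemma loc_int_Re: "loc_int f \<Longrightarrow> loc_int (\<lambda>t. Re (f t))"
  unfolding loc_int_def set_integrable_def
proof (intro allI)
  fix x y assume "\<forall>x y. integrable lborel (\<lambda>t. indicator {x<..y} t *\<^sub>R f t)"
  then have "integrable lborel (\<lambda>t. Re (indicator {x<..y} t *\<^sub>R f t))" by (intro integrable_Re) auto
  then show "integrable lborel (\<lambda>t. indicator {x<..y} t *\<^sub>R Re (f t))" by simp
qed

lemma continuous_locally_bdd:
  assumes c: "continuous_on UNIV f" shows "locally_bdd f"
  unfolding locally_bdd_def
proof (intro conjI allI)
  show "f \<in> borel_measurable borel" by (rule borel_measurable_continuous_onI[OF c])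
  fix K
  have "bounded (f ` {-K..K})"
    by (rule compact_imp_bounded[OF compact_continuous_image[OF continuous_on_subset[OF c]]]) auto
  then obtain C where "\<And>x. x \<in> {-K..K} \<Longrightarrow> cmod (f x) \<le> C" unfolding bounded_iff by blast
  then show "\<exists>C. \<forall>x. \<bar>x\<bar> \<le> K \<longrightarrow> cmod (f x) \<le> C" by (intro exI[of _ C]) (auto simp: abs_le_iff)
qed

lemma prim_on_mult_real:
  fixes U V w z :: "real \<Rightarrow> real"
  assumes U: "prim_on S U w" and V: "prim_on S V z"
  shows "prim_on S (\<lambda>t. U t * V t) (\<lambda>t. w t * V t + U t * z t)"
proof -
  note * = prim_on_mult[OF prim_on_bounded_linear[OF bounded_linear_of_real U] prim_on_bounded_linear[OF bounded_linear_of_real V]]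
  show ?thesis using prim_on_bounded_linear[OF bounded_linear_Re *] by simp
qed

lemma prim_on_power:
  fixes U w :: "real \<Rightarrow> real"
  assumes U: "prim_on S U w"
  shows "prim_on S (\<lambda>t. U t ^ Suc n) (\<lambda>t. real (Suc n) * U t ^ n * w t)"
proof (induction n)
  case (Suc n)
  show ?case by (rule prim_on_cong[OF prim_on_mult_real[OF U Suc]]) (auto simp: algebra_simps)
qed (use U in simp)

text \<open>The chain rule for powers of a primitive. It replaces the powers of \<open>x\<close> in
  Picard iteration when coefficients are merely locally integrable, and is the source of the
  factorials there.\<close>

lemma prim0_power:
  fixes l :: "real \<Rightarrow> real"
  assumes l: "loc_int l" and nn: "\<And>t. 0 \<le> l t"
  shows "\<bar>prim0 (\<lambda>t. l t * \<bar>prim0 l t\<bar> ^ n) x\<bar> = \<bar>prim0 l x\<bar> ^ Suc n / real (Suc n)"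
proof -
  note p = prim0_prim_on[OF l]
  have sgn: "0 \<le> x \<Longrightarrow> 0 \<le> prim0 l x" "x \<le> 0 \<Longrightarrow> prim0 l x \<le> 0" for x
    using nn by (auto simp: prim0_def set_lebesgue_integral_def intro!: Bochner_Integration.integral_nonneg)
  \<comment> \<open>The orientation sign: \<open>\<sigma> * prim0 l\<close> is nonnegative between 0
    and \<open>x\<close>, so both half lines are handled together.\<close>
  define \<sigma> :: real where "\<sigma> = (if 0 \<le> x then 1 else -1)"
  have \<sigma>: "\<bar>prim0 l t\<bar> = \<sigma> * prim0 l t" if "t \<in> {min 0 x..max 0 x}" for t
    using that sgn[of t] by (auto simp: \<sigma>_def min_def max_def split: if_splits)
  have p1: "prim_on UNIV (\<lambda>t. (\<sigma> * prim0 l t) ^ Suc n) (\<lambda>t. real (Suc n) * (\<sigma> * prim0 l t) ^ n * (\<sigma> * l t))"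
    by (rule prim_on_power[OF prim_on_cmult[OF p]])
  have "(LINT t:{min 0 x<..max 0 x}|lborel. l t * \<bar>prim0 l t\<bar> ^ n) = \<bar>prim0 l x\<bar> ^ Suc n / real (Suc n)"
  proof -
    have "(\<sigma> * prim0 l (max 0 x)) ^ Suc n - (\<sigma> * prim0 l (min 0 x)) ^ Suc n
        = (LINT t:{min 0 x<..max 0 x}|lborel. real (Suc n) * (\<sigma> * prim0 l t) ^ n * (\<sigma> * l t))"
      by (rule prim_onD(2)[OF p1]) auto
    also have "\<dots> = (LINT t:{min 0 x<..max 0 x}|lborel. (real (Suc n) * \<sigma>) * (l t * \<bar>prim0 l t\<bar> ^ n))"
      unfolding set_lebesgue_integral_def
      by (rule Bochner_Integration.integral_cong) (use \<sigma> in \<open>auto simp: indicator_def\<close>)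
    also have "\<dots> = real (Suc n) * \<sigma> * (LINT t:{min 0 x<..max 0 x}|lborel. l t * \<bar>prim0 l t\<bar> ^ n)" by simp
    finally have "real (Suc n) * (LINT t:{min 0 x<..max 0 x}|lborel. l t * \<bar>prim0 l t\<bar> ^ n) = \<bar>prim0 l x\<bar> ^ Suc n"
      using \<sigma>[of x] by (auto simp: \<sigma>_def algebra_simps split: if_splits)
    then show ?thesis by (metis nonzero_mult_div_cancel_left of_nat_neq_0)
  qed
  moreover have "\<bar>prim0 (\<lambda>t. l t * \<bar>prim0 l t\<bar> ^ n) x\<bar> = (LINT t:{min 0 x<..max 0 x}|lborel. l t * \<bar>prim0 l t\<bar> ^ n)"
  proof -
    have "0 \<le> (LINT t:A|lborel. l t * \<bar>prim0 l t\<bar> ^ n)" for A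
      unfolding set_lebesgue_integral_def using nn by (intro Bochner_Integration.integral_nonneg) auto
    then show ?thesis by (cases "0 \<le> x") (auto simp: prim0_def set_lebesgue_integral_def[of _ "{}"])
  qed
  ultimately show ?thesis by simp
qed

lemma prim0_add: "loc_int f \<Longrightarrow> loc_int g \<Longrightarrow> prim0 (\<lambda>t. f t + g t) x = prim0 f x + prim0 g x"
  and prim0_diff: "loc_int f \<Longrightarrow> loc_int g \<Longrightarrow> prim0 (\<lambda>t. f t - g t) x = prim0 f x - prim0 g x"
  by (auto simp: prim0_def loc_int_def set_integral_add set_integral_diff)

lemma locally_bdd_add:
  assumes "locally_bdd f" "locally_bdd g" shows "locally_bdd (\<lambda>x. f x + g x)"
  unfolding locally_bdd_def
proof (intro conjI allI)
  show "(\<lambda>x. f x + g x) \<in> borel_measurable borel" using assms by (auto simp: locally_bdd_def)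
  fix K
  obtain C D where "\<And>x. \<bar>x\<bar> \<le> K \<Longrightarrow> cmod (f x) \<le> C" "\<And>x. \<bar>x\<bar> \<le> K \<Longrightarrow> cmod (g x) \<le> D"
    using assms unfolding locally_bdd_def by blast
  then show "\<exists>C. \<forall>x. \<bar>x\<bar> \<le> K \<longrightarrow> cmod (f x + g x) \<le> C"
    by (intro exI[of _ "C + D"]) (auto intro!: norm_triangle_mono)
qed

lemma locally_bdd_uminus: "locally_bdd f \<Longrightarrow> locally_bdd (\<lambda>x. - f x)"
  by (auto simp: locally_bdd_def)

lemma prim0_limit:
  fixes w :: "nat \<Rightarrow> real \<Rightarrow> complex"
  assumes w: "\<And>n. loc_int (w n)" and w': "loc_int w'" and k: "loc_int k"
    and lim: "\<And>t. (\<lambda>n. w n t) \<longlonglongrightarrow> w' t" and le: "\<And>n t. \<bar>t\<bar> \<le> \<bar>x\<bar> \<Longrightarrow> cmod (w n t) \<le> k t"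
  shows "(\<lambda>n. prim0 (w n) x) \<longlonglongrightarrow> prim0 w' x"
proof -
  have "(\<lambda>n. LINT t:{u<..v}|lborel. w n t) \<longlonglongrightarrow> (LINT t:{u<..v}|lborel. w' t)"
    if "\<And>t. t \<in> {u<..v} \<Longrightarrow> \<bar>t\<bar> \<le> \<bar>x\<bar>" for u v
    unfolding set_lebesgue_integral_def
  proof (rule integral_dominated_convergence[where w = "\<lambda>t. indicator {u<..v} t *\<^sub>R k t"])
    show "AE t in lborel. (\<lambda>n. indicator {u<..v} t *\<^sub>R w n t) \<longlonglongrightarrow> indicator {u<..v} t *\<^sub>R w' t"
      by (intro always_eventually allI tendsto_scaleR tendsto_const lim)
    show "AE t in lborel. norm (indicator {u<..v} t *\<^sub>R w n t) \<le> indicator {u<..v} t *\<^sub>R k t" for n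
      using le that by (intro always_eventually allI) (auto simp: indicator_def)
    show "(\<lambda>t. indicator {u<..v} t *\<^sub>R w n t) \<in> borel_measurable lborel" for n
      using w[of n] unfolding loc_int_def set_integrable_def by (blast intro: borel_measurable_integrable)
    show "(\<lambda>t. indicator {u<..v} t *\<^sub>R w' t) \<in> borel_measurable lborel"
      using w' unfolding loc_int_def set_integrable_def by (blast intro: borel_measurable_integrable)
  qed (use k in \<open>auto simp: loc_int_def set_integrable_def\<close>)
  from this[of 0 x] this[of x 0] show ?thesis
    unfolding prim0_def by (cases "0 \<le> x"; intro tendsto_diff; simp add: set_lebesgue_integral_def[of _ "{}"])
qed

text \<open>Picard iteration. With \<open>s\<close> the primitive of an integrable majorant of the
  matrix, successive iterates differ by at most
  \<open>B * \<bar>s x\<bar> ^ Suc n / fact (Suc n)\<close>. The series therefore converges locally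
  uniformly, on the whole line and without any smallness.\<close>

theorem linear_system_exists:
  fixes A :: "nat \<Rightarrow> nat \<Rightarrow> real \<Rightarrow> complex" and F :: "nat \<Rightarrow> real \<Rightarrow> complex" and c :: "nat \<Rightarrow> complex"
  assumes A: "\<And>i j. loc_int (A i j)" and F: "\<And>i. loc_int (F i)"
  shows "\<exists>y. \<forall>i<N. y i 0 = c i \<and> prim_on UNIV (y i) (\<lambda>t. (\<Sum>j<N. A i j t * y j t) + F i t)"
proof -
  define y0 where "y0 i x = c i + prim0 (F i) x" for i x
  define T where "T v i t = (\<Sum>j<N. A i j t * v j t)" for v :: "nat \<Rightarrow> real \<Rightarrow> complex" and i t
  define Y where "Y n = rec_nat y0 (\<lambda>_ v i x. y0 i x + prim0 (T v i) x) n" for n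
  have Y0: "Y 0 = y0" and YS: "Y (Suc n) i x = y0 i x + prim0 (T (Y n) i) x" for n i x
    by (simp_all add: Y_def)
  define l where "l t = (\<Sum>i<N. \<Sum>j<N. cmod (A i j t))" for t
  \<comment> \<open>The factor \<open>N\<close> pays for summing the same bound over all components,
    so that the step from one iterate to the next has exactly the form of
    \<open>prim0_power\<close>.\<close>
  define m where "m t = real N * l t" for t
  define s where "s = prim0 m"
  have l: "loc_int l" unfolding l_def[abs_def] by (intro loc_int_sum loc_int_cmod A)
  have l0: "0 \<le> l t" for t by (auto simp: l_def intro!: sum_nonneg)
  have m: "loc_int m" unfolding m_def[abs_def] using l by (auto simp: loc_int_def)
  have m0: "0 \<le> m t" for t using l0 by (simp add: m_def)
  have prim0_bdd: "locally_bdd (prim0 w)" if "loc_int w" for w :: "real \<Rightarrow> complex"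
    by (rule continuous_locally_bdd[OF prim_on_UNIV_continuous[OF prim0_prim_on[OF that]]])
  have Tint: "loc_int (T v i)" if "\<And>j. locally_bdd (v j)" for v i
    unfolding T_def[abs_def] by (intro loc_int_sum loc_int_mult_bdd A that)
  have y0b: "locally_bdd (y0 i)" for i
    unfolding y0_def[abs_def] by (intro locally_bdd_add locally_bdd_const prim0_bdd F)
  have Yb: "locally_bdd (Y n i)" for n i
  proof (induction n arbitrary: i)
    case 0
    then show ?case by (simp add: Y0 y0b)
  next
    case (Suc n)
    have "Y (Suc n) i = (\<lambda>x. y0 i x + prim0 (T (Y n) i) x)" by (rule ext) (rule YS)
    then show ?case using locally_bdd_add[OF y0b prim0_bdd[OF Tint[OF Suc]]] by simp
  qed
  have TD: "cmod (T v i t) \<le> l t * (\<Sum>j<N. cmod (v j t))" if "i < N" for v i t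
  proof -
    have "cmod (T v i t) \<le> (\<Sum>j<N. cmod (A i j t) * cmod (v j t))"
      unfolding T_def by (rule order_trans[OF norm_sum]) (simp add: norm_mult)
    also have "\<dots> \<le> (\<Sum>j<N. (\<Sum>k<N. cmod (A i k t)) * cmod (v j t))"
      by (intro sum_mono mult_right_mono member_le_sum) auto
    also have "\<dots> = (\<Sum>k<N. cmod (A i k t)) * (\<Sum>j<N. cmod (v j t))" by (simp add: sum_distrib_left)
    also have "\<dots> \<le> l t * (\<Sum>j<N. cmod (v j t))"
      unfolding l_def using that
      by (intro mult_right_mono sum_nonneg) (auto intro!: member_le_sum[of i "{..<N}" "\<lambda>i. \<Sum>k<N. cmod (A i k t)"] sum_nonneg)
    finally show ?thesis .
  qed
  have sc: "continuous_on UNIV s" unfolding s_def by (rule prim_on_UNIV_continuous[OF prim0_prim_on[OF m]])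
  have lm: "loc_int (\<lambda>t. l t * (C * \<bar>s t\<bar> ^ n))" for C n
  proof -
    have c: "continuous_on UNIV (\<lambda>t. complex_of_real (C * \<bar>s t\<bar> ^ n))"
      by (intro continuous_intros sc)
    have "loc_int (\<lambda>t. complex_of_real (l t) * complex_of_real (C * \<bar>s t\<bar> ^ n))"
      by (rule loc_int_mult_bdd[OF loc_int_of_real[OF l] continuous_locally_bdd[OF c]])
    from loc_int_Re[OF this] show ?thesis by simp
  qed
  have step: "(\<Sum>i<N. cmod (prim0 (T v i) x)) \<le> C * \<bar>s x\<bar> ^ Suc k / real (Suc k)"
    if v: "\<And>j. locally_bdd (v j)" and C: "0 \<le> C" and le: "\<And>t. \<bar>t\<bar> \<le> \<bar>x\<bar> \<Longrightarrow> (\<Sum>j<N. cmod (v j t)) \<le> C * \<bar>s t\<bar> ^ k" for v C k x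
  proof -
    have "cmod (prim0 (T v i) x) \<le> \<bar>prim0 (\<lambda>t. l t * (C * \<bar>s t\<bar> ^ k)) x\<bar>" if "i < N" for i
    proof (rule prim0_norm_le[OF Tint[OF v] lm])
      fix t assume "\<bar>t\<bar> \<le> \<bar>x\<bar>"
      then have "(\<Sum>j<N. cmod (v j t)) \<le> C * \<bar>s t\<bar> ^ k" by (rule le)
      then show "cmod (T v i t) \<le> l t * (C * \<bar>s t\<bar> ^ k)"
        by (rule order_trans[OF TD[OF that] mult_left_mono[OF _ l0]])
    qed
    then have "(\<Sum>i<N. cmod (prim0 (T v i) x)) \<le> real N * \<bar>prim0 (\<lambda>t. l t * (C * \<bar>s t\<bar> ^ k)) x\<bar>"
      using sum_bounded_above[of "{..<N}" "\<lambda>i. cmod (prim0 (T v i) x)"] by simp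
    also have "\<dots> = \<bar>real N * prim0 (\<lambda>t. l t * (C * \<bar>s t\<bar> ^ k)) x\<bar>" by (simp add: abs_mult)
    also have "real N * prim0 (\<lambda>t. l t * (C * \<bar>s t\<bar> ^ k)) x = C * prim0 (\<lambda>t. m t * \<bar>s t\<bar> ^ k) x"
    proof -
      have e: "(LINT t:B|lborel. m t * \<bar>s t\<bar> ^ k) = real N * (LINT t:B|lborel. l t * \<bar>s t\<bar> ^ k)" for B
        unfolding m_def mult.assoc by simp
      have e': "(LINT t:B|lborel. l t * (C * \<bar>s t\<bar> ^ k)) = C * (LINT t:B|lborel. l t * \<bar>s t\<bar> ^ k)" for B
        unfolding mult.left_commute[of _ C] by simp
      show ?thesis unfolding prim0_def e e' by (simp add: algebra_simps)
    qed
    also have "\<bar>C * prim0 (\<lambda>t. m t * \<bar>s t\<bar> ^ k) x\<bar> = C * (\<bar>s x\<bar> ^ Suc k / real (Suc k))"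
      unfolding abs_mult s_def prim0_power[OF m m0] using C by simp
    finally show ?thesis by simp
  qed
  have bound: "(\<Sum>i<N. cmod (Y (Suc n) i x - Y n i x)) \<le> B * \<bar>s x\<bar> ^ Suc n / fact (Suc n)"
    if B: "\<And>t. \<bar>t\<bar> \<le> K \<Longrightarrow> (\<Sum>i<N. cmod (y0 i t)) \<le> B" "0 \<le> B" and x: "\<bar>x\<bar> \<le> K" for n x B K
    using x
  proof (induction n arbitrary: x)
    case 0
    have "(\<Sum>i<N. cmod (prim0 (T y0 i) x)) \<le> B * \<bar>s x\<bar> ^ Suc 0 / real (Suc 0)"
      by (rule step) (use 0 B y0b in auto)
    then show ?case by (simp add: YS Y0)
  next
    case (Suc n)
    define v where "v i t = Y (Suc n) i t - Y n i t" for i t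
    have vb: "locally_bdd (v i)" for i
      using locally_bdd_add[OF Yb locally_bdd_uminus[OF Yb], of "Suc n" i n i] by (simp add: v_def[abs_def])
    have "Y (Suc (Suc n)) i x - Y (Suc n) i x = prim0 (T v i) x" for i
    proof -
      have "T v i = (\<lambda>t. T (Y (Suc n)) i t - T (Y n) i t)"
        by (rule ext) (simp add: T_def v_def right_diff_distrib sum_subtractf)
      then show ?thesis using prim0_diff[OF Tint[OF Yb] Tint[OF Yb]] YS[of "Suc n" i x] YS[of n i x] by simp
    qed
    moreover have "(\<Sum>i<N. cmod (prim0 (T v i) x)) \<le> (B / fact (Suc n)) * \<bar>s x\<bar> ^ Suc (Suc n) / real (Suc (Suc n))"
    proof (rule step[OF vb])
      show "(\<Sum>j<N. cmod (v j t)) \<le> B / fact (Suc n) * \<bar>s t\<bar> ^ Suc n" if "\<bar>t\<bar> \<le> \<bar>x\<bar>" for t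
        unfolding v_def using Suc.IH[of t] Suc.prems that by simp
    qed (use B in simp)
    moreover have "(B / fact (Suc n)) * \<bar>s x\<bar> ^ Suc (Suc n) / real (Suc (Suc n)) = B * \<bar>s x\<bar> ^ Suc (Suc n) / fact (Suc (Suc n))"
      by (simp add: field_simps)
    ultimately show ?case by (simp only:)
  qed
  have local: "\<exists>C. \<forall>x i. \<bar>x\<bar> \<le> K \<longrightarrow> i < N \<longrightarrow> convergent (\<lambda>n. Y n i x) \<and> (\<forall>n. cmod (Y n i x) \<le> C)" for K
  proof -
    have "\<forall>i. \<exists>C. \<forall>x. \<bar>x\<bar> \<le> K \<longrightarrow> cmod (y0 i x) \<le> C" using y0b unfolding locally_bdd_def by blast
    then obtain b where b: "\<And>i x. \<bar>x\<bar> \<le> K \<Longrightarrow> cmod (y0 i x) \<le> b i" by metis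
    define B where "B = max 0 (\<Sum>i<N. b i)"
    have B: "(\<Sum>i<N. cmod (y0 i t)) \<le> B" if "\<bar>t\<bar> \<le> K" for t
      using sum_mono[of "{..<N}" "\<lambda>i. cmod (y0 i t)" b] b[OF that] by (simp add: B_def le_max_iff_disj)
    have B0: "0 \<le> B" by (simp add: B_def)
    have "continuous_on UNIV (\<lambda>t. complex_of_real (s t))" by (intro continuous_intros sc)
    from continuous_locally_bdd[OF this] obtain S where S: "\<And>x. \<bar>x\<bar> \<le> K \<Longrightarrow> \<bar>s x\<bar> \<le> S"
      unfolding locally_bdd_def norm_of_real by blast
    define e where "e n = B * (\<bar>S\<bar> ^ Suc n / fact (Suc n))" for n
    have es: "summable e"
      unfolding e_def[abs_def] using summable_ignore_initial_segment[OF summable_exp[of "\<bar>S\<bar>"], of 1]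
      by (intro summable_mult) (simp add: divide_inverse mult.commute)
    have e0: "0 \<le> e n" for n using B0 by (simp add: e_def)
    have d: "cmod (Y (Suc n) i x - Y n i x) \<le> e n" if x: "\<bar>x\<bar> \<le> K" and i: "i < N" for x i n
    proof -
      have "cmod (Y (Suc n) i x - Y n i x) \<le> (\<Sum>i<N. cmod (Y (Suc n) i x - Y n i x))"
        by (rule member_le_sum[of i "{..<N}" "\<lambda>i. cmod (Y (Suc n) i x - Y n i x)"]) (use i in auto)
      also have "\<dots> \<le> B * \<bar>s x\<bar> ^ Suc n / fact (Suc n)" by (rule bound[OF B B0 x])
      also have "\<dots> \<le> B * \<bar>S\<bar> ^ Suc n / fact (Suc n)"
        using S[OF x] B0 by (intro divide_right_mono mult_left_mono power_mono) auto
      finally show ?thesis by (simp add: e_def)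
    qed
    have Yeq: "Y n i x = y0 i x + (\<Sum>k<n. Y (Suc k) i x - Y k i x)" for n i x
      by (induction n) (auto simp: Y0)
    show ?thesis
    proof (intro exI[of _ "B + suminf e"] allI impI conjI)
      fix x i assume x: "\<bar>x\<bar> \<le> K" and i: "i < N"
      have "summable (\<lambda>n. Y (Suc n) i x - Y n i x)"
        by (rule summable_comparison_test[OF _ es]) (use d[OF x i] in auto)
      then have "convergent (\<lambda>n. \<Sum>k<n. Y (Suc k) i x - Y k i x)" by (simp add: summable_iff_convergent)
      then have "convergent (\<lambda>n. y0 i x + (\<Sum>k<n. Y (Suc k) i x - Y k i x))"
        by (intro convergent_add convergent_const)
      then show "convergent (\<lambda>n. Y n i x)" by (subst Yeq)
      fix n
      have "cmod (Y n i x) \<le> cmod (y0 i x) + cmod (\<Sum>k<n. Y (Suc k) i x - Y k i x)"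
        by (subst Yeq) (rule norm_triangle_ineq)
      also have "cmod (\<Sum>k<n. Y (Suc k) i x - Y k i x) \<le> (\<Sum>k<n. e k)"
        by (rule order_trans[OF norm_sum sum_mono]) (rule d[OF x i])
      also have "\<dots> \<le> suminf e" by (rule sum_le_suminf[OF es]) (use e0 in auto)
      also have "cmod (y0 i x) \<le> (\<Sum>i<N. cmod (y0 i x))"
        by (rule member_le_sum[of i "{..<N}" "\<lambda>i. cmod (y0 i x)"]) (use i in auto)
      also have "\<dots> \<le> B" by (rule B[OF x])
      finally show "cmod (Y n i x) \<le> B + suminf e" by simp
    qed
  qed
  define y where "y i x = (if i < N then lim (\<lambda>n. Y n i x) else 0)" for i x
  have ylim: "(\<lambda>n. Y n i x) \<longlonglongrightarrow> y i x" if "i < N" for i x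
    using local[of "\<bar>x\<bar>"] that by (auto simp: y_def convergent_LIMSEQ_iff)
  have yb: "locally_bdd (y i)" for i
  proof (cases "i < N")
    case True
    show ?thesis unfolding locally_bdd_def
    proof (intro conjI allI)
      show "y i \<in> borel_measurable borel"
        by (rule borel_measurable_LIMSEQ_metric[OF _ ylim[OF True]]) (use Yb in \<open>auto simp: locally_bdd_def\<close>)
      fix K
      obtain C where C: "\<And>x n. \<bar>x\<bar> \<le> K \<Longrightarrow> cmod (Y n i x) \<le> C" using local[of K] True by blast
      have "cmod (y i x) \<le> C" if "\<bar>x\<bar> \<le> K" for x
        by (rule LIMSEQ_le_const2[OF tendsto_norm[OF ylim[OF True]]]) (use C[OF that] in blast)
      then show "\<exists>C. \<forall>x. \<bar>x\<bar> \<le> K \<longrightarrow> cmod (y i x) \<le> C" by blast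
    qed
  next
    case False
    then have "y i = (\<lambda>x. 0)" by (auto simp: y_def)
    then show ?thesis by simp
  qed
  have yeq: "y i x = y0 i x + prim0 (T y i) x" if i: "i < N" for i x
  proof -
    obtain C where C: "\<And>t n j. \<bar>t\<bar> \<le> \<bar>x\<bar> \<Longrightarrow> j < N \<Longrightarrow> cmod (Y n j t) \<le> C" using local[of "\<bar>x\<bar>"] by blast
    have "(\<lambda>n. prim0 (T (Y n) i) x) \<longlonglongrightarrow> prim0 (T y i) x"
    proof (rule prim0_limit[OF Tint[OF Yb] Tint[OF yb]])
      show "loc_int (\<lambda>t. l t * (real N * C))" using l by (auto simp: loc_int_def intro!: set_integrable_mult_left)
      show "(\<lambda>n. T (Y n) i t) \<longlonglongrightarrow> T y i t" for t
        unfolding T_def by (intro tendsto_sum tendsto_mult tendsto_const ylim) auto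
      show "cmod (T (Y n) i t) \<le> l t * (real N * C)" if "\<bar>t\<bar> \<le> \<bar>x\<bar>" for n t
        using order_trans[OF TD[OF i] mult_left_mono[OF _ l0]] sum_bounded_above[of "{..<N}" "\<lambda>j. cmod (Y n j t)" C] C[OF that]
        by simp
    qed
    then have "(\<lambda>n. Y (Suc n) i x) \<longlonglongrightarrow> y0 i x + prim0 (T y i) x"
      unfolding YS by (intro tendsto_add tendsto_const)
    then show ?thesis using LIMSEQ_unique[OF LIMSEQ_Suc[OF ylim[OF i]]] by blast
  qed
  show ?thesis
  proof (intro exI[of _ y] allI impI conjI)
    fix i assume i: "i < N"
    show "y i 0 = c i" using yeq[OF i, of 0] by (simp add: y0_def)
    have "prim_on UNIV (\<lambda>x. c i + prim0 (F i) x + prim0 (T y i) x) (\<lambda>t. 0 + F i t + T y i t)"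
      by (intro prim_on_add prim_on_const prim0_prim_on F Tint yb)
    then show "prim_on UNIV (y i) (\<lambda>t. (\<Sum>j<N. A i j t * y j t) + F i t)"
      by (rule prim_on_cong) (use yeq[OF i] in \<open>auto simp: y0_def T_def\<close>)
  qed
qed

section \<open>Energy estimates and solvability on the whole line\<close>

lemma prim_on_integral_le:
  fixes F d k :: "real \<Rightarrow> real"
  assumes p: "prim_on S F d" and xy: "x \<le> y" "{x..y} \<subseteq> S"
    and k: "set_integrable lborel {x<..y} k" and le: "\<And>t. t \<in> {x<..y} \<Longrightarrow> k t \<le> d t"
  shows "(LINT t:{x<..y}|lborel. k t) \<le> F y - F x"
  unfolding prim_onD(2)[OF p xy]
  by (rule set_integral_mono[OF k prim_onD(1)[OF p xy] le])

lemma continuous_bounded_Icc: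
  assumes "continuous_on UNIV (g :: real \<Rightarrow> 'a::real_normed_vector)"
  shows "\<exists>C\<ge>0. \<forall>t\<in>{x..y}. norm (g t) \<le> C"
proof -
  have "bounded (g ` {x..y})"
    by (rule compact_imp_bounded[OF compact_continuous_image[OF continuous_on_subset[OF assms]]]) auto
  then obtain b where "b > 0" "\<forall>x\<in>g ` {x..y}. norm x \<le> b" unfolding bounded_pos by blast
  then show ?thesis by (intro exI[of _ b]) auto
qed

lemma bounded_measurable_set_integrable:
  fixes g :: "real \<Rightarrow> 'a::{banach,second_countable_topology}"
  assumes "g \<in> borel_measurable borel" "\<And>t. t \<in> {x..y} \<Longrightarrow> norm (g t) \<le> C"
  shows "set_integrable lborel {x<..y} g"
  unfolding set_integrable_def
proof (rule integrableI_bounded_set_indicator[where B = C])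
  show "emeasure lborel {x<..y} < \<infinity>" by (cases "x \<le> y") auto
qed (use assms in auto)

lemma continuous_integral_zero:
  fixes g :: "real \<Rightarrow> real"
  assumes c: "continuous_on UNIV g" and nn: "\<And>t. 0 \<le> g t" and i: "(LINT t:{x<..y}|lborel. g t) \<le> 0"
    and s: "x \<le> s" "s < y"
  shows "g s = 0"
proof -
  obtain C where "\<And>t. t \<in> {x..y} \<Longrightarrow> norm (g t) \<le> C" using continuous_bounded_Icc[OF c] by blast
  then have int: "set_integrable lborel {x<..y} g"
    by (intro bounded_measurable_set_integrable borel_measurable_continuous_onI c)
  have "0 \<le> (LINT t:{x<..y}|lborel. g t)"
    unfolding set_lebesgue_integral_def using nn by (intro Bochner_Integration.integral_nonneg) auto
  then have "(LINT t:{x<..y}|lborel. g t) = 0" using i by simp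
  then have "AE t in lborel. indicator {x<..y} t *\<^sub>R g t = 0"
    unfolding set_lebesgue_integral_def
    by (subst (asm) integral_nonneg_eq_0_iff_AE) (use int nn in \<open>auto simp: set_integrable_def\<close>)
  then have ae: "AE t in lborel. s < t \<and> t < y \<longrightarrow> g t = 0"
    by eventually_elim (use s in \<open>auto simp: indicator_def\<close>)
  show "g s = 0"
  proof (rule ccontr)
    assume "g s \<noteq> 0"
    then have pos: "0 < g s" using nn[of s] by simp
    have "(g \<longlongrightarrow> g s) (at s)" using c by (simp add: continuous_on_eq_continuous_at isCont_def)
    from order_tendstoD(1)[OF this pos] obtain d where d: "0 < d" "\<And>z. z \<noteq> s \<Longrightarrow> dist z s < d \<Longrightarrow> 0 < g z"
      unfolding eventually_at by blast
    obtain z where "s < z" "z < min (s + d) y" "s < z \<and> z < y \<longrightarrow> g z = 0"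
      using AE_lborel_Ioo[OF ae, of s "min (s + d) y"] d(1) s(2) by auto
    then show False using d(2)[of z] by (auto simp: dist_real_def)
  qed
qed

lemma in_L2_integrable: "in_L2 f \<Longrightarrow> integrable lborel (\<lambda>t. (cmod (f t))\<^sup>2)"
  and in_L2_measurable: "in_L2 f \<Longrightarrow> f \<in> borel_measurable borel"
  by (auto simp: in_L2_def)

lemma Young_ineq:
  fixes x y \<eta> :: real assumes "0 < \<eta>"
  shows "x * y \<le> \<eta> / 2 * y\<^sup>2 + x\<^sup>2 / (2 * \<eta>)"
proof -
  have "0 \<le> (\<eta> * y - x)\<^sup>2 / (2 * \<eta>)" using assms by simp
  then show ?thesis using assms by (simp add: field_simps power2_eq_square)
qed

lemma in_L2_mult_integrable:
  assumes "in_L2 f" "in_L2 g" shows "integrable lborel (\<lambda>t. cmod (f t) * cmod (g t))"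
proof (rule Bochner_Integration.integrable_bound)
  show "integrable lborel (\<lambda>t. (cmod (f t))\<^sup>2 + (cmod (g t))\<^sup>2)"
    using assms by (intro Bochner_Integration.integrable_add in_L2_integrable)
  show "AE t in lborel. norm (cmod (f t) * cmod (g t)) \<le> norm ((cmod (f t))\<^sup>2 + (cmod (g t))\<^sup>2)"
  proof (intro always_eventually allI)
    fix t
    have "cmod (f t) * cmod (g t) \<le> (cmod (f t))\<^sup>2 + (cmod (g t))\<^sup>2"
      using Young_ineq[of 1 "cmod (f t)" "cmod (g t)"] by (simp add: field_simps) (smt (verit) zero_le_power2)
    then show "norm (cmod (f t) * cmod (g t)) \<le> norm ((cmod (f t))\<^sup>2 + (cmod (g t))\<^sup>2)" by simp
  qed
qed (use assms in \<open>auto simp: in_L2_def\<close>)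

lemma LINT_subset_le:
  fixes k :: "real \<Rightarrow> real"
  assumes "integrable lborel k" "\<And>t. 0 \<le> k t" "A \<in> sets borel"
  shows "(LINT t:A|lborel. k t) \<le> (LINT t|lborel. k t)" "set_integrable lborel A k"
proof -
  show i: "set_integrable lborel A k"
    unfolding set_integrable_def using integrable_mult_indicator[of A lborel k] assms by simp
  show "(LINT t:A|lborel. k t) \<le> (LINT t|lborel. k t)"
    unfolding set_lebesgue_integral_def using i assms
    by (intro integral_mono) (auto simp: set_integrable_def indicator_def)
qed

lemma LINT_Ioc_bounded_integrable:
  fixes k :: "real \<Rightarrow> real"
  assumes m: "k \<in> borel_measurable borel" and nn: "\<And>t. 0 \<le> k t"
    and i: "\<And>n::nat. set_integrable lborel {- real n<..real n} k" and le: "\<And>n::nat. (LINT t:{- real n<..real n}|lborel. k t) \<le> C"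
  shows "integrable lborel k" "(LINT t|lborel. k t) \<le> C"
proof -
  let ?f = "\<lambda>n t. indicator {- real n<..real n} t *\<^sub>R k t"
  have mono: "mono (\<lambda>n. LINT t|lborel. ?f n t)"
    using i nn by (intro monoI integral_mono) (auto simp: set_integrable_def indicator_def)
  have "convergent (\<lambda>n. LINT t|lborel. ?f n t)"
  proof (rule Bseq_mono_convergent)
    show "Bseq (\<lambda>n. LINT t|lborel. ?f n t)"
    proof (rule BseqI'[of _ "C"])
      fix n
      have "0 \<le> (LINT t|lborel. ?f n t)" using nn by (intro Bochner_Integration.integral_nonneg) auto
      then show "norm (LINT t|lborel. ?f n t) \<le> C" using le[of n] by (simp add: set_lebesgue_integral_def)
    qed
  qed (use mono in \<open>auto simp: mono_def\<close>)
  then obtain l where l: "(\<lambda>n. LINT t|lborel. ?f n t) \<longlonglongrightarrow> l" by (auto simp: convergent_def)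
  have mc: "has_bochner_integral lborel k l"
  proof (rule has_bochner_integral_monotone_convergence)
    show "integrable lborel (?f n)" for n using i by (simp add: set_integrable_def)
    show "AE t in lborel. mono (\<lambda>n. ?f n t)" using nn by (auto intro!: always_eventually monoI simp: indicator_def)
    show "AE t in lborel. (\<lambda>n. ?f n t) \<longlonglongrightarrow> k t"
    proof (intro always_eventually allI)
      fix t
      obtain N :: nat where N: "\<bar>t\<bar> < real N" using reals_Archimedean2 by blast
      show "(\<lambda>n. ?f n t) \<longlonglongrightarrow> k t"
        using N by (intro tendsto_eventually eventually_sequentiallyI[of N]) (auto simp: indicator_def)
    qed
  qed (use l m in auto)
  then show "integrable lborel k" by (auto simp: has_bochner_integral_iff)
  have "l \<le> C" by (rule LIMSEQ_le_const2[OF l]) (use le in \<open>auto simp: set_lebesgue_integral_def\<close>)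
  then show "(LINT t|lborel. k t) \<le> C" using mc by (simp add: has_bochner_integral_iff)
qed

text \<open>The substitute for decay at infinity: a nonnegative integrable function need not tend to
  0, but boundary terms can be evaluated at far points where it is small.\<close>

lemma integrable_small_values:
  fixes k :: "real \<Rightarrow> real"
  assumes i: "integrable lborel k" and nn: "\<And>t. 0 \<le> k t" and e: "0 < e"
  shows "\<exists>x>X. k x < e" "\<exists>x<X. k x < e"
proof -
  \<comment> \<open>Were \<open>k\<close> at least \<open>e\<close> on an interval of length
    \<open>C\<close>, its integral would be at least \<open>e * C\<close>, which exceeds the total
    integral by \<open>e\<close>.\<close>
  define C where "C = (LINT t|lborel. k t) / e + 1"
  have C0: "0 \<le> C" using nn e by (auto simp: C_def intro!: add_nonneg_nonneg divide_nonneg_pos Bochner_Integration.integral_nonneg)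
  have *: False if ge: "\<And>x. x \<in> {u<..<u + C} \<Longrightarrow> e \<le> k x" for u
  proof -
    have "(LINT t|lborel. e * indicator {u<..<u + C} t) \<le> (LINT t|lborel. k t)"
    proof (rule integral_mono[OF _ i])
      show "integrable lborel (\<lambda>t. e * indicator {u<..<u + C} t)"
        by (intro integrable_mult_right integrable_real_indicator) (use C0 in auto)
    qed (use ge nn in \<open>auto simp: indicator_def\<close>)
    moreover have "(LINT t|lborel. e * indicator {u<..<u + C} t) = e * C" using C0 by simp
    moreover have "e * C = (LINT t|lborel. k t) + e" using e by (simp add: C_def distrib_left)
    ultimately show False using e by simp
  qed
  show "\<exists>x>X. k x < e" using *[of X] by (force simp: not_less)
  show "\<exists>x<X. k x < e" using *[of "X - C"] by (force simp: not_less)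
qed

text \<open>A Sobolev inequality: on an interval of length at least 1 the minimum is at most the
  integral \<open>K0\<close>, and the oscillation is at most the integral \<open>K1\<close> of the
  majorant of the derivative.\<close>

lemma prim_on_sup_le:
  fixes H h k :: "real \<Rightarrow> real"
  assumes p: "prim_on UNIV H h" and xy: "x + 1 \<le> y" and nn: "\<And>t. 0 \<le> H t"
    and k: "set_integrable lborel {x<..y} k" and le: "\<And>t. t \<in> {x<..y} \<Longrightarrow> \<bar>h t\<bar> \<le> k t"
    and K0: "(LINT t:{x<..y}|lborel. H t) \<le> K0" and K1: "(LINT t:{x<..y}|lborel. k t) \<le> K1" and s: "s \<in> {x..y}"
  shows "H s \<le> K0 + K1"
proof (rule ccontr)
  assume c: "\<not> H s \<le> K0 + K1"
  have knn: "0 \<le> k t" if "t \<in> {x<..y}" for t using le[OF that] by linarith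
  have osc: "H s - K1 \<le> H t" if t: "t \<in> {x<..y}" for t
  proof -
    define u v where "u = min s t" and "v = max s t"
    have uv: "u \<le> v" "{u<..v} \<subseteq> {x<..y}" using s t by (auto simp: u_def v_def)
    have "\<bar>H v - H u\<bar> = \<bar>LINT r:{u<..v}|lborel. h r\<bar>" using prim_onD(2)[OF p uv(1)] by simp
    also have "\<dots> \<le> (LINT r:{u<..v}|lborel. k r)"
    proof -
      have "norm (LINT r:{u<..v}|lborel. h r) \<le> (LINT r:{u<..v}|lborel. k r)"
      proof (rule LINT_norm_le)
        show "set_integrable lborel {u<..v} k" by (rule set_integrable_subset[OF k _ uv(2)]) simp
        show "norm (h r) \<le> k r" if "r \<in> {u<..v}" for r using le[of r] that uv(2) by auto
      qed (use prim_onD(1)[OF p uv(1)] in simp)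
      then show ?thesis by simp
    qed
    also have "\<dots> \<le> (LINT r:{x<..y}|lborel. k r)"
      using k set_integrable_subset[OF k _ uv(2)] knn uv(2) unfolding set_lebesgue_integral_def set_integrable_def
      by (intro integral_mono) (auto simp: indicator_def subset_iff)
    finally have "\<bar>H v - H u\<bar> \<le> K1" using K1 by simp
    then show ?thesis by (auto simp: u_def v_def min_def max_def split: if_splits)
  qed
  have "continuous_on UNIV H" by (rule prim_on_UNIV_continuous[OF p])
  then obtain C where "\<And>t. t \<in> {x..y} \<Longrightarrow> norm (H t) \<le> C" using continuous_bounded_Icc by blast
  then have iH: "set_integrable lborel {x<..y} H"
    by (intro bounded_measurable_set_integrable borel_measurable_continuous_onI \<open>continuous_on UNIV H\<close>)
  have ic: "set_integrable lborel {x<..y} (\<lambda>t. H s - K1)"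
    by (rule bounded_measurable_set_integrable[of _ _ _ "norm (H s - K1)"]) auto
  have "(LINT t:{x<..y}|lborel. H s - K1) \<le> (LINT t:{x<..y}|lborel. H t)"
    by (rule set_integral_mono[OF ic iH osc])
  moreover have "(LINT t:{x<..y}|lborel. H s - K1) = (y - x) * (H s - K1)"
    using xy by (simp add: set_lebesgue_integral_def mult.commute)
  moreover have "0 \<le> (LINT t:{x<..y}|lborel. H t)"
    unfolding set_lebesgue_integral_def using nn by (intro Bochner_Integration.integral_nonneg) auto
  then have K0nn: "0 \<le> K0" using K0 by linarith
  then have "1 * (H s - K1) \<le> (y - x) * (H s - K1)" using xy c by (intro mult_right_mono) auto
  ultimately show False using K0 c by simp
qed

text \<open>The first order system on its own, with \<open>p\<close> of arbitrary sign and
  coefficients that are only measurable and bounded, apart from the locally integrable phase.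
  Constants obtained here may depend on every bound and serve qualitative purposes. The exception is
  \<open>sol_L2_estimate\<close>, which feeds the uniform bound and contains only \<open>r0\<close>
  and \<open>r1\<close>.\<close>

locale line_system =
  fixes a \<kappa> p r W :: "real \<Rightarrow> real" and \<epsilon> a0 a1 r0 r1 p1 W1 :: real
  assumes measurable_coeffs [measurable]: "a \<in> borel_measurable borel" "p \<in> borel_measurable borel"
      "r \<in> borel_measurable borel" "W \<in> borel_measurable borel"
    and loc_int_phase: "loc_int \<kappa>"
    and a_bounds: "0 < a0" "\<And>t. a0 \<le> a t" "\<And>t. a t \<le> a1"
    and r_bounds: "0 < r0" "\<And>t. r0 \<le> r t" "\<And>t. r t \<le> r1"
    and p_bound: "\<And>t. \<bar>p t\<bar> \<le> p1"
    and W_bound: "\<And>t. \<bar>W t\<bar> \<le> W1"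
    and eps_nonzero: "\<epsilon> \<noteq> 0"
begin

definition flux :: "(real \<Rightarrow> complex) \<Rightarrow> (real \<Rightarrow> complex) \<Rightarrow> real \<Rightarrow> complex" where
  "flux u Q t = Q t + of_real (W t) * u t"

text \<open>Formally, with \<open>G = flux u Q\<close>, the second equation says \<open>G' = - \<i>
  * \<kappa> * G - (p + \<i> * \<epsilon> * r) * u - r * f + W' * u\<close>. The term
  \<open>a * W * flux u Q\<close> cancels the part \<open>W * u'\<close> of the derivative of
  \<open>W * u\<close>, so the singular \<open>W' * u\<close> is hidden in the unknown
  \<open>Q\<close>.\<close>

definition sol :: "(real \<Rightarrow> complex) \<Rightarrow> (real \<Rightarrow> complex) \<Rightarrow> (real \<Rightarrow> complex) \<Rightarrow> bool" where
  "sol f u Q \<longleftrightarrow>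
     prim_on UNIV u (\<lambda>t. a t * flux u Q t - \<i> * \<kappa> t * u t) \<and>
     prim_on UNIV Q (\<lambda>t. - \<i> * \<kappa> t * Q t - (p t + \<i> * \<epsilon> * r t) * u t - of_real (r t) * f t - a t * W t * flux u Q t)"

lemma sol_continuous: "sol f u Q \<Longrightarrow> continuous_on UNIV u" "sol f u Q \<Longrightarrow> continuous_on UNIV Q"
  unfolding sol_def by (blast intro: prim_on_UNIV_continuous)+

lemma sol_measurable [measurable_dest]: 
  "sol f u Q \<Longrightarrow> u \<in> borel_measurable borel" "sol f u Q \<Longrightarrow> Q \<in> borel_measurable borel"
  by (blast intro: borel_measurable_continuous_onI sol_continuous)+

lemma flux_measurable [measurable]:
  "u \<in> borel_measurable borel \<Longrightarrow> Q \<in> borel_measurable borel \<Longrightarrow> flux u Q \<in> borel_measurable borel"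
proof -
  assume [measurable]: "u \<in> borel_measurable borel" "Q \<in> borel_measurable borel"
  have [measurable]: "(\<lambda>t. complex_of_real (W t)) \<in> borel_measurable borel"
    by (rule measurable_compose[OF measurable_coeffs(4)]) (intro borel_measurable_continuous_onI continuous_intros)
  show ?thesis unfolding flux_def[abs_def] by measurable
qed

lemma a1_pos: "0 < a1" and r1_pos: "0 < r1" and p1_nonneg: "0 \<le> p1" and W1_nonneg: "0 \<le> W1"
  using a_bounds(1) a_bounds(2,3)[of 0] r_bounds(1) r_bounds(2,3)[of 0] p_bound[of 0] W_bound[of 0] by linarith+

text \<open>The phase terms cancel because \<open>\<kappa>\<close> is real. The function
  \<open>W\<close> enters through a real summand only, so the imaginary part of the identity is free
  of it.\<close>

lemma sol_energy:
  assumes "sol f u Q"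
  shows "prim_on UNIV (\<lambda>t. Q t * cnj (u t))
    (\<lambda>t. of_real (a t * (cmod (flux u Q t))\<^sup>2 - 2 * a t * W t * Re (flux u Q t * cnj (u t)) - p t * (cmod (u t))\<^sup>2)
       - \<i> * of_real (\<epsilon> * r t * (cmod (u t))\<^sup>2) - of_real (r t) * (f t * cnj (u t)))"
proof -
  have u: "prim_on UNIV u (\<lambda>t. a t * flux u Q t - \<i> * \<kappa> t * u t)"
    and Q: "prim_on UNIV Q (\<lambda>t. - \<i> * \<kappa> t * Q t - (p t + \<i> * \<epsilon> * r t) * u t - of_real (r t) * f t - a t * W t * flux u Q t)"
    using assms by (auto simp: sol_def)
  show ?thesis
  proof (rule prim_on_cong[OF prim_on_mult[OF Q prim_on_bounded_linear[OF bounded_linear_cnj u]]])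
    fix t
    have Q: "Q t = flux u Q t - of_real (W t) * u t" by (simp add: flux_def)
    show "(- \<i> * \<kappa> t * Q t - (p t + \<i> * \<epsilon> * r t) * u t - of_real (r t) * f t - a t * W t * flux u Q t) * cnj (u t)
        + Q t * cnj (a t * flux u Q t - \<i> * \<kappa> t * u t)
      = of_real (a t * (cmod (flux u Q t))\<^sup>2 - 2 * a t * W t * Re (flux u Q t * cnj (u t)) - p t * (cmod (u t))\<^sup>2)
         - \<i> * of_real (\<epsilon> * r t * (cmod (u t))\<^sup>2) - of_real (r t) * (f t * cnj (u t))"
      unfolding cmod_power2 using Q by (simp add: complex_eq_iff power2_eq_square) (simp add: algebra_simps)
  qed simp
qed

lemma sol_density_u:
  assumes "sol f u Q"
  shows "prim_on UNIV (\<lambda>t. (cmod (u t))\<^sup>2) (\<lambda>t. 2 * a t * Re (flux u Q t * cnj (u t)))"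
proof -
  have u: "prim_on UNIV u (\<lambda>t. a t * flux u Q t - \<i> * \<kappa> t * u t)" using assms by (simp add: sol_def)
  note p = prim_on_bounded_linear[OF bounded_linear_Re prim_on_mult[OF u prim_on_bounded_linear[OF bounded_linear_cnj u]]]
  show ?thesis
    by (rule prim_on_cong[OF p]) (simp_all add: cmod_power2, simp_all add: power2_eq_square algebra_simps)
qed

lemma sol_density_Q:
  assumes "sol f u Q"
  shows "prim_on UNIV (\<lambda>t. (cmod (Q t))\<^sup>2)
    (\<lambda>t. 2 * Re ((- (p t + \<i> * \<epsilon> * r t) * u t - of_real (r t) * f t - a t * W t * flux u Q t) * cnj (Q t)))"
proof -
  have Q: "prim_on UNIV Q (\<lambda>t. - \<i> * \<kappa> t * Q t - (p t + \<i> * \<epsilon> * r t) * u t - of_real (r t) * f t - a t * W t * flux u Q t)"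
    using assms by (simp add: sol_def)
  note p = prim_on_bounded_linear[OF bounded_linear_Re prim_on_mult[OF Q prim_on_bounded_linear[OF bounded_linear_cnj Q]]]
  show ?thesis
    by (rule prim_on_cong[OF p]) (simp_all add: cmod_power2, simp_all add: power2_eq_square algebra_simps)
qed

lemma sol_integrable:
  assumes s: "sol f u Q" and f: "loc_int f"
  shows "set_integrable lborel {x<..y} (\<lambda>t. (cmod (u t))\<^sup>2)"
    "set_integrable lborel {x<..y} (\<lambda>t. (cmod (Q t))\<^sup>2)"
    "set_integrable lborel {x<..y} (\<lambda>t. (cmod (flux u Q t))\<^sup>2)"
    "set_integrable lborel {x<..y} (\<lambda>t. cmod (f t) * cmod (u t))"
    "set_integrable lborel {x<..y} (\<lambda>t. cmod (f t) * cmod (Q t))"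
proof -
  note c = sol_continuous[OF s] and [measurable] = sol_measurable[OF s]
  obtain C where C: "0 \<le> C" "\<And>t. t \<in> {x..y} \<Longrightarrow> cmod (u t) \<le> C" using continuous_bounded_Icc[OF c(1)] by blast
  obtain D where D: "0 \<le> D" "\<And>t. t \<in> {x..y} \<Longrightarrow> cmod (Q t) \<le> D" using continuous_bounded_Icc[OF c(2)] by blast
  have G: "cmod (flux u Q t) \<le> D + W1 * C" if "t \<in> {x..y}" for t
    unfolding flux_def using C D(2)[OF that] C(2)[OF that] W_bound[of t]
    by (intro norm_triangle_mono) (auto simp: norm_mult intro!: mult_mono)
  show "set_integrable lborel {x<..y} (\<lambda>t. (cmod (u t))\<^sup>2)"
    by (rule bounded_measurable_set_integrable[of _ _ _ "C\<^sup>2"]) (use C in \<open>auto intro: power_mono\<close>)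
  show "set_integrable lborel {x<..y} (\<lambda>t. (cmod (Q t))\<^sup>2)"
    by (rule bounded_measurable_set_integrable[of _ _ _ "D\<^sup>2"]) (use D in \<open>auto intro: power_mono\<close>)
  show "set_integrable lborel {x<..y} (\<lambda>t. (cmod (flux u Q t))\<^sup>2)"
    by (rule bounded_measurable_set_integrable[of _ _ _ "(D + W1 * C)\<^sup>2"]) (use G in \<open>auto intro: power_mono\<close>)
  show "set_integrable lborel {x<..y} (\<lambda>t. cmod (f t) * cmod (u t))"
    using loc_int_cmod[OF loc_int_mult_bdd[OF f continuous_locally_bdd[OF c(1)]]] by (simp add: loc_int_def norm_mult)
  show "set_integrable lborel {x<..y} (\<lambda>t. cmod (f t) * cmod (Q t))"
    using loc_int_cmod[OF loc_int_mult_bdd[OF f continuous_locally_bdd[OF c(2)]]] by (simp add: loc_int_def norm_mult)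
qed

lemma Im_estimate:
  assumes s: "sol f u Q" and f: "loc_int f" and xy: "x \<le> y"
  shows "\<bar>\<epsilon>\<bar> * r0 * (LINT t:{x<..y}|lborel. (cmod (u t))\<^sup>2) \<le> r1 * (LINT t:{x<..y}|lborel. cmod (f t) * cmod (u t))
     + \<bar>Im (Q x * cnj (u x))\<bar> + \<bar>Im (Q y * cnj (u y))\<bar>"
proof -
  \<comment> \<open>The sign makes the contribution of \<open>\<epsilon>\<close> nonnegative,
    whichever half plane the spectral parameter lies in.\<close>
  define \<sigma> where "\<sigma> = - sgn \<epsilon>"
  have bl: "bounded_linear (\<lambda>z. \<sigma> * Im z)" by (intro bounded_linear_const_mult bounded_linear_Im)
  note p = prim_on_bounded_linear[OF bl sol_energy[OF s]]
  note i = sol_integrable[OF s f, of x y]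
  have i': "set_integrable lborel {x<..y} (\<lambda>t. \<bar>\<epsilon>\<bar> * r0 * (cmod (u t))\<^sup>2 - r1 * (cmod (f t) * cmod (u t)))"
    using i by (intro set_integral_diff) auto
  have "(LINT t:{x<..y}|lborel. \<bar>\<epsilon>\<bar> * r0 * (cmod (u t))\<^sup>2 - r1 * (cmod (f t) * cmod (u t)))
      \<le> \<sigma> * Im (Q y * cnj (u y)) - \<sigma> * Im (Q x * cnj (u x))"
  proof (rule prim_on_integral_le[OF p xy _ i'])
    fix t
    have "\<bar>\<epsilon>\<bar> * r0 * (cmod (u t))\<^sup>2 \<le> \<bar>\<epsilon>\<bar> * r t * (cmod (u t))\<^sup>2"
      using r_bounds by (intro mult_right_mono mult_left_mono) auto
    moreover have "\<sigma> * (- (\<epsilon> * r t * (cmod (u t))\<^sup>2)) = \<bar>\<epsilon>\<bar> * r t * (cmod (u t))\<^sup>2"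
      by (simp add: \<sigma>_def sgn_if)
    moreover have "\<sigma> * (r t * Im (f t * cnj (u t))) \<le> r1 * (cmod (f t) * cmod (u t))"
    proof -
      have "\<sigma> * (r t * Im (f t * cnj (u t))) \<le> \<bar>\<sigma> * (r t * Im (f t * cnj (u t)))\<bar>" by simp
      also have "\<dots> \<le> 1 * (r1 * cmod (f t * cnj (u t)))"
        unfolding abs_mult using r_bounds(2,3)[of t] r_bounds(1) abs_Im_le_cmod[of "f t * cnj (u t)"]
        by (intro mult_mono) (auto simp: \<sigma>_def sgn_if)
      finally show ?thesis by (simp add: norm_mult)
    qed
    ultimately show "\<bar>\<epsilon>\<bar> * r0 * (cmod (u t))\<^sup>2 - r1 * (cmod (f t) * cmod (u t)) \<le> \<sigma> * Im (
        of_real (a t * (cmod (flux u Q t))\<^sup>2 - 2 * a t * W t * Re (flux u Q t * cnj (u t)) - p t * (cmod (u t))\<^sup>2)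
       - \<i> * of_real (\<epsilon> * r t * (cmod (u t))\<^sup>2) - of_real (r t) * (f t * cnj (u t)))"
      by (simp add: right_diff_distrib)
  qed simp
  also have "\<dots> \<le> \<bar>Im (Q x * cnj (u x))\<bar> + \<bar>Im (Q y * cnj (u y))\<bar>"
  proof -
    have "\<sigma> * b - \<sigma> * c \<le> \<bar>c\<bar> + \<bar>b\<bar>" for b c by (auto simp: \<sigma>_def sgn_if)
    then show ?thesis .
  qed
  finally show ?thesis using i by (simp add: set_integral_diff)
qed

text \<open>The real part controls the flux by \<open>u\<close>. The indefinite term containing
  \<open>W\<close> is absorbed at the price of half of the flux term.\<close>

lemma Re_estimate:
  assumes s: "sol f u Q" and f: "loc_int f" and xy: "x \<le> y"
  shows "a0 / 2 * (LINT t:{x<..y}|lborel. (cmod (flux u Q t))\<^sup>2)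
     \<le> (2 * a1 * W1\<^sup>2 + p1) * (LINT t:{x<..y}|lborel. (cmod (u t))\<^sup>2)
       + r1 * (LINT t:{x<..y}|lborel. cmod (f t) * cmod (u t))
       + cmod (Q x) * cmod (u x) + cmod (Q y) * cmod (u y)"
proof -
  note p = prim_on_bounded_linear[OF bounded_linear_Re sol_energy[OF s]]
  note i = sol_integrable[OF s f, of x y]
  define k where "k t = a0 / 2 * (cmod (flux u Q t))\<^sup>2 - (2 * a1 * W1\<^sup>2 + p1) * (cmod (u t))\<^sup>2 - r1 * (cmod (f t) * cmod (u t))" for t
  have i': "set_integrable lborel {x<..y} k"
    unfolding k_def using i by (intro set_integral_diff) auto
  have "(LINT t:{x<..y}|lborel. k t) \<le> Re (Q y * cnj (u y)) - Re (Q x * cnj (u x))"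
  proof (rule prim_on_integral_le[OF p xy _ i'])
    fix t
    let ?G = "flux u Q t"
    have "\<bar>Re (?G * cnj (u t))\<bar> \<le> cmod ?G * cmod (u t)" using abs_Re_le_cmod[of "?G * cnj (u t)"] by (simp add: norm_mult)
    then have "2 * a t * W t * Re (?G * cnj (u t)) \<le> 2 * a t * (W1 * (cmod ?G * cmod (u t)))"
    proof -
      have "W t * Re (?G * cnj (u t)) \<le> \<bar>W t * Re (?G * cnj (u t))\<bar>" by simp
      also have "\<dots> \<le> W1 * (cmod ?G * cmod (u t))"
        unfolding abs_mult using W_bound[of t] \<open>\<bar>Re _\<bar> \<le> _\<close> W1_nonneg by (intro mult_mono) auto
      finally have "(2 * a t) * (W t * Re (?G * cnj (u t))) \<le> (2 * a t) * (W1 * (cmod ?G * cmod (u t)))"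
        using a_bounds(1) a_bounds(2)[of t] by (intro mult_left_mono) auto
      then show ?thesis by (simp add: mult.assoc)
    qed
    also have "\<dots> \<le> 2 * a t * (cmod ?G ^ 2 / 4 + W1\<^sup>2 * (cmod (u t))\<^sup>2)"
    proof (rule mult_left_mono)
      \<comment> \<open>Completing this square bounds the cross term. After multiplication by
        \<open>2 * a t\<close> exactly half of \<open>a t * (cmod ?G)\<^sup>2\<close> is left
        over.\<close>
      have "0 \<le> (cmod ?G / 2 - W1 * cmod (u t))\<^sup>2" by simp
      then show "W1 * (cmod ?G * cmod (u t)) \<le> cmod ?G ^ 2 / 4 + W1\<^sup>2 * (cmod (u t))\<^sup>2"
        by (simp add: power2_eq_square field_simps)
    qed (use a_bounds(1) a_bounds(2)[of t] in simp)
    also have "\<dots> = a t / 2 * cmod ?G ^ 2 + 2 * a t * W1\<^sup>2 * (cmod (u t))\<^sup>2" by (simp add: algebra_simps)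
    also have "\<dots> \<le> a t / 2 * cmod ?G ^ 2 + 2 * a1 * W1\<^sup>2 * (cmod (u t))\<^sup>2"
      using a_bounds(3)[of t] by (intro add_left_mono mult_right_mono mult_left_mono) auto
    finally have 1: "2 * a t * W t * Re (?G * cnj (u t)) \<le> a t / 2 * cmod ?G ^ 2 + 2 * a1 * W1\<^sup>2 * (cmod (u t))\<^sup>2" .
    have 2: "a0 / 2 * (cmod ?G)\<^sup>2 \<le> a t / 2 * (cmod ?G)\<^sup>2" using a_bounds(2)[of t] by (intro mult_right_mono) auto
    have 3: "p t * (cmod (u t))\<^sup>2 \<le> p1 * (cmod (u t))\<^sup>2" using p_bound[of t] by (intro mult_right_mono) auto
    have "\<bar>r t * Re (f t * cnj (u t))\<bar> \<le> r1 * cmod (f t * cnj (u t))"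
      unfolding abs_mult using r_bounds(2,3)[of t] r_bounds(1) abs_Re_le_cmod[of "f t * cnj (u t)"] by (intro mult_mono) auto
    then have 4: "r t * Re (f t * cnj (u t)) \<le> r1 * (cmod (f t) * cmod (u t))" by (simp add: norm_mult)
    have "Re (of_real (a t * (cmod ?G)\<^sup>2 - 2 * a t * W t * Re (?G * cnj (u t)) - p t * (cmod (u t))\<^sup>2)
       - \<i> * of_real (\<epsilon> * r t * (cmod (u t))\<^sup>2) - of_real (r t) * (f t * cnj (u t)))
       = (a t * (cmod ?G)\<^sup>2 - 2 * a t * W t * Re (?G * cnj (u t)) - p t * (cmod (u t))\<^sup>2) - r t * Re (f t * cnj (u t))"
      by simp
    then show "k t \<le> Re (of_real (a t * (cmod ?G)\<^sup>2 - 2 * a t * W t * Re (?G * cnj (u t)) - p t * (cmod (u t))\<^sup>2)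
       - \<i> * of_real (\<epsilon> * r t * (cmod (u t))\<^sup>2) - of_real (r t) * (f t * cnj (u t)))"
      unfolding k_def using 1 2 3 4 by (simp add: algebra_simps)
  qed simp
  also have "\<dots> \<le> cmod (Q x) * cmod (u x) + cmod (Q y) * cmod (u y)"
    using abs_Re_le_cmod[of "Q x * cnj (u x)"] abs_Re_le_cmod[of "Q y * cnj (u y)"] by (simp add: norm_mult)
  finally show ?thesis unfolding k_def using i by (simp add: set_integral_diff)
qed

lemma Q_sq_le: "(cmod (Q t))\<^sup>2 \<le> 2 * (cmod (flux u Q t))\<^sup>2 + 2 * W1\<^sup>2 * (cmod (u t))\<^sup>2"
proof -
  have "cmod (Q t) = cmod (flux u Q t - W t * u t)" by (simp add: flux_def)
  also have "\<dots> \<le> cmod (flux u Q t) + \<bar>W t\<bar> * cmod (u t)" using norm_triangle_ineq4[of "flux u Q t" "W t * u t"] by (simp add: norm_mult)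
  also have "\<dots> \<le> cmod (flux u Q t) + W1 * cmod (u t)" using W_bound[of t] by (intro add_left_mono mult_right_mono) auto
  finally have "(cmod (Q t))\<^sup>2 \<le> (cmod (flux u Q t) + W1 * cmod (u t))\<^sup>2" by (intro power_mono) auto
  also have "\<dots> \<le> 2 * (cmod (flux u Q t))\<^sup>2 + 2 * W1\<^sup>2 * (cmod (u t))\<^sup>2"
    using sum_squares_bound[of "cmod (flux u Q t)" "W1 * cmod (u t)"] by (simp add: power2_eq_square algebra_simps)
  finally show ?thesis .
qed

text \<open>\<open>prim_on_sup_le\<close> applied to \<open>|u|^2\<close> and \<open>|Q|^2\<close>,
  whose derivatives are quadratic in \<open>u\<close>, \<open>Q\<close>, the flux and
  \<open>f\<close>. The constant does not depend on the interval, which is what the limit of growing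
  intervals requires.\<close>

lemma sup_estimate:
  "\<exists>K\<ge>0. \<forall>f u Q x y A. sol f u Q \<longrightarrow> in_L2 f \<longrightarrow> x + 1 \<le> y \<longrightarrow>
     (LINT t:{x<..y}|lborel. (cmod (u t))\<^sup>2) \<le> A \<longrightarrow> (LINT t:{x<..y}|lborel. (cmod (flux u Q t))\<^sup>2) \<le> A \<longrightarrow>
     (LINT t|lborel. (cmod (f t))\<^sup>2) \<le> A \<longrightarrow> (\<forall>s\<in>{x..y}. (cmod (u s))\<^sup>2 \<le> K * A \<and> (cmod (Q s))\<^sup>2 \<le> K * A)"
proof -
  define q where "q = p1 + \<bar>\<epsilon>\<bar> * r1 + r1 + a1 * W1"
  define K where "K = 1 + 4 * a1 + (2 + 2 * W1\<^sup>2) + 2 * q * (3 + 3 * (2 + 2 * W1\<^sup>2))"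
  have q0: "0 \<le> q" using p1_nonneg r1_pos a1_pos W1_nonneg by (auto simp: q_def intro!: add_nonneg_nonneg mult_nonneg_nonneg)
  have K0: "0 \<le> K" using q0 a1_pos by (auto simp: K_def intro!: add_nonneg_nonneg mult_nonneg_nonneg)
  show ?thesis
  proof (intro exI[of _ K] conjI K0 allI impI ballI)
    fix f u Q x y A and z :: real
    assume s: "sol f u Q" and f2: "in_L2 f" and xy: "x + 1 \<le> y"
      and Au: "(LINT t:{x<..y}|lborel. (cmod (u t))\<^sup>2) \<le> A" and AG: "(LINT t:{x<..y}|lborel. (cmod (flux u Q t))\<^sup>2) \<le> A"
      and Af: "(LINT t|lborel. (cmod (f t))\<^sup>2) \<le> A" and z: "z \<in> {x..y}"
    note f = in_L2_loc_int[OF f2]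
    note i = sol_integrable[OF s f, of x y]
    have fi: "(LINT t:{x<..y}|lborel. (cmod (f t))\<^sup>2) \<le> (LINT t|lborel. (cmod (f t))\<^sup>2)"
      "set_integrable lborel {x<..y} (\<lambda>t. (cmod (f t))\<^sup>2)"
      by (rule LINT_subset_le[OF in_L2_integrable[OF f2]]; simp)+
    have Af': "(LINT t:{x<..y}|lborel. (cmod (f t))\<^sup>2) \<le> A" using fi(1) Af by linarith
    have "0 \<le> (LINT t:{x<..y}|lborel. (cmod (u t))\<^sup>2)"
      unfolding set_lebesgue_integral_def by (intro Bochner_Integration.integral_nonneg) simp
    then have A0: "0 \<le> A" using Au by linarith
    have AQ: "(LINT t:{x<..y}|lborel. (cmod (Q t))\<^sup>2) \<le> (2 + 2 * W1\<^sup>2) * A"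
    proof -
      have "(LINT t:{x<..y}|lborel. (cmod (Q t))\<^sup>2) \<le> (LINT t:{x<..y}|lborel. 2 * (cmod (flux u Q t))\<^sup>2 + 2 * W1\<^sup>2 * (cmod (u t))\<^sup>2)"
        using i by (intro set_integral_mono Q_sq_le set_integral_add) auto
      also have "\<dots> = 2 * (LINT t:{x<..y}|lborel. (cmod (flux u Q t))\<^sup>2) + 2 * W1\<^sup>2 * (LINT t:{x<..y}|lborel. (cmod (u t))\<^sup>2)"
        using i by (subst set_integral_add) auto
      also have "\<dots> \<le> 2 * A + 2 * W1\<^sup>2 * A" using Au AG by (intro add_mono mult_left_mono) auto
      finally show ?thesis by (simp add: algebra_simps)
    qed
    have prod: "v * w \<le> v\<^sup>2 + w\<^sup>2" if "0 \<le> v" "0 \<le> w" for v w :: real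
      using sum_squares_bound[of v w] mult_nonneg_nonneg[OF that] by (simp add: mult.assoc)
    have "(cmod (u z))\<^sup>2 \<le> A + 2 * a1 * (A + A)"
    proof (rule prim_on_sup_le[OF sol_density_u[OF s] xy _ _ _ Au _ z])
      show "set_integrable lborel {x<..y} (\<lambda>t. 2 * a1 * ((cmod (flux u Q t))\<^sup>2 + (cmod (u t))\<^sup>2))"
        using i by (intro set_integrable_mult_right set_integral_add) auto
      show "(LINT t:{x<..y}|lborel. 2 * a1 * ((cmod (flux u Q t))\<^sup>2 + (cmod (u t))\<^sup>2)) \<le> 2 * a1 * (A + A)"
        using i AG Au a1_pos by (subst set_integral_mult_right, subst set_integral_add) (auto intro!: mult_left_mono add_mono)
      fix t
      have "\<bar>Re (flux u Q t * cnj (u t))\<bar> \<le> (cmod (flux u Q t))\<^sup>2 + (cmod (u t))\<^sup>2"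
        using abs_Re_le_cmod[of "flux u Q t * cnj (u t)"] prod[of "cmod (flux u Q t)" "cmod (u t)"] by (simp add: norm_mult)
      then have "\<bar>2 * a t\<bar> * \<bar>Re (flux u Q t * cnj (u t))\<bar> \<le> 2 * a1 * ((cmod (flux u Q t))\<^sup>2 + (cmod (u t))\<^sup>2)"
        using a_bounds(2,3)[of t] a_bounds(1) by (intro mult_mono) auto
      then show "\<bar>2 * a t * Re (flux u Q t * cnj (u t))\<bar> \<le> 2 * a1 * ((cmod (flux u Q t))\<^sup>2 + (cmod (u t))\<^sup>2)"
        by (simp only: abs_mult)
    qed simp
    also have "\<dots> = (1 + 4 * a1) * A" by (simp add: algebra_simps)
    also have "\<dots> \<le> K * A" using q0 A0 by (intro mult_right_mono) (auto simp: K_def)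
    finally show "(cmod (u z))\<^sup>2 \<le> K * A" .
    define k where "k t = 2 * q * ((cmod (u t))\<^sup>2 + (cmod (f t))\<^sup>2 + (cmod (flux u Q t))\<^sup>2 + 3 * (cmod (Q t))\<^sup>2)" for t
    have i1: "set_integrable lborel {x<..y} (\<lambda>t. (cmod (u t))\<^sup>2 + (cmod (f t))\<^sup>2)"
      using i(1) fi(2) by (rule set_integral_add)
    have i2: "set_integrable lborel {x<..y} (\<lambda>t. (cmod (u t))\<^sup>2 + (cmod (f t))\<^sup>2 + (cmod (flux u Q t))\<^sup>2)"
      by (rule set_integral_add(1)[OF i1 i(3)])
    have i3: "set_integrable lborel {x<..y} (\<lambda>t. 3 * (cmod (Q t))\<^sup>2)" using i by simp
    have "(cmod (Q z))\<^sup>2 \<le> (2 + 2 * W1\<^sup>2) * A + 2 * q * (A + A + A + 3 * ((2 + 2 * W1\<^sup>2) * A))"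
    proof (rule prim_on_sup_le[OF sol_density_Q[OF s] xy _ _ _ AQ _ z])
      show "set_integrable lborel {x<..y} k"
        unfolding k_def by (intro set_integrable_mult_right set_integral_add i2 i3)
      have "(LINT t:{x<..y}|lborel. k t) = 2 * q * ((LINT t:{x<..y}|lborel. (cmod (u t))\<^sup>2) + (LINT t:{x<..y}|lborel. (cmod (f t))\<^sup>2)
          + (LINT t:{x<..y}|lborel. (cmod (flux u Q t))\<^sup>2) + 3 * (LINT t:{x<..y}|lborel. (cmod (Q t))\<^sup>2))"
        unfolding k_def set_integral_mult_right set_integral_add(2)[OF i2 i3] set_integral_add(2)[OF i1 i(3)] set_integral_add(2)[OF i(1) fi(2)] ..
      also have "\<dots> \<le> 2 * q * (A + A + A + 3 * ((2 + 2 * W1\<^sup>2) * A))"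
        using q0 by (intro mult_left_mono add_mono Au Af' AG AQ) auto
      finally show "(LINT t:{x<..y}|lborel. k t) \<le> 2 * q * (A + A + A + 3 * ((2 + 2 * W1\<^sup>2) * A))" .
      fix t
      let ?d = "- (p t + \<i> * \<epsilon> * r t) * u t - of_real (r t) * f t - a t * W t * flux u Q t"
      have "cmod (p t + \<i> * \<epsilon> * r t) \<le> p1 + \<bar>\<epsilon>\<bar> * r1"
        using p_bound[of t] r_bounds(1) r_bounds(2,3)[of t]
        by (intro norm_triangle_mono) (auto simp: norm_mult intro!: mult_left_mono)
      then have 1: "cmod ((p t + \<i> * \<epsilon> * r t) * u t) \<le> q * cmod (u t)"
        unfolding norm_mult using r1_pos a1_pos W1_nonneg
        by (intro mult_right_mono) (auto simp: q_def intro!: add_increasing2 mult_nonneg_nonneg)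
      have 2: "cmod (of_real (r t) * f t) \<le> q * cmod (f t)"
        unfolding norm_mult using r_bounds(1) r_bounds(2,3)[of t] p1_nonneg r1_pos a1_pos W1_nonneg
        by (intro mult_right_mono) (auto simp: q_def intro!: add_nonneg_nonneg order_trans[of "r t" r1])
      have "\<bar>a t\<bar> * \<bar>W t\<bar> \<le> a1 * W1" using a_bounds(1) a_bounds(2,3)[of t] W_bound[of t] by (intro mult_mono) auto
      then have 3: "cmod (a t * W t * flux u Q t) \<le> q * cmod (flux u Q t)"
        unfolding norm_mult norm_of_real using p1_nonneg r1_pos
        by (intro mult_right_mono) (auto simp: q_def abs_mult intro!: add_increasing mult_nonneg_nonneg add_nonneg_nonneg)
      have "cmod ?d \<le> q * cmod (u t) + q * cmod (f t) + q * cmod (flux u Q t)"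
      proof -
        have tri: "cmod (- A * w - B - D) \<le> cmod (A * w) + cmod B + cmod D" for A w B D
          using norm_triangle_ineq4[of "- (A * w) - B" D] norm_triangle_ineq4[of "- (A * w)" B] by simp
        show ?thesis using tri[of "p t + \<i> * \<epsilon> * r t" "u t" "of_real (r t) * f t" "a t * W t * flux u Q t"] 1 2 3 by linarith
      qed
      then have "cmod ?d * cmod (Q t) \<le> (q * cmod (u t) + q * cmod (f t) + q * cmod (flux u Q t)) * cmod (Q t)"
        by (rule mult_right_mono) simp
      also have "\<dots> = q * (cmod (u t) * cmod (Q t) + cmod (f t) * cmod (Q t) + cmod (flux u Q t) * cmod (Q t))"
        by (simp add: algebra_simps)
      also have "\<dots> \<le> q * (((cmod (u t))\<^sup>2 + (cmod (Q t))\<^sup>2) + ((cmod (f t))\<^sup>2 + (cmod (Q t))\<^sup>2) + ((cmod (flux u Q t))\<^sup>2 + (cmod (Q t))\<^sup>2))"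
        using q0 by (intro mult_left_mono add_mono prod) auto
      finally have "2 * (cmod ?d * cmod (Q t)) \<le> k t" by (simp add: k_def algebra_simps)
      moreover have "\<bar>2 * Re (?d * cnj (Q t))\<bar> \<le> 2 * (cmod ?d * cmod (Q t))"
        using abs_Re_le_cmod[of "?d * cnj (Q t)"] by (simp add: norm_mult abs_mult)
      ultimately show "\<bar>2 * Re (?d * cnj (Q t))\<bar> \<le> k t" by linarith
    qed simp
    also have "\<dots> = ((2 + 2 * W1\<^sup>2) + 2 * q * (3 + 3 * (2 + 2 * W1\<^sup>2))) * A" by (simp add: algebra_simps)
    also have "\<dots> \<le> K * A" using a1_pos A0 by (intro mult_right_mono) (auto simp: K_def)
    finally show "(cmod (Q z))\<^sup>2 \<le> K * A" .
  qed
qed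

end

section \<open>Existence of square integrable solutions\<close>

lemma locally_bdd_of_real:
  assumes "g \<in> borel_measurable borel" "\<And>t. \<bar>g t\<bar> \<le> C"
  shows "locally_bdd (\<lambda>t. complex_of_real (g t))"
  unfolding locally_bdd_def
proof (intro conjI allI)
  show "(\<lambda>t. complex_of_real (g t)) \<in> borel_measurable borel"
    by (rule measurable_compose[OF assms(1)]) (intro borel_measurable_continuous_onI continuous_intros)
qed (use assms(2) in auto)

lemma locally_bdd_mult:
  assumes "locally_bdd f" "locally_bdd g" shows "locally_bdd (\<lambda>x. f x * g x)"
  unfolding locally_bdd_def
proof (intro conjI allI)
  show "(\<lambda>x. f x * g x) \<in> borel_measurable borel" using assms by (auto simp: locally_bdd_def)
  fix K
  obtain C D where C: "\<And>x. \<bar>x\<bar> \<le> K \<Longrightarrow> cmod (f x) \<le> C" and D: "\<And>x. \<bar>x\<bar> \<le> K \<Longrightarrow> cmod (g x) \<le> D"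
    using assms unfolding locally_bdd_def by blast
  have "cmod (f x * g x) \<le> C * D" if "\<bar>x\<bar> \<le> K" for x
    unfolding norm_mult using C[OF that] D[OF that] order_trans[OF norm_ge_zero C[OF that]] by (intro mult_mono) auto
  then show "\<exists>C. \<forall>x. \<bar>x\<bar> \<le> K \<longrightarrow> cmod (f x * g x) \<le> C" by blast
qed

context line_system
begin

lemma sol_add_cmult:
  assumes 1: "sol f u Q" and 2: "sol g v P"
  shows "sol (\<lambda>t. f t + c * g t) (\<lambda>t. u t + c * v t) (\<lambda>t. Q t + c * P t)"
proof -
  have fl: "flux (\<lambda>t. u t + c * v t) (\<lambda>t. Q t + c * P t) t = flux u Q t + c * flux v P t" for t
    by (simp add: flux_def algebra_simps)
  show ?thesis
    unfolding sol_def fl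
  proof
    show "prim_on UNIV (\<lambda>t. u t + c * v t) (\<lambda>t. a t * (flux u Q t + c * flux v P t) - \<i> * \<kappa> t * (u t + c * v t))"
      by (rule prim_on_cong[OF prim_on_add[OF conjunct1[OF 1[unfolded sol_def]] prim_on_cmult[OF conjunct1[OF 2[unfolded sol_def]], of c]]])
        (auto simp: algebra_simps)
    show "prim_on UNIV (\<lambda>t. Q t + c * P t) (\<lambda>t. - \<i> * \<kappa> t * (Q t + c * P t) - (p t + \<i> * \<epsilon> * r t) * (u t + c * v t)
        - of_real (r t) * (f t + c * g t) - a t * W t * (flux u Q t + c * flux v P t))"
      by (rule prim_on_cong[OF prim_on_add[OF conjunct2[OF 1[unfolded sol_def]] prim_on_cmult[OF conjunct2[OF 2[unfolded sol_def]], of c]]])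
        (auto simp: algebra_simps)
  qed
qed

lemma coeff_locally_bdd:
  "locally_bdd (\<lambda>t. complex_of_real (a t))" "locally_bdd (\<lambda>t. complex_of_real (p t))"
  "locally_bdd (\<lambda>t. complex_of_real (r t))" "locally_bdd (\<lambda>t. complex_of_real (W t))"
proof -
  have "\<bar>a t\<bar> \<le> a1" "\<bar>r t\<bar> \<le> r1" for t
    using a_bounds(1) a_bounds(2,3)[of t] r_bounds(1) r_bounds(2,3)[of t] by auto
  then show "locally_bdd (\<lambda>t. complex_of_real (a t))" "locally_bdd (\<lambda>t. complex_of_real (p t))"
    "locally_bdd (\<lambda>t. complex_of_real (r t))" "locally_bdd (\<lambda>t. complex_of_real (W t))"
    using p_bound W_bound by (blast intro: locally_bdd_of_real measurable_coeffs)+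
qed

lemma sol_exists:
  assumes f: "loc_int f"
  shows "\<exists>u Q. u 0 = c1 \<and> Q 0 = c2 \<and> sol f u Q"
proof -
  let ?a = "\<lambda>t. complex_of_real (a t)" and ?p = "\<lambda>t. complex_of_real (p t)"
    and ?r = "\<lambda>t. complex_of_real (r t)" and ?W = "\<lambda>t. complex_of_real (W t)" and ?k = "\<lambda>t. complex_of_real (\<kappa> t)"
  define A where "A i j = (if i = 0 then (if j = 0 then (\<lambda>t. ?a t * ?W t + ?k t * (- \<i>)) else ?a)
      else (if j = 0 then (\<lambda>t. (-1) * ?p t + (- (\<i> * \<epsilon>)) * ?r t + (-1) * (?a t * ?W t * ?W t))
        else (\<lambda>t. ?k t * (- \<i>) + (-1) * (?a t * ?W t))))" for i j :: nat
  define F where "F i = (if i = 0 then (\<lambda>t. 0) else (\<lambda>t. f t * ((-1) * ?r t)))" for i :: nat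
  note lb = coeff_locally_bdd locally_bdd_const locally_bdd_mult locally_bdd_add
  have k: "loc_int (\<lambda>t. ?k t * (- \<i>))" by (rule loc_int_mult_bdd[OF loc_int_of_real[OF loc_int_phase]]) simp
  have A: "loc_int (A i j)" for i j
  proof -
    have "loc_int (\<lambda>t. ?a t * ?W t + ?k t * (- \<i>))" "loc_int ?a"
      "loc_int (\<lambda>t. (-1) * ?p t + (- (\<i> * \<epsilon>)) * ?r t + (-1) * (?a t * ?W t * ?W t))"
      "loc_int (\<lambda>t. ?k t * (- \<i>) + (-1) * (?a t * ?W t))"
      by (rule loc_int_add[OF locally_bdd_loc_int[OF lb(6)[OF lb(1,4)]] k], rule locally_bdd_loc_int[OF lb(1)],
          rule locally_bdd_loc_int[OF lb(7)[OF lb(7)[OF lb(6)[OF lb(5,2)] lb(6)[OF lb(5,3)]] lb(6)[OF lb(5) lb(6)[OF lb(6)[OF lb(1,4)] lb(4)]]]],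
          rule loc_int_add[OF k locally_bdd_loc_int[OF lb(6)[OF lb(5) lb(6)[OF lb(1,4)]]]])
    then show ?thesis unfolding A_def by auto
  qed
  have F: "loc_int (F i)" for i
  proof -
    have "loc_int (\<lambda>t. f t * ((-1) * ?r t))" by (rule loc_int_mult_bdd[OF f lb(6)[OF lb(5,3)]])
    then show ?thesis unfolding F_def using loc_int_const[of 0] by auto
  qed
  obtain y where y: "\<And>i. i < 2 \<Longrightarrow> y i 0 = (if i = 0 then c1 else c2)"
    "\<And>i. i < 2 \<Longrightarrow> prim_on UNIV (y i) (\<lambda>t. (\<Sum>j<2. A i j t * y j t) + F i t)"
    using linear_system_exists[of A F 2 "\<lambda>i. if i = 0 then c1 else c2", OF A F] by blast
  show ?thesis
  proof (rule exI[of _ "y 0"], rule exI[of _ "y 1"], intro conjI)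
    show "y 0 0 = c1" "y 1 0 = c2" using y(1)[of 0] y(1)[of 1] by auto
    show "sol f (y 0) (y 1)"
      unfolding sol_def
    proof
      show "prim_on UNIV (y 0) (\<lambda>t. a t * flux (y 0) (y 1) t - \<i> * \<kappa> t * y 0 t)"
        by (rule prim_on_cong[OF y(2)[of 0]]) (auto simp: A_def F_def flux_def numeral_2_eq_2 algebra_simps)
      show "prim_on UNIV (y 1) (\<lambda>t. - \<i> * \<kappa> t * y 1 t - (p t + \<i> * \<epsilon> * r t) * y 0 t - of_real (r t) * f t - a t * W t * flux (y 0) (y 1) t)"
        by (rule prim_on_cong[OF y(2)[of 1]]) (auto simp: A_def F_def flux_def numeral_2_eq_2 algebra_simps)
    qed
  qed
qed

lemma Young_estimate:
  assumes "0 \<le> Nu" "0 \<le> Nf" and 1: "\<bar>\<epsilon>\<bar> * r0 * Nu \<le> r1 * J" and J: "\<And>\<eta>. 0 < \<eta> \<Longrightarrow> J \<le> \<eta> / 2 * Nu + Nf / (2 * \<eta>)"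
  shows "Nu \<le> (r1 / (\<bar>\<epsilon>\<bar> * r0))\<^sup>2 * Nf"
proof -
  define e where "e = \<bar>\<epsilon>\<bar> * r0"
  have e: "0 < e" using eps_nonzero r_bounds(1) by (simp add: e_def)
  \<comment> \<open>Young's inequality with parameter \<open>e / r1\<close>: after multiplication by
    \<open>r1\<close> the first summand is precisely half of the left-hand side
    \<open>e * Nu\<close>.\<close>
  have "J \<le> (e / r1) / 2 * Nu + Nf / (2 * (e / r1))" using e r1_pos by (intro J) simp
  then have "r1 * J \<le> r1 * ((e / r1) / 2 * Nu + Nf / (2 * (e / r1)))" using r1_pos by (intro mult_left_mono) auto
  also have "\<dots> = (e * Nu) / 2 + r1\<^sup>2 * Nf / (2 * e)" using r1_pos e by (simp add: field_simps power2_eq_square)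
  finally have "e * Nu \<le> 2 * (r1\<^sup>2 * Nf / (2 * e))" using 1 unfolding e_def[symmetric] by linarith
  then have "Nu \<le> 2 * (r1\<^sup>2 * Nf / (2 * e)) / e" using e by (simp only: pos_le_divide_eq mult.commute)
  also have "\<dots> = (r1 / e)\<^sup>2 * Nf" using e by (simp add: power2_eq_square)
  finally show ?thesis by (simp only: e_def)
qed

lemma LINT_prod_Young:
  assumes f: "in_L2 f" and u: "set_integrable lborel {x<..y} (\<lambda>t. (cmod (u t))\<^sup>2)"
    and fu: "set_integrable lborel {x<..y} (\<lambda>t. cmod (f t) * cmod (u t))" and \<eta>: "0 < \<eta>"
  shows "(LINT t:{x<..y}|lborel. cmod (f t) * cmod (u t)) \<le> \<eta> / 2 * (LINT t:{x<..y}|lborel. (cmod (u t))\<^sup>2) + (LINT t|lborel. (cmod (f t))\<^sup>2) / (2 * \<eta>)"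
proof -
  have fi: "(LINT t:{x<..y}|lborel. (cmod (f t))\<^sup>2) \<le> (LINT t|lborel. (cmod (f t))\<^sup>2)"
    "set_integrable lborel {x<..y} (\<lambda>t. (cmod (f t))\<^sup>2)"
    by (rule LINT_subset_le[OF in_L2_integrable[OF f]]; simp)+
  have "(LINT t:{x<..y}|lborel. cmod (f t) * cmod (u t)) \<le> (LINT t:{x<..y}|lborel. \<eta> / 2 * (cmod (u t))\<^sup>2 + (cmod (f t))\<^sup>2 / (2 * \<eta>))"
    using Young_ineq[OF \<eta>] u fi(2) by (intro set_integral_mono[OF fu] set_integral_add) auto
  also have "\<dots> = \<eta> / 2 * (LINT t:{x<..y}|lborel. (cmod (u t))\<^sup>2) + (LINT t:{x<..y}|lborel. (cmod (f t))\<^sup>2) / (2 * \<eta>)"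
    using u fi(2) by (subst set_integral_add) auto
  also have "\<dots> \<le> \<eta> / 2 * (LINT t:{x<..y}|lborel. (cmod (u t))\<^sup>2) + (LINT t|lborel. (cmod (f t))\<^sup>2) / (2 * \<eta>)"
    using fi(1) \<eta> by (intro add_left_mono divide_right_mono) auto
  finally show ?thesis .
qed

lemma LINT_sq_nonneg: "0 \<le> (LINT t:A|lborel. (cmod (g t))\<^sup>2)" "0 \<le> (LINT t|lborel. (cmod (g t))\<^sup>2)"
  unfolding set_lebesgue_integral_def by (auto intro!: Bochner_Integration.integral_nonneg)

text \<open>Both energy identities have boundary terms containing the factor \<open>u\<close>, which
  vanish here. The constant \<open>C\<close> is independent of the interval; it deteriorates as
  \<open>\<epsilon>\<close> tends to 0, and it depends on \<open>W1\<close>.\<close>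

lemma dirichlet_estimate:
  "\<exists>C\<ge>0. \<forall>f u Q x y. sol f u Q \<longrightarrow> in_L2 f \<longrightarrow> x \<le> y \<longrightarrow> u x = 0 \<longrightarrow> u y = 0 \<longrightarrow>
     (LINT t:{x<..y}|lborel. (cmod (u t))\<^sup>2) \<le> C * (LINT t|lborel. (cmod (f t))\<^sup>2) \<and>
     (LINT t:{x<..y}|lborel. (cmod (flux u Q t))\<^sup>2) \<le> C * (LINT t|lborel. (cmod (f t))\<^sup>2)"
proof -
  define B where "B = (r1 / (\<bar>\<epsilon>\<bar> * r0))\<^sup>2"
  define D where "D = (2 / a0) * ((2 * a1 * W1\<^sup>2 + p1) * B + r1 * (B / 2 + 1 / 2))"
  have D0: "0 \<le> D" using a_bounds(1) a1_pos p1_nonneg r1_pos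
    by (auto simp: D_def B_def intro!: mult_nonneg_nonneg add_nonneg_nonneg)
  show ?thesis
  proof (intro exI[of _ "B + D"] conjI allI impI)
    show "0 \<le> B + D" using D0 by (simp add: B_def)
    fix f u Q and x y :: real
    assume s: "sol f u Q" and f: "in_L2 f" and xy: "x \<le> y" and z: "u x = 0" "u y = 0"
    note fl = in_L2_loc_int[OF f]
    note i = sol_integrable[OF s fl, of x y]
    define Nu Nf J NG where "Nu = (LINT t:{x<..y}|lborel. (cmod (u t))\<^sup>2)" and "Nf = (LINT t|lborel. (cmod (f t))\<^sup>2)"
      and "J = (LINT t:{x<..y}|lborel. cmod (f t) * cmod (u t))" and "NG = (LINT t:{x<..y}|lborel. (cmod (flux u Q t))\<^sup>2)"
    have J: "J \<le> \<eta> / 2 * Nu + Nf / (2 * \<eta>)" if "0 < \<eta>" for \<eta>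
      unfolding J_def Nu_def Nf_def by (rule LINT_prod_Young[OF f i(1,4) that])
    have nn: "0 \<le> Nu" "0 \<le> Nf" unfolding Nu_def Nf_def by (rule LINT_sq_nonneg)+
    have 1: "\<bar>\<epsilon>\<bar> * r0 * Nu \<le> r1 * J" using Im_estimate[OF s fl xy] z by (simp add: Nu_def J_def)
    have Nu: "Nu \<le> B * Nf" unfolding B_def by (rule Young_estimate[OF nn 1 J])
    have "a0 / 2 * NG \<le> (2 * a1 * W1\<^sup>2 + p1) * Nu + r1 * J"
      using Re_estimate[OF s fl xy] z by (simp add: Nu_def J_def NG_def)
    also have "\<dots> \<le> (2 * a1 * W1\<^sup>2 + p1) * (B * Nf) + r1 * ((B / 2 + 1 / 2) * Nf)"
    proof (intro add_mono mult_left_mono Nu)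
      have "J \<le> Nu / 2 + Nf / 2" using J[of 1] by simp
      also have "\<dots> \<le> (B / 2 + 1 / 2) * Nf" using Nu by (simp add: algebra_simps)
      finally show "J \<le> (B / 2 + 1 / 2) * Nf" .
    qed (use a1_pos p1_nonneg r1_pos in auto)
    finally have NG: "NG \<le> D * Nf" using a_bounds(1) by (simp add: D_def field_simps)
    have "0 \<le> B * Nf" "0 \<le> D * Nf" using nn(2) D0 by (auto simp: B_def)
    then have "Nu \<le> (B + D) * Nf" "NG \<le> (B + D) * Nf" using Nu NG unfolding distrib_right by linarith+
    then show "(LINT t:{x<..y}|lborel. (cmod (u t))\<^sup>2) \<le> (B + D) * (LINT t|lborel. (cmod (f t))\<^sup>2)"
      "(LINT t:{x<..y}|lborel. (cmod (flux u Q t))\<^sup>2) \<le> (B + D) * (LINT t|lborel. (cmod (f t))\<^sup>2)"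
      unfolding Nu_def[symmetric] Nf_def[symmetric] NG_def[symmetric] by blast+
  qed
qed

text \<open>The estimate with \<open>f = 0\<close> makes \<open>u\<close> and the flux, hence also
  \<open>Q\<close>, vanish almost everywhere on the interval. Continuity transfers this to the
  interior point 0, where the initial data are prescribed.\<close>

lemma dirichlet_unique:
  assumes s: "sol (\<lambda>t. 0) u Q" and xy: "x < 0" "0 < y" and z: "u x = 0" "u y = 0"
  shows "u 0 = 0" "Q 0 = 0"
proof -
  have L2: "in_L2 (\<lambda>t. 0)" by (simp add: in_L2_def)
  have xy': "x \<le> y" using xy by simp
  obtain C where "0 \<le> C" and *: "\<And>f u Q x y. sol f u Q \<Longrightarrow> in_L2 f \<Longrightarrow> x \<le> y \<Longrightarrow> u x = 0 \<Longrightarrow> u y = 0 \<Longrightarrow>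
     (LINT t:{x<..y}|lborel. (cmod (u t))\<^sup>2) \<le> C * (LINT t|lborel. (cmod (f t))\<^sup>2) \<and>
     (LINT t:{x<..y}|lborel. (cmod (flux u Q t))\<^sup>2) \<le> C * (LINT t|lborel. (cmod (f t))\<^sup>2)"
    using dirichlet_estimate by blast
  have le: "(LINT t:{x<..y}|lborel. (cmod (u t))\<^sup>2) \<le> 0" "(LINT t:{x<..y}|lborel. (cmod (flux u Q t))\<^sup>2) \<le> 0"
    using *[OF s L2 xy' z] by auto
  note i = sol_integrable[OF s loc_int_const, of x y]
  have "(LINT t:{x<..y}|lborel. (cmod (Q t))\<^sup>2) \<le> (LINT t:{x<..y}|lborel. 2 * (cmod (flux u Q t))\<^sup>2 + 2 * W1\<^sup>2 * (cmod (u t))\<^sup>2)"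
    using i by (intro set_integral_mono Q_sq_le set_integral_add) auto
  also have "\<dots> = 2 * (LINT t:{x<..y}|lborel. (cmod (flux u Q t))\<^sup>2) + 2 * W1\<^sup>2 * (LINT t:{x<..y}|lborel. (cmod (u t))\<^sup>2)"
    using i by (subst set_integral_add) auto
  also have "\<dots> \<le> 0" using le by (intro add_nonpos_nonpos mult_nonneg_nonpos) auto
  finally have leQ: "(LINT t:{x<..y}|lborel. (cmod (Q t))\<^sup>2) \<le> 0" .
  have "(cmod (u 0))\<^sup>2 = 0"
    by (rule continuous_integral_zero[OF _ _ le(1)]) (use xy sol_continuous[OF s] in \<open>auto intro!: continuous_intros\<close>)
  then show "u 0 = 0" by simp
  have "(cmod (Q 0))\<^sup>2 = 0"
    by (rule continuous_integral_zero[OF _ _ leQ]) (use xy sol_continuous[OF s] in \<open>auto intro!: continuous_intros\<close>)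
  then show "Q 0 = 0" by simp
qed

text \<open>Cramer's rule. If the determinant vanished, the vectors
  \<open>(\<delta>, - \<gamma>)\<close> and \<open>(\<beta>, - \<alpha>)\<close> would lie in the
  kernel, injectivity would make all entries 0, and then \<open>(1, 0)\<close> would contradict
  it.\<close>

lemma solve_2x2:
  fixes \<alpha> \<beta> \<gamma> \<delta> e g :: complex
  assumes inj: "\<And>c d. c * \<alpha> + d * \<beta> = 0 \<Longrightarrow> c * \<gamma> + d * \<delta> = 0 \<Longrightarrow> c = 0 \<and> d = 0"
  shows "\<exists>c d. e + c * \<alpha> + d * \<beta> = 0 \<and> g + c * \<gamma> + d * \<delta> = 0"
proof -
  define D where "D = \<alpha> * \<delta> - \<beta> * \<gamma>"
  have "D \<noteq> 0"
  proof
    assume D: "D = 0"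
    have "\<delta> * \<alpha> + (- \<gamma>) * \<beta> = 0" "\<delta> * \<gamma> + (- \<gamma>) * \<delta> = 0" using D by (auto simp: D_def algebra_simps)
    then have 1: "\<delta> = 0" "\<gamma> = 0" using inj[of \<delta> "- \<gamma>"] by auto
    have "\<beta> * \<alpha> + (- \<alpha>) * \<beta> = 0" "\<beta> * \<gamma> + (- \<alpha>) * \<delta> = 0" using 1 by auto
    then have 2: "\<beta> = 0" "\<alpha> = 0" using inj[of \<beta> "- \<alpha>"] by auto
    then show False using inj[of 1 0] 1 by simp
  qed
  then show ?thesis
    by (intro exI[of _ "(\<beta> * g - \<delta> * e) / D"] exI[of _ "(\<gamma> * e - \<alpha> * g) / D"])
      (simp add: field_simps, simp add: D_def algebra_simps)
qed

text \<open>Solutions form an affine family parametrised by the two values at 0, so each Dirichlet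
  problem is a 2 by 2 linear system, solvable by uniqueness. The sup estimate bounds the values at 0
  uniformly in the interval. Compactness is thus needed only for a sequence in a finite dimensional
  space: a limit of initial values selects the solution, and convergence at every point is
  automatic.\<close>

theorem sol_L2_exists:
  assumes f: "in_L2 f"
  shows "\<exists>u Q. sol f u Q \<and> in_L2 u \<and> in_L2 (flux u Q) \<and> (\<exists>C. \<forall>t. cmod (u t) \<le> C \<and> cmod (Q t) \<le> C)"
proof -
  obtain uf Qf where F: "uf 0 = 0" "Qf 0 = 0" "sol f uf Qf" using sol_exists[OF in_L2_loc_int[OF f]] by blast
  obtain u1 Q1 where 1: "u1 0 = 1" "Q1 0 = 0" "sol (\<lambda>t. 0) u1 Q1" using sol_exists[OF loc_int_const] by blast
  obtain u2 Q2 where 2: "u2 0 = 0" "Q2 0 = 1" "sol (\<lambda>t. 0) u2 Q2" using sol_exists[OF loc_int_const] by blast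
  define U where "U c d t = uf t + c * u1 t + d * u2 t" for c d t
  define P where "P c d t = Qf t + c * Q1 t + d * Q2 t" for c d t
  have UP: "sol f (U c d) (P c d)" for c d
    using sol_add_cmult[OF sol_add_cmult[OF F(3) 1(3), of c] 2(3), of d] unfolding U_def[abs_def] P_def[abs_def] by simp
  have U0: "U c d 0 = c" "P c d 0 = d" for c d by (auto simp: U_def P_def F 1 2)
  have "\<exists>c d. U c d (real (Suc n)) = 0 \<and> U c d (- real (Suc n)) = 0" for n
    unfolding U_def
  proof (rule solve_2x2)
    fix c d assume z: "c * u1 (real (Suc n)) + d * u2 (real (Suc n)) = 0" "c * u1 (- real (Suc n)) + d * u2 (- real (Suc n)) = 0"
    have "sol (\<lambda>t. 0) (\<lambda>t. 0) (\<lambda>t. 0)"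
      by (simp add: sol_def flux_def prim_on_const)
    from sol_add_cmult[OF sol_add_cmult[OF this 1(3), of c] 2(3), of d]
    have s: "sol (\<lambda>t. 0) (\<lambda>t. c * u1 t + d * u2 t) (\<lambda>t. c * Q1 t + d * Q2 t)" by simp
    show "c = 0 \<and> d = 0"
      using dirichlet_unique[OF s, of "- real (Suc n)" "real (Suc n)"] z 1 2 by simp
  qed
  then obtain c d where cd: "\<And>n. U (c n) (d n) (real (Suc n)) = 0" "\<And>n. U (c n) (d n) (- real (Suc n)) = 0" by metis
  define Nf where "Nf = (LINT t|lborel. (cmod (f t))\<^sup>2)"
  obtain C where C: "0 \<le> C" and *: "\<And>f u Q x y. sol f u Q \<Longrightarrow> in_L2 f \<Longrightarrow> x \<le> y \<Longrightarrow> u x = 0 \<Longrightarrow> u y = 0 \<Longrightarrow>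
     (LINT t:{x<..y}|lborel. (cmod (u t))\<^sup>2) \<le> C * (LINT t|lborel. (cmod (f t))\<^sup>2) \<and>
     (LINT t:{x<..y}|lborel. (cmod (flux u Q t))\<^sup>2) \<le> C * (LINT t|lborel. (cmod (f t))\<^sup>2)"
    using dirichlet_estimate by blast
  obtain K where K: "0 \<le> K" and **: "\<And>f u Q x y A s. sol f u Q \<Longrightarrow> in_L2 f \<Longrightarrow> x + 1 \<le> y \<Longrightarrow>
     (LINT t:{x<..y}|lborel. (cmod (u t))\<^sup>2) \<le> A \<Longrightarrow> (LINT t:{x<..y}|lborel. (cmod (flux u Q t))\<^sup>2) \<le> A \<Longrightarrow>
     (LINT t|lborel. (cmod (f t))\<^sup>2) \<le> A \<Longrightarrow> s \<in> {x..y} \<Longrightarrow> (cmod (u s))\<^sup>2 \<le> K * A \<and> (cmod (Q s))\<^sup>2 \<le> K * A"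
    using sup_estimate by blast
  define A where "A = (C + 1) * Nf"
  have Nf0: "0 \<le> Nf" unfolding Nf_def by (rule LINT_sq_nonneg)
  have est: "(LINT t:{- real (Suc n)<..real (Suc n)}|lborel. (cmod (U (c n) (d n) t))\<^sup>2) \<le> A"
     "(LINT t:{- real (Suc n)<..real (Suc n)}|lborel. (cmod (flux (U (c n) (d n)) (P (c n) (d n)) t))\<^sup>2) \<le> A" for n
  proof -
    have "C * Nf \<le> A" using Nf0 by (simp add: A_def algebra_simps)
    then show "(LINT t:{- real (Suc n)<..real (Suc n)}|lborel. (cmod (U (c n) (d n) t))\<^sup>2) \<le> A"
     "(LINT t:{- real (Suc n)<..real (Suc n)}|lborel. (cmod (flux (U (c n) (d n)) (P (c n) (d n)) t))\<^sup>2) \<le> A"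
      using *[OF UP f _ cd(2,1), of n] unfolding Nf_def[symmetric] by auto
  qed
  have NfA: "(LINT t|lborel. (cmod (f t))\<^sup>2) \<le> A" using C Nf0 by (simp add: A_def algebra_simps Nf_def)
  define B where "B = sqrt (K * A)"
  have B: "cmod (U (c n) (d n) s) \<le> B" "cmod (P (c n) (d n) s) \<le> B" if "\<bar>s\<bar> \<le> real (Suc n)" for n s
    using **[OF UP f _ est[of n] NfA, of s] that by (auto simp: B_def abs_le_iff real_le_rsqrt)
  have "bounded (range (\<lambda>n. (c n, d n)))"
    unfolding bounded_iff
  proof (intro exI[of _ "B + B"] ballI)
    fix z assume "z \<in> range (\<lambda>n. (c n, d n))"
    then obtain n where z: "z = (c n, d n)" by auto
    have "norm z \<le> norm (c n) + norm (d n)" unfolding z by (rule norm_Pair_le)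
    then show "norm z \<le> B + B" using B[of 0 n] U0 by simp
  qed
  from bounded_imp_convergent_subsequence[OF this]
  obtain l \<rho> where \<rho>: "strict_mono \<rho>" and l: "((\<lambda>n. (c n, d n)) \<circ> \<rho>) \<longlonglongrightarrow> l" by blast
  have lc: "(\<lambda>n. c (\<rho> n)) \<longlonglongrightarrow> fst l" "(\<lambda>n. d (\<rho> n)) \<longlonglongrightarrow> snd l"
    using tendsto_fst[OF l] tendsto_snd[OF l] by (simp_all add: comp_def)
  define u Q where "u = U (fst l) (snd l)" and "Q = P (fst l) (snd l)"
  have s: "sol f u Q" unfolding u_def Q_def by (rule UP)
  note [measurable] = sol_measurable[OF s]
  have lim: "(\<lambda>n. U (c (\<rho> n)) (d (\<rho> n)) t) \<longlonglongrightarrow> u t" "(\<lambda>n. P (c (\<rho> n)) (d (\<rho> n)) t) \<longlonglongrightarrow> Q t" for t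
    unfolding u_def Q_def U_def P_def by (intro tendsto_intros lc)+
  have limG: "(\<lambda>n. flux (U (c (\<rho> n)) (d (\<rho> n))) (P (c (\<rho> n)) (d (\<rho> n))) t) \<longlonglongrightarrow> flux u Q t" for t
    unfolding flux_def by (intro tendsto_intros lim)
  \<comment> \<open>Since \<open>n \<le> \<rho> n\<close> for a strictly monotone
    \<open>\<rho>\<close>, the window of radius \<open>n\<close> lies inside the Dirichlet interval
    belonging to \<open>\<rho> n\<close>.\<close>
  have large: "\<bar>t\<bar> \<le> real (Suc (\<rho> n))" if "\<bar>t\<bar> \<le> real n" for t n
    using seq_suble[OF \<rho>, of n] that by linarith
  have bd: "cmod (u t) \<le> B \<and> cmod (Q t) \<le> B" for t
  proof -
    obtain N :: nat where N: "\<bar>t\<bar> < real N" using reals_Archimedean2 by blast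
    have "\<forall>n\<ge>N. cmod (U (c (\<rho> n)) (d (\<rho> n)) t) \<le> B \<and> cmod (P (c (\<rho> n)) (d (\<rho> n)) t) \<le> B"
      using N by (intro allI impI conjI B large) auto
    then show ?thesis
      using LIMSEQ_le_const2[OF tendsto_norm[OF lim(1)[of t]], of B] LIMSEQ_le_const2[OF tendsto_norm[OF lim(2)[of t]], of B] by blast
  qed
  have B0: "0 \<le> B" using bd[of 0] norm_ge_zero order_trans by blast
  have Gb: "cmod (flux v R t) \<le> B + W1 * B" if "cmod (v t) \<le> B" "cmod (R t) \<le> B" for v R t
    unfolding flux_def using that W_bound[of t] W1_nonneg B0 by (intro norm_triangle_mono) (auto simp: norm_mult intro!: mult_mono)
  \<comment> \<open>The bound on the integral survives in the limit on each fixed window, where the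
    constant \<open>D\<^sup>2\<close> dominates. Index \<open>n + N\<close> guarantees that the
    Dirichlet interval already covers the window.\<close>
  have conv: "(LINT t:{- real N<..real N}|lborel. (cmod (g t))\<^sup>2) \<le> A \<and> set_integrable lborel {- real N<..real N} (\<lambda>t. (cmod (g t))\<^sup>2)"
    if m: "\<And>n. h n \<in> borel_measurable borel" and gm: "g \<in> borel_measurable borel" and lg: "\<And>t. (\<lambda>n. h (\<rho> n) t) \<longlonglongrightarrow> g t"
      and hb: "\<And>n t. \<bar>t\<bar> \<le> real (Suc n) \<Longrightarrow> cmod (h n t) \<le> D" and gb: "\<And>t. cmod (g t) \<le> D"
      and hA: "\<And>n. (LINT t:{- real (Suc n)<..real (Suc n)}|lborel. (cmod (h n t))\<^sup>2) \<le> A" for h g D N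
  proof
    have sq: "x\<^sup>2 \<le> D\<^sup>2" if "0 \<le> x" "x \<le> D" for x :: real using that by (intro power_mono)
    show "set_integrable lborel {- real N<..real N} (\<lambda>t. (cmod (g t))\<^sup>2)"
      by (rule bounded_measurable_set_integrable[of _ _ _ "D\<^sup>2"]) (use gm gb in \<open>auto intro!: power_mono\<close>)
    have "(\<lambda>n. LINT t:{- real N<..real N}|lborel. (cmod (h (\<rho> (n + N)) t))\<^sup>2) \<longlonglongrightarrow> (LINT t:{- real N<..real N}|lborel. (cmod (g t))\<^sup>2)"
      unfolding set_lebesgue_integral_def
    proof (rule integral_dominated_convergence[where w = "\<lambda>t. indicator {- real N<..real N} t *\<^sub>R D\<^sup>2"])
      show "integrable lborel (\<lambda>t. indicator {- real N<..real N} t *\<^sub>R D\<^sup>2)"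
        by (intro integrable_scaleR_left integrable_real_indicator) auto
      show "AE t in lborel. (\<lambda>n. indicator {- real N<..real N} t *\<^sub>R (cmod (h (\<rho> (n + N)) t))\<^sup>2) \<longlonglongrightarrow> indicator {- real N<..real N} t *\<^sub>R (cmod (g t))\<^sup>2"
        by (intro always_eventually allI tendsto_scaleR tendsto_const tendsto_power tendsto_norm LIMSEQ_ignore_initial_segment[OF lg])
      show "AE t in lborel. norm (indicator {- real N<..real N} t *\<^sub>R (cmod (h (\<rho> (n + N)) t))\<^sup>2) \<le> indicator {- real N<..real N} t *\<^sub>R D\<^sup>2" for n
      proof (intro always_eventually allI)
        fix t
        show "norm (indicator {- real N<..real N} t *\<^sub>R (cmod (h (\<rho> (n + N)) t))\<^sup>2) \<le> indicator {- real N<..real N} t *\<^sub>R D\<^sup>2"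
          using sq[OF norm_ge_zero hb[OF large[of t "n + N"]]] by (auto simp: indicator_def)
      qed
    qed (use m gm in auto)
    then show "(LINT t:{- real N<..real N}|lborel. (cmod (g t))\<^sup>2) \<le> A"
    proof (rule LIMSEQ_le_const2, intro exI[of _ 0] allI impI)
      fix n :: nat
      let ?m = "\<rho> (n + N)"
      have "N \<le> Suc ?m" using seq_suble[OF \<rho>, of "n + N"] by linarith
      then have "(LINT t:{- real N<..real N}|lborel. (cmod (h ?m t))\<^sup>2) \<le> (LINT t:{- real (Suc ?m)<..real (Suc ?m)}|lborel. (cmod (h ?m t))\<^sup>2)"
        unfolding set_lebesgue_integral_def
      proof (intro integral_mono)
        have i: "set_integrable lborel {- real (Suc ?m)<..real (Suc ?m)} (\<lambda>t. (cmod (h ?m t))\<^sup>2)"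
          by (rule bounded_measurable_set_integrable[of _ _ _ "D\<^sup>2"]) (use m hb in \<open>auto simp: abs_le_iff intro!: power_mono\<close>)
        then show "integrable lborel (\<lambda>t. indicator {- real (Suc ?m)<..real (Suc ?m)} t *\<^sub>R (cmod (h ?m t))\<^sup>2)"
          by (simp add: set_integrable_def)
        have "set_integrable lborel {- real N<..real N} (\<lambda>t. (cmod (h ?m t))\<^sup>2)"
          by (rule set_integrable_subset[OF i]) (use \<open>N \<le> Suc ?m\<close> in auto)
        then show "integrable lborel (\<lambda>t. indicator {- real N<..real N} t *\<^sub>R (cmod (h ?m t))\<^sup>2)"
          by (simp add: set_integrable_def)
      qed (use \<open>N \<le> Suc ?m\<close> in \<open>auto simp: indicator_def\<close>)
      then show "(LINT t:{- real N<..real N}|lborel. (cmod (h ?m t))\<^sup>2) \<le> A" using hA[of ?m] by linarith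
    qed
  qed
  have mU: "U (c n) (d n) \<in> borel_measurable borel" "flux (U (c n) (d n)) (P (c n) (d n)) \<in> borel_measurable borel" for n
    using sol_measurable[OF UP[of "c n" "d n"]] by (auto intro: flux_measurable)
  have Dn: "B \<le> B + W1 * B" using B0 W1_nonneg by simp
  have cu: "(LINT t:{- real N<..real N}|lborel. (cmod (u t))\<^sup>2) \<le> A \<and> set_integrable lborel {- real N<..real N} (\<lambda>t. (cmod (u t))\<^sup>2)" for N
    by (rule conv[where h = "\<lambda>n. U (c n) (d n)" and D = B]) (use mU lim B bd est in auto)
  have cG: "(LINT t:{- real N<..real N}|lborel. (cmod (flux u Q t))\<^sup>2) \<le> A \<and> set_integrable lborel {- real N<..real N} (\<lambda>t. (cmod (flux u Q t))\<^sup>2)" for N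
    by (rule conv[where h = "\<lambda>n. flux (U (c n) (d n)) (P (c n) (d n))" and D = "B + W1 * B"]) (use mU limG B bd est Gb in auto)
  have "in_L2 u" unfolding in_L2_def
    using LINT_Ioc_bounded_integrable(1)[of "\<lambda>t. (cmod (u t))\<^sup>2" A] cu by simp
  moreover have "in_L2 (flux u Q)" unfolding in_L2_def
    using LINT_Ioc_bounded_integrable(1)[of "\<lambda>t. (cmod (flux u Q t))\<^sup>2" A] cG by simp
  ultimately show ?thesis using s bd by blast
qed

section \<open>Whole-line estimates for square integrable solutions\<close>

lemma Im_flux: "Im (Q t * cnj (u t)) = Im (flux u Q t * cnj (u t))"
  by (simp add: flux_def algebra_simps)

text \<open>The boundary terms are evaluated at far points where \<open>|u|^2 + |flux|^2\<close> is
  small. Rewriting \<open>Im (Q * cnj u)\<close> with the flux instead of \<open>Q\<close> makes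
  them small without any reference to \<open>W1\<close>, so the constants are those of
  \<open>r\<close> alone.\<close>

theorem sol_L2_estimate:
  assumes s: "sol f u Q" and f: "in_L2 f" and u: "in_L2 u" and G: "in_L2 (flux u Q)"
  shows "\<bar>\<epsilon>\<bar> * r0 * (LINT t|lborel. (cmod (u t))\<^sup>2) \<le> r1 * (LINT t|lborel. cmod (f t) * cmod (u t))"
proof -
  note fl = in_L2_loc_int[OF f]
  define J where "J = (LINT t|lborel. cmod (f t) * cmod (u t))"
  define e where "e = \<bar>\<epsilon>\<bar> * r0"
  have e: "0 < e" using eps_nonzero r_bounds(1) by (simp add: e_def)
  let ?k = "\<lambda>t. (cmod (u t))\<^sup>2 + (cmod (flux u Q t))\<^sup>2"
  have ki: "integrable lborel ?k" using in_L2_integrable[OF u] in_L2_integrable[OF G] by simp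
  have bdry: "\<bar>Im (Q t * cnj (u t))\<bar> \<le> ?k t" for t
  proof -
    have "\<bar>Im (Q t * cnj (u t))\<bar> \<le> cmod (flux u Q t) * cmod (u t)"
      using abs_Im_le_cmod[of "flux u Q t * cnj (u t)"] by (simp only: Im_flux[of Q t u] norm_mult complex_mod_cnj)
    also have "\<dots> \<le> ?k t"
      using Young_ineq[of 1 "cmod (flux u Q t)" "cmod (u t)"] zero_le_power2[of "cmod (u t)"] zero_le_power2[of "cmod (flux u Q t)"]
      by linarith
    finally show ?thesis .
  qed
  have le: "e * (LINT t:{- real n<..real n}|lborel. (cmod (u t))\<^sup>2) \<le> r1 * J" for n
  proof (rule field_le_epsilon)
    fix d :: real assume d: "0 < d"
    obtain y where y: "real n < y" "?k y < d / 2" using integrable_small_values(1)[OF ki _ half_gt_zero[OF d]] by auto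
    obtain x where x: "x < - real n" "?k x < d / 2" using integrable_small_values(2)[OF ki _ half_gt_zero[OF d]] by auto
    have xy: "x \<le> y" using x y by linarith
    note i = sol_integrable[OF s fl, of x y]
    have "(LINT t:{- real n<..real n}|lborel. (cmod (u t))\<^sup>2) \<le> (LINT t:{x<..y}|lborel. (cmod (u t))\<^sup>2)"
      unfolding set_lebesgue_integral_def using sol_integrable(1)[OF s fl] x y
      by (intro integral_mono) (auto simp: set_integrable_def indicator_def)
    then have "e * (LINT t:{- real n<..real n}|lborel. (cmod (u t))\<^sup>2) \<le> e * (LINT t:{x<..y}|lborel. (cmod (u t))\<^sup>2)"
      using e by (intro mult_left_mono) auto
    also have "\<dots> \<le> r1 * (LINT t:{x<..y}|lborel. cmod (f t) * cmod (u t)) + ?k x + ?k y"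
      using Im_estimate[OF s fl xy] bdry[of x] bdry[of y] unfolding e_def by linarith
    also have "(LINT t:{x<..y}|lborel. cmod (f t) * cmod (u t)) \<le> J"
      unfolding J_def by (rule LINT_subset_le(1)[OF in_L2_mult_integrable[OF f u]]) auto
    finally show "e * (LINT t:{- real n<..real n}|lborel. (cmod (u t))\<^sup>2) \<le> r1 * J + d"
      using x(2) y(2) r1_pos by (simp add: mult_left_mono)
  qed
  have "(LINT t|lborel. (cmod (u t))\<^sup>2) \<le> r1 * J / e"
  proof (rule LINT_Ioc_bounded_integrable(2))
    show "(LINT t:{- real n<..real n}|lborel. (cmod (u t))\<^sup>2) \<le> r1 * J / e" for n
      using le[of n] e by (simp add: field_simps)
  qed (use u sol_integrable(1)[OF s fl] in \<open>auto simp: in_L2_def\<close>)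
  then show ?thesis unfolding e_def[symmetric] J_def[symmetric] using e by (simp add: field_simps)
qed

lemma sol_L2_bounded:
  assumes s: "sol f u Q" and f: "in_L2 f" and u: "in_L2 u" and G: "in_L2 (flux u Q)"
  shows "\<exists>C. \<forall>t. cmod (u t) \<le> C \<and> cmod (Q t) \<le> C"
proof -
  obtain K where K: "0 \<le> K" and *: "\<And>f u Q x y A s. sol f u Q \<Longrightarrow> in_L2 f \<Longrightarrow> x + 1 \<le> y \<Longrightarrow>
     (LINT t:{x<..y}|lborel. (cmod (u t))\<^sup>2) \<le> A \<Longrightarrow> (LINT t:{x<..y}|lborel. (cmod (flux u Q t))\<^sup>2) \<le> A \<Longrightarrow>
     (LINT t|lborel. (cmod (f t))\<^sup>2) \<le> A \<Longrightarrow> s \<in> {x..y} \<Longrightarrow> (cmod (u s))\<^sup>2 \<le> K * A \<and> (cmod (Q s))\<^sup>2 \<le> K * A"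
    using sup_estimate by blast
  define A where "A = (LINT t|lborel. (cmod (u t))\<^sup>2) + (LINT t|lborel. (cmod (flux u Q t))\<^sup>2) + (LINT t|lborel. (cmod (f t))\<^sup>2)"
  have nn: "0 \<le> (LINT t|lborel. (cmod (u t))\<^sup>2)" "0 \<le> (LINT t|lborel. (cmod (flux u Q t))\<^sup>2)" "0 \<le> (LINT t|lborel. (cmod (f t))\<^sup>2)"
    by (rule LINT_sq_nonneg)+
  have "(cmod (u t))\<^sup>2 \<le> K * A \<and> (cmod (Q t))\<^sup>2 \<le> K * A" for t
  proof (rule *[OF s f, of "t - 1" "t + 1"])
    show "(LINT t:{t - 1<..t + 1}|lborel. (cmod (u t))\<^sup>2) \<le> A"
    proof -
      have "(LINT t:{t - 1<..t + 1}|lborel. (cmod (u t))\<^sup>2) \<le> (LINT t|lborel. (cmod (u t))\<^sup>2)"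
        by (rule LINT_subset_le(1)[OF in_L2_integrable[OF u]]) auto
      then show ?thesis using nn unfolding A_def by linarith
    qed
    show "(LINT t:{t - 1<..t + 1}|lborel. (cmod (flux u Q t))\<^sup>2) \<le> A"
    proof -
      have "(LINT t:{t - 1<..t + 1}|lborel. (cmod (flux u Q t))\<^sup>2) \<le> (LINT t|lborel. (cmod (flux u Q t))\<^sup>2)"
        by (rule LINT_subset_le(1)[OF in_L2_integrable[OF G]]) auto
      then show ?thesis using nn unfolding A_def by linarith
    qed
  qed (use nn in \<open>auto simp: A_def\<close>)
  then show ?thesis by (intro exI[of _ "sqrt (K * A)"]) (auto intro: real_le_rsqrt)
qed

lemma sol_L2_norm_bound:
  assumes s: "sol f u Q" and f: "in_L2 f" and u: "in_L2 u" and G: "in_L2 (flux u Q)"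
  shows "(LINT t|lborel. (cmod (u t))\<^sup>2) \<le> (r1 / (\<bar>\<epsilon>\<bar> * r0))\<^sup>2 * (LINT t|lborel. (cmod (f t))\<^sup>2)"
proof (rule Young_estimate[OF LINT_sq_nonneg(2) LINT_sq_nonneg(2) sol_L2_estimate[OF assms]])
  fix \<eta> :: real assume \<eta>: "0 < \<eta>"
  have "(LINT t|lborel. cmod (f t) * cmod (u t)) \<le> (LINT t|lborel. \<eta> / 2 * (cmod (u t))\<^sup>2 + (cmod (f t))\<^sup>2 / (2 * \<eta>))"
    using Young_ineq[OF \<eta>] in_L2_integrable[OF u] in_L2_integrable[OF f]
    by (intro integral_mono[OF in_L2_mult_integrable[OF f u]]) auto
  also have "\<dots> = \<eta> / 2 * (LINT t|lborel. (cmod (u t))\<^sup>2) + (LINT t|lborel. (cmod (f t))\<^sup>2) / (2 * \<eta>)"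
    using in_L2_integrable[OF u] in_L2_integrable[OF f] by simp
  finally show "(LINT t|lborel. cmod (f t) * cmod (u t)) \<le> \<eta> / 2 * (LINT t|lborel. (cmod (u t))\<^sup>2) + (LINT t|lborel. (cmod (f t))\<^sup>2) / (2 * \<eta>)" .
qed

end

section \<open>The Schroedinger operator as a first order system\<close>

lemma set_LINT_indicator:
  fixes g :: "real \<Rightarrow> complex"
  shows "(LINT x:A|lborel. g x) = (LINT x|lborel. indicator A x * g x)"
  unfolding set_lebesgue_integral_def by (rule Bochner_Integration.integral_cong) (auto simp: indicator_def)

lemma in_L2_add: 
  assumes "in_L2 f" "in_L2 g" shows "in_L2 (\<lambda>x. f x + g x)"
  unfolding in_L2_def
proof
  show m: "(\<lambda>x. f x + g x) \<in> borel_measurable borel" using assms by (auto simp: in_L2_def)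
  show "integrable lborel (\<lambda>x. (cmod (f x + g x))\<^sup>2)"
  proof (rule Bochner_Integration.integrable_bound)
    show "integrable lborel (\<lambda>x. 2 * (cmod (f x))\<^sup>2 + 2 * (cmod (g x))\<^sup>2)"
      using in_L2_integrable[OF assms(1)] in_L2_integrable[OF assms(2)] by simp
    show "AE x in lborel. norm ((cmod (f x + g x))\<^sup>2) \<le> norm (2 * (cmod (f x))\<^sup>2 + 2 * (cmod (g x))\<^sup>2)"
    proof (intro always_eventually allI)
      fix x
      have "(cmod (f x + g x))\<^sup>2 \<le> (cmod (f x) + cmod (g x))\<^sup>2" by (intro power_mono norm_triangle_ineq) simp
      also have "\<dots> \<le> 2 * (cmod (f x))\<^sup>2 + 2 * (cmod (g x))\<^sup>2"
        using sum_squares_bound[of "cmod (f x)" "cmod (g x)"] by (simp add: power2_eq_square algebra_simps)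
      finally show "norm ((cmod (f x + g x))\<^sup>2) \<le> norm (2 * (cmod (f x))\<^sup>2 + 2 * (cmod (g x))\<^sup>2)" by simp
    qed
  qed (use m in measurable)
qed

lemma in_L2_mult_bdd:
  assumes f: "in_L2 f" and k: "k \<in> borel_measurable borel" "\<And>x. cmod (k x) \<le> C"
  shows "in_L2 (\<lambda>x. k x * f x)"
  unfolding in_L2_def
proof
  show m: "(\<lambda>x. k x * f x) \<in> borel_measurable borel" using assms by (auto simp: in_L2_def)
  show "integrable lborel (\<lambda>x. (cmod (k x * f x))\<^sup>2)"
  proof (rule Bochner_Integration.integrable_bound)
    show "integrable lborel (\<lambda>x. C\<^sup>2 * (cmod (f x))\<^sup>2)" using in_L2_integrable[OF f] by simp
    have "(cmod (k x))\<^sup>2 \<le> C\<^sup>2" for x using k(2)[of x] by (intro power_mono) auto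
    then show "AE x in lborel. norm ((cmod (k x * f x))\<^sup>2) \<le> norm (C\<^sup>2 * (cmod (f x))\<^sup>2)"
      by (intro always_eventually allI) (auto simp: norm_mult power_mult_distrib intro!: mult_right_mono)
  qed (use m in measurable)
qed

lemma in_L2_cmult: "in_L2 f \<Longrightarrow> in_L2 (\<lambda>x. c * f x)"
  by (rule in_L2_mult_bdd[of f "\<lambda>x. c" "cmod c"]) auto

lemma in_L2_diff: "in_L2 f \<Longrightarrow> in_L2 g \<Longrightarrow> in_L2 (\<lambda>x. f x - g x)"
  using in_L2_add[of f "\<lambda>x. -1 * g x"] in_L2_cmult[of g "-1"] by simp

lemma in_L2_cong_AE:
  assumes "in_L2 f" "g \<in> borel_measurable borel" "AE x in lborel. f x = g x"
  shows "in_L2 g"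
  unfolding in_L2_def
proof
  show "integrable lborel (\<lambda>x. (cmod (g x))\<^sup>2)"
    by (rule integrable_cong_AE_imp[OF in_L2_integrable[OF assms(1)]]) (use assms(2,3) in \<open>auto elim!: eventually_mono\<close>)
qed (rule assms(2))

text \<open>The embedding of the Sobolev space into bounded functions. Since \<open>b0\<close> is
  only square integrable, \<open>b0 * u\<close> is seen to be in \<open>L2\<close> through the
  boundedness of \<open>u\<close>.\<close>

lemma in_L2_prim_bounded:
  assumes p: "prim_on UNIV U w" and U: "in_L2 U" and w: "in_L2 w"
  shows "\<exists>C. \<forall>t. cmod (U t) \<le> C"
proof -
  note p2 = prim_on_bounded_linear[OF bounded_linear_Re prim_on_mult[OF p prim_on_bounded_linear[OF bounded_linear_cnj p]]]
  have p3: "prim_on UNIV (\<lambda>t. (cmod (U t))\<^sup>2) (\<lambda>t. Re (w t * cnj (U t) + U t * cnj (w t)))"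
    by (rule prim_on_cong[OF p2]) (simp_all add: cmod_power2, simp_all add: power2_eq_square)
  define k where "k t = 2 * (cmod (w t) * cmod (U t))" for t
  have ki: "integrable lborel k" unfolding k_def using in_L2_mult_integrable[OF w U] by simp
  have "(cmod (U s))\<^sup>2 \<le> (LINT t|lborel. (cmod (U t))\<^sup>2) + (LINT t|lborel. k t)" for s
  proof (rule prim_on_sup_le[OF p3, of "s - 1" "s + 1"])
    show "set_integrable lborel {s - 1<..s + 1} k" "(LINT t:{s - 1<..s + 1}|lborel. k t) \<le> (LINT t|lborel. k t)"
      by (rule LINT_subset_le[OF ki]; simp add: k_def)+
    show "(LINT t:{s - 1<..s + 1}|lborel. (cmod (U t))\<^sup>2) \<le> (LINT t|lborel. (cmod (U t))\<^sup>2)"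
      by (rule LINT_subset_le[OF in_L2_integrable[OF U]]) auto
    fix t
    have "\<bar>Re (w t * cnj (U t) + U t * cnj (w t))\<bar> \<le> cmod (w t * cnj (U t) + U t * cnj (w t))" by (rule abs_Re_le_cmod)
    also have "\<dots> \<le> k t" using norm_triangle_ineq[of "w t * cnj (U t)" "U t * cnj (w t)"] by (simp add: k_def norm_mult mult.commute)
    finally show "\<bar>Re (w t * cnj (U t) + U t * cnj (w t))\<bar> \<le> k t" .
  qed auto
  then show ?thesis by (blast intro: real_le_rsqrt)
qed

lemma bounded_variation_measurable:
  assumes "bounded_variation f" shows "f \<in> borel_measurable borel"
proof -
  obtain p q where pq: "mono p" "mono q" "f = (\<lambda>x. p x - q x)"
    using assms unfolding bounded_variation_def by blast
  show ?thesis unfolding pq(3) using borel_measurable_mono[OF pq(1)] borel_measurable_mono[OF pq(2)] by auto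
qed

lemma bounded_variation_bounded:
  assumes "bounded_variation f" shows "\<exists>C. \<forall>x. \<bar>f x\<bar> \<le> C"
proof -
  obtain p q where pq: "bounded (range p)" "bounded (range q)" "f = (\<lambda>x. p x - q x)"
    using assms unfolding bounded_variation_def by blast
  obtain A B where "\<And>x. \<bar>p x\<bar> \<le> A" "\<And>x. \<bar>q x\<bar> \<le> B"
    using pq(1,2) unfolding bounded_iff by auto
  then have "\<bar>f x\<bar> \<le> A + B" for x unfolding pq(3) using abs_triangle_ineq4[of "p x" "q x"] by (meson add_mono order_trans)
  then show ?thesis by blast
qed

text \<open>
  The bound \<open>Bd\<close> on \<open>V1\<close> and \<open>b1\<close> holds everywhere but is not uniform in \<open>h\<close>; it must not enter
  the constants of the final estimate.
\<close>

locale schroedinger_line =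
  fixes h c M Bd R0 E \<epsilon> :: real and \<alpha> \<beta> b0 b1 V1 :: "real \<Rightarrow> real" and V0 :: "real set \<Rightarrow> real"
  assumes h: "0 < h" and c: "0 < c" and R0: "0 < R0" and eps: "\<epsilon> \<noteq> 0"
    and coefficients: "coefficients \<alpha> \<beta> b0 b1 V0 V1"
    and \<alpha>_bounds: "\<And>x. c \<le> \<alpha> x" "\<And>x. \<alpha> x \<le> M"
    and \<beta>_bounds: "\<And>x. c \<le> \<beta> x" "\<And>x. \<beta> x \<le> M"
    and V1_bound: "\<And>x. \<bar>V1 x\<bar> \<le> Bd" and b1_bound: "\<And>x. \<bar>b1 x\<bar> \<le> Bd"
    and V0_support: "\<And>A. A \<in> sets borel \<Longrightarrow> A \<inter> {- R0..R0} = {} \<Longrightarrow> V0 A = 0"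
    and b0_support: "AE x in lborel. x \<notin> {- R0..R0} \<longrightarrow> b0 x = 0"
begin

lemma coefficients_measurable [measurable]: "\<alpha> \<in> borel_measurable borel" "\<beta> \<in> borel_measurable borel"
  "b0 \<in> borel_measurable borel" "b1 \<in> borel_measurable borel" "V1 \<in> borel_measurable borel"
  using coefficients unfolding coefficients_def by (auto intro: bounded_variation_measurable)

lemma b0_int: "integrable lborel b0" "integrable lborel (\<lambda>x. (b0 x)\<^sup>2)"
  using coefficients unfolding coefficients_def by auto

lemma V0: "local_signed_measure V0"
  using coefficients unfolding coefficients_def by (blast intro: finite_signed_imp_local)

lemma pos: "0 < \<alpha> x" "0 < \<beta> x" "0 < M" "0 \<le> Bd"
  using c \<alpha>_bounds[of x] \<beta>_bounds[of x] V1_bound[of 0] by linarith+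

abbreviation "b \<equiv> \<lambda>x. b0 x + b1 x"
abbreviation "V \<equiv> potential_measure V0 V1"
abbreviation "D \<equiv> schroedinger_domain h \<alpha> \<beta> b V"
abbreviation "P \<equiv> schroedinger_op h \<alpha> \<beta> b V"
abbreviation "z \<equiv> Complex E \<epsilon>"

text \<open>
  The jumps of \<open>h \<alpha> u' + i b u\<close> are those of \<open>cW u\<close>, and \<open>cW\<close> also absorbs the integrable but
  unbounded part \<open>ca (b\<^sup>2 - b1\<^sup>2)\<close> of the coefficient of \<open>u\<close>.
\<close>

definition "ca t = 1 / (h * \<alpha> t)"
definition "cr t = 1 / (h * \<beta> t)"
definition "ck t = ca t * b t"
definition "cp t = cr t * (E - V1 t) + ca t * (b1 t)\<^sup>2"
definition "LV f = signed_integral V0 (\<lambda>t. complex_of_real (cr t) * f t)"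
definition "W0 x = Re (cdf LV x - cdf LV (- R0 - 1))"
definition "kb t = ca t * ((b t)\<^sup>2 - (b1 t)\<^sup>2)"
definition "Kb x = prim0 kb x - prim0 kb (- R0 - 1)"
definition "cW x = W0 x - Kb x"

lemma ca_meas [measurable]: "ca \<in> borel_measurable borel" and cr_meas [measurable]: "cr \<in> borel_measurable borel"
  unfolding ca_def[abs_def] cr_def[abs_def] by measurable

lemma ca_bounds: "1 / (h * M) \<le> ca t" "ca t \<le> 1 / (h * c)" and cr_bounds: "1 / (h * M) \<le> cr t" "cr t \<le> 1 / (h * c)"
  unfolding ca_def cr_def using h c pos(1)[of t] pos(2)[of t] pos(3) \<alpha>_bounds[of t] \<beta>_bounds[of t]
  by (auto intro!: divide_left_mono mult_left_mono mult_pos_pos)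

lemma ca_pos: "0 < ca t" and cr_pos: "0 < cr t"
  unfolding ca_def cr_def using h pos(1)[of t] pos(2)[of t] by auto

lemma coefficients_locally_bdd: "locally_bdd (\<lambda>t. complex_of_real (ca t))" "locally_bdd (\<lambda>t. complex_of_real (cr t))"
  "locally_bdd (\<lambda>t. complex_of_real (\<beta> t))" "locally_bdd (\<lambda>t. complex_of_real (V1 t))" "locally_bdd (\<lambda>t. complex_of_real (b1 t))"
proof -
  have "\<bar>ca t\<bar> \<le> 1 / (h * c)" "\<bar>cr t\<bar> \<le> 1 / (h * c)" "\<bar>\<beta> t\<bar> \<le> M" for t
    using ca_pos[of t] cr_pos[of t] ca_bounds(2)[of t] cr_bounds(2)[of t] pos(2)[of t] \<beta>_bounds[of t] by auto
  then show "locally_bdd (\<lambda>t. complex_of_real (ca t))" "locally_bdd (\<lambda>t. complex_of_real (cr t))"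
    "locally_bdd (\<lambda>t. complex_of_real (\<beta> t))" "locally_bdd (\<lambda>t. complex_of_real (V1 t))" "locally_bdd (\<lambda>t. complex_of_real (b1 t))"
    using V1_bound b1_bound by (blast intro: locally_bdd_of_real coefficients_measurable ca_meas cr_meas)+
qed

lemma b0_loc_int: "loc_int (\<lambda>t. complex_of_real (b0 t))"
proof (rule loc_int_of_real)
  show "loc_int b0" unfolding loc_int_def set_integrable_def using b0_int(1)
    by (intro allI integrable_mult_indicator) auto
qed

lemma b_loc_int: "loc_int (\<lambda>t. complex_of_real (b t))"
  using loc_int_add[OF b0_loc_int locally_bdd_loc_int[OF coefficients_locally_bdd(5)]] by simp

lemma ck_loc_int: "loc_int ck"
  using loc_int_Re[OF loc_int_mult_bdd[OF b_loc_int coefficients_locally_bdd(1)]] by (simp add: ck_def[abs_def] mult.commute)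

lemma LV: "radon LV"
  unfolding LV_def[abs_def] by (rule radon_mult[OF radon_signed_integral(1)[OF V0] coefficients_locally_bdd(2)])

lemma LV_outside:
  assumes f: "bdd_fun f" "\<And>x. x \<in> {- R0..R0} \<Longrightarrow> f x = 0"
  shows "signed_integral V0 f = 0" "LV f = 0"
proof -
  note s = radon_signed_integral[OF V0]
  let ?k = "\<lambda>x. complex_of_real (indicator (- {- R0..R0}) x)"
  have k: "locally_bdd ?k"
    unfolding locally_bdd_def
  proof (intro conjI allI)
    show "?k \<in> borel_measurable borel"
      by (rule measurable_compose[of "indicator (- {- R0..R0})" borel borel]) (auto intro!: borel_measurable_continuous_onI continuous_intros)
  qed (auto simp: indicator_def intro!: exI[of _ 1])
  have z: "signed_integral V0 f = 0" if f: "bdd_fun f" "\<And>x. x \<in> {- R0..R0} \<Longrightarrow> f x = 0" for f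
  proof -
    have "signed_integral V0 (\<lambda>x. ?k x * f x) = 0"
    proof (rule radon_eq_zero[OF radon_mult[OF s(1) k] _ f(1)])
      fix A :: "real set" assume A: "A \<in> sets borel" "bounded A"
      have "(\<lambda>x. ?k x * indicator A x) = indicator (A - {- R0..R0})" by (auto simp: indicator_def)
      moreover have "signed_integral V0 (indicator (A - {- R0..R0})) = of_real (V0 (A - {- R0..R0}))"
        by (rule s(2)) (use A in \<open>auto intro: bounded_subset\<close>)
      moreover have "V0 (A - {- R0..R0}) = 0" by (rule V0_support) (use A in auto)
      ultimately show "signed_integral V0 (\<lambda>x. ?k x * indicator A x) = 0" by simp
    qed
    moreover have "(\<lambda>x. ?k x * f x) = f"
    proof
      fix x show "?k x * f x = f x" using f(2)[of x] by (cases "x \<in> {- R0..R0}") auto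
    qed
    ultimately show ?thesis by simp
  qed
  show "signed_integral V0 f = 0" by (rule z[OF f])
  show "LV f = 0" unfolding LV_def by (rule z[OF bdd_fun_mult[OF coefficients_locally_bdd(2) f(1)]]) (use f(2) in simp)
qed

lemma LV_real: "Im (LV (indicator A)) = 0"
proof -
  have "(\<lambda>t. complex_of_real (cr t) * indicator A t) = (\<lambda>t. complex_of_real (cr t * indicator A t))"
    by (auto simp: indicator_def)
  then have "LV (indicator A) = of_real ((LINT t|positive_part_measure V0. cr t * indicator A t) - (LINT t|positive_part_measure (\<lambda>A. - V0 A). cr t * indicator A t))"
    unfolding LV_def signed_integral_def by (simp only: integral_complex_of_real of_real_diff)
  then show ?thesis by simp
qed

text \<open>\<open>W0\<close> is a real distribution function of \<open>V0\<close> divided by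
  \<open>h * \<beta>\<close>; the imaginary part discarded in its definition was zero on
  differences.\<close>

lemma W0_diff: "x \<le> y \<Longrightarrow> LV (indicator {x<..y}) = of_real (W0 y - W0 x)"
  using cdf_diff[OF LV, of x y] LV_real[of "{x<..y}"] by (simp add: W0_def complex_eq_iff)

text \<open>The asymmetry between the strict and the weak inequality reflects right continuity: an
  atom of \<open>V0\<close> at \<open>- R0\<close> is seen by \<open>{x<..- R0}\<close>, while
  \<open>{R0<..y}\<close> misses an atom at \<open>R0\<close>.\<close>

lemma W0_const: "x \<le> y \<Longrightarrow> y < - R0 \<Longrightarrow> W0 x = W0 y" "R0 \<le> x \<Longrightarrow> x \<le> y \<Longrightarrow> W0 x = W0 y"
proof -
  have *: "W0 x = W0 y" if "x \<le> y" "{x<..y} \<inter> {- R0..R0} = {}" for x y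
  proof -
    have "LV (indicator {x<..y}) = 0"
      by (rule LV_outside(2)) (use that(2) in \<open>auto simp: indicator_def\<close>)
    then show ?thesis using W0_diff[OF that(1)] by simp
  qed
  show "x \<le> y \<Longrightarrow> y < - R0 \<Longrightarrow> W0 x = W0 y" "R0 \<le> x \<Longrightarrow> x \<le> y \<Longrightarrow> W0 x = W0 y"
    by (rule *; auto)+
qed

lemma W0_meas [measurable]: "W0 \<in> borel_measurable borel"
  unfolding W0_def[abs_def] using cdf_borel_measurable[OF LV] by measurable

text \<open>\<open>(b t)\<^sup>2 - (b1 t)\<^sup>2 = (b0 t)\<^sup>2 + 2 * b1 t * b0 t\<close>. This
  is where both the integrability and the square integrability of \<open>b0\<close> are
  used.\<close>

lemma kb_int: "integrable lborel kb"
proof -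
  have "integrable lborel (\<lambda>t. (b0 t)\<^sup>2 + 2 * Bd * \<bar>b0 t\<bar>)" using b0_int by simp
  then have i: "integrable lborel (\<lambda>t. 1 / (h * c) * ((b0 t)\<^sup>2 + 2 * Bd * \<bar>b0 t\<bar>))" by (rule integrable_mult_right)
  show ?thesis
  proof (rule Bochner_Integration.integrable_bound[OF i])
    show "AE t in lborel. norm (kb t) \<le> norm (1 / (h * c) * ((b0 t)\<^sup>2 + 2 * Bd * \<bar>b0 t\<bar>))"
    proof (intro always_eventually allI)
      fix t
      have "\<bar>(b t)\<^sup>2 - (b1 t)\<^sup>2\<bar> = \<bar>(b0 t)\<^sup>2 + 2 * b1 t * b0 t\<bar>" by (simp add: power2_eq_square algebra_simps)
      also have "\<dots> \<le> (b0 t)\<^sup>2 + 2 * \<bar>b1 t\<bar> * \<bar>b0 t\<bar>"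
        using abs_triangle_ineq[of "(b0 t)\<^sup>2" "2 * b1 t * b0 t"] by (simp add: abs_mult)
      also have "\<dots> \<le> (b0 t)\<^sup>2 + 2 * Bd * \<bar>b0 t\<bar>"
        using b1_bound[of t] by (intro add_left_mono mult_right_mono mult_left_mono) auto
      finally have "\<bar>ca t\<bar> * \<bar>(b t)\<^sup>2 - (b1 t)\<^sup>2\<bar> \<le> 1 / (h * c) * ((b0 t)\<^sup>2 + 2 * Bd * \<bar>b0 t\<bar>)"
        using ca_pos[of t] ca_bounds(2)[of t] h c pos(4) by (intro mult_mono) auto
      then show "norm (kb t) \<le> norm (1 / (h * c) * ((b0 t)\<^sup>2 + 2 * Bd * \<bar>b0 t\<bar>))"
        unfolding kb_def real_norm_def abs_mult[of "ca t"] by (rule order_trans[OF _ abs_ge_self])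
    qed
    show "kb \<in> borel_measurable lborel" unfolding kb_def[abs_def] by measurable
  qed
qed

lemma kb_loc_int: "loc_int kb"
  unfolding loc_int_def set_integrable_def by (intro allI integrable_mult_indicator kb_int) auto

lemma Kb_prim: "prim_on UNIV Kb kb"
  using prim_on_diff[OF prim0_prim_on[OF kb_loc_int] prim_on_const] by (simp add: Kb_def[abs_def])

lemma Kb_const: "x \<le> y \<Longrightarrow> y < - R0 \<Longrightarrow> Kb x = Kb y" "R0 \<le> x \<Longrightarrow> x \<le> y \<Longrightarrow> Kb x = Kb y"
proof -
  have ae: "AE x in lborel. x \<notin> {- R0..R0} \<longrightarrow> kb x = 0" using b0_support by eventually_elim (simp add: kb_def)
  have *: "Kb x = Kb y" if "x \<le> y" "{x<..y} \<inter> {- R0..R0} = {}" for x y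
  proof -
    have "AE t in lborel. indicator {x<..y} t *\<^sub>R kb t = 0"
      using ae by eventually_elim (use that(2) in \<open>auto simp: indicator_def\<close>)
    then have "(LINT t:{x<..y}|lborel. kb t) = 0" unfolding set_lebesgue_integral_def by (rule integral_eq_zero_AE)
    then show ?thesis using prim_onD(2)[OF Kb_prim that(1)] by simp
  qed
  show "x \<le> y \<Longrightarrow> y < - R0 \<Longrightarrow> Kb x = Kb y" "R0 \<le> x \<Longrightarrow> x \<le> y \<Longrightarrow> Kb x = Kb y"
    by (rule *; auto)+
qed

lemma Kb_continuous: "continuous_on UNIV Kb"
  by (rule prim_on_UNIV_continuous[OF Kb_prim])

text \<open>The base point \<open>- R0 - 1\<close> was taken strictly to the left of all supports.
  With this normalisation \<open>Q\<close> and the flux coincide to the left, and on the right they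
  differ by the constant multiple \<open>cW R0\<close> of \<open>u\<close>.\<close>

lemma cW_left:
  assumes x: "x < - R0" shows "cW x = 0"
proof (cases "x \<le> - R0 - 1")
  case True
  then have "W0 x = W0 (- R0 - 1)" "Kb x = Kb (- R0 - 1)" by (intro W0_const(1) Kb_const(1); simp)+
  then show ?thesis by (simp add: cW_def W0_def Kb_def)
next
  case False
  then have "W0 (- R0 - 1) = W0 x" "Kb (- R0 - 1) = Kb x" using x by (intro W0_const(1) Kb_const(1); simp)+
  then show ?thesis unfolding cW_def by (simp add: W0_def[of "- R0 - 1"] Kb_def[of "- R0 - 1"])
qed

lemma cW_right: "R0 \<le> x \<Longrightarrow> cW x = cW R0"
  using W0_const(2)[of R0 x] Kb_const(2)[of R0 x] by (simp add: cW_def)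

lemma cW_meas [measurable]: "cW \<in> borel_measurable borel"
  unfolding cW_def[abs_def] using borel_measurable_continuous_onI[OF Kb_continuous] by measurable

lemma cW_bounded: "\<exists>w. \<forall>t. \<bar>cW t\<bar> \<le> w"
proof -
  obtain C where C: "\<And>x. \<bar>x\<bar> \<le> R0 \<Longrightarrow> cmod (cdf LV x) \<le> C"
    using cdf_locally_bounded[OF LV] unfolding locally_bdd_def by blast
  obtain B where B: "\<And>x. x \<in> {- R0..R0} \<Longrightarrow> norm (Kb x) \<le> B" using continuous_bounded_Icc[OF Kb_continuous] by blast
  define w where "w = C + cmod (cdf LV (- R0 - 1)) + B"
  have w: "\<bar>cW x\<bar> \<le> w" if "\<bar>x\<bar> \<le> R0" for x
  proof -
    have "\<bar>W0 x\<bar> \<le> cmod (cdf LV x - cdf LV (- R0 - 1))" unfolding W0_def by (rule abs_Re_le_cmod)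
    also have "\<dots> \<le> C + cmod (cdf LV (- R0 - 1))"
      using norm_triangle_ineq4[of "cdf LV x" "cdf LV (- R0 - 1)"] C[OF that] by linarith
    finally show ?thesis using B[of x] that unfolding cW_def w_def by (auto simp: abs_le_iff)
  qed
  have "\<bar>cW t\<bar> \<le> w" for t
  proof -
    have "0 \<le> w" "\<bar>cW R0\<bar> \<le> w" using w[of R0] R0 by auto
    then show ?thesis using cW_left[of t] cW_right[of t] w[of t]
      by (cases "t < - R0"; cases "R0 \<le> t") (auto simp: abs_le_iff)
  qed
  then show ?thesis by blast
qed

text \<open>Some bound for \<open>cW\<close>, with no control in \<open>h\<close> or in the norms of
  \<open>V0\<close> and \<open>b0\<close>. It may enter qualitative statements such as finiteness
  and membership in \<open>L2\<close>, but no constant of the final estimate.\<close>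

definition "cW1 = (SOME w. \<forall>t. \<bar>cW t\<bar> \<le> w)"

lemma cp_bound: "\<bar>cp t\<bar> \<le> 1 / (h * c) * (\<bar>E\<bar> + Bd) + 1 / (h * c) * Bd\<^sup>2"
proof -
  have "\<bar>cr t * (E - V1 t)\<bar> \<le> 1 / (h * c) * (\<bar>E\<bar> + Bd)"
    unfolding abs_mult using cr_pos[of t] cr_bounds(2)[of t] V1_bound[of t] h c by (intro mult_mono) auto
  moreover have "(b1 t)\<^sup>2 \<le> Bd\<^sup>2" using b1_bound[of t] pos(4) by (simp add: abs_le_square_iff[symmetric])
  then have "\<bar>ca t * (b1 t)\<^sup>2\<bar> \<le> 1 / (h * c) * Bd\<^sup>2"
    unfolding abs_mult using ca_pos[of t] ca_bounds(2)[of t] h c by (intro mult_mono) auto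
  ultimately show ?thesis unfolding cp_def by linarith
qed

sublocale line_system ca ck cp cr cW \<epsilon> "1 / (h * M)" "1 / (h * c)" "1 / (h * M)" "1 / (h * c)"
  "1 / (h * c) * (\<bar>E\<bar> + Bd) + 1 / (h * c) * Bd\<^sup>2" cW1
proof
  show "cp \<in> borel_measurable borel" unfolding cp_def[abs_def] by measurable
  show "\<bar>cW t\<bar> \<le> cW1" for t using someI_ex[OF cW_bounded] unfolding cW1_def by blast
qed (use ca_bounds cr_bounds cp_bound ck_loc_int eps h pos(3) in auto)

text \<open>The definition integrates against the Jordan parts of \<open>V0 + V1 dx\<close>, which
  are not the sums of the individual parts. Both sides are Radon functionals agreeing on indicators,
  so no comparison of Jordan parts is required.\<close>

lemma signed_integral_potential:
  assumes f: "bdd_fun f"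
  shows "signed_integral V f = signed_integral V0 f + (LINT x|lborel. f x * of_real (V1 x))"
proof -
  define L where "L f = signed_integral V0 f + (LINT x|lborel. f x * complex_of_real (V1 x))" for f
  have L: "radon L"
    unfolding L_def[abs_def] by (intro radon_plus radon_signed_integral(1)[OF V0] radon_density locally_bdd_loc_int coefficients_locally_bdd)
  have VA: "L (indicator A) = of_real (V A)" if A: "A \<in> sets borel" "bounded A" for A
  proof -
    have e: "(\<lambda>x. indicator A x * complex_of_real (V1 x)) = (\<lambda>x. complex_of_real (indicator A x *\<^sub>R V1 x))"
      by (auto simp: indicator_def)
    show ?thesis unfolding L_def potential_measure_def set_lebesgue_integral_def e integral_complex_of_real
      using radon_signed_integral(2)[OF V0 A] by simp
  qed
  have V: "local_signed_measure V"
    unfolding local_signed_measure_def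
  proof (intro allI impI)
    fix A :: "nat \<Rightarrow> real set" assume A: "range A \<subseteq> sets borel" "disjoint_family A" "bounded (\<Union>i. A i)"
    note * = local_signed_measureD[OF local_complex_Re[OF radon_local_complex[OF L]] A]
    have "A i \<in> sets borel" "bounded (A i)" for i using A by (auto intro: bounded_subset[OF A(3)])
    moreover have "(\<Union>i. A i) \<in> sets borel" using A(1) by auto
    ultimately show "(\<lambda>i. V (A i)) sums V (\<Union>i. A i)" using * A(3) by (simp add: VA)
  qed
  show ?thesis
    using radon_unique[OF radon_signed_integral(1)[OF V] L _ f] radon_signed_integral(2)[OF V] VA by (simp add: L_def)
qed

lemma prod_loc_int:
  assumes w: "in_L2 w"
  shows "loc_int (\<lambda>t. complex_of_real (b t) * w t)"
proof -
  have b0L2: "in_L2 (\<lambda>t. complex_of_real (b0 t))" using b0_int(2) by (auto simp: in_L2_def)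
  have "integrable lborel (\<lambda>t. complex_of_real (b0 t) * w t)"
    by (rule Bochner_Integration.integrable_bound[OF in_L2_mult_integrable[OF b0L2 w]])
      (use in_L2_measurable[OF w] in \<open>auto simp: norm_mult\<close>)
  then have "loc_int (\<lambda>t. complex_of_real (b0 t) * w t)"
    unfolding loc_int_def set_integrable_def by (intro allI integrable_mult_indicator) auto
  from loc_int_add[OF this loc_int_mult_bdd[OF in_L2_loc_int[OF w] coefficients_locally_bdd(5)]]
  show ?thesis by (simp add: algebra_simps)
qed

text \<open>Removes the choice operators: the derivative measure becomes any Radon functional whose
  distribution function represents \<open>h \<alpha> u' + i b u\<close>, and the continuous
  representative becomes \<open>U\<close>. The factor \<open>- h\<close> arises because the
  differentiated function is \<open>- h\<close> times that expression.\<close>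

lemma schroedinger_measure_eq:
  assumes H1: "in_L2 u" "in_L2 (weak_derivative u)"
    and U: "continuous_on UNIV U" "AE x in lborel. u x = U x"
    and L: "radon L" and ae: "AE x in lborel. of_real (h * \<alpha> x) * weak_derivative u x + \<i> * of_real (b x) * u x = C + cdf L x"
    and A: "A \<in> sets borel" "bounded A"
  shows "schroedinger_measure h \<alpha> \<beta> b V u A =
    - of_real h * L (\<lambda>x. of_real (\<beta> x) * indicator A x)
    + (LINT x|lborel. indicator A x * (of_real (h * \<beta> x * b x) * (- \<i> * weak_derivative u x)))
    + signed_integral V0 (\<lambda>x. U x * indicator A x) + (LINT x|lborel. indicator A x * (U x * of_real (V1 x)))"
proof -
  let ?F = "\<lambda>x. - (of_real (h\<^sup>2 * \<alpha> x) * weak_derivative u x) - \<i> * of_real (h * b x) * u x"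
  note [measurable] = in_L2_measurable[OF H1(1)] in_L2_measurable[OF H1(2)]
  have or [measurable]: "(\<lambda>x. complex_of_real (g x)) \<in> borel_measurable borel" if "g \<in> borel_measurable borel" for g
    by (rule measurable_compose[OF that]) (intro borel_measurable_continuous_onI continuous_intros)
  have Fm: "?F \<in> borel_measurable borel" by measurable
  have aeF: "AE x in lborel. ?F x = - of_real h * C + cdf (\<lambda>f. - of_real h * L f) x"
    using ae
  proof eventually_elim
    case (elim x)
    have "?F x = - of_real h * (of_real (h * \<alpha> x) * weak_derivative u x + \<i> * of_real (b x) * u x)"
      by (simp add: power2_eq_square algebra_simps)
    then show ?case unfolding elim cdf_scale by (simp add: algebra_simps)
  qed
  have bi: "bdd_fun (indicator A)" by (rule bdd_fun_indicator[OF A])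
  have e1: "(\<lambda>x. complex_of_real (indicator A x * \<beta> x)) = (\<lambda>x. of_real (\<beta> x) * indicator A x)" by (auto simp: indicator_def)
  have "complex_measure_integral (derivative_measure ?F) (\<lambda>x. of_real (indicator A x * \<beta> x)) = - of_real h * L (\<lambda>x. of_real (\<beta> x) * indicator A x)"
    unfolding e1 by (rule derivative_measure_radon(2)[OF radon_scale[OF L] Fm aeF bdd_fun_mult[OF coefficients_locally_bdd(3) bi]])
  moreover have cr: "continuous_rep u = U" by (rule continuous_rep_eq[OF U])
  have e2: "(\<lambda>x. complex_of_real (indicator A x) * U x) = (\<lambda>x. U x * indicator A x)" by (auto simp: indicator_def)
  have "signed_integral V (\<lambda>x. of_real (indicator A x) * continuous_rep u x) = signed_integral V0 (\<lambda>x. U x * indicator A x) + (LINT x|lborel. indicator A x * (U x * of_real (V1 x)))"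
    unfolding cr e2 by (subst signed_integral_potential[OF bdd_fun_mult[OF continuous_locally_bdd[OF U(1)] bi]]) (simp add: mult_ac)
  ultimately show ?thesis
    unfolding schroedinger_measure_def set_LINT_indicator by simp
qed

text \<open>The singular term of the equation, \<open>U\<close> integrated against
  \<open>V0 / (h \<beta>)\<close>, becomes an increment of \<open>W0 * U\<close> up to an absolutely
  continuous remainder. Subtracting \<open>W0 * U\<close> from the flux therefore leaves something
  absolutely continuous.\<close>

lemma W0_ibp:
  assumes p: "prim_on UNIV U w" and xy: "x \<le> y"
  shows "set_integrable lborel {x<..y} (\<lambda>s. w s * of_real (W0 s))"
    and "LV (\<lambda>t. indicator {x<..y} t * U t) = of_real (W0 y) * U y - of_real (W0 x) * U x - (LINT s:{x<..y}|lborel. w s * of_real (W0 s))"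
proof -
  note ibp = radon_ibp[OF LV xy prim_on_subset[OF p subset_UNIV]]
  have e: "indicator {x<..y} s *\<^sub>R (w s * LV (indicator {x<..s})) = indicator {x<..y} s *\<^sub>R (w s * of_real (W0 s) - w s * of_real (W0 x))" for s
  proof (cases "s \<in> {x<..y}")
    case True
    then have "LV (indicator {x<..s}) = of_real (W0 s) - of_real (W0 x)" using W0_diff[of x s] by simp
    then show ?thesis by (simp only: right_diff_distrib)
  qed simp
  have iw: "set_integrable lborel {x<..y} w" using prim_onD(1)[OF p xy] by simp
  have i: "set_integrable lborel {x<..y} (\<lambda>s. w s * of_real (W0 s) - w s * of_real (W0 x))"
    using ibp(1) unfolding set_integrable_def e .
  show i2: "set_integrable lborel {x<..y} (\<lambda>s. w s * of_real (W0 s))"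
    using set_integral_add(1)[OF i set_integrable_mult_const[OF iw, of "of_real (W0 x)"]] by simp
  have "(LINT s:{x<..y}|lborel. w s * LV (indicator {x<..s})) = (LINT s:{x<..y}|lborel. w s * of_real (W0 s) - w s * of_real (W0 x))"
    unfolding set_lebesgue_integral_def e ..
  also have "\<dots> = (LINT s:{x<..y}|lborel. w s * of_real (W0 s)) - (U y - U x) * of_real (W0 x)"
    using set_integral_diff(2)[OF i2 set_integrable_mult_const[OF iw, of "of_real (W0 x)"]] prim_onD(2)[OF p xy] by simp
  finally show "LV (\<lambda>t. indicator {x<..y} t * U t) = of_real (W0 y) * U y - of_real (W0 x) * U x - (LINT s:{x<..y}|lborel. w s * of_real (W0 s))"
    using ibp(2) W0_diff[OF xy] by (simp add: algebra_simps)
qed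

text \<open>Pointwise algebra behind the system. Substituting \<open>w\<close> into
  \<open>- \<i> * b * w\<close> produces \<open>- ca * b\<^sup>2 * u\<close>; adding
  \<open>kb * u\<close> turns this into \<open>- ca * b1\<^sup>2 * u\<close>, the magnetic part of
  \<open>cp\<close>.\<close>

lemma density_identity:
  assumes "w = of_real (ca t) * G - \<i> * of_real (ck t) * u" "Q = G - of_real (cW t) * u" "g = z * u + f"
  shows "- \<i> * of_real (b t) * w + of_real (cr t) * (u * of_real (V1 t)) - of_real (cr t) * g - w * of_real (cW t) + of_real (kb t) * u
    = - \<i> * of_real (ck t) * Q - (of_real (cp t) + \<i> * of_real \<epsilon> * of_real (cr t)) * u - of_real (cr t) * f - of_real (ca t * cW t) * G"
proof -
  have z: "z = of_real E + \<i> * of_real \<epsilon>" by (simp add: complex_eq_iff)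
  show ?thesis
    unfolding assms z ck_def cp_def kb_def by (simp add: power2_eq_square algebra_simps)
qed

end

section \<open>Equivalence of the operator equation and the first order system\<close>

context schroedinger_line
begin

text \<open>
  Tested against \<open>f / (h \<beta>)\<close>, the equation with right-hand side \<open>g\<close> says that \<open>LG\<close> is the
  distributional derivative of \<open>h \<alpha> u' + i b u\<close>; here \<open>w = u'\<close>, and \<open>U\<close> is the continuous
  representative of \<open>u\<close>.
\<close>

definition "g1 w U g s = - \<i> * of_real (b s) * w s + of_real (cr s) * (U s * of_real (V1 s)) - of_real (cr s) * g s"
definition "LG w U g f = (LINT s|lborel. f s * g1 w U g s) + LV (\<lambda>s. U s * f s)"

lemma of_real_measurable [measurable]:
  "k \<in> borel_measurable borel \<Longrightarrow> (\<lambda>x. complex_of_real (k x)) \<in> borel_measurable borel"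
  by (rule measurable_compose[of k borel borel]) (auto intro!: borel_measurable_continuous_onI continuous_intros)

lemma g1_loc_int:
  assumes w: "in_L2 w" and U: "continuous_on UNIV U" and g: "in_L2 g"
  shows "loc_int (g1 w U g)"
proof -
  note lU = continuous_locally_bdd[OF U]
  have 1: "loc_int (\<lambda>s. (of_real (b s) * w s) * (- \<i>))" by (rule loc_int_mult_bdd[OF prod_loc_int[OF w]]) simp
  have 2: "loc_int (\<lambda>s. of_real (cr s) * (U s * of_real (V1 s)))"
    by (intro locally_bdd_loc_int locally_bdd_mult coefficients_locally_bdd lU)
  have 3: "loc_int (\<lambda>s. g s * of_real (cr s))" by (rule loc_int_mult_bdd[OF in_L2_loc_int[OF g] coefficients_locally_bdd(2)])
  show ?thesis unfolding g1_def[abs_def] using loc_int_diff[OF loc_int_add[OF 1 2] 3] by (simp add: mult_ac)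
qed

lemma LG_radon:
  assumes "in_L2 w" "continuous_on UNIV U" "in_L2 g"
  shows "radon (LG w U g)"
  unfolding LG_def[abs_def]
  by (intro radon_plus radon_density g1_loc_int radon_mult[OF LV] continuous_locally_bdd assms)

text \<open>The only singular part of \<open>LG\<close> is \<open>U\<close> against
  \<open>V0 / (h \<beta>)\<close>, which \<open>W0_ibp\<close> matches with the increments of
  \<open>W0 * U\<close>.\<close>

lemma LG_prim:
  assumes p: "prim_on UNIV U w" and w: "in_L2 w" and g: "in_L2 g"
  shows "prim_on UNIV (\<lambda>t. cdf (LG w U g) t - of_real (W0 t) * U t) (\<lambda>s. g1 w U g s - w s * of_real (W0 s))"
proof (rule prim_onI)
  fix x y :: real assume xy: "x \<le> y"
  note U = prim_on_UNIV_continuous[OF p]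
  note ibp = W0_ibp[OF p xy]
  have gi: "set_integrable lborel {x<..y} (g1 w U g)" using g1_loc_int[OF w U g] unfolding loc_int_def by blast
  show "set_integrable lborel {x<..y} (\<lambda>s. g1 w U g s - w s * of_real (W0 s))"
    by (rule set_integral_diff(1)[OF gi ibp(1)])
  have "LG w U g (indicator {x<..y}) = (LINT s:{x<..y}|lborel. g1 w U g s) + LV (\<lambda>t. indicator {x<..y} t * U t)"
    unfolding LG_def set_LINT_indicator by (simp only: mult.commute)
  then show "(cdf (LG w U g) y - of_real (W0 y) * U y) - (cdf (LG w U g) x - of_real (W0 x) * U x) = (LINT s:{x<..y}|lborel. g1 w U g s - w s * of_real (W0 s))"
    using cdf_diff[OF LG_radon[OF w U g] xy] ibp(2) set_integral_diff(2)[OF gi ibp(1)] by algebra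
qed

lemma flux_prim:
  assumes p: "prim_on UNIV U w" and w: "in_L2 w" and g: "in_L2 g"
    and ae: "AE t in lborel. w t = of_real (ca t) * (C + cdf (LG w U g) t) - \<i> * of_real (ck t) * U t"
  defines "G \<equiv> \<lambda>t. C + cdf (LG w U g) t"
  defines "Q \<equiv> \<lambda>t. G t - of_real (cW t) * U t"
  shows "sol (\<lambda>t. g t - z * U t) U Q" "flux U Q = G"
proof -
  note U = prim_on_UNIV_continuous[OF p]
  show fG: "flux U Q = G" by (rule ext) (simp add: flux_def Q_def)
  note [measurable] = cdf_borel_measurable[OF LG_radon[OF w U g]] borel_measurable_continuous_onI[OF U] in_L2_measurable[OF g] in_L2_measurable[OF w]
  have [measurable]: "G \<in> borel_measurable borel" "Q \<in> borel_measurable borel" "ck \<in> borel_measurable borel" "cp \<in> borel_measurable borel"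
    unfolding G_def Q_def ck_def[abs_def] cp_def[abs_def] by measurable
  have Kp: "prim_on UNIV (\<lambda>t. complex_of_real (Kb t)) (\<lambda>t. of_real (kb t))"
    by (rule prim_on_bounded_linear[OF bounded_linear_of_real Kb_prim])
  note q = prim_on_add[OF prim_on_add[OF LG_prim[OF p w g] prim_on_mult[OF Kp p]] prim_on_const[of _ C]]
  show "sol (\<lambda>t. g t - z * U t) U Q"
    unfolding sol_def fG
  proof
    show "prim_on UNIV U (\<lambda>t. of_real (ca t) * G t - \<i> * of_real (ck t) * U t)"
      by (rule prim_on_cong_AE[OF p]) (use ae in \<open>auto simp: G_def\<close>)
    show "prim_on UNIV Q (\<lambda>t. - \<i> * of_real (ck t) * Q t - (of_real (cp t) + \<i> * of_real \<epsilon> * of_real (cr t)) * U t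
        - of_real (cr t) * (g t - z * U t) - of_real (ca t * cW t) * G t)"
    proof (rule prim_on_cong_AE)
      show "prim_on UNIV Q (\<lambda>t. g1 w U g t - w t * of_real (W0 t) + (of_real (kb t) * U t + of_real (Kb t) * w t) + 0)"
        by (rule prim_on_cong[OF q]) (simp_all add: Q_def G_def cW_def algebra_simps)
      show "AE t in lborel. t \<in> UNIV \<longrightarrow> g1 w U g t - w t * of_real (W0 t) + (of_real (kb t) * U t + of_real (Kb t) * w t) + 0
        = - \<i> * of_real (ck t) * Q t - (of_real (cp t) + \<i> * of_real \<epsilon> * of_real (cr t)) * U t
        - of_real (cr t) * (g t - z * U t) - of_real (ca t * cW t) * G t"
        using ae
      proof eventually_elim
        case (elim t)
        have "g1 w U g t - w t * of_real (W0 t) + (of_real (kb t) * U t + of_real (Kb t) * w t) + 0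
          = - \<i> * of_real (b t) * w t + of_real (cr t) * (U t * of_real (V1 t)) - of_real (cr t) * g t - w t * of_real (cW t) + of_real (kb t) * U t"
          by (simp add: g1_def cW_def algebra_simps)
        also have "\<dots> = - \<i> * of_real (ck t) * Q t - (of_real (cp t) + \<i> * of_real \<epsilon> * of_real (cr t)) * U t
            - of_real (cr t) * (g t - z * U t) - of_real (ca t * cW t) * G t"
          by (rule density_identity) (use elim in \<open>simp_all add: G_def Q_def\<close>)
        finally show ?case by simp
      qed
    qed measurable
  qed
qed

lemma cr_\<beta>: "h * \<beta> t * cr t = 1"
  using h pos(2)[of t] by (simp add: cr_def)

lemma LG_if_density:
  assumes H1: "in_L2 u" "in_L2 (weak_derivative u)"
    and U: "continuous_on UNIV U" "AE x in lborel. u x = U x"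
    and L: "radon L" and ae: "AE x in lborel. of_real (h * \<alpha> x) * weak_derivative u x + \<i> * of_real (b x) * u x = C + cdf L x"
    and g: "in_L2 g" and d: "is_density g (schroedinger_measure h \<alpha> \<beta> b V u)" and xy: "x \<le> y"
  shows "L (indicator {x<..y}) = LG (weak_derivative u) U g (indicator {x<..y})"
proof -
  let ?w = "weak_derivative u"
  let ?I = "indicator {x<..y} :: real \<Rightarrow> complex"
  define k where "k x = of_real (h * \<beta> x * b x) * (- \<i> * ?w x)" for x
  have k: "loc_int k"
    unfolding k_def[abs_def]
    using loc_int_mult_bdd[OF prod_loc_int[OF H1(2)] locally_bdd_mult[OF locally_bdd_const[of "- \<i> * of_real h"] coefficients_locally_bdd(3)]]
    by (simp add: mult_ac)
  define L1 where "L1 f = - of_real h * L (\<lambda>x. of_real (\<beta> x) * f x) + (LINT x|lborel. f x * k x)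
     + signed_integral V0 (\<lambda>x. U x * f x) + (LINT x|lborel. f x * (U x * of_real (V1 x)))" for f
  define L2 where "L2 f = (LINT x|lborel. f x * g x)" for f
  have 1: "radon L1" unfolding L1_def[abs_def]
    by (intro radon_plus radon_scale radon_mult[OF L coefficients_locally_bdd(3)] radon_density k radon_mult[OF radon_signed_integral(1)[OF V0]]
        locally_bdd_loc_int locally_bdd_mult coefficients_locally_bdd continuous_locally_bdd U)
  have 2: "radon L2" unfolding L2_def[abs_def] by (intro radon_density in_L2_loc_int g)
  \<comment> \<open>Testing with \<open>cr\<close> times the indicator undoes the factor
    \<open>h * \<beta>\<close> in front of \<open>L\<close>, so that \<open>L\<close> is evaluated
    on the interval itself.\<close>
  define f where "f x = of_real (cr x) * ?I x" for x
  have f: "bdd_fun f" unfolding f_def by (rule bdd_fun_mult[OF coefficients_locally_bdd(2) bdd_fun_Ioc])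
  have eq: "L1 f = L2 f"
  proof (rule radon_unique[OF 1 2 _ f])
    fix A :: "real set" assume A: "A \<in> sets borel" "bounded A"
    show "L1 (indicator A) = L2 (indicator A)"
      using schroedinger_measure_eq[OF H1 U L ae A] d A
      unfolding L1_def L2_def k_def is_density_def set_LINT_indicator by simp
  qed
  have c: "of_real h * (complex_of_real (\<beta> t) * of_real (cr t)) = 1" for t
    using cr_\<beta>[of t] by (metis of_real_1 of_real_mult mult.assoc)
  have e1: "of_real h * L (\<lambda>x. of_real (\<beta> x) * f x) = L ?I"
  proof -
    have "of_real h * L (\<lambda>x. of_real (\<beta> x) * f x) = L (\<lambda>x. of_real h * (of_real (\<beta> x) * f x))"
      by (rule radon_cmult[OF L bdd_fun_mult[OF coefficients_locally_bdd(3) f], symmetric])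
    also have "(\<lambda>x. of_real h * (of_real (\<beta> x) * f x)) = ?I" using c by (simp add: f_def mult.assoc[symmetric])
    finally show ?thesis .
  qed
  have ki: "f t * k t = ?I t * (- \<i> * of_real (b t) * ?w t)" for t
  proof -
    have "f t * k t = (of_real h * (of_real (\<beta> t) * of_real (cr t))) * (?I t * (- \<i> * of_real (b t) * ?w t))"
      by (simp add: f_def k_def mult_ac)
    then show ?thesis by (simp only: c mult_1)
  qed
  have e3: "signed_integral V0 (\<lambda>x. U x * f x) = LV (\<lambda>s. U s * ?I s)"
    unfolding LV_def f_def by (simp add: mult_ac)
  have i1: "integrable lborel (\<lambda>x. f x * k x)" by (rule loc_int_bdd_fun[OF k f])
  have i2: "integrable lborel (\<lambda>x. f x * (U x * of_real (V1 x)))"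
    by (rule loc_int_bdd_fun[OF _ f]) (intro locally_bdd_loc_int locally_bdd_mult coefficients_locally_bdd continuous_locally_bdd U)
  have i3: "integrable lborel (\<lambda>x. f x * g x)" by (rule loc_int_bdd_fun[OF in_L2_loc_int[OF g] f])
  have "(LINT s|lborel. ?I s * g1 ?w U g s) = (LINT s|lborel. f s * k s + f s * (U s * of_real (V1 s)) - f s * g s)"
    by (rule Bochner_Integration.integral_cong) (simp_all add: ki, simp_all add: f_def g1_def algebra_simps)
  also have "\<dots> = (LINT s|lborel. f s * k s) + (LINT s|lborel. f s * (U s * of_real (V1 s))) - (LINT s|lborel. f s * g s)"
    using i1 i2 i3 by simp
  finally show ?thesis using eq e1 e3 unfolding LG_def L1_def L2_def by algebra
qed

lemma \<alpha>_bdd: "cmod (of_real (h * \<alpha> x)) \<le> h * M"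
  using h pos(1)[of x] \<alpha>_bounds(2)[of x] by (auto simp: norm_mult)

lemma b_mult_in_L2:
  assumes U: "in_L2 U" and bd: "\<And>t. cmod (U t) \<le> K"
  shows "in_L2 (\<lambda>t. of_real (b t) * U t)"
proof -
  have b0L2: "in_L2 (\<lambda>t. complex_of_real (b0 t))" using b0_int(2) by (auto simp: in_L2_def)
  have "in_L2 (\<lambda>t. of_real (b1 t) * U t)" by (rule in_L2_mult_bdd[OF U, of _ Bd]) (use b1_bound in auto)
  from in_L2_add[OF in_L2_mult_bdd[OF b0L2 in_L2_measurable[OF U] bd] this] show ?thesis
    by (simp add: algebra_simps)
qed

text \<open>Locally bounded variation supplies some Radon functional whose distribution function
  represents \<open>h \<alpha> u' + i b u\<close>. The equation identifies it with \<open>LG\<close>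
  on half-open intervals, hence the distribution functions coincide everywhere, and
  \<open>flux_prim\<close> reads off the system.\<close>

theorem domain_imp_sol:
  assumes u: "u \<in> D" and g: "in_L2 g" and d: "is_density g (schroedinger_measure h \<alpha> \<beta> b V u)"
  shows "\<exists>U Q. (AE x in lborel. u x = U x) \<and> sol (\<lambda>t. g t - z * U t) U Q \<and> in_L2 U \<and> in_L2 (flux U Q)"
proof -
  let ?w = "weak_derivative u"
  have "in_H1 u" and lbv: "has_locally_bounded_variation_rep (\<lambda>x. of_real (h * \<alpha> x) * ?w x + \<i> * of_real (b x) * u x)"
    using u unfolding schroedinger_domain_def by auto
  note H1 = in_H1_weak_derivative[OF this(1)]
  obtain U where p: "prim_on UNIV U ?w" and U: "AE x in lborel. u x = U x" "continuous_on UNIV U"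
    using weak_derivative_prim_on[OF in_L2_loc_int[OF H1(1)] in_L2_loc_int[OF H1(2)] H1(3)] by blast
  have U2: "in_L2 U" by (rule in_L2_cong_AE[OF H1(1) borel_measurable_continuous_onI[OF U(2)] U(1)])
  obtain g0 where g0: "locally_bounded_variation g0" "AE x in lborel. of_real (h * \<alpha> x) * ?w x + \<i> * of_real (b x) * u x = g0 x"
    using lbv unfolding has_locally_bounded_variation_rep_def by blast
  obtain L C where L: "radon L" and LC: "AE x in lborel. g0 x = C + cdf L x" using locally_bounded_variation_cdf[OF g0(1)] by blast
  have ae: "AE x in lborel. of_real (h * \<alpha> x) * ?w x + \<i> * of_real (b x) * u x = C + cdf L x"
    using g0(2) LC by eventually_elim simp
  note Lg = LG_radon[OF H1(2) U(2) g]
  have cdf: "cdf L x = cdf (LG ?w U g) x" for x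
    using LG_if_density[OF H1(1,2) U(2,1) L ae g d] radon_Ioc_empty[OF L] radon_Ioc_empty[OF Lg]
    unfolding cdf_def by (metis linear)
  define G where "G t = C + cdf (LG ?w U g) t" for t
  have G: "AE t in lborel. G t = of_real (h * \<alpha> t) * ?w t + \<i> * (of_real (b t) * U t)"
    using ae U(1) by eventually_elim (simp add: G_def cdf mult.assoc)
  have w: "AE t in lborel. ?w t = of_real (ca t) * (C + cdf (LG ?w U g) t) - \<i> * of_real (ck t) * U t"
    using G
  proof eventually_elim
    case (elim t)
    have "of_real (ca t) * G t = (of_real (ca t) * of_real (h * \<alpha> t)) * ?w t + \<i> * (of_real (ck t) * U t)"
      by (simp only: elim ck_def of_real_mult) (simp add: algebra_simps)
    also have "complex_of_real (ca t) * of_real (h * \<alpha> t) = 1"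
      using h pos(1)[of t] by (simp add: ca_def flip: of_real_mult)
    finally show ?case by (simp add: G_def)
  qed
  note fp = flux_prim[OF p H1(2) g w]
  obtain K where K: "\<And>t. cmod (U t) \<le> K" using in_L2_prim_bounded[OF p U2 H1(2)] by blast
  have "in_L2 (\<lambda>t. of_real (h * \<alpha> t) * ?w t + \<i> * (of_real (b t) * U t))"
    by (intro in_L2_add in_L2_mult_bdd[OF H1(2) _ \<alpha>_bdd] in_L2_cmult b_mult_in_L2[OF U2 K]) measurable
  then have "in_L2 G"
    by (rule in_L2_cong_AE) (use G cdf_borel_measurable[OF Lg] in \<open>auto simp: G_def[abs_def]\<close>)
  then show ?thesis using fp U U2 unfolding G_def[abs_def, symmetric] by blast
qed

text \<open>The converse of \<open>LG_if_density\<close>. A density must be verified on every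
  bounded Borel set \<open>A\<close>, so \<open>LG\<close> is evaluated on \<open>\<beta>\<close>
  times the indicator of \<open>A\<close>, where \<open>h * \<beta> * cr = 1\<close> restores the
  original equation.\<close>

lemma density_if_LG:
  assumes H1: "in_L2 u" "in_L2 (weak_derivative u)" and U: "continuous_on UNIV u"
    and ae: "AE x in lborel. of_real (h * \<alpha> x) * weak_derivative u x + \<i> * of_real (b x) * u x = C + cdf (LG (weak_derivative u) u g) x"
    and g: "in_L2 g"
  shows "is_density g (schroedinger_measure h \<alpha> \<beta> b V u)"
  unfolding is_density_def
proof (intro allI impI)
  let ?w = "weak_derivative u"
  fix A :: "real set" assume A: "A \<in> sets borel" "bounded A"
  let ?I = "indicator A :: real \<Rightarrow> complex"
  define k where "k x = of_real (h * \<beta> x * b x) * (- \<i> * ?w x)" for x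
  have k: "loc_int k"
    unfolding k_def[abs_def]
    using loc_int_mult_bdd[OF prod_loc_int[OF H1(2)] locally_bdd_mult[OF locally_bdd_const[of "- \<i> * of_real h"] coefficients_locally_bdd(3)]]
    by (simp add: mult_ac)
  have I: "bdd_fun ?I" by (rule bdd_fun_indicator[OF A])
  have c: "of_real h * (complex_of_real (\<beta> t) * of_real (cr t)) = 1" for t
    using cr_\<beta>[of t] by (metis of_real_1 of_real_mult mult.assoc)
  have i1: "integrable lborel (\<lambda>x. ?I x * k x)" by (rule loc_int_bdd_fun[OF k I])
  have i2: "integrable lborel (\<lambda>x. ?I x * (u x * of_real (V1 x)))"
    by (rule loc_int_bdd_fun[OF _ I]) (intro locally_bdd_loc_int locally_bdd_mult coefficients_locally_bdd continuous_locally_bdd U)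
  have i3: "integrable lborel (\<lambda>x. ?I x * g x)" by (rule loc_int_bdd_fun[OF in_L2_loc_int[OF g] I])
  have pt: "of_real h * ((of_real (\<beta> s) * ?I s) * g1 ?w u g s) = ?I s * k s + ?I s * (u s * of_real (V1 s)) - ?I s * g s" for s
  proof -
    have "of_real h * (of_real (\<beta> s) * g1 ?w u g s)
      = k s + (of_real h * (of_real (\<beta> s) * of_real (cr s))) * (u s * of_real (V1 s)) - (of_real h * (of_real (\<beta> s) * of_real (cr s))) * g s"
      by (simp add: g1_def k_def algebra_simps)
    then show ?thesis unfolding c mult_1 by (simp add: algebra_simps indicator_def)
  qed
  have "of_real h * (LINT s|lborel. (of_real (\<beta> s) * ?I s) * g1 ?w u g s) = (LINT s|lborel. ?I s * k s + ?I s * (u s * of_real (V1 s)) - ?I s * g s)"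
    unfolding integral_mult_right_zero[symmetric] pt ..
  also have "\<dots> = (LINT s|lborel. ?I s * k s) + (LINT s|lborel. ?I s * (u s * of_real (V1 s))) - (LINT s|lborel. ?I s * g s)"
    using i1 i2 i3 by simp
  finally have 1: "of_real h * (LINT s|lborel. (of_real (\<beta> s) * ?I s) * g1 ?w u g s)
    = (LINT s|lborel. ?I s * k s) + (LINT s|lborel. ?I s * (u s * of_real (V1 s))) - (LINT s|lborel. ?I s * g s)" .
  have "of_real h * LV (\<lambda>s. u s * (of_real (\<beta> s) * ?I s)) = LV (\<lambda>s. of_real h * (u s * (of_real (\<beta> s) * ?I s)))"
    by (rule radon_cmult[OF LV, symmetric]) (intro bdd_fun_mult continuous_locally_bdd U coefficients_locally_bdd I)
  also have "\<dots> = signed_integral V0 (\<lambda>s. u s * ?I s)"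
  proof -
    have "of_real (cr s) * (of_real h * (u s * (of_real (\<beta> s) * ?I s))) = u s * ?I s" for s
      using arg_cong[OF c[of s], of "\<lambda>c. c * (u s * ?I s)"] by (simp add: mult_ac)
    then show ?thesis by (simp only: LV_def)
  qed
  finally have 2: "of_real h * LV (\<lambda>s. u s * (of_real (\<beta> s) * ?I s)) = signed_integral V0 (\<lambda>s. u s * ?I s)" .
  have "schroedinger_measure h \<alpha> \<beta> b V u A = - of_real h * LG ?w u g (\<lambda>x. of_real (\<beta> x) * ?I x) + (LINT s|lborel. ?I s * k s)
     + signed_integral V0 (\<lambda>s. u s * ?I s) + (LINT s|lborel. ?I s * (u s * of_real (V1 s)))"
    using schroedinger_measure_eq[OF H1 U _ LG_radon[OF H1(2) U g] ae A] by (simp add: k_def)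
  then show "schroedinger_measure h \<alpha> \<beta> b V u A = (LINT x:A|lborel. g x)"
    using 1 2 unfolding LG_def set_LINT_indicator by algebra
qed

lemma density_AE_unique:
  assumes "in_L2 g" "in_L2 g'" "is_density g \<nu>" "is_density g' \<nu>"
  shows "AE x in lborel. g x = g' x"
proof -
  have l: "loc_int g" "loc_int g'" using assms by (auto intro: in_L2_loc_int)
  have "AE x in lborel. g x - g' x = 0"
  proof (rule AE_zero_if_Ioc_integrals_zero[OF loc_int_diff[OF l]])
    fix x y :: real
    have "\<nu> {x<..y} = (LINT t:{x<..y}|lborel. g t)" "\<nu> {x<..y} = (LINT t:{x<..y}|lborel. g' t)"
      using assms unfolding is_density_def by auto
    moreover have "set_integrable lborel {x<..y} g" "set_integrable lborel {x<..y} g'" using l unfolding loc_int_def by auto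
    ultimately show "(LINT t:{x<..y}|lborel. g t - g' t) = 0" by (simp add: set_integral_diff)
  qed
  then show ?thesis by simp
qed

text \<open>Everything follows once the flux is recognised as a constant plus the distribution
  function of \<open>LG\<close>: this gives the locally bounded variation and the density. The bound
  on \<open>h \<alpha> u' + i b u\<close> comes from the boundedness of \<open>U\<close> and
  \<open>Q\<close>.\<close>

theorem sol_imp_domain:
  assumes s: "sol f U Q" and f: "in_L2 f" and U2: "in_L2 U" and G2: "in_L2 (flux U Q)"
  shows "U \<in> D" "AE x in lborel. P U x - z * U x = f x"
proof -
  obtain K where K: "\<And>t. cmod (U t) \<le> K" "\<And>t. cmod (Q t) \<le> K" using sol_L2_bounded[OF s f U2 G2] by blast
  note Uc = sol_continuous(1)[OF s]
  let ?G = "flux U Q"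
  define w0 where "w0 t = of_real (ca t) * ?G t - \<i> * of_real (ck t) * U t" for t
  note [measurable] = sol_measurable[OF s] in_L2_measurable[OF f]
  have pw0: "prim_on UNIV U w0" using s unfolding sol_def w0_def[abs_def] by blast
  have cab: "cmod (of_real (ca t)) \<le> 1 / (h * c)" for t using ca_pos[of t] ca_bounds(2)[of t] by simp
  have "in_L2 (\<lambda>t. of_real (ca t) * ?G t - \<i> * (of_real (ca t) * (of_real (b t) * U t)))"
    by (intro in_L2_diff in_L2_cmult in_L2_mult_bdd[OF G2 _ cab] in_L2_mult_bdd[OF b_mult_in_L2[OF U2 K(1)] _ cab]) measurable
  then have w0: "in_L2 w0" by (simp add: w0_def[abs_def] ck_def mult.assoc)
  have H: "in_H1 U" unfolding in_H1_def using U2 w0 prim_on_weak_derivative[OF pw0] by blast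
  \<comment> \<open>A chosen weak derivative, which agrees with the density \<open>w0\<close> of
    \<open>U\<close> only almost everywhere. The domain is formulated with \<open>w\<close>, the
    system with \<open>w0\<close>.\<close>
  define w where "w = weak_derivative U"
  note H1 = in_H1_weak_derivative[OF H, folded w_def]
  obtain U' where U': "prim_on UNIV U' w" "AE x in lborel. U x = U' x" "continuous_on UNIV U'"
    using weak_derivative_prim_on[OF in_L2_loc_int[OF H1(1)] in_L2_loc_int[OF H1(2)] H1(3)] by blast
  have p: "prim_on UNIV U w" using U'(1) continuous_AE_eq[OF Uc U'(3,2)] by simp
  have ww: "AE t in lborel. w t = w0 t" by (rule prim_on_unique_density[OF p pw0])
  define g where "g t = z * U t + f t" for t
  have g: "in_L2 g" unfolding g_def[abs_def] by (intro in_L2_add in_L2_cmult U2 f)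
  note [measurable] = in_L2_measurable[OF g] in_L2_measurable[OF H1(2)]
  have Kp: "prim_on UNIV (\<lambda>t. complex_of_real (Kb t)) (\<lambda>t. of_real (kb t))"
    by (rule prim_on_bounded_linear[OF bounded_linear_of_real Kb_prim])
  define q where "q t = - \<i> * of_real (ck t) * Q t - (of_real (cp t) + \<i> * of_real \<epsilon> * of_real (cr t)) * U t
        - of_real (cr t) * f t - of_real (ca t * cW t) * ?G t" for t
  have qp: "prim_on UNIV Q q" using s unfolding sol_def q_def[abs_def] by blast
  note d = prim_on_diff[OF prim_on_diff[OF qp prim_on_mult[OF Kp p]] LG_prim[OF p H1(2) g]]
  \<comment> \<open>Both \<open>Q\<close> and \<open>cdf (LG w U g) - W0 * U\<close> have known
    densities; with the correction by \<open>Kb * U\<close> they agree, so the flux minus the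
    distribution function has density 0.\<close>
  have "prim_on UNIV (\<lambda>t. ?G t - cdf (LG w U g) t) (\<lambda>t. 0)"
  proof (rule prim_on_cong_AE)
    show "prim_on UNIV (\<lambda>t. ?G t - cdf (LG w U g) t) (\<lambda>t. q t - (of_real (kb t) * U t + of_real (Kb t) * w t) - (g1 w U g t - w t * of_real (W0 t)))"
      by (rule prim_on_cong[OF d]) (simp_all add: flux_def cW_def algebra_simps)
    show "AE t in lborel. t \<in> UNIV \<longrightarrow> q t - (of_real (kb t) * U t + of_real (Kb t) * w t) - (g1 w U g t - w t * of_real (W0 t)) = 0"
      using ww
    proof eventually_elim
      case (elim t)
      have "- \<i> * of_real (b t) * w t + of_real (cr t) * (U t * of_real (V1 t)) - of_real (cr t) * g t - w t * of_real (cW t) + of_real (kb t) * U t = q t"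
        unfolding q_def by (rule density_identity) (use elim in \<open>simp_all add: w0_def flux_def g_def\<close>)
      then show ?case by (simp add: g1_def cW_def algebra_simps)
    qed
  qed simp
  then have const: "?G y - cdf (LG w U g) y = ?G x - cdf (LG w U g) x" if "x \<le> y" for x y
    using prim_onD(2)[of UNIV "\<lambda>t. ?G t - cdf (LG w U g) t" "\<lambda>t. 0" x y] that by simp
  define C where "C = ?G 0 - cdf (LG w U g) 0"
  have GC: "?G t = C + cdf (LG w U g) t" for t
    using const[of 0 t] const[of t 0] unfolding C_def by (cases "0 \<le> t") (auto simp: algebra_simps)
  have ae: "AE x in lborel. of_real (h * \<alpha> x) * w x + \<i> * of_real (b x) * U x = ?G x"
    using ww
  proof eventually_elim
    case (elim x)
    have "complex_of_real (h * \<alpha> x) * of_real (ca x) = 1"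
      using h pos(1)[of x] by (simp add: ca_def flip: of_real_mult)
    then have "of_real (h * \<alpha> x) * (of_real (ca x) * (?G x - \<i> * (of_real (b x) * U x))) = ?G x - \<i> * (of_real (b x) * U x)"
      by (metis mult.assoc mult_1)
    then show ?case unfolding elim w0_def ck_def by (simp add: algebra_simps)
  qed
  have den: "is_density g (schroedinger_measure h \<alpha> \<beta> b V U)"
    by (rule density_if_LG[of U C g]) (use H1 Uc g ae GC in \<open>simp_all add: w_def\<close>)
  show D: "U \<in> D"
    unfolding schroedinger_domain_def mem_Collect_eq w_def[symmetric]
  proof (intro conjI)
    show "in_H1 U" by (rule H)
    have "AE x in lborel. cmod (of_real (h * \<alpha> x) * w x + \<i> * of_real (b x) * U x) \<le> K + cW1 * K"
      using ae
    proof eventually_elim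
      case (elim x)
      have "cmod (?G x) \<le> cmod (Q x) + cmod (of_real (cW x) * U x)" unfolding flux_def by (rule norm_triangle_ineq)
      also have "cmod (of_real (cW x) * U x) \<le> cW1 * K"
        unfolding norm_mult using W_bound[of x] K(1)[of x] W1_nonneg by (intro mult_mono) auto
      finally show ?case unfolding elim using K(2)[of x] by linarith
    qed
    then show "in_Linf (\<lambda>x. of_real (h * \<alpha> x) * w x + \<i> * of_real (b x) * U x)"
      unfolding in_Linf_def by (intro conjI exI[of _ "K + cW1 * K"]) (auto simp: H1)
    show "has_locally_bounded_variation_rep (\<lambda>x. of_real (h * \<alpha> x) * w x + \<i> * of_real (b x) * U x)"
      unfolding has_locally_bounded_variation_rep_def
      using cdf_locally_bounded_variation[OF LG_radon[OF H1(2) Uc g]] ae unfolding GC by blast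
    show "\<exists>g. in_L2 g \<and> is_density g (schroedinger_measure h \<alpha> \<beta> b V U)" using den g by blast
  qed
  have "in_L2 (P U) \<and> is_density (P U) (schroedinger_measure h \<alpha> \<beta> b V U)"
    unfolding schroedinger_op_def by (rule someI[of _ g]) (use g den in blast)
  then have "AE x in lborel. P U x = g x" using density_AE_unique g den by blast
  then show "AE x in lborel. P U x - z * U x = f x" by eventually_elim (simp add: g_def)
qed

section \<open>Unique solvability and the resolvent\<close>

lemma op_in_L2:
  assumes "u \<in> D" shows "in_L2 (P u)" "is_density (P u) (schroedinger_measure h \<alpha> \<beta> b V u)"
proof -
  have "\<exists>g. in_L2 g \<and> is_density g (schroedinger_measure h \<alpha> \<beta> b V u)" using assms unfolding schroedinger_domain_def by blast
  then have "in_L2 (P u) \<and> is_density (P u) (schroedinger_measure h \<alpha> \<beta> b V u)"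
    unfolding schroedinger_op_def by (rule someI_ex)
  then show "in_L2 (P u)" "is_density (P u) (schroedinger_measure h \<alpha> \<beta> b V u)" by auto
qed

lemma sol_cong_AE:
  assumes s: "sol f u Q" and ae: "AE t in lborel. f t = f' t" and f': "f' \<in> borel_measurable borel"
  shows "sol f' u Q"
  unfolding sol_def
proof
  note [measurable] = sol_measurable[OF s] f'
  have [measurable]: "flux u Q \<in> borel_measurable borel" "ck \<in> borel_measurable borel" "cp \<in> borel_measurable borel"
    unfolding ck_def[abs_def] cp_def[abs_def] by measurable
  show "prim_on UNIV u (\<lambda>t. of_real (ca t) * flux u Q t - \<i> * of_real (ck t) * u t)" using s unfolding sol_def by blast
  show "prim_on UNIV Q (\<lambda>t. - \<i> * of_real (ck t) * Q t - (of_real (cp t) + \<i> * of_real \<epsilon> * of_real (cr t)) * u t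
        - of_real (cr t) * f' t - of_real (ca t * cW t) * flux u Q t)"
    by (rule prim_on_cong_AE[OF conjunct2[OF s[unfolded sol_def]]]) (use ae in \<open>auto elim!: eventually_mono\<close>)
qed

lemma equation_imp_sol:
  assumes u: "u \<in> D" and f: "in_L2 f" and eq: "AE x in lborel. P u x - z * u x = f x"
  shows "\<exists>U Q. (AE x in lborel. u x = U x) \<and> sol f U Q \<and> in_L2 U \<and> in_L2 (flux U Q)"
proof -
  obtain U Q where U: "AE x in lborel. u x = U x" "sol (\<lambda>t. P u t - z * U t) U Q" "in_L2 U" "in_L2 (flux U Q)"
    using domain_imp_sol[OF u op_in_L2[OF u]] by blast
  have "AE t in lborel. P u t - z * U t = f t" using U(1) eq by eventually_elim simp
  from sol_cong_AE[OF U(2) this in_L2_measurable[OF f]] U show ?thesis by blast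
qed

lemma equation_unique:
  assumes "u \<in> D" "v \<in> D" and f: "in_L2 f"
    and "AE x in lborel. P u x - z * u x = f x" "AE x in lborel. P v x - z * v x = f x"
  shows "AE x in lborel. v x = u x"
proof -
  obtain U Q where U: "AE x in lborel. u x = U x" "sol f U Q" "in_L2 U" "in_L2 (flux U Q)"
    using equation_imp_sol[OF assms(1) f assms(4)] by blast
  obtain X R where X: "AE x in lborel. v x = X x" "sol f X R" "in_L2 X" "in_L2 (flux X R)"
    using equation_imp_sol[OF assms(2) f assms(5)] by blast
  have s: "sol (\<lambda>t. 0) (\<lambda>t. U t - X t) (\<lambda>t. Q t - R t)" using sol_add_cmult[OF U(2) X(2), of "-1"] by simp
  have fl: "flux (\<lambda>t. U t - X t) (\<lambda>t. Q t - R t) = (\<lambda>t. flux U Q t - flux X R t)" by (auto simp: flux_def algebra_simps)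
  have UX: "in_L2 (\<lambda>t. U t - X t)" by (rule in_L2_diff[OF U(3) X(3)])
  have "(LINT t|lborel. (cmod (U t - X t))\<^sup>2) \<le> 0"
    using sol_L2_norm_bound[OF s _ UX] in_L2_diff[OF U(4) X(4)] unfolding fl by (simp add: in_L2_def)
  moreover have "0 \<le> (LINT t|lborel. (cmod (U t - X t))\<^sup>2)" by (rule Bochner_Integration.integral_nonneg) simp
  ultimately have "AE t in lborel. (cmod (U t - X t))\<^sup>2 = 0"
    using integral_nonneg_eq_0_iff_AE[OF in_L2_integrable[OF UX]] by simp
  then show ?thesis using U(1) X(1) by eventually_elim simp
qed

lemma equation_exists:
  assumes "in_L2 f" shows "\<exists>u\<in>D. AE x in lborel. P u x - z * u x = f x"
  using sol_L2_exists[OF assms] sol_imp_domain[OF _ assms] by blast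

lemma in_resolvent_set: "in_resolvent_set D P z"
  unfolding in_resolvent_set_def
proof (intro conjI allI impI)
  fix f assume f: "in_L2 f"
  then show "\<exists>u\<in>D. (AE x in lborel. P u x - z * u x = f x) \<and> (\<forall>v\<in>D. (AE x in lborel. P v x - z * v x = f x) \<longrightarrow> (AE x in lborel. v x = u x))"
    using equation_exists[OF f] equation_unique[OF _ _ f] by blast
next
  \<comment> \<open>This is \<open>M / (c * \<bar>\<epsilon>\<bar>)\<close>; the powers of
    \<open>h\<close> cancel.\<close>
  define K where "K = 1 / (h * c) / (\<bar>\<epsilon>\<bar> * (1 / (h * M)))"
  have K0: "0 \<le> K" using h c pos(3) by (simp add: K_def)
  show "\<exists>C::real. \<forall>u\<in>D. L2_norm u \<le> ennreal C * L2_norm (\<lambda>x. P u x - z * u x)"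
  proof (intro exI[of _ K] ballI)
    fix u assume u: "u \<in> D"
    let ?f = "\<lambda>x. P u x - z * u x"
    have u2: "in_L2 u" using u unfolding schroedinger_domain_def in_H1_def by blast
    have f: "in_L2 ?f" by (intro in_L2_diff in_L2_cmult op_in_L2(1)[OF u] u2)
    obtain U Q where U: "AE x in lborel. u x = U x" "sol ?f U Q" "in_L2 U" "in_L2 (flux U Q)"
      using equation_imp_sol[OF u f] by blast
    have "(LINT t|lborel. (cmod (u t))\<^sup>2) = (LINT t|lborel. (cmod (U t))\<^sup>2)"
      by (rule integral_cong_AE) (use U(1) in_L2_measurable[OF u2] in_L2_measurable[OF U(3)] in \<open>auto elim!: eventually_mono\<close>)
    then have "(LINT t|lborel. (cmod (u t))\<^sup>2) \<le> K\<^sup>2 * (LINT t|lborel. (cmod (?f t))\<^sup>2)"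
      using sol_L2_norm_bound[OF U(2) f U(3,4)] unfolding K_def by simp
    then have "sqrt (LINT t|lborel. (cmod (u t))\<^sup>2) \<le> sqrt (K\<^sup>2 * (LINT t|lborel. (cmod (?f t))\<^sup>2))" by (rule real_sqrt_le_mono)
    also have "\<dots> = K * sqrt (LINT t|lborel. (cmod (?f t))\<^sup>2)" using K0 by (simp add: real_sqrt_mult)
    finally show "L2_norm u \<le> ennreal K * L2_norm ?f"
      using u2 f K0 by (simp add: L2_norm_def flip: ennreal_mult')
  qed
qed

lemma resolvent_sol:
  assumes f: "in_L2 f"
  shows "\<exists>U Q. (AE x in lborel. resolvent D P z f x = U x) \<and> in_L2 (resolvent D P z f) \<and> sol f U Q \<and> in_L2 U \<and> in_L2 (flux U Q)"
proof -
  have "resolvent D P z f \<in> D \<and> (AE x in lborel. P (resolvent D P z f) x - z * resolvent D P z f x = f x)"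
    unfolding resolvent_def using someI_ex[OF equation_exists[OF f, unfolded Bex_def]] by simp
  moreover from this have "in_L2 (resolvent D P z f)" unfolding schroedinger_domain_def in_H1_def by blast
  ultimately show ?thesis using equation_imp_sol[OF _ f] by blast
qed

end

section \<open>The energy estimate on a half line\<close>

text \<open>The step error \<open>\<eta> * (\<tau> t - \<tau> s) * (t - s)\<close> is of second
  order. Over a uniform partition these errors add up to at most the mesh times the total increase
  of \<open>\<tau>\<close>, which disappears in the limit even though \<open>\<eta>\<close> may be
  huge. The exponential factors multiply to a single one. Information is carried from
  \<open>y\<close> down to \<open>x\<close>.\<close>

lemma Gronwall_bounded_variation:
  fixes F J \<tau> :: "real \<Rightarrow> real"
  assumes step: "\<And>s t. x \<le> s \<Longrightarrow> s \<le> t \<Longrightarrow> t \<le> y \<Longrightarrow> F s \<le> exp (C * (\<tau> t - \<tau> s)) * (F t + (J t - J s) + \<eta> * (\<tau> t - \<tau> s) * (t - s))"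
    and F: "\<And>t. 0 \<le> F t" and J: "\<And>s t. x \<le> s \<Longrightarrow> s \<le> t \<Longrightarrow> J s \<le> J t" and \<tau>: "mono \<tau>" and C: "0 \<le> C" "0 \<le> \<eta>" and xy: "x \<le> y"
  shows "F x \<le> exp (C * (\<tau> y - \<tau> x)) * (F y + (J y - J x))"
proof -
  have \<tau>: "\<tau> s \<le> \<tau> t" if "s \<le> t" for s t using monoD[OF \<tau> that] .
  have chain: "F (y - real n * d) \<le> exp (C * (\<tau> y - \<tau> (y - real n * d))) * (F y + (J y - J (y - real n * d)) + \<eta> * d * (\<tau> y - \<tau> (y - real n * d)))"
    if d: "0 \<le> d" "real n * d \<le> y - x" for n d
    using d(2)
  proof (induction n)
    case 0 show ?case using F[of y] by simp
  next
    case (Suc n)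
    define s t where "s = y - real (Suc n) * d" and "t = y - real n * d"
    have st: "x \<le> s" "s \<le> t" "t \<le> y" "t - s = d" using Suc.prems d(1) by (auto simp: s_def t_def algebra_simps)
    have ih: "F t \<le> exp (C * (\<tau> y - \<tau> t)) * (F y + (J y - J t) + \<eta> * d * (\<tau> y - \<tau> t))"
      unfolding t_def using Suc.prems d(1) by (intro Suc.IH) (simp add: algebra_simps)
    define r where "r = (J t - J s) + \<eta> * (\<tau> t - \<tau> s) * d"
    have r: "0 \<le> r" unfolding r_def using J[OF st(1,2)] \<tau>[OF st(2)] C d by (intro add_nonneg_nonneg mult_nonneg_nonneg) auto
    have "1 \<le> exp (C * (\<tau> y - \<tau> t))" using C \<tau>[OF st(3)] by simp
    then have "r \<le> exp (C * (\<tau> y - \<tau> t)) * r" using mult_right_mono[OF _ r, of 1] by simp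
    have "F s \<le> exp (C * (\<tau> t - \<tau> s)) * (F t + r)" using step[OF st(1-3)] unfolding st(4) r_def by (simp only: add.assoc)
    also have "\<dots> \<le> exp (C * (\<tau> t - \<tau> s)) * (exp (C * (\<tau> y - \<tau> t)) * (F y + (J y - J t) + \<eta> * d * (\<tau> y - \<tau> t)) + exp (C * (\<tau> y - \<tau> t)) * r)"
      using ih \<open>r \<le> _\<close> by (intro mult_left_mono add_mono) auto
    also have "\<dots> = exp (C * (\<tau> t - \<tau> s)) * exp (C * (\<tau> y - \<tau> t)) * (F y + (J y - J s) + \<eta> * d * (\<tau> y - \<tau> s))"
      by (simp add: r_def algebra_simps)
    also have "exp (C * (\<tau> t - \<tau> s)) * exp (C * (\<tau> y - \<tau> t)) = exp (C * (\<tau> y - \<tau> s))"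
      by (simp add: algebra_simps flip: exp_add)
    finally show ?case unfolding s_def .
  qed
  \<comment> \<open>The bound obtained from \<open>Suc n\<close> equal steps; only the summand with
    the mesh \<open>(y - x) / real (Suc n)\<close> depends on \<open>n\<close>.\<close>
  define e where "e n = exp (C * (\<tau> y - \<tau> x)) * (F y + (J y - J x) + \<eta> * ((y - x) / real (Suc n)) * (\<tau> y - \<tau> x))" for n
  have le: "F x \<le> e n" for n
    using chain[of "(y - x) / real (Suc n)" "Suc n"] xy by (simp add: e_def)
  have "e \<longlonglongrightarrow> exp (C * (\<tau> y - \<tau> x)) * (F y + (J y - J x) + \<eta> * ((y - x) * 0) * (\<tau> y - \<tau> x))"
    unfolding e_def divide_inverse by (intro tendsto_mult tendsto_add tendsto_const LIMSEQ_inverse_real_of_nat)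
  then show ?thesis using LIMSEQ_le_const[of e _ "F x"] le by auto
qed

text \<open>
  The parameter \<open>\<eta>\<close> of Young's inequality is chosen such that the boundary term in
  \<open>flux_energy\<close> contributes exactly \<open>S / 2\<close> to the final bound, where it can be absorbed.
\<close>

definition half_line_const :: "real \<Rightarrow> real \<Rightarrow> real \<Rightarrow> real \<Rightarrow> real \<Rightarrow> real \<Rightarrow> real \<Rightarrow> real \<Rightarrow> real" where
  "half_line_const A0 A1 P0 P1 B1 T e0 c1 =
     (let K = exp (T / min A0 P0) / min A0 P0; \<eta> = A0 / (K * A1 * B1 * e0)
      in K * (2 * (A1 * B1)) * (1 + \<eta> / (2 * A0) * (P1 * c1 + e0 * B1) + c1 / (2 * \<eta>)))"

text \<open>The equation on one exterior half line, meant for \<open>A = 1 / \<alpha>\<close>,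
  \<open>B = 1 / \<beta>\<close> and \<open>p = h * cp\<close>, with representatives whose variation
  is dominated by the increasing function \<open>\<tau>\<close>. All bounds but \<open>S\<close> are
  to be uniform in \<open>h\<close>. \<open>S\<close> is an a priori bound on the energy, finite but
  uncontrolled, which \<open>half_line_estimate\<close> improves.\<close>

locale half_line =
  fixes A p B k \<tau> :: "real \<Rightarrow> real" and u G f :: "real \<Rightarrow> complex" and h \<epsilon> A0 A1 P0 P1 B1 T S X0 :: real
  assumes h: "0 < h" and A: "0 < A0" "\<And>t. A0 \<le> A t" "\<And>t. A t \<le> A1"
    and p: "0 < P0" "\<And>t. P0 \<le> p t" "\<And>t. p t \<le> P1"
    and B: "\<And>t. 0 < B t" "\<And>t. B t \<le> B1"
    and \<tau>: "mono \<tau>" "\<And>x y. \<tau> y - \<tau> x \<le> T"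
    and A_variation: "\<And>x y. x \<le> y \<Longrightarrow> \<bar>A y - A x\<bar> \<le> \<tau> y - \<tau> x"
    and p_variation: "\<And>x y. x \<le> y \<Longrightarrow> \<bar>p y - p x\<bar> \<le> \<tau> y - \<tau> x"
    and prim_u: "prim_on {X0..} u (\<lambda>t. of_real (A t / h) * G t - \<i> * of_real (k t) * u t)"
    and prim_G: "prim_on {X0..} G (\<lambda>t. - \<i> * of_real (k t) * G t - (of_real (p t / h) + \<i> * of_real (\<epsilon> * (B t / h))) * u t - of_real (B t / h) * f t)"
    and L2: "in_L2 u" "in_L2 G" "in_L2 f"
    and S: "\<And>t. X0 \<le> t \<Longrightarrow> (cmod (u t))\<^sup>2 + (cmod (G t))\<^sup>2 \<le> S"
begin

lemma pos: "0 < A t" "0 < p t" "0 < A1" "0 < P1" "0 < B1" "0 \<le> S" "0 \<le> T"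
  using A(1) A(2,3)[of t] p(1) p(2,3)[of t] B[of t] S[of X0] \<tau>(2)[of 0 0] zero_le_power2[of "cmod (u X0)"] zero_le_power2[of "cmod (G X0)"]
  by linarith+

lemma density_u: "prim_on {X0..} (\<lambda>t. (cmod (u t))\<^sup>2) (\<lambda>t. 2 * (A t / h) * Re (G t * cnj (u t)))"
proof (rule prim_on_cong[OF prim_on_bounded_linear[OF bounded_linear_Re prim_on_mult[OF prim_u prim_on_bounded_linear[OF bounded_linear_cnj prim_u]]]])
  fix t
  show "Re (u t * cnj (u t)) = (cmod (u t))\<^sup>2" unfolding cmod_power2 by (simp add: power2_eq_square)
  show "Re ((of_real (A t / h) * G t - \<i> * of_real (k t) * u t) * cnj (u t) + u t * cnj (of_real (A t / h) * G t - \<i> * of_real (k t) * u t)) = 2 * (A t / h) * Re (G t * cnj (u t))"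
    by (simp add: algebra_simps add_divide_distrib)
qed

lemma density_G: "prim_on {X0..} (\<lambda>t. (cmod (G t))\<^sup>2)
  (\<lambda>t. - 2 * (p t / h) * Re (G t * cnj (u t)) - 2 / h * Re ((\<i> * of_real (\<epsilon> * B t) * u t + of_real (B t) * f t) * cnj (G t)))"
proof (rule prim_on_cong[OF prim_on_bounded_linear[OF bounded_linear_Re prim_on_mult[OF prim_G prim_on_bounded_linear[OF bounded_linear_cnj prim_G]]]])
  fix t
  let ?g = "- \<i> * of_real (k t) * G t - (of_real (p t / h) + \<i> * of_real (\<epsilon> * (B t / h))) * u t - of_real (B t / h) * f t"
  show "Re (G t * cnj (G t)) = (cmod (G t))\<^sup>2" unfolding cmod_power2 by (simp add: power2_eq_square)
  show "Re (?g * cnj (G t) + G t * cnj ?g) = - 2 * (p t / h) * Re (G t * cnj (u t)) - 2 / h * Re ((\<i> * of_real (\<epsilon> * B t) * u t + of_real (B t) * f t) * cnj (G t))"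
    using h by (simp add: field_simps)
qed

definition "source t = cmod (G t) * (\<bar>\<epsilon>\<bar> * cmod (u t) + cmod (f t))"
definition "F t = A t * (cmod (G t))\<^sup>2 + p t * (cmod (u t))\<^sup>2"

lemma source_integrable: "integrable lborel source"
  unfolding source_def[abs_def]
  using integrable_mult_right[OF in_L2_mult_integrable[OF L2(2,1)], of "\<bar>\<epsilon>\<bar>"] in_L2_mult_integrable[OF L2(2,3)]
  by (simp add: algebra_simps)

lemma source_nonneg: "0 \<le> source t"
  by (simp add: source_def)

lemma source_set_integrable: "set_integrable lborel {x<..y} source"
  by (rule LINT_subset_le(2)[OF source_integrable source_nonneg]) auto

lemma product_bound: "X0 \<le> t \<Longrightarrow> cmod (G t) * cmod (u t) \<le> S / 2"
  using S[of t] sum_squares_bound[of "cmod (G t)" "cmod (u t)"] by (simp add: field_simps)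

text \<open>Freeze the coefficients at the right end point \<open>t\<close>. In the derivative of
  \<open>A t * |G|^2 + p t * |u|^2\<close> the large cross terms combine to a multiple of
  \<open>p t * A r - A t * p r\<close>, which the variation of \<open>A\<close> and \<open>p\<close>
  makes small; integration over the step gains another factor \<open>t - s\<close>. Returning to the
  coefficients at \<open>s\<close> costs the exponential factor.\<close>

lemma energy_step:
  assumes st: "X0 \<le> s" "s \<le> t"
  shows "F s \<le> exp (1 / min A0 P0 * (\<tau> t - \<tau> s)) *
    (F t + (LINT r:{s<..t}|lborel. 2 / h * (A1 * B1) * source r) + 1 / h * ((P1 + A1) * S) * (\<tau> t - \<tau> s) * (t - s))"
proof -
  define d where "d = \<tau> t - \<tau> s"
  have d: "0 \<le> d" using monoD[OF \<tau>(1) st(2)] by (simp add: d_def)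
  define H where "H r = A t * (cmod (G r))\<^sup>2 + p t * (cmod (u r))\<^sup>2" for r
  define j where "j r = 2 / h * (A1 * B1) * source r" for r
  note pr = prim_on_add[OF prim_on_cmult[OF density_G, of "A t"] prim_on_cmult[OF density_u, of "p t"]]
  have j: "set_integrable lborel {s<..t} j" unfolding j_def[abs_def] using source_set_integrable by simp
  have cst: "set_integrable lborel {s<..t} (\<lambda>r. 1 / h * ((P1 + A1) * d * S))"
    by (rule bounded_measurable_set_integrable[of _ _ _ "\<bar>1 / h * ((P1 + A1) * d * S)\<bar>"]) auto
  have "(LINT r:{s<..t}|lborel. - (1 / h * ((P1 + A1) * d * S)) - j r) \<le> H t - H s"
    unfolding H_def
  proof (rule prim_on_integral_le[OF pr st(2)])
    show "{s..t} \<subseteq> {X0..}" using st by auto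
    show "set_integrable lborel {s<..t} (\<lambda>r. - (1 / h * ((P1 + A1) * d * S)) - j r)"
      using set_integral_diff(1)[OF set_integrable_mult_right[OF cst, of "-1"] j] by simp
    fix r assume r: "r \<in> {s<..t}"
    have "\<bar>A t - A r\<bar> \<le> d" "\<bar>p t - p r\<bar> \<le> d"
      using A_variation[of r t] p_variation[of r t] monoD[OF \<tau>(1), of s r] r by (auto simp: d_def)
    then have "\<bar>A t * (p t - p r) - p t * (A t - A r)\<bar> \<le> A1 * d + P1 * d"
      using A(2,3)[of t] p(2,3)[of t] pos(1,2)[of t] d
      by (intro order_trans[OF abs_triangle_ineq4] add_mono) (auto simp: abs_mult intro!: mult_mono)
    then have coef: "\<bar>p t * A r - A t * p r\<bar> \<le> (P1 + A1) * d" by (simp add: algebra_simps)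
    have "\<bar>(p t * A r - A t * p r) * Re (G r * cnj (u r))\<bar> \<le> ((P1 + A1) * d) * (S / 2)"
      unfolding abs_mult
    proof (rule mult_mono[OF coef])
      have "\<bar>Re (G r * cnj (u r))\<bar> \<le> cmod (G r * cnj (u r))" by (rule abs_Re_le_cmod)
      then show "\<bar>Re (G r * cnj (u r))\<bar> \<le> S / 2" using product_bound[of r] r st by (simp add: norm_mult)
    qed (use pos d in auto)
    then have 1: "- ((P1 + A1) * d * S) \<le> 2 * ((p t * A r - A t * p r) * Re (G r * cnj (u r)))" by (simp add: abs_le_iff)
    let ?R = "Re ((\<i> * of_real (\<epsilon> * B r) * u r + of_real (B r) * f r) * cnj (G r))"
    have "?R \<le> cmod ((\<i> * of_real (\<epsilon> * B r) * u r + of_real (B r) * f r) * cnj (G r))" by (rule complex_Re_le_cmod)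
    also have "\<dots> \<le> (\<bar>\<epsilon>\<bar> * B1 * cmod (u r) + B1 * cmod (f r)) * cmod (G r)"
      unfolding norm_mult complex_mod_cnj
      using B[of r] by (intro mult_right_mono norm_triangle_mono) (auto simp: norm_mult abs_mult intro!: mult_right_mono mult_left_mono)
    also have "\<dots> = B1 * source r" by (simp add: source_def algebra_simps)
    finally have R: "?R \<le> B1 * source r" .
    have "A t * ?R \<le> A t * (B1 * source r)" using R pos(1)[of t] by (intro mult_left_mono) auto
    also have "\<dots> \<le> A1 * (B1 * source r)" using A(3)[of t] pos(5) source_nonneg[of r] by (intro mult_right_mono mult_nonneg_nonneg) auto
    finally have 2: "A t * ?R \<le> A1 * (B1 * source r)" .
    have "- ((P1 + A1) * d * S) - 2 * (A1 * (B1 * source r)) \<le> 2 * ((p t * A r - A t * p r) * Re (G r * cnj (u r))) - 2 * (A t * ?R)"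
      using 1 2 by linarith
    from divide_right_mono[OF this less_imp_le[OF h]]
    show "- (1 / h * ((P1 + A1) * d * S)) - j r \<le> A t * (- 2 * (p r / h) * Re (G r * cnj (u r)) - 2 / h * ?R) + p t * (2 * (A r / h) * Re (G r * cnj (u r)))"
      using h by (simp add: j_def diff_divide_distrib right_diff_distrib left_diff_distrib mult_ac)
  qed
  moreover have "(LINT r:{s<..t}|lborel. - (1 / h * ((P1 + A1) * d * S)) - j r) = - (LINT r:{s<..t}|lborel. 1 / h * ((P1 + A1) * d * S)) - (LINT r:{s<..t}|lborel. j r)"
  proof -
    have "(LINT r:{s<..t}|lborel. - w) = - (LINT r:{s<..t}|lborel. w)" for w :: real by (simp add: set_lebesgue_integral_def)
    then show ?thesis using set_integral_diff(2)[OF set_integrable_mult_right[OF cst, of "-1"] j] by simp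
  qed
  moreover have "(LINT r:{s<..t}|lborel. 1 / h * ((P1 + A1) * d * S)) = 1 / h * ((P1 + A1) * S) * d * (t - s)"
    using st by (simp add: set_lebesgue_integral_def)
  moreover have "H t = F t" by (simp add: H_def F_def)
  ultimately have Hs: "H s \<le> F t + (LINT r:{s<..t}|lborel. j r) + 1 / h * ((P1 + A1) * S) * d * (t - s)" by linarith
  define m where "m = min A0 P0"
  have m: "0 < m" "m \<le> A t" "m \<le> p t" using A(1) A(2)[of t] p(1) p(2)[of t] by (auto simp: m_def)
  \<comment> \<open>A coefficient bounded below by \<open>m\<close> that moves by at most
    \<open>d\<close> changes by a factor of at most \<open>1 + d / m\<close>.\<close>
  have ratio: "y \<le> exp (1 / m * d) * x" if "m \<le> x" "\<bar>x - y\<bar> \<le> d" for x y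
  proof -
    have "d * m \<le> d * x" using that(1) d by (intro mult_left_mono)
    then have "d \<le> 1 / m * d * x" using m by (simp add: field_simps)
    then have "y \<le> (1 + 1 / m * d) * x" using that(2) by (simp add: distrib_right)
    also have "\<dots> \<le> exp (1 / m * d) * x" using that(1) m by (intro mult_right_mono exp_ge_add_one_self) auto
    finally show ?thesis .
  qed
  have "A s * (cmod (G s))\<^sup>2 \<le> exp (1 / m * d) * A t * (cmod (G s))\<^sup>2"
    by (intro mult_right_mono ratio m) (use A_variation[OF st(2)] in \<open>auto simp: d_def\<close>)
  moreover have "p s * (cmod (u s))\<^sup>2 \<le> exp (1 / m * d) * p t * (cmod (u s))\<^sup>2"
    by (intro mult_right_mono ratio m) (use p_variation[OF st(2)] in \<open>auto simp: d_def\<close>)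
  ultimately have "F s \<le> exp (1 / m * d) * H s" by (simp add: F_def H_def algebra_simps)
  also have "\<dots> \<le> exp (1 / m * d) * (F t + (LINT r:{s<..t}|lborel. j r) + 1 / h * ((P1 + A1) * S) * d * (t - s))"
    using Hs by (intro mult_left_mono) auto
  finally show ?thesis unfolding j_def d_def m_def .
qed

lemma F_nonneg: "0 \<le> F t"
  using pos(1,2)[of t] by (simp add: F_def)

lemma energy_transport:
  assumes xy: "X0 \<le> x" "x \<le> y"
  shows "F x \<le> exp (T / min A0 P0) * (F y + 2 / h * (A1 * B1) * (LINT r:{x<..y}|lborel. source r))"
proof -
  define J where "J t = (LINT r:{x<..t}|lborel. 2 / h * (A1 * B1) * source r)" for t
  have J: "J t - J s = (LINT r:{s<..t}|lborel. 2 / h * (A1 * B1) * source r)" if "x \<le> s" "s \<le> t" for s t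
  proof -
    have "set_integrable lborel {x<..t} (\<lambda>r. 2 / h * (A1 * B1) * source r)" by (intro set_integrable_mult_right source_set_integrable)
    from LINT_Ioc_split[OF this that] show ?thesis unfolding J_def by linarith
  qed
  have nn: "0 \<le> (LINT r:{s<..t}|lborel. 2 / h * (A1 * B1) * source r)" for s t
    unfolding set_lebesgue_integral_def using h pos source_nonneg by (intro Bochner_Integration.integral_nonneg) auto
  have "F x \<le> exp (1 / min A0 P0 * (\<tau> y - \<tau> x)) * (F y + (J y - J x))"
  proof (rule Gronwall_bounded_variation[OF _ F_nonneg _ \<tau>(1) _ _ xy(2)])
    fix s t assume st: "x \<le> s" "s \<le> t"
    show "F s \<le> exp (1 / min A0 P0 * (\<tau> t - \<tau> s)) * (F t + (J t - J s) + 1 / h * ((P1 + A1) * S) * (\<tau> t - \<tau> s) * (t - s))"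
      unfolding J[OF st] using energy_step[of s t] st xy by simp
    show "J s \<le> J t" using J[OF st] nn[of s t] by linarith
  qed (use A(1) p(1) h pos in auto)
  also have "J y - J x = 2 / h * (A1 * B1) * (LINT r:{x<..y}|lborel. source r)" using J[of x y] xy by simp
  also have "exp (1 / min A0 P0 * (\<tau> y - \<tau> x)) * (F y + 2 / h * (A1 * B1) * (LINT r:{x<..y}|lborel. source r))
    \<le> exp (T / min A0 P0) * (F y + 2 / h * (A1 * B1) * (LINT r:{x<..y}|lborel. source r))"
  proof (rule mult_right_mono)
    have "1 / min A0 P0 * (\<tau> y - \<tau> x) \<le> 1 / min A0 P0 * T" using \<tau>(2)[of y x] A(1) p(1) by (intro mult_left_mono) auto
    then show "exp (1 / min A0 P0 * (\<tau> y - \<tau> x)) \<le> exp (T / min A0 P0)" by simp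
    have "(LINT r:{x<..y}|lborel. source r) \<ge> 0" unfolding set_lebesgue_integral_def
      using source_nonneg by (intro Bochner_Integration.integral_nonneg) auto
    then show "0 \<le> F y + 2 / h * (A1 * B1) * (LINT r:{x<..y}|lborel. source r)"
      using F_nonneg[of y] h pos by (intro add_nonneg_nonneg mult_nonneg_nonneg) auto
  qed
  finally show ?thesis .
qed

text \<open>The real part of the derivative of \<open>G * cnj u\<close>, multiplied by
  \<open>h\<close>. The resulting factor \<open>h\<close> on the boundary term later cancels the
  \<open>1 / h\<close> in front of the source integral.\<close>

lemma flux_energy:
  assumes xy: "X0 \<le> x" "x \<le> y"
  shows "A0 * (LINT r:{x<..y}|lborel. (cmod (G r))\<^sup>2) \<le> h * (cmod (G x) * cmod (u x) + cmod (G y) * cmod (u y))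
    + P1 * (LINT r:{x<..y}|lborel. (cmod (u r))\<^sup>2) + B1 * (LINT r:{x<..y}|lborel. cmod (f r) * cmod (u r))"
proof -
  note pr0 = prim_on_bounded_linear[OF bounded_linear_Re prim_on_mult[OF prim_G prim_on_bounded_linear[OF bounded_linear_cnj prim_u]]]
  have pr: "prim_on {X0..} (\<lambda>t. Re (G t * cnj (u t))) (\<lambda>t. 1 / h * (A t * (cmod (G t))\<^sup>2 - p t * (cmod (u t))\<^sup>2 - B t * Re (f t * cnj (u t))))"
  proof (rule prim_on_cong[OF pr0])
    fix t
    show "Re ((- \<i> * of_real (k t) * G t - (of_real (p t / h) + \<i> * of_real (\<epsilon> * (B t / h))) * u t - of_real (B t / h) * f t) * cnj (u t)
        + G t * cnj (of_real (A t / h) * G t - \<i> * of_real (k t) * u t)) = 1 / h * (A t * (cmod (G t))\<^sup>2 - p t * (cmod (u t))\<^sup>2 - B t * Re (f t * cnj (u t)))"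
      unfolding cmod_power2 using h by (simp add: field_simps power2_eq_square)
  qed simp
  have iG: "set_integrable lborel {x<..y} (\<lambda>r. (cmod (G r))\<^sup>2)" and iu: "set_integrable lborel {x<..y} (\<lambda>r. (cmod (u r))\<^sup>2)"
    and if': "set_integrable lborel {x<..y} (\<lambda>r. cmod (f r) * cmod (u r))"
    by (rule LINT_subset_le(2)[OF in_L2_integrable[OF L2(2)]], simp, simp, rule LINT_subset_le(2)[OF in_L2_integrable[OF L2(1)]], simp, simp,
        rule LINT_subset_le(2)[OF in_L2_mult_integrable[OF L2(3,1)]], simp, simp)
  let ?k = "\<lambda>r. 1 / h * (A0 * (cmod (G r))\<^sup>2 - P1 * (cmod (u r))\<^sup>2 - B1 * (cmod (f r) * cmod (u r)))"
  have i: "set_integrable lborel {x<..y} (\<lambda>r. A0 * (cmod (G r))\<^sup>2 - P1 * (cmod (u r))\<^sup>2 - B1 * (cmod (f r) * cmod (u r)))"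
    using iG iu if' by (intro set_integral_diff(1) set_integrable_mult_right) auto
  have "(LINT r:{x<..y}|lborel. ?k r) \<le> Re (G y * cnj (u y)) - Re (G x * cnj (u x))"
  proof (rule prim_on_integral_le[OF pr xy(2)])
    show "set_integrable lborel {x<..y} ?k" using i by simp
    fix t
    have "Re (f t * cnj (u t)) \<le> cmod (f t) * cmod (u t)" using complex_Re_le_cmod[of "f t * cnj (u t)"] by (simp add: norm_mult)
    then have "B t * Re (f t * cnj (u t)) \<le> B t * (cmod (f t) * cmod (u t))" using B(1)[of t] by (intro mult_left_mono) auto
    also have "\<dots> \<le> B1 * (cmod (f t) * cmod (u t))" using B(2)[of t] by (intro mult_right_mono) auto
    finally have "B t * Re (f t * cnj (u t)) \<le> B1 * (cmod (f t) * cmod (u t))" .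
    moreover have "A0 * (cmod (G t))\<^sup>2 \<le> A t * (cmod (G t))\<^sup>2" "p t * (cmod (u t))\<^sup>2 \<le> P1 * (cmod (u t))\<^sup>2"
      using A(2)[of t] p(3)[of t] by (auto intro: mult_right_mono)
    ultimately show "?k t \<le> 1 / h * (A t * (cmod (G t))\<^sup>2 - p t * (cmod (u t))\<^sup>2 - B t * Re (f t * cnj (u t)))"
      using h by (intro mult_left_mono) auto
  qed (use xy in auto)
  moreover have "(LINT r:{x<..y}|lborel. ?k r) = 1 / h * (A0 * (LINT r:{x<..y}|lborel. (cmod (G r))\<^sup>2) - P1 * (LINT r:{x<..y}|lborel. (cmod (u r))\<^sup>2) - B1 * (LINT r:{x<..y}|lborel. cmod (f r) * cmod (u r)))"
    using iG iu if' by (simp add: set_integral_diff)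
  moreover have "\<bar>Re (G t * cnj (u t))\<bar> \<le> cmod (G t) * cmod (u t)" for t
    using abs_Re_le_cmod[of "G t * cnj (u t)"] by (simp add: norm_mult)
  from this[of x] this[of y] have "Re (G y * cnj (u y)) - Re (G x * cnj (u x)) \<le> cmod (G x) * cmod (u x) + cmod (G y) * cmod (u y)" by linarith
  ultimately have "1 / h * (A0 * (LINT r:{x<..y}|lborel. (cmod (G r))\<^sup>2) - P1 * (LINT r:{x<..y}|lborel. (cmod (u r))\<^sup>2) - B1 * (LINT r:{x<..y}|lborel. cmod (f r) * cmod (u r)))
    \<le> cmod (G x) * cmod (u x) + cmod (G y) * cmod (u y)" by linarith
  from mult_left_mono[OF this less_imp_le[OF h]] show ?thesis using h by simp
qed

text \<open>Transport of the energy from a far point where it is negligible. The flux in the source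
  is bounded by Young's inequality and \<open>flux_energy\<close>, the mass of \<open>u\<close> by
  the hypothesis on \<open>\<bar>\<epsilon>\<bar>\<close> times that mass. The outcome returns
  \<open>S\<close> with the factor one half.\<close>

theorem half_line_estimate:
  assumes f: "integrable lborel (\<lambda>t. cmod (f t))"
    and e0: "\<bar>\<epsilon>\<bar> \<le> e0" "0 < e0"
    and c1: "0 \<le> c1" "\<bar>\<epsilon>\<bar> * (LINT t|lborel. (cmod (u t))\<^sup>2) \<le> c1 * (LINT t|lborel. cmod (f t) * cmod (u t))"
    and x: "X0 \<le> x"
  defines "D \<equiv> half_line_const A0 A1 P0 P1 B1 T e0 c1"
  shows "(cmod (u x))\<^sup>2 + (cmod (G x))\<^sup>2 \<le> S / 2 + D / h * ((LINT t|lborel. cmod (f t) * cmod (u t)) + sqrt S * (LINT t|lborel. cmod (f t)))"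
proof (rule field_le_epsilon)
  fix d :: real assume d: "0 < d"
  define K where "K = exp (T / min A0 P0) / min A0 P0"
  define \<eta> where "\<eta> = A0 / (K * A1 * B1 * e0)"
  have D: "D = K * (2 * (A1 * B1)) * (1 + \<eta> / (2 * A0) * (P1 * c1 + e0 * B1) + c1 / (2 * \<eta>))"
    unfolding D_def half_line_const_def Let_def K_def \<eta>_def ..
  define m where "m = min A0 P0"
  have m: "0 < m" "m \<le> A x" "m \<le> p x" using A(1) A(2)[of x] p(1) p(2)[of x] by (auto simp: m_def)
  have K: "0 < K" using m(1) by (simp add: K_def flip: m_def)
  have \<eta>: "0 < \<eta>" using K A(1) pos e0 by (simp add: \<eta>_def)
  define L N where "L = (LINT t|lborel. cmod (f t) * cmod (u t))" and "N = (LINT t|lborel. cmod (f t))"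
  have LN: "0 \<le> L" "0 \<le> N" unfolding L_def N_def by (auto intro!: Bochner_Integration.integral_nonneg)
  \<comment> \<open>Chosen so that the energy at the far point, amplified by transport, together
    with the slack \<open>e\<close> itself uses up exactly \<open>d\<close>.\<close>
  define e where "e = d / (K * (A1 + P1) + 1)"
  have e: "0 < e" using d K pos by (auto simp: e_def intro!: divide_pos_pos add_pos_pos)
  have ki: "integrable lborel (\<lambda>t. (cmod (u t))\<^sup>2 + (cmod (G t))\<^sup>2)" using in_L2_integrable[OF L2(1)] in_L2_integrable[OF L2(2)] by simp
  obtain y where y: "x < y" "(cmod (u y))\<^sup>2 + (cmod (G y))\<^sup>2 < e" using integrable_small_values(1)[OF ki _ e] by auto
  have xy: "x \<le> y" using y by simp
  define NG NU NX where "NG = (LINT r:{x<..y}|lborel. (cmod (G r))\<^sup>2)" and "NU = (LINT r:{x<..y}|lborel. (cmod (u r))\<^sup>2)"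
    and "NX = (LINT r:{x<..y}|lborel. cmod (f r) * cmod (u r))"
  have NU: "NU \<le> (LINT t|lborel. (cmod (u t))\<^sup>2)" unfolding NU_def by (rule LINT_subset_le(1)[OF in_L2_integrable[OF L2(1)]]) auto
  have NX: "NX \<le> L" unfolding NX_def L_def by (rule LINT_subset_le(1)[OF in_L2_mult_integrable[OF L2(3,1)]]) auto
  have NUe: "\<bar>\<epsilon>\<bar> * NU \<le> c1 * L" using mult_left_mono[OF NU, of "\<bar>\<epsilon>\<bar>"] c1(2) by (simp add: L_def)
  have iG: "set_integrable lborel {x<..y} (\<lambda>r. (cmod (G r))\<^sup>2)" and iu: "set_integrable lborel {x<..y} (\<lambda>r. (cmod (u r))\<^sup>2)"
    and iGu: "set_integrable lborel {x<..y} (\<lambda>r. cmod (G r) * cmod (u r))" and iGf: "set_integrable lborel {x<..y} (\<lambda>r. cmod (G r) * cmod (f r))"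
    and if': "set_integrable lborel {x<..y} (\<lambda>r. cmod (f r))"
    by (rule LINT_subset_le(2)[OF in_L2_integrable[OF L2(2)]], simp, simp, rule LINT_subset_le(2)[OF in_L2_integrable[OF L2(1)]], simp, simp,
        rule LINT_subset_le(2)[OF in_L2_mult_integrable[OF L2(2,1)]], simp, simp, rule LINT_subset_le(2)[OF in_L2_mult_integrable[OF L2(2,3)]], simp, simp,
        rule LINT_subset_le(2)[OF f], simp, simp)
  have sS: "cmod (G t) \<le> sqrt S" if "X0 \<le> t" for t
  proof (rule real_le_rsqrt)
    show "(cmod (G t))\<^sup>2 \<le> S" using S[OF that] zero_le_power2[of "cmod (u t)"] by linarith
  qed
  have Gf: "(LINT r:{x<..y}|lborel. cmod (G r) * cmod (f r)) \<le> sqrt S * N"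
  proof -
    have "(LINT r:{x<..y}|lborel. cmod (G r) * cmod (f r)) \<le> (LINT r:{x<..y}|lborel. sqrt S * cmod (f r))"
      using if' sS x by (intro set_integral_mono[OF iGf] set_integrable_mult_right mult_right_mono) auto
    also have "\<dots> = sqrt S * (LINT r:{x<..y}|lborel. cmod (f r))" by simp
    also have "(LINT r:{x<..y}|lborel. cmod (f r)) \<le> N" unfolding N_def by (rule LINT_subset_le(1)[OF f]) auto
    finally show ?thesis using pos(6) by (simp add: mult_left_mono)
  qed
  have Gu: "(LINT r:{x<..y}|lborel. cmod (G r) * cmod (u r)) \<le> \<eta> / 2 * NG + NU / (2 * \<eta>)"
  proof -
    have "(LINT r:{x<..y}|lborel. cmod (G r) * cmod (u r)) \<le> (LINT r:{x<..y}|lborel. \<eta> / 2 * (cmod (G r))\<^sup>2 + (cmod (u r))\<^sup>2 / (2 * \<eta>))"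
    proof (intro set_integral_mono[OF iGu] set_integral_add(1))
      show "set_integrable lborel {x<..y} (\<lambda>r. \<eta> / 2 * (cmod (G r))\<^sup>2)" "set_integrable lborel {x<..y} (\<lambda>r. (cmod (u r))\<^sup>2 / (2 * \<eta>))"
        using iG iu by auto
      show "cmod (G r) * cmod (u r) \<le> \<eta> / 2 * (cmod (G r))\<^sup>2 + (cmod (u r))\<^sup>2 / (2 * \<eta>)" for r
        using Young_ineq[OF \<eta>, of "cmod (u r)" "cmod (G r)"] by (simp add: mult.commute)
    qed
    also have "\<dots> = \<eta> / 2 * NG + NU / (2 * \<eta>)"
      unfolding NG_def NU_def using iG iu by (subst set_integral_add) auto
    finally show ?thesis .
  qed
  have prod_y: "cmod (G y) * cmod (u y) \<le> e / 2"
    using y(2) sum_squares_bound[of "cmod (G y)" "cmod (u y)"] by (simp add: field_simps)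
  have "A0 * NG \<le> h * ((S + e) / 2) + P1 * NU + B1 * L"
  proof -
    have "h * (cmod (G x) * cmod (u x) + cmod (G y) * cmod (u y)) \<le> h * ((S + e) / 2)"
      using h product_bound[OF x] prod_y by (intro mult_left_mono) auto
    moreover have "B1 * NX \<le> B1 * L" using NX pos(5) by (intro mult_left_mono) auto
    ultimately show ?thesis using flux_energy[OF x xy] unfolding NG_def NU_def NX_def by linarith
  qed
  \<comment> \<open>Multiplication by \<open>\<bar>\<epsilon>\<bar>\<close> is essential:
    \<open>NU\<close> alone has no bound uniform in \<open>\<epsilon>\<close>, whereas
    \<open>\<bar>\<epsilon>\<bar> * NU\<close> is controlled by \<open>c1 * L\<close>. The remaining
    terms only need \<open>\<bar>\<epsilon>\<bar> \<le> e0\<close>.\<close>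
  then have "\<bar>\<epsilon>\<bar> * (A0 * NG) \<le> \<bar>\<epsilon>\<bar> * (h * ((S + e) / 2) + P1 * NU + B1 * L)" by (intro mult_left_mono) auto
  also have "\<dots> = \<bar>\<epsilon>\<bar> * (h * ((S + e) / 2)) + P1 * (\<bar>\<epsilon>\<bar> * NU) + \<bar>\<epsilon>\<bar> * (B1 * L)" by (simp add: algebra_simps)
  also have "\<dots> \<le> e0 * (h * ((S + e) / 2)) + P1 * (c1 * L) + e0 * (B1 * L)"
    using e0 NUe h e pos LN by (intro add_mono mult_right_mono mult_left_mono mult_nonneg_nonneg) auto
  also have "\<dots> = A0 * (1 / A0 * (e0 * h * ((S + e) / 2) + (P1 * c1 + e0 * B1) * L))" using A(1) by (simp add: algebra_simps)
  finally have NG: "\<bar>\<epsilon>\<bar> * NG \<le> 1 / A0 * (e0 * h * ((S + e) / 2) + (P1 * c1 + e0 * B1) * L)"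
    using A(1) by (simp only: mult.left_commute[of _ A0] mult_le_cancel_left_pos)
  have "(LINT r:{x<..y}|lborel. source r) = \<bar>\<epsilon>\<bar> * (LINT r:{x<..y}|lborel. cmod (G r) * cmod (u r)) + (LINT r:{x<..y}|lborel. cmod (G r) * cmod (f r))"
  proof -
    have "(LINT r:{x<..y}|lborel. source r) = (LINT r:{x<..y}|lborel. \<bar>\<epsilon>\<bar> * (cmod (G r) * cmod (u r)) + cmod (G r) * cmod (f r))"
      by (simp add: source_def algebra_simps)
    then show ?thesis using iGu iGf by (simp add: set_integral_add)
  qed
  also have "\<dots> \<le> \<bar>\<epsilon>\<bar> * (\<eta> / 2 * NG + NU / (2 * \<eta>)) + sqrt S * N"
    using Gu Gf by (intro add_mono mult_left_mono) auto
  also have "\<bar>\<epsilon>\<bar> * (\<eta> / 2 * NG + NU / (2 * \<eta>)) = \<eta> / 2 * (\<bar>\<epsilon>\<bar> * NG) + 1 / (2 * \<eta>) * (\<bar>\<epsilon>\<bar> * NU)" using \<eta> by (simp add: field_simps)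
  also have "\<dots> \<le> \<eta> / 2 * (1 / A0 * (e0 * h * ((S + e) / 2) + (P1 * c1 + e0 * B1) * L)) + 1 / (2 * \<eta>) * (c1 * L)"
    using NG NUe \<eta> by (intro add_mono mult_left_mono) auto
  finally have src: "(LINT r:{x<..y}|lborel. source r) \<le> \<eta> / (2 * A0) * (e0 * h * ((S + e) / 2)) + (\<eta> / (2 * A0) * (P1 * c1 + e0 * B1) + c1 / (2 * \<eta>)) * L + sqrt S * N"
    using A(1) \<eta> by (simp add: algebra_simps add_divide_distrib)
  define q where "q = \<eta> / (2 * A0) * (P1 * c1 + e0 * B1) + c1 / (2 * \<eta>)"
  have q: "0 \<le> q" unfolding q_def using \<eta> A(1) pos c1 e0 by (intro add_nonneg_nonneg mult_nonneg_nonneg divide_nonneg_nonneg) auto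
  have "q * L + sqrt S * N \<le> (1 + q) * (L + sqrt S * N)" using q LN pos(6) by (simp add: algebra_simps add_increasing)
  with src have src2: "(LINT r:{x<..y}|lborel. source r) \<le> \<eta> / (2 * A0) * (e0 * h * ((S + e) / 2)) + (1 + q) * (L + sqrt S * N)"
    unfolding q_def by linarith
  have Fy: "F y \<le> (A1 + P1) * e"
  proof -
    have "F y \<le> A1 * (cmod (G y))\<^sup>2 + P1 * (cmod (u y))\<^sup>2" unfolding F_def using A(3) p(3) by (intro add_mono mult_right_mono) auto
    also have "\<dots> \<le> A1 * e + P1 * e"
      using y(2) pos(3,4) zero_le_power2[of "cmod (u y)"] zero_le_power2[of "cmod (G y)"] by (intro add_mono mult_left_mono) linarith+
    finally show ?thesis by (simp add: algebra_simps)
  qed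
  have "m * ((cmod (u x))\<^sup>2 + (cmod (G x))\<^sup>2) \<le> F x"
    unfolding F_def using m mult_right_mono[OF m(2), of "(cmod (G x))\<^sup>2"] mult_right_mono[OF m(3), of "(cmod (u x))\<^sup>2"] by (simp add: algebra_simps)
  also have "\<dots> \<le> (m * K) * (F y + 2 / h * (A1 * B1) * (LINT r:{x<..y}|lborel. source r))"
    using energy_transport[OF x xy] m(1) by (simp add: K_def flip: m_def)
  also have "\<dots> \<le> (m * K) * ((A1 + P1) * e + 2 / h * (A1 * B1) * (\<eta> / (2 * A0) * (e0 * h * ((S + e) / 2)) + (1 + q) * (L + sqrt S * N)))"
    using Fy src2 m(1) K h pos by (intro mult_left_mono add_mono) auto
  finally have "(cmod (u x))\<^sup>2 + (cmod (G x))\<^sup>2 \<le> K * ((A1 + P1) * e + 2 / h * (A1 * B1) * (\<eta> / (2 * A0) * (e0 * h * ((S + e) / 2)) + (1 + q) * (L + sqrt S * N)))"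
    using m(1) by (simp add: mult.assoc)
  also have "\<dots> = K * (A1 + P1) * e + K * (2 / h * (A1 * B1)) * (\<eta> / (2 * A0) * (e0 * h * ((S + e) / 2))) + D / h * (L + sqrt S * N)"
  proof -
    have Dq: "D = K * (2 * (A1 * B1)) * (1 + q)" by (simp add: D q_def add.assoc)
    have "K * ((A1 + P1) * e + 2 / h * (A1 * B1) * (X + (1 + q) * Y)) = K * (A1 + P1) * e + K * (2 / h * (A1 * B1)) * X + D / h * Y" for X Y
      unfolding Dq using h by (simp add: field_simps)
    then show ?thesis .
  qed
  also have "K * (2 / h * (A1 * B1)) * (\<eta> / (2 * A0) * (e0 * h * ((S + e) / 2))) = (S + e) / 2"
    using K pos(3,5) e0(2) A(1) h unfolding \<eta>_def by (simp add: field_simps)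
  also have "K * (A1 + P1) * e + (S + e) / 2 + D / h * (L + sqrt S * N) \<le> S / 2 + D / h * (L + sqrt S * N) + d"
  proof -
    have "(K * (A1 + P1) + 1) * e = d" using K pos unfolding e_def by (simp add: add_pos_pos less_imp_neq[symmetric])
    then have "K * (A1 + P1) * e + e = d" by (simp add: distrib_right)
    moreover have "Z + (S + e) / 2 + X \<le> S / 2 + X + d" if "Z + e = d" for Z X using that e by (simp add: field_simps)
    ultimately show ?thesis by blast
  qed
  finally show "(cmod (u x))\<^sup>2 + (cmod (G x))\<^sup>2 \<le> S / 2 + D / h * ((LINT t|lborel. cmod (f t) * cmod (u t)) + sqrt S * (LINT t|lborel. cmod (f t))) + d"
    unfolding L_def N_def .
qed

end

section \<open>The exterior estimate\<close>

text \<open>Clipping to \<open>[a, b]\<close> leaves the class of \<open>f\<close> unchanged almost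
  everywhere and, being 1-Lipschitz, keeps the domination by \<open>\<tau>\<close>. It turns almost
  everywhere bounds into bounds at every point.\<close>

lemma bounded_representative:
  fixes f :: "real \<Rightarrow> real"
  assumes "bounded_variation f" "total_variation_norm (derivative_measure (\<lambda>x. of_real (f x))) \<le> ennreal M" "a \<le> b"
    and ae: "AE x in lborel. a \<le> f x \<and> f x \<le> b"
  shows "\<exists>g \<tau>. (AE x in lborel. f x = g x) \<and> g \<in> borel_measurable borel \<and> (\<forall>x. a \<le> g x \<and> g x \<le> b) \<and>
    mono \<tau> \<and> (\<forall>x. 0 \<le> \<tau> x \<and> \<tau> x \<le> 2 * \<bar>M\<bar>) \<and> (\<forall>x y. x \<le> y \<longrightarrow> \<bar>g y - g x\<bar> \<le> \<tau> y - \<tau> x)"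
proof -
  obtain g \<tau> where g: "AE x in lborel. f x = g x" "g \<in> borel_measurable borel" and \<tau>: "mono \<tau>" "\<And>x. 0 \<le> \<tau> x" "\<And>x. \<tau> x \<le> 2 * \<bar>M\<bar>"
    and v: "\<And>x y. x \<le> y \<Longrightarrow> \<bar>g y - g x\<bar> \<le> \<tau> y - \<tau> x"
    by (rule total_variation_representative[OF assms(1,2)]) blast
  define k where "k x = max a (min b (g x))" for x
  have "AE x in lborel. f x = k x" using g(1) ae by eventually_elim (auto simp: k_def)
  moreover have "k \<in> borel_measurable borel" unfolding k_def[abs_def] using g(2) by measurable
  moreover have "a \<le> k x \<and> k x \<le> b" for x using assms(3) by (auto simp: k_def)
  moreover have "\<bar>k y - k x\<bar> \<le> \<tau> y - \<tau> x" if "x \<le> y" for x y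
  proof -
    have "\<bar>max a (min b r) - max a (min b r')\<bar> \<le> \<bar>r - r'\<bar>" for r r' :: real
      unfolding max_def min_def by (smt (verit))
    then show ?thesis unfolding k_def by (rule order_trans[OF _ v[OF that]])
  qed
  ultimately show ?thesis using \<tau> by (intro exI[of _ k] exI[of _ \<tau>]) simp
qed

lemma in_L2_reflect:
  assumes "in_L2 f" shows "in_L2 (\<lambda>x. f (- x))"
  unfolding in_L2_def
proof
  have [measurable]: "f \<in> borel_measurable borel" by (rule in_L2_measurable[OF assms])
  show "(\<lambda>x. f (- x)) \<in> borel_measurable borel" by measurable
  show "integrable lborel (\<lambda>x. (cmod (f (- x)))\<^sup>2)"
    using lborel_integrable_real_affine[OF in_L2_integrable[OF assms], of "-1" 0] by simp
qed

lemma LINT_reflect: "(LINT x|lborel. g (- x)) = (LINT x|lborel. g x)" for g :: "real \<Rightarrow> real"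
  using lborel_integral_real_affine[of "-1" g 0] by simp

text \<open>\<open>half_line_const\<close> at the bounds available in the exterior. The penultimate
  group bounds a total variation: Lipschitz constants of \<open>1 / \<alpha>\<close> and
  \<open>p\<close> in the four coefficients, times \<open>8 * M\<close>, since each coefficient
  contributes at most \<open>2 * M\<close>. The last argument \<open>M / c\<close> is the quotient
  of the bounds on \<open>1 / \<beta>\<close> in \<open>sol_L2_estimate\<close>.\<close>

definition exterior_const :: "real \<Rightarrow> real \<Rightarrow> real \<Rightarrow> real \<Rightarrow> real \<Rightarrow> real" where
  "exterior_const c M \<delta> Em e0 =
     half_line_const (1 / M) (1 / c) (\<delta> / M) (\<delta> / M + ((Em + M) / c + M\<^sup>2 / c)) (1 / c)
       (((Em + M) / c\<^sup>2 + 1 / c + M\<^sup>2 / c\<^sup>2 + 2 * M / c + 1 / c\<^sup>2) * (8 * M)) e0 (M / c)"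

locale schroedinger_exterior = schroedinger_line +
  fixes R Em e0 \<delta> :: real
  assumes R: "R0 \<le> R" and E_bound: "\<bar>E\<bar> \<le> Em" and eps_bound: "\<bar>\<epsilon>\<bar> \<le> e0" and \<delta>: "0 < \<delta>"
    and exterior: "\<And>x. R \<le> \<bar>x\<bar> \<Longrightarrow> \<delta> \<le> inverse (\<beta> x) * \<alpha> x * (E - V1 x) + (b1 x)\<^sup>2"
    and V1_AE: "AE x in lborel. \<bar>V1 x\<bar> \<le> M" and b1_AE: "AE x in lborel. \<bar>b1 x\<bar> \<le> M"
    and variation: "total_variation_norm (derivative_measure (\<lambda>x. of_real (V1 x))) \<le> ennreal M"
      "total_variation_norm (derivative_measure (\<lambda>x. of_real (b1 x))) \<le> ennreal M"
      "total_variation_norm (derivative_measure (\<lambda>x. of_real (\<alpha> x))) \<le> ennreal M"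
      "total_variation_norm (derivative_measure (\<lambda>x. of_real (\<beta> x))) \<le> ennreal M"
begin

text \<open>The variation bounds hold for representatives, whereas exterior positivity is assumed
  for the coefficients themselves. Almost everywhere outside \<open>R\<close> both apply to the same
  values. The monotone function is a multiple of the sum of those of the four coefficients, which
  dominates \<open>1 / \<alpha>\<close> and \<open>p\<close> simultaneously.\<close>

lemma coefficient_representatives:
  "\<exists>A p \<tau>. A \<in> borel_measurable borel \<and> p \<in> borel_measurable borel \<and>
     (AE x in lborel. 1 / \<alpha> x = A x) \<and> (AE x in lborel. R \<le> \<bar>x\<bar> \<longrightarrow> h * cp x = p x) \<and>
     (\<forall>x. 1 / M \<le> A x \<and> A x \<le> 1 / c) \<and> (\<forall>x. \<delta> / M \<le> p x \<and> p x \<le> \<delta> / M + ((Em + M) / c + M\<^sup>2 / c)) \<and>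
     mono \<tau> \<and> (\<forall>x y. \<tau> y - \<tau> x \<le> ((Em + M) / c\<^sup>2 + 1 / c + M\<^sup>2 / c\<^sup>2 + 2 * M / c + 1 / c\<^sup>2) * (8 * M)) \<and>
     (\<forall>x y. x \<le> y \<longrightarrow> \<bar>A y - A x\<bar> \<le> \<tau> y - \<tau> x \<and> \<bar>p y - p x\<bar> \<le> \<tau> y - \<tau> x)"
proof -
  have cM: "c \<le> M" using \<alpha>_bounds[of 0] by linarith
  have M: "0 < M" by (rule pos(3))
  have Em: "0 \<le> Em" using E_bound by linarith
  have bv: "bounded_variation \<alpha>" "bounded_variation \<beta>" "bounded_variation V1" "bounded_variation b1"
    using coefficients unfolding coefficients_def by auto
  obtain al ta where al: "AE x in lborel. \<alpha> x = al x" "al \<in> borel_measurable borel" "\<And>x. c \<le> al x \<and> al x \<le> M" "mono ta"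
    "\<And>x. 0 \<le> ta x \<and> ta x \<le> 2 * \<bar>M\<bar>" "\<And>x y. x \<le> y \<Longrightarrow> \<bar>al y - al x\<bar> \<le> ta y - ta x"
    using bounded_representative[OF bv(1) variation(3) cM] \<alpha>_bounds by auto
  obtain be tb where be: "AE x in lborel. \<beta> x = be x" "be \<in> borel_measurable borel" "\<And>x. c \<le> be x \<and> be x \<le> M" "mono tb"
    "\<And>x. 0 \<le> tb x \<and> tb x \<le> 2 * \<bar>M\<bar>" "\<And>x y. x \<le> y \<Longrightarrow> \<bar>be y - be x\<bar> \<le> tb y - tb x"
    using bounded_representative[OF bv(2) variation(4) cM] \<beta>_bounds by auto
  have aeV: "AE x in lborel. - M \<le> V1 x \<and> V1 x \<le> M" using V1_AE by eventually_elim auto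
  have aeb: "AE x in lborel. - M \<le> b1 x \<and> b1 x \<le> M" using b1_AE by eventually_elim auto
  obtain v tv where v: "AE x in lborel. V1 x = v x" "v \<in> borel_measurable borel" "\<And>x. - M \<le> v x \<and> v x \<le> M" "mono tv"
    "\<And>x. 0 \<le> tv x \<and> tv x \<le> 2 * \<bar>M\<bar>" "\<And>x y. x \<le> y \<Longrightarrow> \<bar>v y - v x\<bar> \<le> tv y - tv x"
    using bounded_representative[OF bv(3) variation(1) _ aeV] M by auto
  obtain w tw where w: "AE x in lborel. b1 x = w x" "w \<in> borel_measurable borel" "\<And>x. - M \<le> w x \<and> w x \<le> M" "mono tw"
    "\<And>x. 0 \<le> tw x \<and> tw x \<le> 2 * \<bar>M\<bar>" "\<And>x y. x \<le> y \<Longrightarrow> \<bar>w y - w x\<bar> \<le> tw y - tw x"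
    using bounded_representative[OF bv(4) variation(2) _ aeb] M by auto
  note [measurable] = al(2) be(2) v(2) w(2)
  define K where "K = (Em + M) / c\<^sup>2 + 1 / c + M\<^sup>2 / c\<^sup>2 + 2 * M / c + 1 / c\<^sup>2"
  define s where "s x = ta x + tb x + tv x + tw x" for x
  define A B where "A x = 1 / al x" and "B x = 1 / be x" for x
  define q where "q x = (E - v x) * B x + (w x)\<^sup>2 * A x" for x
  \<comment> \<open>Inside \<open>R\<close> the function \<open>q\<close> may be negative, and a
    representative may misbehave on null sets. The maximum is bounded below everywhere, varies no
    more than \<open>q\<close>, and equals \<open>q\<close> almost everywhere in the exterior,
    because dividing the positivity assumption by \<open>\<alpha> \<le> M\<close> gives at least
    \<open>\<delta> / M\<close>.\<close>
  define p where "p x = max (\<delta> / M) (q x)" for x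
  have ap: "0 < al x" "0 < be x" for x using c al(3)[of x] be(3)[of x] by linarith+
  have inv: "\<bar>1 / y - 1 / x\<bar> \<le> \<bar>y - x\<bar> / c\<^sup>2" if "c \<le> x" "c \<le> y" for x y :: real
  proof -
    have xy: "0 < x" "0 < y" using that c by linarith+
    have "\<bar>1 / y - 1 / x\<bar> = \<bar>(x - y) / (x * y)\<bar>" using xy by (simp add: field_simps)
    also have "\<dots> = \<bar>y - x\<bar> / (x * y)" using xy by (simp add: abs_minus_commute)
    also have "\<dots> \<le> \<bar>y - x\<bar> / c\<^sup>2"
      using that c xy unfolding power2_eq_square by (intro divide_left_mono mult_mono mult_pos_pos) auto
    finally show ?thesis .
  qed
  have ABb: "0 < A x" "A x \<le> 1 / c" "1 / M \<le> A x" "0 < B x" "B x \<le> 1 / c" for x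
    using ap[of x] al(3)[of x] be(3)[of x] c M by (auto simp: A_def B_def intro!: divide_left_mono mult_pos_pos)
  have d: "0 \<le> ta y - ta x" "0 \<le> tb y - tb x" "0 \<le> tv y - tv x" "0 \<le> tw y - tw x" if "x \<le> y" for x y
    using monoD[OF al(4) that] monoD[OF be(4) that] monoD[OF v(4) that] monoD[OF w(4) that] by auto
  have K0: "0 \<le> K" using Em M c by (auto simp: K_def intro!: add_nonneg_nonneg)
  have Ad: "\<bar>A y - A x\<bar> \<le> (ta y - ta x) / c\<^sup>2" if "x \<le> y" for x y
    using inv[of "al x" "al y"] al(3)[of x] al(3)[of y] divide_right_mono[OF al(6)[OF that], of "c\<^sup>2"] unfolding A_def by auto
  have Bd: "\<bar>B y - B x\<bar> \<le> (tb y - tb x) / c\<^sup>2" if "x \<le> y" for x y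
    using inv[of "be x" "be y"] be(3)[of x] be(3)[of y] divide_right_mono[OF be(6)[OF that], of "c\<^sup>2"] unfolding B_def by auto
  have Kge: "1 / c\<^sup>2 \<le> K" "(Em + M) / c\<^sup>2 \<le> K" "1 / c \<le> K" "M\<^sup>2 / c\<^sup>2 + 1 / c\<^sup>2 \<le> K" "2 * M / c \<le> K"
    using Em M c unfolding K_def
    by (auto intro!: add_increasing add_increasing2)
  have AdK: "\<bar>A y - A x\<bar> \<le> K * s y - K * s x" if xy: "x \<le> y" for x y
  proof -
    have "(ta y - ta x) / c\<^sup>2 \<le> K * (ta y - ta x)" using mult_right_mono[OF Kge(1) d(1)[OF xy]] by simp
    also have "\<dots> \<le> K * (s y - s x)" using d[OF xy] K0 by (intro mult_left_mono) (auto simp: s_def)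
    finally show ?thesis using Ad[OF xy] by (simp add: right_diff_distrib)
  qed
  have qd: "\<bar>q y - q x\<bar> \<le> K * s y - K * s x" if xy: "x \<le> y" for x y
  proof -
    have "q y - q x = (E - v y) * (B y - B x) + (- (v y - v x)) * B x + ((w y)\<^sup>2 * (A y - A x) + ((w y + w x) * (w y - w x)) * A x)"
      by (simp add: q_def power2_eq_square algebra_simps)
    also have "\<bar>\<dots>\<bar> \<le> (\<bar>(E - v y) * (B y - B x)\<bar> + \<bar>(- (v y - v x)) * B x\<bar>) + (\<bar>(w y)\<^sup>2 * (A y - A x)\<bar> + \<bar>((w y + w x) * (w y - w x)) * A x\<bar>)"
      by (intro order_trans[OF abs_triangle_ineq] add_mono abs_triangle_ineq)
    also have "\<dots> \<le> ((Em + M) * ((tb y - tb x) / c\<^sup>2) + (tv y - tv x) * (1 / c)) + (M\<^sup>2 * ((ta y - ta x) / c\<^sup>2) + (2 * M * (tw y - tw x)) * (1 / c))"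
    proof (intro add_mono)
      have "\<bar>E - v y\<bar> \<le> Em + M" using E_bound v(3)[of y] by (auto simp: abs_le_iff)
      then show "\<bar>(E - v y) * (B y - B x)\<bar> \<le> (Em + M) * ((tb y - tb x) / c\<^sup>2)"
        unfolding abs_mult using Bd[OF xy] Em M by (intro mult_mono) auto
      show "\<bar>(- (v y - v x)) * B x\<bar> \<le> (tv y - tv x) * (1 / c)"
        unfolding abs_mult using v(6)[OF xy] ABb[of x] d[OF xy] by (intro mult_mono) auto
      have "(w y)\<^sup>2 \<le> M\<^sup>2" using w(3)[of y] M by (intro power2_le_iff_abs_le[THEN iffD2]) auto
      then show "\<bar>(w y)\<^sup>2 * (A y - A x)\<bar> \<le> M\<^sup>2 * ((ta y - ta x) / c\<^sup>2)"
        unfolding abs_mult using Ad[OF xy] by (intro mult_mono) auto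
      have "\<bar>w y + w x\<bar> \<le> 2 * M" using w(3)[of y] w(3)[of x] by (auto simp: abs_le_iff)
      then show "\<bar>((w y + w x) * (w y - w x)) * A x\<bar> \<le> (2 * M * (tw y - tw x)) * (1 / c)"
        unfolding abs_mult using w(6)[OF xy] ABb[of x] d[OF xy] M by (intro mult_mono mult_nonneg_nonneg) auto
    qed
    also have "\<dots> = ((Em + M) / c\<^sup>2) * (tb y - tb x) + (1 / c) * (tv y - tv x) + (M\<^sup>2 / c\<^sup>2) * (ta y - ta x) + (2 * M / c) * (tw y - tw x)"
      by simp
    also have "\<dots> \<le> K * (tb y - tb x) + K * (tv y - tv x) + K * (ta y - ta x) + K * (tw y - tw x)"
    proof -
      have "M\<^sup>2 / c\<^sup>2 \<le> K" using Kge(4) c by (smt (verit) zero_le_divide_1_iff zero_le_power2)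
      then show ?thesis using Kge d[OF xy] by (intro add_mono mult_right_mono) auto
    qed
    also have "\<dots> = K * s y - K * s x" by (simp add: s_def algebra_simps)
    finally show ?thesis .
  qed
  have pd: "\<bar>p y - p x\<bar> \<le> K * s y - K * s x" if "x \<le> y" for x y
    using qd[OF that] by (auto simp: p_def max_def abs_if split: if_splits)
  have qb: "q x \<le> (Em + M) / c + M\<^sup>2 / c" for x
  proof -
    have "\<bar>E - v x\<bar> \<le> Em + M" using E_bound v(3)[of x] by (auto simp: abs_le_iff)
    then have "(E - v x) * B x \<le> (Em + M) * (1 / c)" using ABb[of x] Em M by (intro mult_mono) auto
    moreover have "(w x)\<^sup>2 \<le> M\<^sup>2" using w(3)[of x] M by (intro power2_le_iff_abs_le[THEN iffD2]) auto
    then have "(w x)\<^sup>2 * A x \<le> M\<^sup>2 * (1 / c)" using ABb[of x] by (intro mult_mono) auto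
    ultimately show ?thesis by (simp add: q_def)
  qed
  have "AE x in lborel. 1 / \<alpha> x = A x" using al(1) by eventually_elim (simp add: A_def)
  moreover have "AE x in lborel. R \<le> \<bar>x\<bar> \<longrightarrow> h * cp x = p x"
    using al(1) be(1) v(1) w(1)
  proof eventually_elim
    case (elim x)
    show ?case
    proof
      assume x: "R \<le> \<bar>x\<bar>"
      have qx: "h * cp x = q x" using h elim by (simp add: cp_def cr_def ca_def q_def A_def B_def distrib_left)
      have "\<delta> / M \<le> \<delta> / \<alpha> x" using \<delta> pos(1)[of x] \<alpha>_bounds[of x] M by (intro divide_left_mono mult_pos_pos) auto
      also have "\<dots> \<le> (inverse (\<beta> x) * \<alpha> x * (E - V1 x) + (b1 x)\<^sup>2) / \<alpha> x"
        using exterior[OF x] pos(1)[of x] by (intro divide_right_mono) auto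
      also have "\<dots> = q x" using pos(1,2)[of x] elim by (simp add: q_def A_def B_def field_simps)
      finally show "h * cp x = p x" using qx by (simp add: p_def)
    qed
  qed
  moreover have "A \<in> borel_measurable borel" "p \<in> borel_measurable borel"
    unfolding A_def[abs_def] p_def[abs_def] q_def[abs_def] B_def[abs_def] by measurable
  moreover have "mono (\<lambda>x. K * s x)"
    using al(4) be(4) v(4) w(4) K0 by (auto simp: mono_def s_def intro!: mult_left_mono add_mono)
  moreover have "K * s y - K * s x \<le> K * (8 * M)" for x y
  proof -
    have "s y - s x \<le> 8 * M" using al(5)[of x] al(5)[of y] be(5)[of x] be(5)[of y] v(5)[of x] v(5)[of y] w(5)[of x] w(5)[of y] M
      unfolding s_def by linarith
    from mult_left_mono[OF this K0] show ?thesis by (simp add: right_diff_distrib)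
  qed
  moreover have "\<delta> / M \<le> p x \<and> p x \<le> \<delta> / M + ((Em + M) / c + M\<^sup>2 / c)" for x
  proof -
    have "0 \<le> (Em + M) / c + M\<^sup>2 / c" "0 \<le> \<delta> / M" using Em M c \<delta> by auto
    then show ?thesis using qb[of x] unfolding p_def max_def by auto
  qed
  ultimately show ?thesis
    using ABb AdK pd unfolding K_def[symmetric]
    by - (rule exI[of _ A], rule exI[of _ p], rule exI[of _ "\<lambda>x. K * s x"], simp)
qed

abbreviation "Dx \<equiv> exterior_const c M \<delta> Em e0"

lemma cW_right': "R \<le> t \<Longrightarrow> cW t = cW R0"
  using cW_right[of t] R by linarith

text \<open>On the right the flux is \<open>Q + cW R0 * u\<close> with a constant factor, on the
  left it is \<open>Q\<close>. In both cases it is absolutely continuous, and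
  \<open>half_line_estimate\<close> applies, after a reflection on the left.\<close>

lemma exterior_step:
  assumes s: "sol f u Q" and f: "in_L2 f" and u: "in_L2 u" and G: "in_L2 (flux u Q)"
    and fi: "integrable lborel (\<lambda>t. cmod (f t))"
    and S: "\<And>t. R \<le> t \<Longrightarrow> (cmod (u t))\<^sup>2 + (cmod (Q t + of_real (cW R0) * u t))\<^sup>2 \<le> S"
      "\<And>t. t \<le> - R \<Longrightarrow> (cmod (u t))\<^sup>2 + (cmod (Q t))\<^sup>2 \<le> S"
  defines "Y \<equiv> S / 2 + Dx / h * ((LINT t|lborel. cmod (f t) * cmod (u t)) + sqrt S * (LINT t|lborel. cmod (f t)))"
  shows "R \<le> t \<Longrightarrow> (cmod (u t))\<^sup>2 + (cmod (Q t + of_real (cW R0) * u t))\<^sup>2 \<le> Y"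
    and "t \<le> - R \<Longrightarrow> (cmod (u t))\<^sup>2 + (cmod (Q t))\<^sup>2 \<le> Y"
proof -
  obtain A p \<tau> where Am: "A \<in> borel_measurable borel" "p \<in> borel_measurable borel"
    and Aae: "AE x in lborel. 1 / \<alpha> x = A x" and pae: "AE x in lborel. R \<le> \<bar>x\<bar> \<longrightarrow> h * cp x = p x"
    and Ab: "\<And>x. 1 / M \<le> A x \<and> A x \<le> 1 / c" and pb: "\<And>x. \<delta> / M \<le> p x \<and> p x \<le> \<delta> / M + ((Em + M) / c + M\<^sup>2 / c)"
    and \<tau>: "mono \<tau>" "\<And>x y. \<tau> y - \<tau> x \<le> ((Em + M) / c\<^sup>2 + 1 / c + M\<^sup>2 / c\<^sup>2 + 2 * M / c + 1 / c\<^sup>2) * (8 * M)"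
    and var: "\<And>x y. x \<le> y \<Longrightarrow> \<bar>A y - A x\<bar> \<le> \<tau> y - \<tau> x \<and> \<bar>p y - p x\<bar> \<le> \<tau> y - \<tau> x"
    using coefficient_representatives by blast
  have M: "0 < M" by (rule pos(3))
  note [measurable] = sol_measurable[OF s] in_L2_measurable[OF f] Am
  have [measurable]: "ck \<in> borel_measurable borel" unfolding ck_def[abs_def] by measurable
  have Bb: "0 < 1 / \<beta> t" "1 / \<beta> t \<le> 1 / c" for t
    using pos(2)[of t] \<beta>_bounds[of t] c by (auto intro!: divide_left_mono mult_pos_pos)
  have crB: "cr t = 1 / \<beta> t / h" for t by (simp add: cr_def)
  obtain K where K: "\<And>t. cmod (u t) \<le> K" "\<And>t. cmod (Q t) \<le> K" using sol_L2_bounded[OF s f u G] by blast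
  have Q2: "in_L2 Q"
  proof -
    have "in_L2 (\<lambda>t. flux u Q t - of_real (cW t) * u t)"
      by (intro in_L2_diff G in_L2_mult_bdd[OF u, of _ cW1]) (use W_bound in auto)
    then show ?thesis by (simp add: flux_def)
  qed
  have c1: "\<bar>\<epsilon>\<bar> * (LINT t|lborel. (cmod (u t))\<^sup>2) \<le> M / c * (LINT t|lborel. cmod (f t) * cmod (u t))"
    using sol_L2_estimate[OF s f u G] h M c by (simp add: field_simps)
  have e0: "0 < e0" using eps eps_bound by linarith
  define G1 where "G1 t = Q t + of_real (cW R0) * u t" for t
  have ca_ae: "AE t in lborel. ca t = A t / h" using Aae by eventually_elim (metis ca_def divide_divide_eq_left mult.commute)
  have cp_ae: "AE t in lborel. R \<le> \<bar>t\<bar> \<longrightarrow> cp t = p t / h" using pae by eventually_elim (use h in \<open>auto simp: field_simps\<close>)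
  have pu: "prim_on UNIV u (\<lambda>t. of_real (ca t) * flux u Q t - \<i> * of_real (ck t) * u t)"
    and pQ: "prim_on UNIV Q (\<lambda>t. - \<i> * of_real (ck t) * Q t - (of_real (cp t) + \<i> * of_real \<epsilon> * of_real (cr t)) * u t
        - of_real (cr t) * f t - of_real (ca t * cW t) * flux u Q t)"
    using s unfolding sol_def by blast+
  show "(cmod (u t))\<^sup>2 + (cmod (Q t + of_real (cW R0) * u t))\<^sup>2 \<le> Y" if t: "R \<le> t"
  proof -
    have "half_line A p (\<lambda>t. 1 / \<beta> t) ck \<tau> u G1 f h \<epsilon> (1 / M) (1 / c) (\<delta> / M) (\<delta> / M + ((Em + M) / c + M\<^sup>2 / c)) (1 / c)
       (((Em + M) / c\<^sup>2 + 1 / c + M\<^sup>2 / c\<^sup>2 + 2 * M / c + 1 / c\<^sup>2) * (8 * M)) S R"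
    proof
      show "prim_on {R..} u (\<lambda>t. of_real (A t / h) * G1 t - \<i> * of_real (ck t) * u t)"
      proof (rule prim_on_cong_AE[OF prim_on_subset[OF pu subset_UNIV]])
        show "AE t in lborel. t \<in> {R..} \<longrightarrow> of_real (ca t) * flux u Q t - \<i> * of_real (ck t) * u t = of_real (A t / h) * G1 t - \<i> * of_real (ck t) * u t"
          using ca_ae by eventually_elim (auto simp: flux_def G1_def cW_right')
        show "(\<lambda>t. of_real (A t / h) * G1 t - \<i> * of_real (ck t) * u t) \<in> borel_measurable borel" unfolding G1_def by measurable
      qed
      show "prim_on {R..} G1 (\<lambda>t. - \<i> * of_real (ck t) * G1 t - (of_real (p t / h) + \<i> * of_real (\<epsilon> * (1 / \<beta> t / h))) * u t - of_real (1 / \<beta> t / h) * f t)"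
        unfolding G1_def
      proof (rule prim_on_cong_AE[OF prim_on_subset[OF prim_on_add[OF pQ prim_on_cmult[OF pu, of "of_real (cW R0)"]] subset_UNIV]])
        show "AE t in lborel. t \<in> {R..} \<longrightarrow> - \<i> * of_real (ck t) * Q t - (of_real (cp t) + \<i> * of_real \<epsilon> * of_real (cr t)) * u t
            - of_real (cr t) * f t - of_real (ca t * cW t) * flux u Q t + of_real (cW R0) * (of_real (ca t) * flux u Q t - \<i> * of_real (ck t) * u t)
          = - \<i> * of_real (ck t) * (Q t + of_real (cW R0) * u t) - (of_real (p t / h) + \<i> * of_real (\<epsilon> * (1 / \<beta> t / h))) * u t - of_real (1 / \<beta> t / h) * f t"
          using cp_ae
        proof (eventually_elim, intro impI)
          fix t assume *: "R \<le> \<bar>t\<bar> \<longrightarrow> cp t = p t / h" "t \<in> {R..}"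
          then have "cp t = p t / h" by auto
          then show "- \<i> * of_real (ck t) * Q t - (of_real (cp t) + \<i> * of_real \<epsilon> * of_real (cr t)) * u t
            - of_real (cr t) * f t - of_real (ca t * cW t) * flux u Q t + of_real (cW R0) * (of_real (ca t) * flux u Q t - \<i> * of_real (ck t) * u t)
          = - \<i> * of_real (ck t) * (Q t + of_real (cW R0) * u t) - (of_real (p t / h) + \<i> * of_real (\<epsilon> * (1 / \<beta> t / h))) * u t - of_real (1 / \<beta> t / h) * f t"
            using *(2) by (simp only: cW_right'[of t] atLeast_iff crB[symmetric] of_real_mult) (simp add: algebra_simps)
        qed
        show "(\<lambda>t. - \<i> * of_real (ck t) * (Q t + of_real (cW R0) * u t) - (of_real (p t / h) + \<i> * of_real (\<epsilon> * (1 / \<beta> t / h))) * u t - of_real (1 / \<beta> t / h) * f t) \<in> borel_measurable borel"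
          by measurable
      qed
      show "in_L2 G1" unfolding G1_def[abs_def] by (intro in_L2_add Q2 in_L2_cmult u)
      show "R \<le> t \<Longrightarrow> (cmod (u t))\<^sup>2 + (cmod (G1 t))\<^sup>2 \<le> S" for t using S(1) by (simp add: G1_def)
    qed (use h M \<delta> Ab pb Bb \<tau> var u f in auto)
    from half_line.half_line_estimate[OF this fi eps_bound e0 _ c1 t] show ?thesis
      using M c by (simp add: Y_def exterior_const_def G1_def)
  qed
  show "(cmod (u t))\<^sup>2 + (cmod (Q t))\<^sup>2 \<le> Y" if t: "t \<le> - R" for t
  proof -
    have im: "uminus ` {..- R} = {R..}" by auto
    have u1: "prim_on {..- R} u (\<lambda>t. of_real (A t / h) * Q t - \<i> * of_real (ck t) * u t)"
    proof (rule prim_on_cong_AE[OF prim_on_subset[OF pu subset_UNIV]])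
      show "AE t in lborel. t \<in> {..- R} \<longrightarrow> of_real (ca t) * flux u Q t - \<i> * of_real (ck t) * u t = of_real (A t / h) * Q t - \<i> * of_real (ck t) * u t"
        \<comment> \<open>The point \<open>- R\<close> is excluded because \<open>cW\<close>
          vanishes only strictly to the left of \<open>- R0\<close>, and \<open>R = R0\<close> is
          possible.\<close>
        using ca_ae AE_lborel_singleton[of "- R"]
      proof eventually_elim
        case (elim t)
        then show ?case using cW_left[of t] R by (auto simp: flux_def)
      qed
    qed measurable
    have Q1: "prim_on {..- R} Q (\<lambda>t. - \<i> * of_real (ck t) * Q t - (of_real (p t / h) + \<i> * of_real (\<epsilon> * (1 / \<beta> t / h))) * u t - of_real (1 / \<beta> t / h) * f t)"
    proof (rule prim_on_cong_AE[OF prim_on_subset[OF pQ subset_UNIV]])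
      show "AE t in lborel. t \<in> {..- R} \<longrightarrow> - \<i> * of_real (ck t) * Q t - (of_real (cp t) + \<i> * of_real \<epsilon> * of_real (cr t)) * u t
          - of_real (cr t) * f t - of_real (ca t * cW t) * flux u Q t
        = - \<i> * of_real (ck t) * Q t - (of_real (p t / h) + \<i> * of_real (\<epsilon> * (1 / \<beta> t / h))) * u t - of_real (1 / \<beta> t / h) * f t"
        using cp_ae AE_lborel_singleton[of "- R"]
      proof (eventually_elim, intro impI)
        fix t assume *: "R \<le> \<bar>t\<bar> \<longrightarrow> cp t = p t / h" "t \<noteq> - R" "t \<in> {..- R}"
        then have "cp t = p t / h" "cW t = 0" using cW_left[of t] R R0 by auto
        then show "- \<i> * of_real (ck t) * Q t - (of_real (cp t) + \<i> * of_real \<epsilon> * of_real (cr t)) * u t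
          - of_real (cr t) * f t - of_real (ca t * cW t) * flux u Q t
        = - \<i> * of_real (ck t) * Q t - (of_real (p t / h) + \<i> * of_real (\<epsilon> * (1 / \<beta> t / h))) * u t - of_real (1 / \<beta> t / h) * f t"
          by (simp add: crB)
      qed
    qed measurable
    \<comment> \<open>Under \<open>t \<mapsto> - t\<close> derivatives change sign. Replacing
      \<open>Q\<close> by \<open>- Q\<close> and the phase by its negative restores the form of the
      system, and \<open>- \<tau> (- t)\<close> is again increasing with the same total
      increase.\<close>
    have "half_line (\<lambda>t. A (- t)) (\<lambda>t. p (- t)) (\<lambda>t. 1 / \<beta> (- t)) (\<lambda>t. - ck (- t)) (\<lambda>t. - \<tau> (- t)) (\<lambda>t. u (- t)) (\<lambda>t. - Q (- t)) (\<lambda>t. f (- t))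
       h \<epsilon> (1 / M) (1 / c) (\<delta> / M) (\<delta> / M + ((Em + M) / c + M\<^sup>2 / c)) (1 / c)
       (((Em + M) / c\<^sup>2 + 1 / c + M\<^sup>2 / c\<^sup>2 + 2 * M / c + 1 / c\<^sup>2) * (8 * M)) S R"
    proof
      show "prim_on {R..} (\<lambda>t. u (- t)) (\<lambda>t. of_real (A (- t) / h) * - Q (- t) - \<i> * of_real (- ck (- t)) * u (- t))"
        by (rule prim_on_cong[OF prim_on_reflect[OF u1, unfolded im]]) simp_all
      show "prim_on {R..} (\<lambda>t. - Q (- t)) (\<lambda>t. - \<i> * of_real (- ck (- t)) * - Q (- t) - (of_real (p (- t) / h) + \<i> * of_real (\<epsilon> * (1 / \<beta> (- t) / h))) * u (- t) - of_real (1 / \<beta> (- t) / h) * f (- t))"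
        by (rule prim_on_cong[OF prim_on_cmult[OF prim_on_reflect[OF Q1, unfolded im], of "-1"]]) simp_all
      show "in_L2 (\<lambda>t. u (- t))" "in_L2 (\<lambda>t. f (- t))" by (rule in_L2_reflect, fact)+
      show "in_L2 (\<lambda>t. - Q (- t))" using in_L2_cmult[OF in_L2_reflect[OF Q2], of "-1"] by simp
      show "mono (\<lambda>t. - \<tau> (- t))" using \<tau>(1) by (auto simp: mono_def)
      show "- \<tau> (- y) - - \<tau> (- x) \<le> ((Em + M) / c\<^sup>2 + 1 / c + M\<^sup>2 / c\<^sup>2 + 2 * M / c + 1 / c\<^sup>2) * (8 * M)" for x y
        using \<tau>(2)[of "- x" "- y"] by simp
      show "\<bar>A (- y) - A (- x)\<bar> \<le> - \<tau> (- y) - - \<tau> (- x)" "\<bar>p (- y) - p (- x)\<bar> \<le> - \<tau> (- y) - - \<tau> (- x)" if "x \<le> y" for x y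
        using var[of "- y" "- x"] that by (auto simp: abs_minus_commute)
      show "(cmod (u (- t)))\<^sup>2 + (cmod (- Q (- t)))\<^sup>2 \<le> S" if "R \<le> t" for t using S(2)[of "- t"] that by simp
    qed (use h M \<delta> Ab pb Bb in auto)
    note hl = half_line.half_line_estimate[OF this _ eps_bound e0, of "M / c" "- t"]
    have i1: "integrable lborel (\<lambda>t. cmod (f (- t)))" using lborel_integrable_real_affine[OF fi, of "-1" 0] by simp
    have r: "(LINT t|lborel. (cmod (u (- t)))\<^sup>2) = (LINT t|lborel. (cmod (u t))\<^sup>2)"
      "(LINT t|lborel. cmod (f (- t)) * cmod (u (- t))) = (LINT t|lborel. cmod (f t) * cmod (u t))"
      "(LINT t|lborel. cmod (f (- t))) = (LINT t|lborel. cmod (f t))"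
      by (rule LINT_reflect[of "\<lambda>t. (cmod (u t))\<^sup>2"] LINT_reflect[of "\<lambda>t. cmod (f t) * cmod (u t)"] LINT_reflect[of "\<lambda>t. cmod (f t)"])+
    show ?thesis
      using hl i1 c1 M c t unfolding r by (simp add: Y_def exterior_const_def)
  qed
qed

text \<open>A self-improving bound for the exact supremum \<open>S\<close> of the exterior energy.
  \<open>S\<close> is finite because square integrable solutions are bounded, with a bound depending
  on \<open>h\<close>; \<open>exterior_step\<close> then bounds \<open>S\<close> by
  \<open>S / 2\<close> plus a term linear in \<open>sqrt S\<close>. As \<open>f\<close> vanishes for
  \<open>\<bar>t\<bar> \<le> R\<close>, the pairing of \<open>f\<close> with \<open>u\<close> is
  also at most \<open>sqrt S\<close> times the integral of \<open>|f|\<close>.\<close>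

theorem exterior_sup_estimate:
  assumes s: "sol f u Q" and f: "in_L2 f" and u: "in_L2 u" and G: "in_L2 (flux u Q)"
    and fi: "integrable lborel (\<lambda>t. cmod (f t))" and f0: "\<And>t. \<bar>t\<bar> \<le> R \<Longrightarrow> f t = 0" and t: "R < \<bar>t\<bar>"
  shows "cmod (u t) \<le> 4 * \<bar>Dx\<bar> / h * (LINT t|lborel. cmod (f t))"
proof -
  define q where "q t = (if R \<le> t then (cmod (u t))\<^sup>2 + (cmod (Q t + of_real (cW R0) * u t))\<^sup>2 else (cmod (u t))\<^sup>2 + (cmod (Q t))\<^sup>2)" for t
  define X where "X = {t. R \<le> \<bar>t\<bar>}"
  define S where "S = (SUP t\<in>X. q t)"
  obtain K where K: "\<And>t. cmod (u t) \<le> K" "\<And>t. cmod (Q t) \<le> K" using sol_L2_bounded[OF s f u G] by blast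
  have "q t \<le> K\<^sup>2 + (K + \<bar>cW R0\<bar> * K)\<^sup>2" for t
  proof -
    have K0: "0 \<le> K" using K(1)[of 0] norm_ge_zero order_trans by blast
    have "cmod (Q t + of_real (cW R0) * u t) \<le> K + \<bar>cW R0\<bar> * K"
      using K by (intro norm_triangle_mono) (auto simp: norm_mult intro!: mult_left_mono)
    moreover have "cmod (Q t) \<le> K + \<bar>cW R0\<bar> * K" using K(2)[of t] K0 by (simp add: add_increasing2)
    ultimately show ?thesis unfolding q_def using K(1)[of t] by (auto intro!: add_mono power_mono)
  qed
  then have bdd: "bdd_above (q ` X)" by (intro bdd_aboveI[of _ "K\<^sup>2 + (K + \<bar>cW R0\<bar> * K)\<^sup>2"]) auto
  have Sq: "q t \<le> S" if "t \<in> X" for t unfolding S_def by (rule cSUP_upper[OF that bdd])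
  have RX: "R \<in> X" by (auto simp: X_def)
  have qn: "0 \<le> q t" for t by (simp add: q_def)
  have S0: "0 \<le> S" using Sq[OF RX] qn[of R] by linarith
  have Rp: "0 < R" using R R0 by linarith
  define L N where "L = (LINT t|lborel. cmod (f t) * cmod (u t))" and "N = (LINT t|lborel. cmod (f t))"
  have N0: "0 \<le> N" unfolding N_def by (rule Bochner_Integration.integral_nonneg) simp
  have uS: "cmod (u t) \<le> sqrt S" if "R \<le> \<bar>t\<bar>" for t
  proof (rule real_le_rsqrt)
    have "(cmod (u t))\<^sup>2 \<le> q t" by (simp add: q_def)
    also have "\<dots> \<le> S" by (rule Sq) (simp add: X_def that)
    finally show "(cmod (u t))\<^sup>2 \<le> S" .
  qed
  have L: "L \<le> sqrt S * N"
  proof -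
    have "L \<le> (LINT t|lborel. sqrt S * cmod (f t))"
      unfolding L_def
    proof (rule integral_mono[OF in_L2_mult_integrable[OF f u]])
      show "integrable lborel (\<lambda>t. sqrt S * cmod (f t))" using fi by simp
      show "cmod (f t) * cmod (u t) \<le> sqrt S * cmod (f t)" for t
        using f0[of t] mult_left_mono[OF uS[of t], of "cmod (f t)"] by (cases "\<bar>t\<bar> \<le> R") (auto simp: mult.commute)
    qed
    then show ?thesis by (simp add: N_def)
  qed
  define Z where "Z = S / 2 + 2 * \<bar>Dx\<bar> / h * (sqrt S * N)"
  have le: "S / 2 + Dx / h * (L + sqrt S * N) \<le> Z"
  proof -
    have "0 \<le> L" unfolding L_def by (rule Bochner_Integration.integral_nonneg) simp
    then have n: "0 \<le> L + sqrt S * N" using S0 N0 by simp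
    have "Dx / h * (L + sqrt S * N) \<le> \<bar>Dx\<bar> / h * (L + sqrt S * N)" using h n by (intro mult_right_mono divide_right_mono) auto
    also have "\<dots> \<le> \<bar>Dx\<bar> / h * (2 * (sqrt S * N))" using L h by (intro mult_left_mono) (auto simp: mult.commute)
    finally show ?thesis by (simp add: Z_def)
  qed
  have "q t \<le> Z" if "t \<in> X" for t
  proof -
    have S1: "\<And>t. R \<le> t \<Longrightarrow> (cmod (u t))\<^sup>2 + (cmod (Q t + of_real (cW R0) * u t))\<^sup>2 \<le> S"
      "\<And>t. t \<le> - R \<Longrightarrow> (cmod (u t))\<^sup>2 + (cmod (Q t))\<^sup>2 \<le> S"
    proof -
      fix t assume t: "R \<le> t"
      then have "t \<in> X" by (simp add: X_def)
      from Sq[OF this] t show "(cmod (u t))\<^sup>2 + (cmod (Q t + of_real (cW R0) * u t))\<^sup>2 \<le> S" by (simp add: q_def)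
    next
      fix t assume t: "t \<le> - R"
      then have "t \<in> X" "\<not> R \<le> t" using Rp by (auto simp: X_def)
      from Sq[OF this(1)] this(2) show "(cmod (u t))\<^sup>2 + (cmod (Q t))\<^sup>2 \<le> S" by (simp add: q_def)
    qed
    note st = exterior_step[OF s f u G fi, of S, folded L_def N_def, OF S1]
    have "R \<le> t \<or> t \<le> - R" using that by (auto simp: X_def)
    then show ?thesis
    proof
      assume "R \<le> t" then show ?thesis using st(1)[of t] le unfolding q_def by simp
    next
      assume *: "t \<le> - R" then have "\<not> R \<le> t" using Rp by linarith
      then show ?thesis using st(2)[of t] * le unfolding q_def by simp
    qed
  qed
  \<comment> \<open>\<open>Z\<close> does not depend on the point, so it bounds the supremum.
    Absorbing \<open>S / 2\<close> leaves \<open>S\<close> below a multiple of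
    \<open>sqrt S\<close>, and division by \<open>sqrt S\<close> makes the bound linear in
    \<open>f\<close>; the case \<open>S = 0\<close> is separate.\<close>
  then have "S \<le> Z" unfolding S_def using RX by (intro cSUP_least) auto
  then have "S \<le> 2 * (2 * \<bar>Dx\<bar> / h * (sqrt S * N))" unfolding Z_def by linarith
  then have "sqrt S * sqrt S \<le> 4 * \<bar>Dx\<bar> / h * N * sqrt S" using S0 by (simp add: mult_ac)
  then have "sqrt S \<le> 4 * \<bar>Dx\<bar> / h * N"
  proof (cases "S = 0")
    case False
    then show ?thesis using mult_right_le_imp_le[OF \<open>sqrt S * sqrt S \<le> _\<close>] S0 by simp
  qed (use h N0 in simp)
  then show ?thesis using uS[of t] t unfolding N_def by linarith
qed

end

section \<open>From the supremum bound to the weighted operator norm\<close>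

lemma weight_integrable:
  fixes s :: real assumes s: "1 / 2 < s"
  shows "integrable lborel (\<lambda>x. (1 + x\<^sup>2) powr (- s))"
proof -
  define w where "w x = indicator {1..} x *\<^sub>R (x powr (- 2 * s))" for x :: real
  have wm [measurable]: "w \<in> borel_measurable borel" unfolding w_def[abs_def] by measurable
  have "((\<lambda>x::real. x powr (- 2 * s)) has_integral - (1 powr (- 2 * s + 1)) / (- 2 * s + 1)) {1..}"
    by (rule has_integral_powr_to_inf) (use s in auto)
  then have "(\<lambda>x::real. x powr (- 2 * s)) absolutely_integrable_on {1..}"
    by (intro nonnegative_absolutely_integrable_1) (auto dest: has_integral_integrable)
  then have "integrable lebesgue w" unfolding set_integrable_def w_def[abs_def] .
  then have w: "integrable lborel w" using integrable_completion[of w lborel] by simp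
  have i: "integrable lborel (\<lambda>x. indicator {-1..1} x + w x + w (- x))"
    using w lborel_integrable_real_affine[OF w, of "-1" 0] by (intro Bochner_Integration.integrable_add integrable_real_indicator) auto
  show ?thesis
  proof (rule Bochner_Integration.integrable_bound[OF i])
    show "(\<lambda>x. (1 + x\<^sup>2) powr (- s)) \<in> borel_measurable lborel" by measurable
    have "(1 + x\<^sup>2) powr (- s) \<le> indicator {-1..1} x + w x + w (- x)" for x :: real
    proof -
      have far: "(1 + y\<^sup>2) powr (- s) \<le> w y" if "1 \<le> y" for y :: real
      proof -
        have "(1 + y\<^sup>2) powr (- s) \<le> (y\<^sup>2) powr (- s)" using that s by (intro powr_mono2') auto
        also have "\<dots> = w y" using that powr_powr[of y 2 "- s"] by (simp add: w_def powr_numeral)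
        finally show ?thesis .
      qed
      have "(1 + x\<^sup>2) powr (- s) \<le> 1" using powr_mono2'[of "- s" 1 "1 + x\<^sup>2"] s by simp
      moreover have "0 \<le> w x" "0 \<le> w (- x)" by (simp_all add: w_def)
      ultimately show ?thesis
        using far[of x] far[of "- x"] by (cases "1 \<le> x"; cases "x \<le> - 1") (auto simp: indicator_def)
    qed
    then show "AE x in lborel. norm ((1 + x\<^sup>2) powr (- s)) \<le> norm (indicator {-1..1} x + w x + w (- x))"
      by (intro always_eventually allI) (force intro: order_trans[OF _ abs_ge_self])
  qed
qed

lemma exterior_weight_properties:
  fixes s R :: real
  defines "w \<equiv> \<lambda>x. sqrt (1 + \<bar>x\<bar>\<^sup>2) powr (- s) * indicator {x. \<bar>x\<bar> > R} x"
  assumes s: "0 < s"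
  shows "w \<in> borel_measurable borel" "0 \<le> w x" "w x \<le> 1" "(w x)\<^sup>2 \<le> (1 + x\<^sup>2) powr (- s)"
proof -
  show "w \<in> borel_measurable borel" unfolding w_def by measurable
  show "0 \<le> w x" by (simp add: w_def)
  have "sqrt (1 + \<bar>x\<bar>\<^sup>2) powr (- s) \<le> 1" using powr_mono2'[of "- s" 1 "sqrt (1 + \<bar>x\<bar>\<^sup>2)"] s by simp
  then show "w x \<le> 1" by (auto simp: w_def indicator_def)
  have "(sqrt (1 + x\<^sup>2) powr (- s))\<^sup>2 = (1 + x\<^sup>2) powr (- s)"
    by (simp add: powr_half_sqrt[symmetric] powr_powr power2_eq_square add_nonneg_nonneg flip: powr_add)
  then show "(w x)\<^sup>2 \<le> (1 + x\<^sup>2) powr (- s)" by (auto simp: w_def indicator_def)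
qed

context schroedinger_exterior
begin

text \<open>The weight acts twice, each time with a factor \<open>sqrt W\<close>: it bounds the
  integral of the weighted data by their \<open>L2\<close> norm, and it turns the supremum bound on
  the solution into an \<open>L2\<close> bound. Adding 1 in \<open>W\<close> makes it
  positive.\<close>

lemma weighted_resolvent_estimate:
  assumes s: "1 / 2 < s" and \<phi>: "L2_norm \<phi> \<le> 1"
  defines "W \<equiv> (LINT x|lborel. (1 + x\<^sup>2) powr (- s)) + 1"
  shows "L2_norm (exterior_weight s R (resolvent D P z (exterior_weight s R \<phi>))) \<le> ennreal (4 * \<bar>Dx\<bar> * W / h)"
proof -
  define w where "w x = sqrt (1 + \<bar>x\<bar>\<^sup>2) powr (- s) * indicator {x. \<bar>x\<bar> > R} x" for x
  have s0: "0 < s" using s by linarith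
  note w = exterior_weight_properties[OF s0, where R = R, folded w_def]
  note [measurable] = w(1)
  have ew: "exterior_weight s R g = (\<lambda>x. of_real (w x) * g x)" for g by (simp add: exterior_weight_def w_def fun_eq_iff)
  note \<rho> = weight_integrable[OF s]
  have "0 \<le> (LINT x|lborel. (1 + x\<^sup>2) powr (- s))" by (rule Bochner_Integration.integral_nonneg) simp
  then have W: "0 < W" unfolding W_def by linarith
  have w2: "integrable lborel (\<lambda>x. (w x)\<^sup>2)"
    by (rule Bochner_Integration.integrable_bound[OF \<rho>]) (use w in auto)
  have w2W: "(LINT x|lborel. (w x)\<^sup>2) \<le> W"
    using integral_mono[OF w2 \<rho> w(4)] by (simp add: W_def)
  have wL2: "in_L2 (\<lambda>x. complex_of_real (w x))" using w2 by (simp add: in_L2_def)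
  have \<phi>2: "in_L2 \<phi>" and \<phi>1: "(LINT x|lborel. (cmod (\<phi> x))\<^sup>2) \<le> 1"
    using \<phi> by (auto simp: L2_norm_def top_unique split: if_splits)
  have cw: "cmod (complex_of_real (w x)) \<le> 1" for x using w(2,3)[of x] by simp
  define f where "f = exterior_weight s R \<phi>"
  have f: "in_L2 f" unfolding f_def ew by (rule in_L2_mult_bdd[OF \<phi>2 _ cw]) measurable
  have fn: "cmod (f x) = w x * cmod (\<phi> x)" for x using w(2)[of x] by (simp add: f_def ew norm_mult)
  have fi: "integrable lborel (\<lambda>x. cmod (f x))"
    unfolding fn using in_L2_mult_integrable[OF wL2 \<phi>2] w(2) by simp
  have N: "(LINT x|lborel. cmod (f x)) \<le> sqrt W"
  proof -
    \<comment> \<open>Young's inequality with this parameter reproduces the Cauchy-Schwarz bound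
      \<open>sqrt W\<close>.\<close>
    have sW: "0 < 1 / sqrt W" using W by simp
    have "(LINT x|lborel. cmod (f x)) \<le> (LINT x|lborel. (1 / sqrt W) / 2 * (w x)\<^sup>2 + (cmod (\<phi> x))\<^sup>2 / (2 * (1 / sqrt W)))"
      using Young_ineq[OF sW] w2 in_L2_integrable[OF \<phi>2]
      by (intro integral_mono[OF fi]) (auto simp: fn mult.commute[of "w _"])
    also have "\<dots> = (1 / sqrt W) / 2 * (LINT x|lborel. (w x)\<^sup>2) + (LINT x|lborel. (cmod (\<phi> x))\<^sup>2) / (2 * (1 / sqrt W))"
      using w2 in_L2_integrable[OF \<phi>2] by simp
    also have "\<dots> \<le> (1 / sqrt W) / 2 * W + 1 / (2 * (1 / sqrt W))"
      using w2W \<phi>1 W by (intro add_mono mult_left_mono divide_right_mono) auto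
    also have "\<dots> = sqrt W" using W by (simp add: field_simps)
    finally show ?thesis .
  qed
  define r where "r = resolvent D P z f"
  obtain U Q where U: "AE x in lborel. r x = U x" "in_L2 r" "sol f U Q" "in_L2 U" "in_L2 (flux U Q)"
    using resolvent_sol[OF f] unfolding r_def by blast
  define B where "B = 4 * \<bar>Dx\<bar> / h * sqrt W"
  have B0: "0 \<le> B" using h W by (simp add: B_def)
  have UB: "cmod (U t) \<le> B" if "R < \<bar>t\<bar>" for t
  proof -
    have "cmod (U t) \<le> 4 * \<bar>Dx\<bar> / h * (LINT x|lborel. cmod (f x))"
      by (rule exterior_sup_estimate[OF U(3) f U(4,5) fi _ that]) (simp add: f_def exterior_weight_def)
    also have "\<dots> \<le> B" unfolding B_def using N h by (intro mult_left_mono) auto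
    finally show ?thesis .
  qed
  have g: "in_L2 (exterior_weight s R r)" unfolding ew by (rule in_L2_mult_bdd[OF U(2) _ cw]) measurable
  have "(LINT x|lborel. (cmod (exterior_weight s R r x))\<^sup>2) \<le> (LINT x|lborel. B\<^sup>2 * (1 + x\<^sup>2) powr (- s))"
  proof (rule integral_mono_AE[OF in_L2_integrable[OF g]])
    show "integrable lborel (\<lambda>x. B\<^sup>2 * (1 + x\<^sup>2) powr (- s))" using \<rho> by simp
    show "AE x in lborel. (cmod (exterior_weight s R r x))\<^sup>2 \<le> B\<^sup>2 * (1 + x\<^sup>2) powr (- s)"
      using U(1)
    proof eventually_elim
      case (elim x)
      have "(cmod (exterior_weight s R r x))\<^sup>2 = (w x)\<^sup>2 * (cmod (U x))\<^sup>2" by (simp add: ew elim norm_mult power_mult_distrib)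
      also have "\<dots> \<le> (w x)\<^sup>2 * B\<^sup>2"
      proof (cases "R < \<bar>x\<bar>")
        case True then show ?thesis using UB[OF True] by (intro mult_left_mono power_mono) auto
      next
        case False then have "w x = 0" by (simp add: w_def)
        then show ?thesis by simp
      qed
      also have "\<dots> \<le> (1 + x\<^sup>2) powr (- s) * B\<^sup>2" using w(4)[of x] by (intro mult_right_mono) auto
      finally show ?case by (simp add: mult.commute)
    qed
  qed
  also have "\<dots> = B\<^sup>2 * (LINT x|lborel. (1 + x\<^sup>2) powr (- s))" by simp
  also have "\<dots> \<le> B\<^sup>2 * W" by (intro mult_left_mono) (auto simp: W_def)
  finally have "sqrt (LINT x|lborel. (cmod (exterior_weight s R r x))\<^sup>2) \<le> sqrt (B\<^sup>2 * W)" by (rule real_sqrt_le_mono)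
  also have "\<dots> = 4 * \<bar>Dx\<bar> * W / h" using B0 W by (simp add: real_sqrt_mult) (simp add: B_def)
  finally show ?thesis using g unfolding f_def[symmetric] r_def[symmetric] by (simp add: L2_norm_def ennreal_leI)
qed

end

theorem corollary1p4:
  fixes s E\<^sub>m\<^sub>a\<^sub>x h\<^sub>0 \<epsilon>\<^sub>0 c R\<^sub>0 R\<^sub>1 :: real
    and E :: "real \<Rightarrow> real"
    and \<alpha> \<beta> b\<^sub>0 b\<^sub>1 V\<^sub>1 :: "real \<Rightarrow> real \<Rightarrow> real"
    and V\<^sub>0 :: "real \<Rightarrow> real set \<Rightarrow> real"
  assumes "s > 1/2" "E\<^sub>m\<^sub>a\<^sub>x > 0" "h\<^sub>0 > 0" "\<epsilon>\<^sub>0 > 0"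
    and energy: "\<And>h. h \<in> {0<..h\<^sub>0} \<Longrightarrow> E h \<in> {- E\<^sub>m\<^sub>a\<^sub>x..E\<^sub>m\<^sub>a\<^sub>x}"
    and coefficients:
      "\<And>h. h \<in> {0<..h\<^sub>0} \<Longrightarrow> coefficients (\<alpha> h) (\<beta> h) (b\<^sub>0 h) (b\<^sub>1 h) (V\<^sub>0 h) (V\<^sub>1 h)"
    and uniform_upper:
      "\<exists>M::real. \<forall>h\<in>{0<..h\<^sub>0}.
         (AE x in lborel. \<bar>V\<^sub>1 h x\<bar> \<le> M) \<and>
         total_variation_norm (derivative_measure (\<lambda>x. of_real (V\<^sub>1 h x))) \<le> ennreal M \<and>
         (AE x in lborel. \<bar>b\<^sub>1 h x\<bar> \<le> M) \<and>
         total_variation_norm (derivative_measure (\<lambda>x. of_real (b\<^sub>1 h x))) \<le> ennreal M \<and>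
         total_variation_norm (derivative_measure (\<lambda>x. of_real (\<alpha> h x))) \<le> ennreal M \<and>
         total_variation_norm (derivative_measure (\<lambda>x. of_real (\<beta> h x))) \<le> ennreal M \<and>
         (\<forall>x. \<alpha> h x \<le> M) \<and> (\<forall>x. \<beta> h x \<le> M)"
    and uniform_lower:
      "c > 0" "\<And>h. h \<in> {0<..h\<^sub>0} \<Longrightarrow> (INF x. \<alpha> h x) > c \<and> (INF x. \<beta> h x) > c"
    and exterior_positivity:
      "R\<^sub>1 > 0"
      "\<exists>\<delta>>0. \<forall>h\<in>{0<..h\<^sub>0}. \<forall>x. \<bar>x\<bar> \<ge> R\<^sub>1 \<longrightarrow>
         inverse (\<beta> h x) * \<alpha> h x * (E h - V\<^sub>1 h x) + (b\<^sub>1 h x)\<^sup>2 \<ge> \<delta>"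
    and compact_support:
      "R\<^sub>0 > 0"
      "\<And>h A. h \<in> {0<..h\<^sub>0} \<Longrightarrow> A \<in> sets borel \<Longrightarrow> A \<inter> {- R\<^sub>0..R\<^sub>0} = {} \<Longrightarrow> V\<^sub>0 h A = 0"
      "\<And>h. h \<in> {0<..h\<^sub>0} \<Longrightarrow> AE x in lborel. x \<notin> {- R\<^sub>0..R\<^sub>0} \<longrightarrow> b\<^sub>0 h x = 0"
  shows "\<exists>C\<^sub>0>0. \<forall>h\<in>{0<..h\<^sub>0}. \<forall>\<epsilon>\<in>{- \<epsilon>\<^sub>0..\<epsilon>\<^sub>0}. \<epsilon> \<noteq> 0 \<longrightarrow>
    (let b = (\<lambda>x. b\<^sub>0 h x + b\<^sub>1 h x);
         V = potential_measure (V\<^sub>0 h) (V\<^sub>1 h);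
         D = schroedinger_domain h (\<alpha> h) (\<beta> h) b V;
         P = schroedinger_op h (\<alpha> h) (\<beta> h) b V;
         z = Complex (E h) \<epsilon>;
         R = max R\<^sub>0 R\<^sub>1
     in in_resolvent_set D P z \<and>
        L2_op_norm (\<lambda>f. exterior_weight s R (resolvent D P z (exterior_weight s R f)))
          \<le> ennreal (C\<^sub>0 / h))"
proof -
  obtain M where M: "\<And>h. h \<in> {0<..h\<^sub>0} \<Longrightarrow>
         (AE x in lborel. \<bar>V\<^sub>1 h x\<bar> \<le> M) \<and>
         total_variation_norm (derivative_measure (\<lambda>x. of_real (V\<^sub>1 h x))) \<le> ennreal M \<and>
         (AE x in lborel. \<bar>b\<^sub>1 h x\<bar> \<le> M) \<and>
         total_variation_norm (derivative_measure (\<lambda>x. of_real (b\<^sub>1 h x))) \<le> ennreal M \<and>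
         total_variation_norm (derivative_measure (\<lambda>x. of_real (\<alpha> h x))) \<le> ennreal M \<and>
         total_variation_norm (derivative_measure (\<lambda>x. of_real (\<beta> h x))) \<le> ennreal M \<and>
         (\<forall>x. \<alpha> h x \<le> M) \<and> (\<forall>x. \<beta> h x \<le> M)"
    using uniform_upper by blast
  obtain \<delta> where \<delta>: "0 < \<delta>" "\<And>h x. h \<in> {0<..h\<^sub>0} \<Longrightarrow> \<bar>x\<bar> \<ge> R\<^sub>1 \<Longrightarrow>
      inverse (\<beta> h x) * \<alpha> h x * (E h - V\<^sub>1 h x) + (b\<^sub>1 h x)\<^sup>2 \<ge> \<delta>"
    using exterior_positivity(2) by blast
  define W where "W = (LINT x|lborel. (1 + x\<^sup>2) powr (- s)) + 1"
  have "0 \<le> (LINT x|lborel. (1 + x\<^sup>2) powr (- s))" by (rule Bochner_Integration.integral_nonneg) simp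
  then have W: "0 < W" unfolding W_def by linarith
  \<comment> \<open>All arguments are independent of \<open>h\<close> and \<open>\<epsilon>\<close>;
    the summand 1 makes \<open>C\<close> positive whatever the value of
    \<open>exterior_const\<close>.\<close>
  define C where "C = 4 * \<bar>exterior_const c M \<delta> E\<^sub>m\<^sub>a\<^sub>x \<epsilon>\<^sub>0\<bar> * W + 1"
  have C: "0 < C" using W by (simp add: C_def add_nonneg_pos)
  show ?thesis
  proof (intro exI[of _ C] conjI C ballI impI)
    fix h \<epsilon> assume h: "h \<in> {0<..h\<^sub>0}" and e: "\<epsilon> \<in> {- \<epsilon>\<^sub>0..\<epsilon>\<^sub>0}" "\<epsilon> \<noteq> 0"
    note co = coefficients[OF h]
    have pos: "0 < \<alpha> h x" "0 < \<beta> h x" for x using co unfolding coefficients_def by auto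
    have lower: "c \<le> \<alpha> h x" "c \<le> \<beta> h x" for x
    proof -
      have "bdd_below (range (\<alpha> h))" "bdd_below (range (\<beta> h))" using pos by (auto intro!: bdd_belowI[of _ 0] less_imp_le)
      then have "(INF x. \<alpha> h x) \<le> \<alpha> h x" "(INF x. \<beta> h x) \<le> \<beta> h x" by (auto intro: cINF_lower)
      then show "c \<le> \<alpha> h x" "c \<le> \<beta> h x" using uniform_lower(2)[OF h] by linarith+
    qed
    \<comment> \<open>The uniform bounds on these two coefficients hold only almost everywhere.
      Bounded variation gives bounds at every point, which may depend on \<open>h\<close> and are
      used only as the qualitative constant \<open>max B1 B2\<close>.\<close>
    have "bounded_variation (V\<^sub>1 h)" "bounded_variation (b\<^sub>1 h)" using co unfolding coefficients_def by auto
    then obtain B1 B2 where B: "\<And>x. \<bar>V\<^sub>1 h x\<bar> \<le> B1" "\<And>x. \<bar>b\<^sub>1 h x\<bar> \<le> B2" using bounded_variation_bounded by metis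
    interpret ext: schroedinger_exterior h c M "max B1 B2" R\<^sub>0 "E h" \<epsilon> "\<alpha> h" "\<beta> h" "b\<^sub>0 h" "b\<^sub>1 h" "V\<^sub>1 h" "V\<^sub>0 h" "max R\<^sub>0 R\<^sub>1" E\<^sub>m\<^sub>a\<^sub>x \<epsilon>\<^sub>0 \<delta>
    proof
      show "\<bar>V\<^sub>1 h x\<bar> \<le> max B1 B2" "\<bar>b\<^sub>1 h x\<bar> \<le> max B1 B2" for x using B[of x] by auto
      show "\<bar>E h\<bar> \<le> E\<^sub>m\<^sub>a\<^sub>x" using energy[OF h] by auto
      show "\<delta> \<le> inverse (\<beta> h x) * \<alpha> h x * (E h - V\<^sub>1 h x) + (b\<^sub>1 h x)\<^sup>2" if "max R\<^sub>0 R\<^sub>1 \<le> \<bar>x\<bar>" for x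
        using \<delta>(2)[OF h, of x] that by simp
    qed (use h e co lower M[OF h] uniform_lower(1) compact_support(1) compact_support(3)[OF h] compact_support(2)[OF h] \<delta>(1) in auto)
    have "4 * \<bar>exterior_const c M \<delta> E\<^sub>m\<^sub>a\<^sub>x \<epsilon>\<^sub>0\<bar> * W / h \<le> C / h" using h by (intro divide_right_mono) (auto simp: C_def)
    then have "L2_norm (exterior_weight s (max R\<^sub>0 R\<^sub>1) (resolvent ext.D ext.P ext.z (exterior_weight s (max R\<^sub>0 R\<^sub>1) f))) \<le> ennreal (C / h)"
      if "L2_norm f \<le> 1" for f
      using ext.weighted_resolvent_estimate[OF \<open>s > 1/2\<close> that] unfolding W_def by (meson ennreal_leI order_trans)
    then show "let b = (\<lambda>x. b\<^sub>0 h x + b\<^sub>1 h x);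
         V = potential_measure (V\<^sub>0 h) (V\<^sub>1 h);
         D = schroedinger_domain h (\<alpha> h) (\<beta> h) b V;
         P = schroedinger_op h (\<alpha> h) (\<beta> h) b V;
         z = Complex (E h) \<epsilon>;
         R = max R\<^sub>0 R\<^sub>1
     in in_resolvent_set D P z \<and>
        L2_op_norm (\<lambda>f. exterior_weight s R (resolvent D P z (exterior_weight s R f)))
          \<le> ennreal (C / h)"
      unfolding Let_def L2_op_norm_def using ext.in_resolvent_set by (auto intro!: SUP_least)
  qed
qed

end
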